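(* Let $\sigma\colon \mathbb{M}^{m\times n}\to \mathbb{M}^{m\times n}$ be continuous and satisfy Condition (OC) with open set $\Sigma \subset \mathbb{M}^{m\times n}\times (\mathbb{R}^n)^m$. Assume $[A,(b^i)]\in\Sigma$. Then the initial-boundary value problem $$\begin{cases} u_t=\operatorname{div}\sigma(Du) & \text{in }\Omega_T,\\ u(x,t)=Ax & (x\in\partial\Omega,\ 0<t<T),\\ u(x,0)=Ax & (x\in\Omega)\end{cases}$$ possesses a weakly* convergent (in $W^{1,\infty}(\Omega_T;\mathbb{R}^m)$) sequence of Lipschitz weak solutions whose limit is not a weak solution itself.
   Context: Setting: $m,n\ge 1$, $T>0$, $\Omega\subset\mathbb{R}^n$ is a bounded domain with Lipschitz boundary, $\Omega_T=\Omega\times(0,T)$. $\mathbb{M}^{m\times n}$ is the space of real $m\times n$ matrices. For $\sigma=(\sigma^i_k)\colon\mathbb{M}^{m\times n}\to\mathbb{M}^{m\times n}$, $\sigma^i(A)=(\sigma^i_1(A),\dots,\sigma^i_n(A))\in\mathbb{R}^n$ is the $i$-th row. $D$ and $\operatorname{div}$ are the Jacobi matrix and the divergence in $x$ only, and the subscript $t$ denotes the time derivative. $[A,(b^i)]$ denotes the element of $\mathbb{M}^{m\times n}\times(\mathbb{R}^n)^m$ with components $A$ and $b^1,\dots,b^m\in\mathbb{R}^n$. For vectors $p,\alpha$, $p\otimes\alpha$ is the matrix $(p_i\alpha_k)$. Weak solution of $u_t=\operatorname{div}\sigma(Du)$ in $\Omega_T$: a function $u\in W^{1,1}_{loc}(\Omega_T;\mathbb{R}^m)$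 with $\int_{\Omega_T}\big(u^i\phi_t-\sum_{k=1}^n\sigma^i_k(Du)\phi_{x_k}\big)\,dx\,dt=0$ for all $\phi\in C_c^\infty(\Omega_T)$ and $i=1,\dots,m$. A weak solution of the initial-boundary value problem is such a $u\in W^{1,1}(\Omega_T;\mathbb{R}^m)$ satisfying the initial and boundary conditions in the sense of trace; it is a Lipschitz weak solution if $u\in W^{1,\infty}(\Omega_T;\mathbb{R}^m)$. $\tau_N$-configuration: an $N$-tuple $(\xi_1,\dots,\xi_N)$ of elements of $\mathbb{M}^{m\times n}\times(\mathbb{R}^n)^m$ for which there exist $\rho,\gamma_1,\dots,\gamma_N\in\mathbb{M}^{m\times n}\times(\mathbb{R}^n)^m$ and $\kappa_1>1,\dots,\kappa_N>1$ such that $\xi_1=\rho+\kappa_1\gamma_1$ and $\xi_j=\rho+\gamma_1+\dots+\gamma_{j-1}+\kappa_j\gamma_j$ for $2\le j\le N$, where $\gamma_j=[p_j\otimes\alpha_j,(s_j\beta^i_j)]$ with $s_j\in\mathbb{R}$, $\alpha_j\in\mathbb{R}^n\setminus\{0\}$, $\beta_j^i\in\mathbb{R}^n$, $p_j\in\mathbb{R}^m$ satisfying $\sum_j s_jp_j=0$, $\sum_j s_j\beta^i_j=0$, $\sum_j p_j\otimes\alpha_j=0$, $\sum_j\beta^i_j\otimes\alpha_j=0$ (for all $i$), and $\beta^i_j\cdot\alpha_j=0$ (for all $i,j$). In this case put $\rho_1=\rho$, $\rho_j=\rho+\gamma_1+\dots+\gamma_{j-1}$ ($2\le j\le N$), and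 $\tau(\xi_1,\dots,\xi_N)=\bigcup_{j=1}^N\{(1-\lambda)\xi_j+\lambda\rho_j:0<\lambda<1\}$. Graph of $\sigma$: $\mathbb{K}=\{[A,(\sigma^i(A))]:A\in\mathbb{M}^{m\times n}\}$. Condition (OC): $\sigma$ satisfies Condition (OC) with open set $\Sigma$ if $\Sigma\subset\mathbb{M}^{m\times n}\times(\mathbb{R}^n)^m$ is a nonempty bounded open set such that for every $[A,(b^i)]\in\Sigma$ there exist $N\ge2$ and a $\tau_N$-configuration $(\xi_1,\dots,\xi_N)$ with $\xi_j\in\mathbb{K}$ for all $j$ and $[A,(b^i)]\in\tau(\xi_1,\dots,\xi_N)\subseteq\Sigma$. *)

theory Defs
  imports "HOL-Analysis.Analysis"
begin

fun cont_diff :: "nat \<Rightarrow> ('a::euclidean_space \<Rightarrow> real) \<Rightarrow> bool" where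
  "cont_diff 0 f \<longleftrightarrow> continuous_on UNIV f"
| "cont_diff (Suc k) f \<longleftrightarrow>
     (\<forall>x. f differentiable (at x)) \<and>
     (\<forall>e\<in>Basis. cont_diff k (\<lambda>x. frechet_derivative f (at x) e))"

(* C_c^infinity(U), each function being extended by zero to the whole space. *)
definition test_function :: "'a::euclidean_space set \<Rightarrow> ('a \<Rightarrow> real) \<Rightarrow> bool" where
  "test_function U \<phi> \<longleftrightarrow>
     (\<forall>k. cont_diff k \<phi>) \<and>
     compact (closure {x. \<phi> x \<noteq> 0}) \<and> closure {x. \<phi> x \<noteq> 0} \<subseteq> U"

definition L1_loc :: "'a::euclidean_space set \<Rightarrow> ('a \<Rightarrow> 'b::euclidean_space) \<Rightarrow> bool" where
  "L1_loc U f \<longleftrightarrow> (\<forall>K. compact K \<and> K \<subseteq> U \<longrightarrow> f absolutely_integrable_on K)"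

definition L_infinity :: "'a::euclidean_space set \<Rightarrow> ('a \<Rightarrow> 'b::euclidean_space) \<Rightarrow> bool" where
  "L_infinity U f \<longleftrightarrow>
     f \<in> borel_measurable (lebesgue_on U) \<and> (\<exists>C. AE x in lebesgue_on U. norm (f x) \<le> C)"

definition has_weak_deriv ::
  "'a::euclidean_space set \<Rightarrow> ('a \<Rightarrow> 'b::euclidean_space) \<Rightarrow> 'a \<Rightarrow> ('a \<Rightarrow> 'b) \<Rightarrow> bool" where
  "has_weak_deriv U u e v \<longleftrightarrow>
     L1_loc U u \<and> L1_loc U v \<and>
     (\<forall>\<phi>. test_function U \<phi> \<longrightarrow>
        (LINT x:U|lebesgue. frechet_derivative \<phi> (at x) e *\<^sub>R u x)
          = - (LINT x:U|lebesgue. \<phi> x *\<^sub>R v x))"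

(* On open U the weak derivative is unique up to null sets; this picks a representative.
   It is only meaningful where a weak derivative exists. *)
definition weak_deriv ::
  "'a::euclidean_space set \<Rightarrow> ('a \<Rightarrow> 'b::euclidean_space) \<Rightarrow> 'a \<Rightarrow> 'a \<Rightarrow> 'b" where
  "weak_deriv U u e = (SOME v. has_weak_deriv U u e v)"

definition W11_loc :: "'a::euclidean_space set \<Rightarrow> ('a \<Rightarrow> 'b::euclidean_space) \<Rightarrow> bool" where
  "W11_loc U u \<longleftrightarrow> L1_loc U u \<and> (\<forall>e\<in>Basis. \<exists>v. has_weak_deriv U u e v)"

definition W11 :: "'a::euclidean_space set \<Rightarrow> ('a \<Rightarrow> 'b::euclidean_space) \<Rightarrow> bool" where
  "W11 U u \<longleftrightarrow> u absolutely_integrable_on U \<and>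
     (\<forall>e\<in>Basis. \<exists>v. has_weak_deriv U u e v \<and> v absolutely_integrable_on U)"

definition W1_infinity :: "'a::euclidean_space set \<Rightarrow> ('a \<Rightarrow> 'b::euclidean_space) \<Rightarrow> bool" where
  "W1_infinity U u \<longleftrightarrow> L_infinity U u \<and>
     (\<forall>e\<in>Basis. \<exists>v. has_weak_deriv U u e v \<and> L_infinity U v)"

definition W11_norm :: "'a::euclidean_space set \<Rightarrow> ('a \<Rightarrow> 'b::euclidean_space) \<Rightarrow> real" where
  "W11_norm U u =
     (LINT x:U|lebesgue. norm (u x)) +
     (\<Sum>e\<in>Basis. LINT x:U|lebesgue. norm (weak_deriv U u e x))"

(* Weak* convergence in L^infinity(U) = (L^1(U))'. *)
definition weak_star_L_infinity ::
  "'a::euclidean_space set \<Rightarrow> (nat \<Rightarrow> 'a \<Rightarrow> 'b::euclidean_space) \<Rightarrow> ('a \<Rightarrow> 'b) \<Rightarrow> bool" where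
  "weak_star_L_infinity U f g \<longleftrightarrow>
     (\<forall>h. h absolutely_integrable_on U \<longrightarrow>
        (\<lambda>j. LINT x:U|lebesgue. f j x \<bullet> h x) \<longlonglongrightarrow> (LINT x:U|lebesgue. g x \<bullet> h x))"

definition weak_star_W1_infinity ::
  "'a::euclidean_space set \<Rightarrow> (nat \<Rightarrow> 'a \<Rightarrow> 'b::euclidean_space) \<Rightarrow> ('a \<Rightarrow> 'b) \<Rightarrow> bool" where
  "weak_star_W1_infinity U u v \<longleftrightarrow>
     (\<forall>j. W1_infinity U (u j)) \<and> W1_infinity U v \<and>
     weak_star_L_infinity U u v \<and>
     (\<forall>e\<in>Basis. weak_star_L_infinity U (\<lambda>j. weak_deriv U (u j) e) (weak_deriv U v e))"

(* Near each boundary point, Omega is the strict epigraph, in some direction nu, of a Lipschitz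
   function on the hyperplane orthogonal to nu (this avoids choosing rotated coordinates). *)
definition lipschitz_boundary :: "'a::euclidean_space set \<Rightarrow> bool" where
  "lipschitz_boundary \<Omega> \<longleftrightarrow>
     (\<forall>x\<in>frontier \<Omega>. \<exists>r>0. \<exists>\<nu> g L.
        norm \<nu> = 1 \<and> L-lipschitz_on {y. y \<bullet> \<nu> = 0} g \<and>
        \<Omega> \<inter> ball x r = {y \<in> ball x r. g (y - (y \<bullet> \<nu>) *\<^sub>R \<nu>) < y \<bullet> \<nu>})"

definition bounded_lipschitz_domain :: "'a::euclidean_space set \<Rightarrow> bool" where
  "bounded_lipschitz_domain \<Omega> \<longleftrightarrow>
     \<Omega> \<noteq> {} \<and> open \<Omega> \<and> connected \<Omega> \<and> bounded \<Omega> \<and> lipschitz_boundary \<Omega>"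

(* Normalised so that the s-dimensional Hausdorff measure agrees with Lebesgue measure on R^s. *)
definition hausdorff_pre :: "nat \<Rightarrow> real \<Rightarrow> 'a::metric_space set \<Rightarrow> ennreal" where
  "hausdorff_pre s \<delta> X =
     (INF C \<in> {C :: nat \<Rightarrow> 'a set.
                 X \<subseteq> (\<Union>i. C i) \<and> (\<forall>i. bounded (C i) \<and> diameter (C i) \<le> \<delta>)}.
        \<Sum>i. if C i = {} then 0
            else ennreal (unit_ball_vol (real s) * (diameter (C i) / 2) ^ s))"

definition hausdorff_outer :: "nat \<Rightarrow> 'a::metric_space set \<Rightarrow> ennreal" where
  "hausdorff_outer s X = (SUP \<delta>\<in>{0<..}. hausdorff_pre s \<delta> X)"

(* hausdorff_outer is a metric outer measure, hence countably additive on the Borel sets. *)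
definition hausdorff_measure :: "nat \<Rightarrow> 'a::metric_space measure" where
  "hausdorff_measure s = measure_of UNIV (sets borel) (hausdorff_outer s)"

(* The trace operator is the continuous extension, from the W^{1,1}(U)-norm to L^1 of the boundary
   with its surface measure, of the restriction w |-> w|boundary defined on
   W^{1,1}(U) \<inter> C(closure U).  For bounded Lipschitz U, the relation below is its graph
   (with Borel representatives of the boundary functions). *)
definition has_trace ::
  "'a::euclidean_space set \<Rightarrow> ('a \<Rightarrow> 'b::euclidean_space) \<Rightarrow> ('a \<Rightarrow> 'b) \<Rightarrow> bool" where
  "has_trace U u g \<longleftrightarrow>
     W11 U u \<and> g \<in> borel_measurable (restrict_space borel (frontier U)) \<and>
     (\<exists>w. (\<forall>k. W11 U (w k) \<and> continuous_on (closure U) (w k)) \<and>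
          (\<lambda>k. W11_norm U (\<lambda>x. w k x - u x)) \<longlonglongrightarrow> 0 \<and>
          (\<lambda>k. \<integral>\<^sup>+x\<in>frontier U. ennreal (norm (w k x - g x))
                  \<partial>hausdorff_measure (DIM('a) - 1)) \<longlonglongrightarrow> 0)"

definition trace_eq_on ::
  "'a::euclidean_space set \<Rightarrow> 'a set \<Rightarrow> ('a \<Rightarrow> 'b::euclidean_space) \<Rightarrow> ('a \<Rightarrow> 'b) \<Rightarrow> bool" where
  "trace_eq_on U \<Gamma> u f \<longleftrightarrow>
     (\<exists>g. has_trace U u g \<and>
          (AE x in hausdorff_measure (DIM('a) - 1). x \<in> \<Gamma> \<longrightarrow> g x = f x))"

definition cylinder :: "(real^'n) set \<Rightarrow> real \<Rightarrow> ((real^'n) \<times> real) set" where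
  "cylinder \<Omega> T = \<Omega> \<times> {0<..<T}"

definition spatial_jacobian ::
  "((real^'n) \<times> real) set \<Rightarrow> ((real^'n) \<times> real \<Rightarrow> real^'m) \<Rightarrow> (real^'n) \<times> real \<Rightarrow> real^'n^'m" where
  "spatial_jacobian U u p = (\<chi> i k. weak_deriv U u (axis k 1, 0) p $ i)"

(* has_bochner_integral ... 0 also demands that the integrand be integrable, so that the integral
   in the definition of a weak solution is meaningful. *)
definition weak_solution ::
  "(real^'n^'m \<Rightarrow> real^'n^'m) \<Rightarrow> (real^'n) set \<Rightarrow> real \<Rightarrow> ((real^'n) \<times> real \<Rightarrow> real^'m) \<Rightarrow> bool" where
  "weak_solution \<sigma> \<Omega> T u \<longleftrightarrow>
     W11_loc (cylinder \<Omega> T) u \<and>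
     (\<forall>\<phi> i. test_function (cylinder \<Omega> T) \<phi> \<longrightarrow>
        has_bochner_integral (lebesgue_on (cylinder \<Omega> T))
          (\<lambda>p. u p $ i * frechet_derivative \<phi> (at p) (0, 1)
             - (\<Sum>k\<in>UNIV. \<sigma> (spatial_jacobian (cylinder \<Omega> T) u p) $ i $ k
                            * frechet_derivative \<phi> (at p) (axis k 1, 0)))
          0)"

definition weak_solution_ibvp ::
  "(real^'n^'m \<Rightarrow> real^'n^'m) \<Rightarrow> (real^'n) set \<Rightarrow> real \<Rightarrow>
   (real^'n \<Rightarrow> real \<Rightarrow> real^'m) \<Rightarrow> (real^'n \<Rightarrow> real^'m) \<Rightarrow> ((real^'n) \<times> real \<Rightarrow> real^'m) \<Rightarrow> bool" where
  "weak_solution_ibvp \<sigma> \<Omega> T bdry init u \<longleftrightarrow>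
     W11 (cylinder \<Omega> T) u \<and> weak_solution \<sigma> \<Omega> T u \<and>
     trace_eq_on (cylinder \<Omega> T) (frontier \<Omega> \<times> {0<..<T}) u (\<lambda>(x, t). bdry x t) \<and>
     trace_eq_on (cylinder \<Omega> T) (\<Omega> \<times> {0}) u (\<lambda>(x, t). init x)"

definition lipschitz_weak_solution_ibvp ::
  "(real^'n^'m \<Rightarrow> real^'n^'m) \<Rightarrow> (real^'n) set \<Rightarrow> real \<Rightarrow>
   (real^'n \<Rightarrow> real \<Rightarrow> real^'m) \<Rightarrow> (real^'n \<Rightarrow> real^'m) \<Rightarrow> ((real^'n) \<times> real \<Rightarrow> real^'m) \<Rightarrow> bool" where
  "lipschitz_weak_solution_ibvp \<sigma> \<Omega> T bdry init u \<longleftrightarrow>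
     weak_solution_ibvp \<sigma> \<Omega> T bdry init u \<and> W1_infinity (cylinder \<Omega> T) u"

definition tensor :: "real^'a \<Rightarrow> real^'b \<Rightarrow> real^'b^'a" where
  "tensor p \<alpha> = (\<chi> i k. p $ i * \<alpha> $ k)"

(* Elements [A,(b^i)] of M^{m x n} x (R^n)^m are pairs (A, b) with b $ i = b^i. *)

definition rho_at ::
  "((real^'n^'m) \<times> (real^'n^'m)) \<Rightarrow> (nat \<Rightarrow> (real^'n^'m) \<times> (real^'n^'m)) \<Rightarrow> nat \<Rightarrow>
   (real^'n^'m) \<times> (real^'n^'m)" where
  "rho_at \<rho> \<gamma> j = \<rho> + (\<Sum>l\<in>{1..<j}. \<gamma> l)"

(* (xi_1,...,xi_N) is a tau_N-configuration, witnessed by rho and gamma. *)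
definition tau_configuration ::
  "nat \<Rightarrow> (nat \<Rightarrow> (real^'n^'m) \<times> (real^'n^'m)) \<Rightarrow>
   ((real^'n^'m) \<times> (real^'n^'m)) \<Rightarrow> (nat \<Rightarrow> (real^'n^'m) \<times> (real^'n^'m)) \<Rightarrow> bool" where
  "tau_configuration N \<xi> \<rho> \<gamma> \<longleftrightarrow>
     (\<exists>(\<kappa> :: nat \<Rightarrow> real) (p :: nat \<Rightarrow> real^'m) (\<alpha> :: nat \<Rightarrow> real^'n)
       (s :: nat \<Rightarrow> real) (\<beta> :: nat \<Rightarrow> 'm \<Rightarrow> real^'n).
        (\<forall>j\<in>{1..N}. \<kappa> j > 1 \<and> \<xi> j = rho_at \<rho> \<gamma> j + \<kappa> j *\<^sub>R \<gamma> j \<and>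
           \<gamma> j = (tensor (p j) (\<alpha> j), \<chi> i. s j *\<^sub>R \<beta> j i) \<and>
           \<alpha> j \<noteq> 0 \<and> (\<forall>i. \<beta> j i \<bullet> \<alpha> j = 0)) \<and>
        (\<Sum>j\<in>{1..N}. s j *\<^sub>R p j) = 0 \<and>
        (\<forall>i. (\<Sum>j\<in>{1..N}. s j *\<^sub>R \<beta> j i) = 0) \<and>
        (\<Sum>j\<in>{1..N}. tensor (p j) (\<alpha> j)) = 0 \<and>
        (\<forall>i. (\<Sum>j\<in>{1..N}. tensor (\<beta> j i) (\<alpha> j)) = 0))"

definition tau_set ::
  "nat \<Rightarrow> (nat \<Rightarrow> (real^'n^'m) \<times> (real^'n^'m)) \<Rightarrow>
   ((real^'n^'m) \<times> (real^'n^'m)) \<Rightarrow> (nat \<Rightarrow> (real^'n^'m) \<times> (real^'n^'m)) \<Rightarrow>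
   ((real^'n^'m) \<times> (real^'n^'m)) set" where
  "tau_set N \<xi> \<rho> \<gamma> =
     (\<Union>j\<in>{1..N}. {(1 - c) *\<^sub>R \<xi> j + c *\<^sub>R rho_at \<rho> \<gamma> j | c. 0 < c \<and> c < 1})"

definition sigma_graph ::
  "(real^'n^'m \<Rightarrow> real^'n^'m) \<Rightarrow> ((real^'n^'m) \<times> (real^'n^'m)) set" where
  "sigma_graph \<sigma> = {(A, \<chi> i. row i (\<sigma> A)) | A. True}"

(* The set tau(xi_1,...,xi_N) is formed with the rho, gamma witnessing the configuration. *)
definition condition_OC ::
  "(real^'n^'m \<Rightarrow> real^'n^'m) \<Rightarrow> ((real^'n^'m) \<times> (real^'n^'m)) set \<Rightarrow> bool" where
  "condition_OC \<sigma> S \<longleftrightarrow>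
     S \<noteq> {} \<and> bounded S \<and> open S \<and>
     (\<forall>(A, b)\<in>S. \<exists>N\<ge>2. \<exists>\<xi> \<rho> \<gamma>.
        tau_configuration N \<xi> \<rho> \<gamma> \<and> (\<forall>j\<in>{1..N}. \<xi> j \<in> sigma_graph \<sigma>) \<and>
        (A, b) \<in> tau_set N \<xi> \<rho> \<gamma> \<and> tau_set N \<xi> \<rho> \<gamma> \<subseteq> S)"

end

theory Submission
  imports Defs "HOL-Computational_Algebra.Polynomial"
begin

text \<open>
Write a function as \<open>A x + w\<close> and record at every space-time point a state \<open>(P, q, V)\<close>: the spatial
gradient, the velocity and a flux. The equation \<open>u\<^sub>t = div \<sigma>(Du)\<close> means that some flux \<open>V\<close> satisfies
\<open>u\<^sub>t = div V\<close> and that \<open>(Du, V)\<close> takes its values in the graph of \<open>\<sigma>\<close>. A subsolution keeps the linear part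
\<open>u\<^sub>t = div V\<close> and relaxes the inclusion to \<open>(Du, V) \<in> S\<close>. Convex integration adds finer and finer
oscillations to a subsolution until its states reach the graph.

The oscillations come from the rank-one structure of the \<open>\<gamma>\<^sub>j\<close> in a tau configuration. If \<open>\<gamma> = (p \<otimes> \<alpha>, B)\<close> and
the rows of \<open>B\<close> are orthogonal to \<open>\<alpha>\<close>, then a rapidly oscillating profile \<open>f(\<alpha> \<bullet> x)\<close> times \<open>\<gamma>\<close> is, up to a small error, the state
of a compactly supported perturbation: \<open>f p \<otimes> \<alpha>\<close> is a gradient and \<open>f B\<close> is divergence-free. The wave
does not oscillate in time, so its velocity is small too (\<open>plane_wave\<close>).

The function \<open>max_gain\<close> measures how much oscillation a state admits: it is the supremum of the mean energy of
perturbations of the unit ball that keep the state inside the constraint set. The main point is that at a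
state \<open>\<eta>\<close> it is at least half the squared distance of \<open>\<eta>\<close> to the graph (\<open>max_gain_ge_dist\<close>). For the proof
\<open>max_gain y + \<bar>y - \<eta>\<bar>\<^sup>2 / 2\<close> is minimised over the closed polygon formed by the segments from \<open>\<rho>\<^sub>j\<close> to \<open>\<xi>\<^sub>j\<close>.
A minimum in the interior of a nondegenerate segment is impossible: a plane wave along the segment, followed by
nearly optimal perturbations of the states that it visits, would gain more than the minimum allows
(\<open>strict_gain_along_wave\<close>). Each \<open>\<rho>\<^sub>j\<close> is interior to the preceding segment because \<open>\<kappa> > 1\<close>, cyclically
because the \<open>\<gamma>\<^sub>j\<close> sum to zero. Hence the minimum is attained at some \<open>\<xi>\<^sub>j\<close> in the graph, where the function is at least
\<open>\<bar>\<xi>\<^sub>j - \<eta>\<bar>\<^sup>2 / 2\<close>; at \<open>\<eta>\<close> it equals \<open>max_gain \<eta>\<close>.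

A Vitali covering packs rescaled nearly optimal perturbations into the space-time domain (\<open>fill\<close>). A subsolution
can therefore be changed by a uniformly small amount so that the squared \<open>L\<^sup>2\<close> norm of the change of its states is at least half
of the integral of the squared distance to the graph, up to a small error, and the change is almost orthogonal to all earlier states (\<open>improvement_step\<close>). Almost
orthogonality makes the energies increase, boundedness makes them converge, so the states are Cauchy in
\<open>L\<^sup>2\<close> and the distance to the graph tends to zero (\<open>convex_integration\<close>). The limits are Lipschitz weak solutions
that are uniformly close to the given subsolution and have the same boundary values.

It remains to find a subsolution that is not a solution. Let \<open>g\<close> be a bump centred at time \<open>T / 2\<close> and let
\<open>v = A x + \<epsilon> (\<partial>\<^sub>k g) e\<^sub>i\<close>, which is a subsolution for small \<open>\<epsilon>\<close> since \<open>S\<close> is open. Test the equation with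
\<open>\<phi> = \<partial>\<^sub>t \<partial>\<^sub>k g\<close>. Under the reflection \<open>t \<mapsto> T - t\<close> the spatial gradient of \<open>v\<close> is even and the spatial derivatives of \<open>\<phi>\<close> are odd,
so the flux term vanishes, whatever \<open>\<sigma>\<close> is, while the other term is \<open>- \<epsilon> \<integral>\<phi>\<^sup>2 \<noteq> 0\<close> (\<open>bump_not_weak_solution\<close>).
Exact solutions converging uniformly to \<open>v\<close> with bounded derivatives converge weakly* in
\<open>W\<^sup>1\<^sup>,\<^sup>\<infinity>\<close>, which proves the theorem.
\<close>

section \<open>Smooth functions and the standard bump\<close>

definition dirderiv :: "'a::euclidean_space \<Rightarrow> ('a \<Rightarrow> real) \<Rightarrow> 'a \<Rightarrow> real" where
  "dirderiv e f x = frechet_derivative f (at x) e"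

text \<open>A function together with all its derivatives, so that compositions can be differentiated without
naming the derivative again.\<close>

definition derivative_tower :: "(nat \<Rightarrow> real \<Rightarrow> real) \<Rightarrow> bool" where
  "derivative_tower \<psi> \<longleftrightarrow> (\<forall>n x. (\<psi> n has_real_derivative \<psi> (Suc n) x) (at x))"

text \<open>A syntactic class of smooth functions. It contains all functions that the construction uses, is closed under directional
derivatives, and symmetry of second derivatives follows by induction, without any
calculus of multilinear derivatives.\<close>

inductive smooth_expr :: "('a::euclidean_space \<Rightarrow> real) \<Rightarrow> bool" where
  const: "smooth_expr (\<lambda>x. c)"
| inner: "smooth_expr (\<lambda>x. x \<bullet> a)"
| add: "smooth_expr f \<Longrightarrow> smooth_expr g \<Longrightarrow> smooth_expr (\<lambda>x. f x + g x)"
| mult: "smooth_expr f \<Longrightarrow> smooth_expr g \<Longrightarrow> smooth_expr (\<lambda>x. f x * g x)"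
| compose: "derivative_tower \<psi> \<Longrightarrow> smooth_expr f \<Longrightarrow> smooth_expr (\<lambda>x. \<psi> 0 (f x))"

lemma dirderiv_eqI: "(f has_derivative f') (at x) \<Longrightarrow> dirderiv e f x = f' e"
  unfolding dirderiv_def using frechet_derivative_at by fastforce

lemma dirderiv_const [simp]: "dirderiv e (\<lambda>x. c) = (\<lambda>x. 0)"
  by (rule ext, rule dirderiv_eqI[THEN trans, OF has_derivative_const]) simp

lemma dirderiv_inner [simp]: "dirderiv e (\<lambda>x. x \<bullet> a) = (\<lambda>x. e \<bullet> a)"
proof
  fix x
  have "((\<lambda>x. x \<bullet> a) has_derivative (\<lambda>h. h \<bullet> a)) (at x)"
    by (auto intro!: derivative_eq_intros)
  then show "dirderiv e (\<lambda>x. x \<bullet> a) x = e \<bullet> a" by (rule dirderiv_eqI)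
qed

lemma has_derivative_dirderiv:
  "f differentiable (at x) \<Longrightarrow> (f has_derivative (\<lambda>h. dirderiv h f x)) (at x)"
  unfolding dirderiv_def by (simp add: frechet_derivative_works[symmetric])

lemma dirderiv_add:
  assumes "\<And>x. f differentiable (at x)" "\<And>x. g differentiable (at x)"
  shows "dirderiv e (\<lambda>x. f x + g x) = (\<lambda>x. dirderiv e f x + dirderiv e g x)"
proof
  fix x
  have "((\<lambda>x. f x + g x) has_derivative (\<lambda>h. dirderiv h f x + dirderiv h g x)) (at x)"
    by (intro has_derivative_add has_derivative_dirderiv assms)
  then show "dirderiv e (\<lambda>x. f x + g x) x = dirderiv e f x + dirderiv e g x" by (rule dirderiv_eqI)
qed

lemma dirderiv_mult:
  assumes "\<And>x. f differentiable (at x)" "\<And>x. g differentiable (at x)"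
  shows "dirderiv e (\<lambda>x. f x * g x) = (\<lambda>x. f x * dirderiv e g x + dirderiv e f x * g x)"
proof
  fix x
  have "((\<lambda>x. f x * g x) has_derivative (\<lambda>h. f x * dirderiv h g x + dirderiv h f x * g x)) (at x)"
    by (intro has_derivative_mult has_derivative_dirderiv assms)
  then show "dirderiv e (\<lambda>x. f x * g x) x = f x * dirderiv e g x + dirderiv e f x * g x"
    by (rule dirderiv_eqI)
qed

lemma has_derivative_compose_tower:
  assumes "derivative_tower \<psi>" "f differentiable (at x)"
  shows "((\<lambda>x. \<psi> n (f x)) has_derivative (\<lambda>h. \<psi> (Suc n) (f x) * dirderiv h f x)) (at x)"
proof -
  have "(\<psi> n has_derivative (\<lambda>h. \<psi> (Suc n) (f x) * h)) (at (f x))"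
    using assms(1) unfolding derivative_tower_def has_field_derivative_def by blast
  from has_derivative_compose[OF has_derivative_dirderiv[OF assms(2)] this] show ?thesis .
qed

lemma dirderiv_compose:
  assumes "derivative_tower \<psi>" "\<And>x. f differentiable (at x)"
  shows "dirderiv e (\<lambda>x. \<psi> n (f x)) = (\<lambda>x. \<psi> (Suc n) (f x) * dirderiv e f x)"
  using has_derivative_compose_tower[OF assms(1) assms(2)] by (intro ext dirderiv_eqI)

lemma derivative_tower_Suc: "derivative_tower \<psi> \<Longrightarrow> derivative_tower (\<lambda>n. \<psi> (n + k))"
  unfolding derivative_tower_def by simp

lemma smooth_expr_compose_nth:
  "derivative_tower \<psi> \<Longrightarrow> smooth_expr f \<Longrightarrow> smooth_expr (\<lambda>x. \<psi> n (f x))"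
  using smooth_expr.compose[OF derivative_tower_Suc[of \<psi> n], of f] by simp

lemma smooth_expr_differentiable: "smooth_expr f \<Longrightarrow> f differentiable (at x)"
proof (induction rule: smooth_expr.induct)
  case (compose \<psi> f)
  from has_derivative_compose_tower[OF compose(1,3)] show ?case
    unfolding differentiable_def by blast
qed (auto intro!: differentiable_add differentiable_mult simp: inner_commute)

lemma smooth_expr_dirderiv: "smooth_expr f \<Longrightarrow> smooth_expr (dirderiv e f)"
proof (induction rule: smooth_expr.induct)
  case (compose \<psi> f)
  show ?case
    using smooth_expr.mult[OF smooth_expr_compose_nth[OF compose(1,2), of "Suc 0"] compose(3)]
    by (simp add: dirderiv_compose[OF compose(1) smooth_expr_differentiable[OF compose(2)]])
qed (auto simp: dirderiv_add dirderiv_mult smooth_expr_differentiable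
    intro!: smooth_expr.intros(1-4))

lemma smooth_expr_dirderiv_commute:
  "smooth_expr f \<Longrightarrow> dirderiv a (dirderiv b f) = dirderiv b (dirderiv a f)"
proof (induction rule: smooth_expr.induct)
  case (add f g)
  then show ?case
    by (simp add: dirderiv_add smooth_expr_differentiable smooth_expr_dirderiv)
next
  case (mult f g)
  then show ?case
    by (simp add: dirderiv_mult dirderiv_add smooth_expr_differentiable smooth_expr_dirderiv
        smooth_expr.mult algebra_simps)
next
  case (compose \<psi> f)
  then show ?case
    by (simp add: dirderiv_compose dirderiv_mult smooth_expr_compose_nth
        smooth_expr_differentiable smooth_expr_dirderiv algebra_simps)
qed simp_all

lemma smooth_expr_has_derivative:
  "smooth_expr f \<Longrightarrow> (f has_derivative (\<lambda>h. dirderiv h f x)) (at x)"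
  by (simp add: has_derivative_dirderiv smooth_expr_differentiable)

lemma smooth_expr_continuous: "smooth_expr f \<Longrightarrow> continuous_on A f"
  by (meson continuous_at_imp_continuous_on differentiable_imp_continuous_within
      smooth_expr_differentiable)

lemma smooth_expr_cont_diff: "smooth_expr f \<Longrightarrow> cont_diff k f"
proof (induction k arbitrary: f)
  case 0
  then show ?case by (simp add: smooth_expr_continuous)
next
  case (Suc k)
  then show ?case
    using smooth_expr_dirderiv[OF Suc(2)]
    by (simp add: smooth_expr_differentiable dirderiv_def[abs_def])
qed

lemma smooth_expr_uminus: "smooth_expr f \<Longrightarrow> smooth_expr (\<lambda>x. - f x)"
  using smooth_expr.mult[OF smooth_expr.const[of "-1"], of f] by simp

lemma smooth_expr_diff: "smooth_expr f \<Longrightarrow> smooth_expr g \<Longrightarrow> smooth_expr (\<lambda>x. f x - g x)"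
  using smooth_expr.add[OF _ smooth_expr_uminus, of f g] by simp

lemma smooth_expr_prod:
  "(\<And>i. i \<in> I \<Longrightarrow> smooth_expr (f i)) \<Longrightarrow> smooth_expr (\<lambda>x. \<Prod>i\<in>I. f i x)"
  by (induction I rule: infinite_finite_induct) (auto intro: smooth_expr.intros(1-4))

lemma smooth_expr_sum:
  "(\<And>i. i \<in> I \<Longrightarrow> smooth_expr (f i)) \<Longrightarrow> smooth_expr (\<lambda>x. \<Sum>i\<in>I. f i x)"
  by (induction I rule: infinite_finite_induct) (auto intro: smooth_expr.intros(1-4))

lemma smooth_expr_norm_sq:
  fixes c :: "'a::euclidean_space"
  shows "smooth_expr (\<lambda>x. (norm (x - c))\<^sup>2)"
proof -
  have "(norm (x - c))\<^sup>2 = (\<Sum>b\<in>Basis. (x \<bullet> b - c \<bullet> b) * (x \<bullet> b - c \<bullet> b))" for x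
    by (subst norm_eq_sqrt_inner, subst euclidean_inner)
      (simp add: inner_diff_left sum_nonneg)
  then show ?thesis
    by (simp only:) (intro smooth_expr_sum smooth_expr.mult smooth_expr_diff smooth_expr.const smooth_expr.inner)
qed

text \<open>The functions \<open>p(1/x) e\<^sup>-\<^sup>1\<^sup>/\<^sup>x\<close>, extended by zero. Differentiation acts on the polynomial alone, by
\<open>p \<mapsto> X\<^sup>2 (p - p')\<close>, so the derivatives of \<open>e\<^sup>-\<^sup>1\<^sup>/\<^sup>x\<close> of every order have this form.\<close>

definition flat :: "real poly \<Rightarrow> real \<Rightarrow> real" where
  "flat p x = (if x \<le> 0 then 0 else poly p (1 / x) * exp (- (1 / x)))"

lemma poly_exp_tendsto_0: "((\<lambda>y. poly p y * exp (- y)) \<longlongrightarrow> (0::real)) at_top"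
proof -
  have "((\<lambda>y. \<Sum>i\<le>degree p. coeff p i * (y ^ i / exp y)) \<longlongrightarrow> (\<Sum>i\<le>degree p. coeff p i * 0)) at_top"
    by (intro tendsto_intros tendsto_power_div_exp_0)
  then show ?thesis
    by (simp add: poly_altdef sum_distrib_right exp_minus divide_inverse mult.assoc)
qed

lemma flat_at_right_0: "(flat p \<longlongrightarrow> 0) (at_right 0)"
proof -
  have "((\<lambda>x. poly p (inverse x) * exp (- (inverse x))) \<longlongrightarrow> 0) (at_right 0)"
    using filterlim_compose[OF poly_exp_tendsto_0 filterlim_inverse_at_top_right] .
  moreover have "\<forall>\<^sub>F x in at_right 0. poly p (inverse x) * exp (- (inverse x)) = flat p x"
    by (auto simp: eventually_at_filter flat_def inverse_eq_divide)
  ultimately show ?thesis by (simp add: tendsto_cong)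
qed

lemma flat_deriv: "(flat p has_real_derivative flat (monom 1 2 * (p - pderiv p)) x) (at x)"
proof -
  consider "x < 0" | "x = 0" | "x > 0" by linarith
  then show ?thesis
  proof cases
    case 1
    have "(flat p has_real_derivative 0) (at x)"
      by (rule has_field_derivative_transform_within_open[of "\<lambda>_. 0" _ _ "{..<0}"])
        (use 1 in \<open>auto simp: flat_def\<close>)
    then show ?thesis using 1 by (simp add: flat_def)
  next
    case 2
    have "((\<lambda>h. (flat p (0 + h) - flat p 0) / h) \<longlongrightarrow> 0) (at 0)"
      proof (rule filterlim_split_at_real)
      have "\<forall>\<^sub>F h in at_left 0. 0 = (flat p (0 + h) - flat p 0) / h"
        by (auto simp: eventually_at_filter flat_def)
      then show "((\<lambda>h. (flat p (0 + h) - flat p 0) / h) \<longlongrightarrow> 0) (at_left 0)"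
        by (rule tendsto_cong[THEN iffD1]) simp
      have "\<forall>\<^sub>F h in at_right 0. flat (monom 1 1 * p) h = (flat p (0 + h) - flat p 0) / h"
        by (auto simp: eventually_at_filter flat_def poly_monom)
      then show "((\<lambda>h. (flat p (0 + h) - flat p 0) / h) \<longlongrightarrow> 0) (at_right 0)"
        by (rule tendsto_cong[THEN iffD1]) (rule flat_at_right_0)
    qed
    then show ?thesis using 2 by (simp add: DERIV_def flat_def)
  next
    case 3
    have "((\<lambda>x. poly p (1 / x) * exp (- (1 / x))) has_real_derivative
        flat (monom 1 2 * (p - pderiv p)) x) (at x)"
      using 3 by (auto intro!: derivative_eq_intros simp: flat_def poly_monom field_simps power2_eq_square)
    then show ?thesis
      by (rule has_field_derivative_transform_within_open[of _ _ _ "{0<..}"])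
        (use 3 in \<open>auto simp: flat_def\<close>)
  qed
qed

definition bump_tower :: "nat \<Rightarrow> real \<Rightarrow> real" where
  "bump_tower n = flat (((\<lambda>p. monom 1 2 * (p - pderiv p)) ^^ n) 1)"

lemma derivative_tower_bump: "derivative_tower bump_tower"
  unfolding derivative_tower_def bump_tower_def using flat_deriv by simp

lemma bump_tower_nonpos: "s \<le> 0 \<Longrightarrow> bump_tower n s = 0"
  by (simp add: bump_tower_def flat_def)

lemma bump_tower_0: "s > 0 \<Longrightarrow> bump_tower 0 s = exp (- (1 / s))"
  by (simp add: bump_tower_def flat_def)

text \<open>On this interval \<open>e\<^sup>-\<^sup>1\<^sup>/\<^sup>s\<close> is convex; the inflection point is \<open>s = 1/2\<close>. This makes a mixed second
derivative of the bump visibly nonzero.\<close>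

lemma bump_tower_2_pos:
  assumes "0 < s" "s < 1/2"
  shows "bump_tower 2 s > 0"
proof -
  have "bump_tower 2 s = ((1/s)^4 - 2 * (1/s)^3) * exp (- (1/s))"
    using assms by (simp add: bump_tower_def flat_def numeral_2_eq_2 pderiv_mult pderiv_diff
        pderiv_monom poly_monom algebra_simps power_numeral_reduce)
  also have "y^4 - 2 * y^3 = y^3 * (y - 2)" for y :: real
    by (simp add: algebra_simps power_numeral_reduce)
  also have "(1/s)^3 * (1/s - 2) * exp (- (1/s)) > 0"
    using assms by (intro mult_pos_pos) (auto simp: field_simps)
  finally show ?thesis .
qed

lemma derivative_tower_cos: "derivative_tower (\<lambda>n x. cos (x + n * pi / 2))"
  unfolding derivative_tower_def
proof (intro allI)
  fix n and x :: real
  have "cos (x + real (Suc n) * pi / 2) = cos ((x + real n * pi / 2) + pi / 2)"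
    by (rule arg_cong[of _ _ cos]) (simp add: field_simps)
  also have "\<dots> = - sin (x + real n * pi / 2)"
    by (simp add: cos_add)
  finally show "((\<lambda>x. cos (x + real n * pi / 2)) has_real_derivative
      cos (x + real (Suc n) * pi / 2)) (at x)"
    by (auto intro!: derivative_eq_intros)
qed

section \<open>Integration by parts\<close>

lemma lborel_integral_affine:
  fixes f :: "'a::euclidean_space \<Rightarrow> 'b::{banach, second_countable_topology}"
  assumes c: "c \<noteq> 0"
  shows "(\<integral>x. f x \<partial>lborel) = (\<bar>c\<bar> ^ DIM('a)) *\<^sub>R (\<integral>x. f (t + c *\<^sub>R x) \<partial>lborel)"
proof -
  have eq: "lborel = density (distr lborel borel (\<lambda>x. t + c *\<^sub>R x)) (\<lambda>_. ennreal (\<bar>c\<bar> ^ DIM('a)))"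
    using lborel_affine[OF c, of t] by (simp add: ennreal_power)
  have *: "integrable lborel (\<lambda>x. f (t + c *\<^sub>R x)) \<and>
      (\<integral>x. f x \<partial>lborel) = (\<bar>c\<bar> ^ DIM('a)) *\<^sub>R (\<integral>x. f (t + c *\<^sub>R x) \<partial>lborel)"
    if f: "integrable lborel f"
      and eq: "lborel = density (distr lborel borel (\<lambda>x. t + c *\<^sub>R x)) (\<lambda>_. ennreal (\<bar>c\<bar> ^ DIM('a)))"
      and c: "c \<noteq> 0" for f :: "'a \<Rightarrow> 'b" and c :: real and t
  proof -
    have [measurable]: "f \<in> borel_measurable borel" using f by auto
    have "integrable (density (distr lborel borel (\<lambda>x. t + c *\<^sub>R x)) (\<lambda>_. ennreal (\<bar>c\<bar> ^ DIM('a)))) f"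
      using f eq by simp
    then have "integrable lborel (\<lambda>x. (\<bar>c\<bar> ^ DIM('a)) *\<^sub>R f (t + c *\<^sub>R x))"
      by (simp add: integrable_density integrable_distr_eq)
    from integrable_scaleR_right[OF this, of "1 / \<bar>c\<bar> ^ DIM('a)"]
    have "integrable lborel (\<lambda>x. f (t + c *\<^sub>R x))" using c by simp
    moreover have "(\<integral>x. f x \<partial>lborel) = (\<integral>x. (\<bar>c\<bar> ^ DIM('a)) *\<^sub>R f (t + c *\<^sub>R x) \<partial>lborel)"
      by (subst eq) (simp add: integral_density integral_distr)
    ultimately show ?thesis using c by simp
  qed
  show ?thesis
  proof (cases "integrable lborel f")
    case True
    then show ?thesis using *[OF True eq c] by blast
  next
    case False
    have "\<not> integrable lborel (\<lambda>x. f (t + c *\<^sub>R x))"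
    proof
      assume I: "integrable lborel (\<lambda>x. f (t + c *\<^sub>R x))"
      have c': "1 / c \<noteq> 0" using c by simp
      have "integrable lborel (\<lambda>x. f (t + c *\<^sub>R (- (t /\<^sub>R c) + (1 / c) *\<^sub>R x)))"
        using *[OF I _ c', of "- (t /\<^sub>R c)"] lborel_affine[OF c', of "- (t /\<^sub>R c)"]
        by (simp add: ennreal_power)
      moreover have "t + c *\<^sub>R (- (t /\<^sub>R c) + (1 / c) *\<^sub>R x) = x" for x
        using c by (simp add: scaleR_add_right scaleR_diff_right)
      ultimately show False using False by simp
    qed
    with False show ?thesis by (simp add: not_integrable_integral_eq)
  qed
qed

lemma integrable_compact_support:
  fixes f :: "'a::euclidean_space \<Rightarrow> 'b::euclidean_space"
  assumes "continuous_on UNIV f" "compact K" "\<And>x. x \<notin> K \<Longrightarrow> f x = 0"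
  shows "integrable lborel f"
proof -
  have "integrable lborel (\<lambda>x. indicator K x *\<^sub>R f x)"
    using assms by (intro borel_integrable_compact) (auto intro: continuous_on_subset)
  moreover have "(\<lambda>x. indicator K x *\<^sub>R f x) = f"
    using assms(3) by (auto simp: indicator_def fun_eq_iff)
  ultimately show ?thesis by simp
qed

lemma bounded_compact_support:
  fixes f :: "'a::euclidean_space \<Rightarrow> 'b::euclidean_space"
  assumes "continuous_on UNIV f" "compact K" "\<And>x. x \<notin> K \<Longrightarrow> f x = 0"
  obtains B where "B > 0" "\<And>x. norm (f x) \<le> B"
proof -
  have "compact (f ` K)"
    using assms(1,2) compact_continuous_image continuous_on_subset by blast
  then obtain B where B: "B > 0" "\<And>x. x \<in> K \<Longrightarrow> norm (f x) \<le> B"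
    using compact_imp_bounded[THEN bounded_pos[THEN iffD1]] by (metis imageI)
  then have "norm (f x) \<le> B" for x
    using assms(3)[of x] by (cases "x \<in> K") auto
  with B(1) show ?thesis using that by blast
qed

lemma derivative_compact_support:
  assumes "\<And>x. (f has_derivative f' x) (at x)" "closed K" "\<And>x. x \<notin> K \<Longrightarrow> f x = 0" "x \<notin> K"
  shows "f' x = (\<lambda>h. 0)"
proof -
  have "(f has_derivative (\<lambda>h. 0)) (at x)"
    by (rule has_derivative_transform_within_open[OF has_derivative_const, of "- K"])
      (use assms in auto)
  then show ?thesis using assms(1)[of x] has_derivative_unique by blast
qed

text \<open>Lebesgue measure is translation invariant, so every difference quotient has integral zero; these converge to the derivative
under a common bound on a common compact set.\<close>

lemma integral_derivative_compact_support:
  fixes f :: "'a::euclidean_space \<Rightarrow> 'b::euclidean_space"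
  assumes der: "\<And>x. (f has_derivative f' x) (at x)"
    and cont: "continuous_on UNIV (\<lambda>x. f' x e)"
    and K: "compact K" "\<And>x. x \<notin> K \<Longrightarrow> f x = 0"
  shows "integrable lborel (\<lambda>x. f' x e)" "(\<integral>x. f' x e \<partial>lborel) = 0"
proof -
  have contf: "continuous_on UNIV f"
    using der by (meson continuous_at_imp_continuous_on has_derivative_continuous)
  have z: "f' x e = 0" if "x \<notin> K" for x
    using derivative_compact_support[OF der compact_imp_closed[OF K(1)] K(2) that] by simp
  obtain B where B: "B > 0" "\<And>x. norm (f' x e) \<le> B"
    using bounded_compact_support[OF cont K(1) z] by blast
  show "integrable lborel (\<lambda>x. f' x e)" by (rule integrable_compact_support[OF cont K(1) z])
  obtain R where R: "R > 0" "\<And>x. x \<in> K \<Longrightarrow> norm x \<le> R"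
    using compact_imp_bounded[OF K(1)] bounded_pos by blast
  define D where "D n x = real (Suc n) *\<^sub>R (f (x + (1 / real (Suc n)) *\<^sub>R e) - f x)" for n x
  have intf: "integrable lborel f" by (rule integrable_compact_support[OF contf K])
  have ints: "integrable lborel (\<lambda>x. f (x + s *\<^sub>R e))" for s
  proof (rule integrable_compact_support[where K="(\<lambda>y. y - s *\<^sub>R e) ` K"])
    show "continuous_on UNIV (\<lambda>x. f (x + s *\<^sub>R e))"
      by (intro continuous_on_compose2[OF contf] continuous_intros) auto
    show "compact ((\<lambda>y. y - s *\<^sub>R e) ` K)"
      by (intro compact_continuous_image K continuous_intros)
    show "f (x + s *\<^sub>R e) = 0" if "x \<notin> (\<lambda>y. y - s *\<^sub>R e) ` K" for x
      using that by (intro K(2)) (auto simp: image_iff)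
  qed
  have trans: "(\<integral>x. f (x + s *\<^sub>R e) \<partial>lborel) = (\<integral>x. f x \<partial>lborel)" for s
    using lborel_integral_affine[of 1 f "s *\<^sub>R e"] by (simp add: add.commute)
  have D0: "(\<integral>x. D n x \<partial>lborel) = 0" for n
    unfolding D_def using ints intf trans by simp
  have lip: "norm (f (x + s *\<^sub>R e) - f x) \<le> B * s" if "s \<ge> 0" for x s
  proof -
    have "norm (f (x + s *\<^sub>R e) - f (x + 0 *\<^sub>R e)) \<le> B * norm (s - 0)"
    proof (rule differentiable_bound[of "{0..s}" "\<lambda>s. f (x + s *\<^sub>R e)" "\<lambda>s h. f' (x + s *\<^sub>R e) (h *\<^sub>R e)"])
      show "((\<lambda>s. f (x + s *\<^sub>R e)) has_derivative (\<lambda>h. f' (x + s *\<^sub>R e) (h *\<^sub>R e))) (at s within {0..s'})" for s s'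
        by (rule has_derivative_compose[of "\<lambda>s. x + s *\<^sub>R e", OF _ der])
          (auto intro!: derivative_eq_intros)
      show "onorm (\<lambda>h. f' (x + s *\<^sub>R e) (h *\<^sub>R e)) \<le> B" for s
      proof (rule onorm_le)
        fix h :: real
        have "f' (x + s *\<^sub>R e) (h *\<^sub>R e) = h *\<^sub>R f' (x + s *\<^sub>R e) e"
          using der has_derivative_bounded_linear bounded_linear.linear linear_scale by blast
        then show "norm (f' (x + s *\<^sub>R e) (h *\<^sub>R e)) \<le> B * norm h"
          using mult_left_mono[OF B(2)[of "x + s *\<^sub>R e"], of "\<bar>h\<bar>"] by (simp add: mult.commute)
      qed
    qed (use that in auto)
    then show ?thesis using that by simp
  qed
  have "(\<lambda>n. \<integral>x. D n x \<partial>lborel) \<longlonglongrightarrow> (\<integral>x. f' x e \<partial>lborel)"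
  proof (rule integral_dominated_convergence[where w="\<lambda>x. indicator (cball 0 (R + norm e)) x *\<^sub>R B"])
    show "(\<lambda>x. f' x e) \<in> borel_measurable lborel"
      using cont by (simp add: borel_measurable_continuous_onI)
    show "D n \<in> borel_measurable lborel" for n
      unfolding D_def using ints[THEN borel_measurable_integrable] intf[THEN borel_measurable_integrable]
      by measurable
    show "integrable lborel (\<lambda>x. indicator (cball 0 (R + norm e)) x *\<^sub>R B)"
      by (intro borel_integrable_compact) auto
    show "AE x in lborel. (\<lambda>n. D n x) \<longlonglongrightarrow> f' x e"
    proof (rule AE_I2)
      fix x
      have "((\<lambda>s. f (x + s *\<^sub>R e)) has_derivative (\<lambda>h. f' (x + 0 *\<^sub>R e) (h *\<^sub>R e))) (at 0)"
        by (rule has_derivative_compose[of "\<lambda>s. x + s *\<^sub>R e", OF _ der])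
          (auto intro!: derivative_eq_intros)
      moreover have "f' x (h *\<^sub>R e) = h *\<^sub>R f' x e" for h
        using der has_derivative_bounded_linear bounded_linear.linear linear_scale by blast
      ultimately have "((\<lambda>s. f (x + s *\<^sub>R e)) has_vector_derivative f' x e) (at 0)"
        by (simp add: has_vector_derivative_def)
      then have "((\<lambda>s. norm (f (x + s *\<^sub>R e) - f x - s *\<^sub>R f' x e) / norm s) \<longlongrightarrow> 0) (at 0)"
        by (simp add: has_vector_derivative_def has_derivative_at)
      moreover have "\<forall>\<^sub>F s in at 0. norm (f (x + s *\<^sub>R e) - f x - s *\<^sub>R f' x e) / norm s =
          norm ((f (x + s *\<^sub>R e) - f x) /\<^sub>R s - f' x e)"
      proof (subst eventually_at_filter, intro always_eventually allI impI)
        fix s :: real assume "s \<noteq> 0"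
        then have "(f (x + s *\<^sub>R e) - f x) /\<^sub>R s - f' x e = (f (x + s *\<^sub>R e) - f x - s *\<^sub>R f' x e) /\<^sub>R s"
          by (simp add: scaleR_diff_right)
        then show "norm (f (x + s *\<^sub>R e) - f x - s *\<^sub>R f' x e) / norm s =
            norm ((f (x + s *\<^sub>R e) - f x) /\<^sub>R s - f' x e)"
          by (simp add: divide_inverse mult.commute)
      qed
      ultimately have "((\<lambda>s. norm ((f (x + s *\<^sub>R e) - f x) /\<^sub>R s - f' x e)) \<longlongrightarrow> 0) (at 0)"
        by (simp add: tendsto_cong)
      then have "((\<lambda>s. (f (x + s *\<^sub>R e) - f x) /\<^sub>R s) \<longlongrightarrow> f' x e) (at 0)"
        by (simp add: tendsto_norm_zero_iff LIM_zero_iff)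
      moreover have "filterlim (\<lambda>n. 1 / real (Suc n)) (at 0) sequentially"
        unfolding filterlim_at using LIMSEQ_inverse_real_of_nat by (auto simp: inverse_eq_divide)
      ultimately have "(\<lambda>n. (f (x + (1 / real (Suc n)) *\<^sub>R e) - f x) /\<^sub>R (1 / real (Suc n))) \<longlonglongrightarrow> f' x e"
        by (rule filterlim_compose)
      then show "(\<lambda>n. D n x) \<longlonglongrightarrow> f' x e" by (simp add: D_def)
    qed
    show "AE x in lborel. norm (D n x) \<le> indicator (cball 0 (R + norm e)) x *\<^sub>R B" for n
    proof (rule AE_I2)
      fix x
      have "norm (D n x) = real (Suc n) * norm (f (x + (1 / real (Suc n)) *\<^sub>R e) - f x)"
        unfolding D_def by (simp only: norm_scaleR abs_of_nat)
      then have "norm (D n x) \<le> B"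
        using lip[of "1 / real (Suc n)" x] by (simp add: field_simps)
      moreover have "D n x = 0" if "x \<notin> cball 0 (R + norm e)"
      proof -
        have "norm ((1 / real (Suc n)) *\<^sub>R e) \<le> norm e"
          by (simp add: field_simps)
        moreover have "norm x \<le> norm (x + (1 / real (Suc n)) *\<^sub>R e) + norm ((1 / real (Suc n)) *\<^sub>R e)"
          using norm_triangle_ineq4[of "x + (1 / real (Suc n)) *\<^sub>R e" "(1 / real (Suc n)) *\<^sub>R e"] by simp
        ultimately have "\<not> norm (x + (1 / real (Suc n)) *\<^sub>R e) \<le> R" "\<not> norm x \<le> R"
          using that norm_ge_zero[of e] unfolding mem_cball dist_0_norm by linarith+
        then have "f (x + (1 / real (Suc n)) *\<^sub>R e) = 0" "f x = 0" using R(2) K(2) by blast+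
        then show ?thesis by (simp add: D_def)
      qed
      ultimately show "norm (D n x) \<le> indicator (cball 0 (R + norm e)) x *\<^sub>R B"
        by (auto simp: indicator_def)
    qed
  qed
  then show "(\<integral>x. f' x e \<partial>lborel) = 0" using D0 by (simp add: LIMSEQ_const_iff)
qed

lemma integral_by_parts_compact_support:
  fixes f :: "'a::euclidean_space \<Rightarrow> real" and g :: "'a \<Rightarrow> 'b::euclidean_space"
  assumes f: "\<And>x. (f has_derivative f' x) (at x)" "continuous_on UNIV (\<lambda>x. f' x e)"
    and g: "\<And>x. (g has_derivative g' x) (at x)" "continuous_on UNIV (\<lambda>x. g' x e)"
    and K: "compact K" "\<And>x. x \<notin> K \<Longrightarrow> f x = 0"
  shows "integrable lborel (\<lambda>x. f' x e *\<^sub>R g x)" "integrable lborel (\<lambda>x. f x *\<^sub>R g' x e)"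
    and "(\<integral>x. f' x e *\<^sub>R g x \<partial>lborel) = - (\<integral>x. f x *\<^sub>R g' x e \<partial>lborel)"
proof -
  have cf: "continuous_on UNIV f" and cg: "continuous_on UNIV g"
    using f(1) g(1) by (meson continuous_at_imp_continuous_on has_derivative_continuous)+
  have z: "f' x e = 0" if "x \<notin> K" for x
    using derivative_compact_support[OF f(1) compact_imp_closed[OF K(1)] K(2) that] by simp
  show 1: "integrable lborel (\<lambda>x. f' x e *\<^sub>R g x)"
    by (rule integrable_compact_support[OF _ K(1)]) (auto intro!: continuous_intros f cg simp: z)
  show 2: "integrable lborel (\<lambda>x. f x *\<^sub>R g' x e)"
    by (rule integrable_compact_support[OF _ K(1)]) (auto intro!: continuous_intros g cf simp: K)
  have "(\<integral>x. f x *\<^sub>R g' x e + f' x e *\<^sub>R g x \<partial>lborel) = 0"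
    by (rule integral_derivative_compact_support(2)[OF has_derivative_scaleR[OF f(1) g(1)] _ K(1)])
      (auto intro!: continuous_intros f g cf cg simp: K)
  then show "(\<integral>x. f' x e *\<^sub>R g x \<partial>lborel) = - (\<integral>x. f x *\<^sub>R g' x e \<partial>lborel)"
    using 1 2 by (simp add: add_eq_0_iff)
qed

text \<open>The vector field \<open>(\<partial>\<^sub>a g) b - (\<partial>\<^sub>b g) a\<close> is divergence-free. All fluxes of the waves
below are of this form, in space or in space-time.\<close>

lemma integral_cross_dirderiv:
  fixes g \<phi> :: "'a::euclidean_space \<Rightarrow> real"
  assumes g: "smooth_expr g" and K: "compact K" "\<And>x. x \<notin> K \<Longrightarrow> g x = 0"
    and \<phi>: "\<And>x. (\<phi> has_derivative \<phi>' x) (at x)" "\<And>e. continuous_on UNIV (\<lambda>x. \<phi>' x e)"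
  shows "integrable lborel (\<lambda>x. dirderiv a g x * \<phi>' x b - dirderiv b g x * \<phi>' x a)"
    and "(\<integral>x. dirderiv a g x * \<phi>' x b - dirderiv b g x * \<phi>' x a \<partial>lborel) = 0"
proof -
  have z: "dirderiv e g x = 0" if "x \<notin> K" for x e
    using derivative_compact_support[OF smooth_expr_has_derivative[OF g] compact_imp_closed[OF K(1)] K(2) that]
    by metis
  have ip: "integrable lborel (\<lambda>x. dirderiv a g x * \<phi>' x b)"
    "(\<integral>x. dirderiv b (dirderiv a g) x * \<phi> x \<partial>lborel) = - (\<integral>x. dirderiv a g x * \<phi>' x b \<partial>lborel)" for a b
    using integral_by_parts_compact_support[where e=b and K=K, OF smooth_expr_has_derivative[OF smooth_expr_dirderiv[OF g]]
        smooth_expr_continuous[OF smooth_expr_dirderiv[OF smooth_expr_dirderiv[OF g]]] \<phi> K(1) z]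
    by simp_all
  show "integrable lborel (\<lambda>x. dirderiv a g x * \<phi>' x b - dirderiv b g x * \<phi>' x a)"
    using ip(1)[of a b] ip(1)[of b a] by simp
  show "(\<integral>x. dirderiv a g x * \<phi>' x b - dirderiv b g x * \<phi>' x a \<partial>lborel) = 0"
    using ip(1)[of a b] ip(1)[of b a] ip(2)[of b a] ip(2)[of a b]
      smooth_expr_dirderiv_commute[OF g, of a b] by simp
qed

section \<open>Compactly supported perturbations of a state\<close>

text \<open>Quantified space-time points stay whole instead of being split into position and time.\<close>

declare split_paired_All [simp del] split_paired_Ex [simp del]

text \<open>Spatial gradient, velocity and flux, in this order.\<close>

type_synonym ('n, 'm) state = "(real^'n^'m) \<times> (real^'m) \<times> (real^'n^'m)"

definition state_deriv :: "('n, 'm) state \<Rightarrow> (real^'n) \<times> real \<Rightarrow> real^'m" where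
  "state_deriv z h = fst z *v fst h + snd h *\<^sub>R fst (snd z)"

definition C1_gradient :: "('a::euclidean_space \<Rightarrow> real) \<Rightarrow> ('a \<Rightarrow> 'a) \<Rightarrow> bool" where
  "C1_gradient \<phi> G \<longleftrightarrow>
     (\<forall>x. (\<phi> has_derivative (\<lambda>h. G x \<bullet> h)) (at x)) \<and> continuous_on UNIV G"

text \<open>A perturbation \<open>u\<close> with gradient and velocity recorded in \<open>z\<close>. The flux is split into two parts: the third component of \<open>z\<close> is divergence-free,
and \<open>y\<close> carries the velocity, \<open>u\<^sub>t = div y\<close>. The two parts
scale differently. Under \<open>x \<mapsto> x / r\<close> the state \<open>z\<close> keeps its size while \<open>u\<close> and \<open>y\<close> shrink by the factor \<open>r\<close>, so that \<open>y\<close>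
is negligible on small balls and only \<open>z\<close> enters the definition of the maximal gain. The conservation laws are imposed against
all \<open>C\<^sup>1\<close> functions, which need no compact support as \<open>u\<close>, \<open>y\<close> and \<open>z\<close> have it.\<close>

definition pert ::
  "((real^'n) \<times> real) set \<Rightarrow> ((real^'n) \<times> real \<Rightarrow> real^'m) \<Rightarrow> ((real^'n) \<times> real \<Rightarrow> ('n, 'm) state) \<Rightarrow>
   ((real^'n) \<times> real \<Rightarrow> real^'n^'m) \<Rightarrow> bool" where
  "pert W u z y \<longleftrightarrow>
     (\<exists>K. compact K \<and> K \<subseteq> W \<and> (\<forall>x. x \<notin> K \<longrightarrow> u x = 0 \<and> z x = 0 \<and> y x = 0)) \<and>
     continuous_on UNIV z \<and> continuous_on UNIV y \<and>
     (\<forall>x. (u has_derivative state_deriv (z x)) (at x)) \<and>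
     (\<forall>\<phi> G i. C1_gradient \<phi> G \<longrightarrow>
        (\<integral>x. G x \<bullet> (- (y x $ i), u x $ i) \<partial>lborel) = 0 \<and>
        (\<integral>x. G x \<bullet> (snd (snd (z x)) $ i, 0) \<partial>lborel) = 0)"

lemma pert_support:
  "pert W u z y \<Longrightarrow> \<exists>K. compact K \<and> K \<subseteq> W \<and> (\<forall>x. x \<notin> K \<longrightarrow> u x = 0 \<and> z x = 0 \<and> y x = 0)"
  unfolding pert_def by (elim conjE)

lemma pert_has_derivative: "pert W u z y \<Longrightarrow> (u has_derivative state_deriv (z x)) (at x)"
  unfolding pert_def by blast

lemma pert_continuous:
  assumes "pert W u z y"
  shows "continuous_on UNIV u" "continuous_on UNIV z" "continuous_on UNIV y"
proof -
  have "isCont u x" for x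
    using assms unfolding pert_def by (elim conjE) (rule has_derivative_continuous, blast)
  then show "continuous_on UNIV u" by (simp add: continuous_at_imp_continuous_on)
  show "continuous_on UNIV z" "continuous_on UNIV y" using assms unfolding pert_def by simp_all
qed

lemma pert_outside:
  assumes "pert W u z y" "x \<notin> W"
  shows "u x = 0" "z x = 0" "y x = 0"
proof -
  from pert_support[OF assms(1)] obtain K where K: "compact K" "K \<subseteq> W"
    "\<forall>x. x \<notin> K \<longrightarrow> u x = 0 \<and> z x = 0 \<and> y x = 0" by (elim exE conjE)
  then have "x \<notin> K" using assms(2) by blast
  then show "u x = 0" "z x = 0" "y x = 0" using K by simp_all
qed

lemma pert_mono: "pert W u z y \<Longrightarrow> W \<subseteq> W' \<Longrightarrow> pert W' u z y"
  unfolding pert_def by (elim conjE exE, intro conjI exI) (assumption | blast)+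

lemma state_deriv_add: "state_deriv (a + b) h = state_deriv a h + state_deriv b h"
  by (simp add: state_deriv_def matrix_vector_mult_add_rdistrib scaleR_add_right)

lemma state_deriv_zero [simp]: "state_deriv 0 = (\<lambda>h. 0)"
  by (simp add: state_deriv_def fun_eq_iff)

lemma linear_state_deriv_left: "linear (\<lambda>z. state_deriv z h)"
  by (rule linearI)
    (simp_all add: state_deriv_add, simp add: state_deriv_def scaleR_matrix_vector_assoc scaleR_add_right)

lemma linear_state_deriv_right: "linear (state_deriv z)"
  by (rule linearI)
    (simp_all add: state_deriv_def matrix_vector_right_distrib matrix_vector_mult_scaleR scaleR_add_right
      scaleR_add_left)

lemma pert_zero: "pert W (\<lambda>x. 0) (\<lambda>x. 0) (\<lambda>x. 0)"
proof -
  have 0: "(0, 0) = (0 :: (real^'a) \<times> real)" by (simp add: zero_prod_def)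
  show ?thesis
    unfolding pert_def by (intro conjI exI[of _ "{}"]) (simp_all add: 0)
qed

lemma pert_integrable_pairing:
  assumes "pert W u z y" "C1_gradient \<phi> G"
  shows "integrable lborel (\<lambda>x. G x \<bullet> (- (y x $ i), u x $ i))"
    "integrable lborel (\<lambda>x. G x \<bullet> (snd (snd (z x)) $ i, 0))"
proof -
  from pert_support[OF assms(1)] obtain K where K: "compact K" "K \<subseteq> W"
    "\<forall>x. x \<notin> K \<longrightarrow> u x = 0 \<and> z x = 0 \<and> y x = 0" by (elim exE conjE)
  have G: "continuous_on UNIV G" using assms(2) by (simp add: C1_gradient_def)
  note c = pert_continuous[OF assms(1)]
  have 0: "(0, 0) = (0 :: (real^'a) \<times> real)" by (simp add: zero_prod_def)
  note vn = bounded_linear.continuous_on[OF bounded_linear_vec_nth]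
  show "integrable lborel (\<lambda>x. G x \<bullet> (- (y x $ i), u x $ i))"
    by (rule integrable_compact_support[OF _ K(1)],
        intro continuous_on_inner G continuous_on_Pair continuous_on_minus vn c)
      (simp add: K 0)
  show "integrable lborel (\<lambda>x. G x \<bullet> (snd (snd (z x)) $ i, 0))"
    by (rule integrable_compact_support[OF _ K(1)],
        intro continuous_on_inner G continuous_on_Pair continuous_on_const vn continuous_on_snd c)
      (simp add: K 0)
qed

lemma pert_add:
  assumes p: "pert W u z y" and p': "pert W' u' z' y'"
  shows "pert (W \<union> W') (\<lambda>x. u x + u' x) (\<lambda>x. z x + z' x) (\<lambda>x. y x + y' x)"
  unfolding pert_def
proof (intro conjI allI impI)
  from pert_support[OF p] obtain K where K: "compact K" "K \<subseteq> W"
    "\<forall>x. x \<notin> K \<longrightarrow> u x = 0 \<and> z x = 0 \<and> y x = 0" by (elim exE conjE)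
  from pert_support[OF p'] obtain K' where K': "compact K'" "K' \<subseteq> W'"
    "\<forall>x. x \<notin> K' \<longrightarrow> u' x = 0 \<and> z' x = 0 \<and> y' x = 0" by (elim exE conjE)
  show "\<exists>K. compact K \<and> K \<subseteq> W \<union> W' \<and>
      (\<forall>x. x \<notin> K \<longrightarrow> u x + u' x = 0 \<and> z x + z' x = 0 \<and> y x + y' x = 0)"
    by (rule exI[of _ "K \<union> K'"]) (use K K' in auto)
  show "continuous_on UNIV (\<lambda>x. z x + z' x)" "continuous_on UNIV (\<lambda>x. y x + y' x)"
    by (intro continuous_intros pert_continuous[OF p] pert_continuous[OF p'])+
  fix x
  have "((\<lambda>x. u x + u' x) has_derivative (\<lambda>h. state_deriv (z x) h + state_deriv (z' x) h)) (at x)"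
    by (intro has_derivative_add pert_has_derivative[OF p] pert_has_derivative[OF p'])
  then show "((\<lambda>x. u x + u' x) has_derivative state_deriv (z x + z' x)) (at x)"
    by (simp add: state_deriv_add[abs_def])
next
  fix \<phi> :: "(real^'a) \<times> real \<Rightarrow> real" and G i
  assume G: "C1_gradient \<phi> G"
  have "G x \<bullet> (- ((y x + y' x) $ i), (u x + u' x) $ i) =
      G x \<bullet> (- (y x $ i), u x $ i) + G x \<bullet> (- (y' x $ i), u' x $ i)" for x
    by (subst inner_add_right[symmetric]) simp
  then show "(\<integral>x. G x \<bullet> (- ((y x + y' x) $ i), (u x + u' x) $ i) \<partial>lborel) = 0"
    using pert_integrable_pairing(1)[OF p G, of i] pert_integrable_pairing(1)[OF p' G, of i] p p' G
    by (simp add: pert_def)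
  have "G x \<bullet> (snd (snd (z x + z' x)) $ i, 0) =
      G x \<bullet> (snd (snd (z x)) $ i, 0) + G x \<bullet> (snd (snd (z' x)) $ i, 0)" for x
    by (subst inner_add_right[symmetric]) simp
  then show "(\<integral>x. G x \<bullet> (snd (snd (z x + z' x)) $ i, 0) \<partial>lborel) = 0"
    using pert_integrable_pairing(2)[OF p G, of i] pert_integrable_pairing(2)[OF p' G, of i] p p' G
    by (simp add: pert_def)
qed

lemma pert_scale:
  fixes u :: "(real^'n) \<times> real \<Rightarrow> real^'m"
  assumes p: "pert (ball 0 1) u z y" and r: "r > 0"
  shows "pert (ball a r) (\<lambda>x. r *\<^sub>R u ((x - a) /\<^sub>R r)) (\<lambda>x. z ((x - a) /\<^sub>R r)) (\<lambda>x. r *\<^sub>R y ((x - a) /\<^sub>R r))"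
  unfolding pert_def
proof (intro conjI allI impI)
  from pert_support[OF p] obtain K where K: "compact K" "K \<subseteq> ball 0 1"
    "\<forall>x. x \<notin> K \<longrightarrow> u x = 0 \<and> z x = 0 \<and> y x = 0" by (elim exE conjE)
  let ?K = "(\<lambda>x. a + r *\<^sub>R x) ` K"
  have out: "(x - a) /\<^sub>R r \<notin> K" if "x \<notin> ?K" for x
  proof
    assume "(x - a) /\<^sub>R r \<in> K"
    then have "a + r *\<^sub>R ((x - a) /\<^sub>R r) \<in> ?K" by blast
    then show False using that r by simp
  qed
  show "\<exists>K. compact K \<and> K \<subseteq> ball a r \<and> (\<forall>x. x \<notin> K \<longrightarrow> r *\<^sub>R u ((x - a) /\<^sub>R r) = 0 \<and>
      z ((x - a) /\<^sub>R r) = 0 \<and> r *\<^sub>R y ((x - a) /\<^sub>R r) = 0)"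
  proof (intro exI[of _ ?K] conjI allI impI)
    show "compact ?K" by (intro compact_continuous_image K continuous_intros)
    show "?K \<subseteq> ball a r"
    proof (rule image_subsetI)
      fix x assume "x \<in> K"
      then have "norm x < 1" using K(2) by (auto simp: subset_iff)
      then show "a + r *\<^sub>R x \<in> ball a r" using r by (simp add: dist_norm)
    qed
  qed (use K out in auto)
  show "continuous_on UNIV (\<lambda>x. z ((x - a) /\<^sub>R r))" "continuous_on UNIV (\<lambda>x. r *\<^sub>R y ((x - a) /\<^sub>R r))"
    by (intro continuous_intros continuous_on_compose2[OF pert_continuous(2)[OF p]]
        continuous_on_compose2[OF pert_continuous(3)[OF p]]; simp)+
  fix x
  have "(u has_derivative state_deriv (z ((x - a) /\<^sub>R r))) (at ((x - a) /\<^sub>R r))"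
    using p by (simp add: pert_def)
  moreover have "((\<lambda>x. (x - a) /\<^sub>R r) has_derivative (\<lambda>h. h /\<^sub>R r)) (at x)"
    by (auto intro!: derivative_eq_intros)
  ultimately have "((\<lambda>x. u ((x - a) /\<^sub>R r)) has_derivative (\<lambda>h. state_deriv (z ((x - a) /\<^sub>R r)) (h /\<^sub>R r))) (at x)"
    by (rule has_derivative_compose[rotated])
  then have "((\<lambda>x. r *\<^sub>R u ((x - a) /\<^sub>R r)) has_derivative
      (\<lambda>h. r *\<^sub>R state_deriv (z ((x - a) /\<^sub>R r)) (h /\<^sub>R r))) (at x)"
    by (rule has_derivative_scaleR_right)
  then show "((\<lambda>x. r *\<^sub>R u ((x - a) /\<^sub>R r)) has_derivative state_deriv (z ((x - a) /\<^sub>R r))) (at x)"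
    using r by (simp add: linear_scale[OF linear_state_deriv_right])
next
  fix \<phi> :: "(real^'n) \<times> real \<Rightarrow> real" and G i
  assume G: "C1_gradient \<phi> G"
  have G': "C1_gradient (\<lambda>x. \<phi> (a + r *\<^sub>R x)) (\<lambda>x. r *\<^sub>R G (a + r *\<^sub>R x))"
    unfolding C1_gradient_def
  proof (intro conjI allI)
    fix x
    have "(\<phi> has_derivative (\<lambda>h. G (a + r *\<^sub>R x) \<bullet> h)) (at (a + r *\<^sub>R x))"
      using G by (simp add: C1_gradient_def)
    moreover have "((\<lambda>x. a + r *\<^sub>R x) has_derivative (\<lambda>h. r *\<^sub>R h)) (at x)"
      by (auto intro!: derivative_eq_intros)
    ultimately show "((\<lambda>x. \<phi> (a + r *\<^sub>R x)) has_derivative (\<lambda>h. r *\<^sub>R G (a + r *\<^sub>R x) \<bullet> h)) (at x)"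
      using has_derivative_compose by fastforce
    show "continuous_on UNIV (\<lambda>x. r *\<^sub>R G (a + r *\<^sub>R x))"
    proof (rule continuous_on_scaleR[OF continuous_on_const])
      have "continuous_on UNIV G" using G by (simp add: C1_gradient_def)
      then show "continuous_on UNIV (\<lambda>x. G (a + r *\<^sub>R x))"
        by (rule continuous_on_compose2[where f="\<lambda>x. a + r *\<^sub>R x"]) (intro continuous_intros, simp)
    qed
  qed
  have *: "(\<integral>x. G x \<bullet> F ((x - a) /\<^sub>R r) \<partial>lborel) =
      (r ^ DIM((real^'n) \<times> real) / r) *\<^sub>R (\<integral>x. r *\<^sub>R G (a + r *\<^sub>R x) \<bullet> F x \<partial>lborel)" for F
  proof -
    have "(\<integral>x. G x \<bullet> F ((x - a) /\<^sub>R r) \<partial>lborel) =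
        r ^ DIM((real^'n) \<times> real) *\<^sub>R (\<integral>x. G (a + r *\<^sub>R x) \<bullet> F x \<partial>lborel)"
      using r by (subst lborel_integral_affine[of r _ a]) (simp_all del: DIM_prod DIM_cart)
    also have "(\<integral>x. r *\<^sub>R G (a + r *\<^sub>R x) \<bullet> F x \<partial>lborel) = r * (\<integral>x. G (a + r *\<^sub>R x) \<bullet> F x \<partial>lborel)"
      by simp
    then have "(\<integral>x. G (a + r *\<^sub>R x) \<bullet> F x \<partial>lborel) = (1 / r) * (\<integral>x. r *\<^sub>R G (a + r *\<^sub>R x) \<bullet> F x \<partial>lborel)"
      using r by simp
    finally show ?thesis by (simp del: DIM_prod DIM_cart)
  qed
  have z: "(\<integral>x. r *\<^sub>R G (a + r *\<^sub>R x) \<bullet> (- (y x $ i), u x $ i) \<partial>lborel) = 0"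
    "(\<integral>x. r *\<^sub>R G (a + r *\<^sub>R x) \<bullet> (snd (snd (z x)) $ i, 0) \<partial>lborel) = 0"
    using p G' unfolding pert_def by blast+
  have scale: "r *\<^sub>R G x \<bullet> r *\<^sub>R v = r * (r *\<^sub>R G x \<bullet> v)" for x v by simp
  have "(\<integral>x. r *\<^sub>R G (a + r *\<^sub>R x) \<bullet> r *\<^sub>R (- (y x $ i), u x $ i) \<partial>lborel) = 0"
    unfolding scale integral_mult_right_zero using z(1) by simp
  with *[of "\<lambda>x. r *\<^sub>R (- (y x $ i), u x $ i)"]
  show "(\<integral>x. G x \<bullet> (- ((r *\<^sub>R y ((x - a) /\<^sub>R r)) $ i), (r *\<^sub>R u ((x - a) /\<^sub>R r)) $ i) \<partial>lborel) = 0"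
    by simp
  from *[of "\<lambda>x. (snd (snd (z x)) $ i, 0)"]
  show "(\<integral>x. G x \<bullet> (snd (snd (z ((x - a) /\<^sub>R r))) $ i, 0) \<partial>lborel) = 0"
    using z(2) by simp
qed

lemma pert_integrable:
  assumes "pert W u z y"
  shows "integrable lborel z" "integrable lborel y"
proof -
  from pert_support[OF assms] obtain K where K: "compact K" "K \<subseteq> W"
    "\<forall>x. x \<notin> K \<longrightarrow> u x = 0 \<and> z x = 0 \<and> y x = 0" by (elim exE conjE)
  show "integrable lborel z"
    by (rule integrable_compact_support[OF pert_continuous(2)[OF assms] K(1)]) (simp add: K(3))
  show "integrable lborel y"
    by (rule integrable_compact_support[OF pert_continuous(3)[OF assms] K(1)]) (simp add: K(3))
qed

lemma C1_gradient_inner: "C1_gradient (\<lambda>x. a \<bullet> x) (\<lambda>x. a)"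
  unfolding C1_gradient_def by (auto intro!: derivative_eq_intros)

text \<open>Derivatives of compactly supported functions have mean zero. For the fluxes the conservation
laws are tested with coordinate functions.\<close>

lemma pert_integral_zero:
  fixes u :: "(real^'n) \<times> real \<Rightarrow> real^'m"
  assumes p: "pert W u z y"
  shows "(\<integral>x. z x \<partial>lborel) = 0" "(\<integral>x. y x \<partial>lborel) = 0"
proof -
  from pert_support[OF p] obtain K where K: "compact K" "K \<subseteq> W"
    "\<forall>x. x \<notin> K \<longrightarrow> u x = 0 \<and> z x = 0 \<and> y x = 0" by (elim exE conjE)
  have lin: "bounded_linear (\<lambda>z. state_deriv z h)" for h :: "(real^'n) \<times> real"
    using linear_state_deriv_left linear_conv_bounded_linear by blast
  have "state_deriv (\<integral>x. z x \<partial>lborel) h = 0" for h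
  proof -
    have "state_deriv (\<integral>x. z x \<partial>lborel) h = (\<integral>x. state_deriv (z x) h \<partial>lborel)"
      using integral_bounded_linear[OF lin pert_integrable(1)[OF p]] by simp
    also have "\<dots> = 0"
    proof (rule integral_derivative_compact_support(2)[OF _ _ K(1)])
      show "u x = 0" if "x \<notin> K" for x using K(3) that by simp
      show "(u has_derivative state_deriv (z x)) (at x)" for x using p by (simp add: pert_def)
      show "continuous_on UNIV (\<lambda>x. state_deriv (z x) h)"
        by (rule bounded_linear.continuous_on[OF lin pert_continuous(2)[OF p]])
    qed
    finally show ?thesis .
  qed
  then have *: "fst (\<integral>x. z x \<partial>lborel) *v h + s *\<^sub>R fst (snd (\<integral>x. z x \<partial>lborel)) = 0" for h s
    unfolding state_deriv_def by (metis fst_conv snd_conv)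
  from *[of _ 0] have 1: "fst (\<integral>x. z x \<partial>lborel) = 0"
    by (simp add: matrix_eq)
  from *[of 0 1] have 2: "fst (snd (\<integral>x. z x \<partial>lborel)) = 0" by simp
  have nth: "(\<integral>x. f x \<partial>lborel) $ i $ k = (\<integral>x. f x $ i $ k \<partial>lborel)"
    if "integrable lborel f" for f :: "(real^'n) \<times> real \<Rightarrow> real^'n^'m" and i k
  proof -
    have "bounded_linear (\<lambda>A::real^'n^'m. A $ i $ k)"
      using bounded_linear_compose[OF bounded_linear_vec_nth bounded_linear_vec_nth] .
    from integral_bounded_linear[OF this that] show ?thesis by simp
  qed
  have C: "C1_gradient (\<lambda>x. (axis k 1, 0) \<bullet> x) (\<lambda>x. (axis k 1 :: real^'n, 0::real))" for k
    by (rule C1_gradient_inner)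
  have ss: "bounded_linear (\<lambda>z::('n,'m) state. snd (snd z))"
    using bounded_linear_compose[OF bounded_linear_snd bounded_linear_snd] .
  have "snd (snd (\<integral>x. z x \<partial>lborel)) $ i $ k = 0" for i k
  proof -
    have "snd (snd (\<integral>x. z x \<partial>lborel)) $ i $ k = (\<integral>x. snd (snd (z x)) $ i $ k \<partial>lborel)"
      using integral_bounded_linear[OF ss pert_integrable(1)[OF p]]
        nth[OF integrable_bounded_linear[OF ss pert_integrable(1)[OF p]]] by simp
    also have "\<dots> = (\<integral>x. (axis k 1, 0::real) \<bullet> (snd (snd (z x)) $ i, 0) \<partial>lborel)"
      by (simp add: inner_axis')
    also have "\<dots> = 0" using p C[of k] unfolding pert_def by blast
    finally show ?thesis .
  qed
  then have "snd (snd (\<integral>x. z x \<partial>lborel)) = 0" by (simp add: vec_eq_iff)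
  with 1 2 show "(\<integral>x. z x \<partial>lborel) = 0" by (simp add: prod_eq_iff)
  have "(\<integral>x. y x \<partial>lborel) $ i $ k = 0" for i k
  proof -
    have "(\<integral>x. y x \<partial>lborel) $ i $ k = (\<integral>x. y x $ i $ k \<partial>lborel)"
      using nth[OF pert_integrable(2)[OF p]] .
    moreover have "(\<integral>x. (axis k 1, 0::real) \<bullet> (- (y x $ i), u x $ i) \<partial>lborel) = 0"
      using p C[of k] unfolding pert_def by blast
    ultimately show ?thesis by (simp add: inner_axis')
  qed
  then show "(\<integral>x. y x \<partial>lborel) = 0" by (simp add: vec_eq_iff)
qed

section \<open>The maximal energy gain\<close>

text \<open>The value zero outside \<open>S\<close> makes the function lower semicontinuous on the whole space of states.\<close>

definition max_gain :: "('n::finite, 'm::finite) state set \<Rightarrow> ('n, 'm) state \<Rightarrow> real" where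
  "max_gain S \<xi> = (if \<xi> \<in> S
     then Sup {(\<integral>x. (norm (z x))\<^sup>2 \<partial>lborel) / measure lborel (ball (0 :: (real^'n) \<times> real) 1) | u z y.
            pert (ball 0 1) u z y \<and> (\<forall>x. \<xi> + z x \<in> S)}
     else 0)"

lemma unit_ball_content_pos: "measure lborel (ball (0::'a::euclidean_space) 1) > 0"
  by (simp add: content_ball unit_ball_vol_pos)

lemma pert_energy_integrable:
  assumes "pert W u z y"
  shows "integrable lborel (\<lambda>x. (norm (z x + lam *\<^sub>R (0, 0, y x)))\<^sup>2)"
    "integrable lborel (\<lambda>x. (norm (z x))\<^sup>2)"
proof -
  from pert_support[OF assms] obtain K where K: "compact K" "K \<subseteq> W"
    "\<forall>x. x \<notin> K \<longrightarrow> u x = 0 \<and> z x = 0 \<and> y x = 0" by (elim exE conjE)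
  have 0: "(0, 0, 0) = (0 :: ('a,'b) state)" by (simp add: zero_prod_def)
  show 1: "integrable lborel (\<lambda>x. (norm (z x + lam *\<^sub>R (0, 0, y x)))\<^sup>2)" for lam
    by (rule integrable_compact_support[OF _ K(1)],
        intro continuous_on_power continuous_on_norm continuous_on_add continuous_on_scaleR
          continuous_on_Pair continuous_on_const pert_continuous[OF assms])
      (simp add: K(3) 0)
  from 1[of 0] show "integrable lborel (\<lambda>x. (norm (z x))\<^sup>2)" by (simp add: 0)
qed

lemma pert_energy_le:
  assumes p: "pert W u z y" and W: "bounded W" "open W" and B: "\<And>x. norm (z x) \<le> B" "B \<ge> 0"
  shows "(\<integral>x. (norm (z x))\<^sup>2 \<partial>lborel) \<le> B\<^sup>2 * measure lborel W"
proof -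
  have fin: "emeasure lborel W < \<infinity>" using emeasure_bounded_finite[OF W(1)] by simp
  have "(\<integral>x. (norm (z x))\<^sup>2 \<partial>lborel) \<le> (\<integral>x. indicator W x * B\<^sup>2 \<partial>lborel)"
  proof (rule integral_mono[OF pert_energy_integrable(2)[OF p]])
    show "integrable lborel (\<lambda>x. indicator W x * B\<^sup>2 :: real)"
      using fin W(2) by (intro integrable_mult_left integrable_real_indicator) auto
    show "(norm (z x))\<^sup>2 \<le> indicator W x * B\<^sup>2" for x
      using pert_outside(2)[OF p, of x] B(1)[of x] by (cases "x \<in> W") (auto intro!: power_mono)
  qed
  also have "\<dots> = B\<^sup>2 * measure lborel W" using W(2) by simp
  finally show ?thesis .
qed

lemma bounded_diff_bound:
  assumes "bounded S"
  obtains B where "B > 0" "\<And>a b. a \<in> S \<Longrightarrow> a + b \<in> S \<Longrightarrow> norm (b::'a::real_normed_vector) \<le> B"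
proof -
  obtain B where B: "B > 0" "\<And>x. x \<in> S \<Longrightarrow> norm x \<le> B" using assms bounded_pos by blast
  have "norm b \<le> 2 * B" if "a \<in> S" "a + b \<in> S" for a b
    using B(2)[OF that(1)] B(2)[OF that(2)] norm_triangle_ineq4[of "a + b" a] by simp
  then show ?thesis using that[of "2 * B"] B(1) by auto
qed

lemma max_gain_bdd:
  fixes S :: "('n::finite, 'm::finite) state set"
  assumes "bounded S" "\<xi> \<in> S"
  shows "bdd_above {(\<integral>x. (norm (z x))\<^sup>2 \<partial>lborel) / measure lborel (ball (0 :: (real^'n) \<times> real) 1) | u z y.
            pert (ball 0 1) u z y \<and> (\<forall>x. \<xi> + z x \<in> S)}"
proof -
  from bounded_diff_bound[OF assms(1)] obtain B where B: "B > 0"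
    "\<And>a b. a \<in> S \<Longrightarrow> a + b \<in> S \<Longrightarrow> norm b \<le> B" by blast
  show ?thesis
  proof (rule bdd_aboveI[of _ "B\<^sup>2"], clarify)
    fix u :: "(real^'n) \<times> real \<Rightarrow> real^'m" and z y
    assume p: "pert (ball 0 1) u z y" and S: "\<forall>x. \<xi> + z x \<in> S"
    have "(\<integral>x. (norm (z x))\<^sup>2 \<partial>lborel) \<le> B\<^sup>2 * measure lborel (ball (0 :: (real^'n) \<times> real) 1)"
      using B S assms(2) by (intro pert_energy_le[OF p]) auto
    then show "(\<integral>x. (norm (z x))\<^sup>2 \<partial>lborel) / measure lborel (ball (0 :: (real^'n) \<times> real) 1) \<le> B\<^sup>2"
      using unit_ball_content_pos[where 'a="(real^'n) \<times> real"] by (simp add: divide_le_eq)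
  qed
qed

lemma max_gain_ge:
  fixes S :: "('n::finite, 'm::finite) state set"
  assumes "bounded S" "\<xi> \<in> S" "pert (ball 0 1) u z y" "\<And>x. \<xi> + z x \<in> S"
  shows "(\<integral>x. (norm (z x))\<^sup>2 \<partial>lborel) \<le> max_gain S \<xi> * measure lborel (ball (0 :: (real^'n) \<times> real) 1)"
proof -
  have "(\<integral>x. (norm (z x))\<^sup>2 \<partial>lborel) / measure lborel (ball (0 :: (real^'n) \<times> real) 1) \<le> max_gain S \<xi>"
    unfolding max_gain_def if_P[OF assms(2)]
    by (rule cSup_upper[OF _ max_gain_bdd[OF assms(1,2)]]) (use assms(3,4) in blast)
  then show ?thesis
    using unit_ball_content_pos[where 'a="(real^'n) \<times> real"] by (simp add: divide_le_eq)
qed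

lemma max_gain_nonneg:
  fixes S :: "('n::finite, 'm::finite) state set"
  assumes "bounded S"
  shows "max_gain S \<xi> \<ge> 0"
proof (cases "\<xi> \<in> S")
  case True
  from max_gain_ge[OF assms True pert_zero] True show ?thesis
    using unit_ball_content_pos[where 'a="(real^'n) \<times> real"]
    by (simp add: zero_le_mult_iff del: content_ball_gt_0_iff)
qed (simp add: max_gain_def)

lemma max_gain_approx:
  fixes S :: "('n::finite, 'm::finite) state set"
  assumes "bounded S" "\<xi> \<in> S" "c < max_gain S \<xi>"
  shows "\<exists>(u :: (real^'n) \<times> real \<Rightarrow> real^'m) z y. pert (ball 0 1) u z y \<and> (\<forall>x. \<xi> + z x \<in> S) \<and>
    c * measure lborel (ball (0 :: (real^'n) \<times> real) 1) < (\<integral>x. (norm (z x))\<^sup>2 \<partial>lborel)"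
proof -
  let ?A = "{(\<integral>x. (norm (z x))\<^sup>2 \<partial>lborel) / measure lborel (ball (0 :: (real^'n) \<times> real) 1) | u z y.
            pert (ball 0 1) (u :: (real^'n) \<times> real \<Rightarrow> real^'m) z y \<and> (\<forall>x. \<xi> + z x \<in> S)}"
  have "?A \<noteq> {}" using pert_zero assms(2) by fastforce
  moreover have "c < Sup ?A" using assms(2,3) by (simp add: max_gain_def)
  ultimately obtain e where "e \<in> ?A" "c < e"
    using less_cSup_iff[OF _ max_gain_bdd[OF assms(1,2)]] by blast
  then obtain u :: "(real^'n) \<times> real \<Rightarrow> real^'m" and z y where
    "pert (ball 0 1) u z y \<and> (\<forall>x. \<xi> + z x \<in> S)"
    "c < (\<integral>x. (norm (z x))\<^sup>2 \<partial>lborel) / measure lborel (ball (0 :: (real^'n) \<times> real) 1)"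
    by blast
  then show ?thesis
    using unit_ball_content_pos[where 'a="(real^'n) \<times> real"] by (auto simp: less_divide_eq)
qed

text \<open>The values taken by \<open>\<xi> + z\<close> form a compact subset of \<open>S\<close>.\<close>

lemma pert_margin:
  assumes p: "pert W u z y" and S: "open S" "\<xi> \<in> S" "\<And>x. \<xi> + z x \<in> S"
  obtains \<eta> where "\<eta> > 0" "\<And>x v. norm v < \<eta> \<Longrightarrow> \<xi> + z x + v \<in> S"
proof -
  from pert_support[OF p] obtain K where K: "compact K" "K \<subseteq> W"
    "\<forall>x. x \<notin> K \<longrightarrow> u x = 0 \<and> z x = 0 \<and> y x = 0" by (elim exE conjE)
  let ?C = "insert \<xi> ((\<lambda>x. \<xi> + z x) ` K)"
  have "compact ?C"
    using K(1) pert_continuous(2)[OF p]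
    by (intro compact_insert compact_continuous_image continuous_on_add continuous_on_const)
      (auto intro: continuous_on_subset)
  from compact_subset_open_imp_ball_epsilon_subset[OF this S(1)] S(2,3)
  obtain \<eta> where \<eta>: "\<eta> > 0" "(\<Union>x\<in>?C. ball x \<eta>) \<subseteq> S" by blast
  have "\<xi> + z x + v \<in> S" if "norm v < \<eta>" for x v
  proof -
    have "\<xi> + z x \<in> ?C" using K(3) by (cases "x \<in> K") auto
    moreover have "\<xi> + z x + v \<in> ball (\<xi> + z x) \<eta>" using that by (simp add: dist_norm)
    ultimately show ?thesis using \<eta>(2) by blast
  qed
  with \<eta>(1) show ?thesis using that by blast
qed

text \<open>A nearly optimal perturbation at \<open>\<xi>\<close> keeps a positive distance from the complement of \<open>S\<close>, hence it is
admissible, with the same energy, at all nearby states.\<close>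

lemma max_gain_lsc:
  fixes S :: "('n::finite, 'm::finite) state set"
  assumes S: "open S" "bounded S" and c: "c < max_gain S \<xi>"
  obtains \<eta> where "\<eta> > 0" "\<And>\<xi>'. dist \<xi>' \<xi> < \<eta> \<Longrightarrow> c < max_gain S \<xi>'"
proof (cases "\<xi> \<in> S")
  case False
  then have "c < 0" using c by (simp add: max_gain_def)
  then have "c < max_gain S \<xi>'" for \<xi>' using max_gain_nonneg[OF S(2), of \<xi>'] by linarith
  then show ?thesis using that[of 1] by simp
next
  case True
  from max_gain_approx[OF S(2) True c] obtain u :: "(real^'n) \<times> real \<Rightarrow> real^'m" and z y where
    p: "pert (ball 0 1) u z y" "\<And>x. \<xi> + z x \<in> S"
    and e: "c * measure lborel (ball (0 :: (real^'n) \<times> real) 1) < (\<integral>x. (norm (z x))\<^sup>2 \<partial>lborel)" by blast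
  from pert_margin[OF p(1) S(1) True p(2)] obtain \<eta> where
    \<eta>: "\<eta> > 0" "\<And>x v. norm v < \<eta> \<Longrightarrow> \<xi> + z x + v \<in> S" by blast
  have "c < max_gain S \<xi>'" if "dist \<xi>' \<xi> < \<eta>" for \<xi>'
  proof -
    have *: "\<xi>' + z x \<in> S" for x
      using \<eta>(2)[of "\<xi>' - \<xi>" x] that by (simp add: dist_norm algebra_simps)
    have "\<xi>' \<in> S"
    proof -
      obtain x :: "(real^'n) \<times> real" where "x \<notin> ball 0 1"
        by (metis UNIV_I bounded_ball equalityI not_bounded_UNIV subsetI)
      with *[of x] pert_outside(2)[OF p(1)] show ?thesis by simp
    qed
    from max_gain_ge[OF S(2) this p(1) *] e
    have "c * measure lborel (ball (0 :: (real^'n) \<times> real) 1) <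
        max_gain S \<xi>' * measure lborel (ball (0 :: (real^'n) \<times> real) 1)" by linarith
    then show ?thesis using unit_ball_content_pos[where 'a="(real^'n) \<times> real"]
      by (simp add: mult_less_cancel_right)
  qed
  then show ?thesis using that \<eta>(1) by blast
qed

section \<open>Filling open sets by rescaled perturbations\<close>

text \<open>With \<open>lam = 1\<close> this is the true state of a perturbation, whose flux includes the part that carries the velocity; with \<open>lam = 0\<close> it is the
ideal state. Both are filled by the same argument: true states for the iteration, ideal ones for the minimum principle.\<close>

definition shifted :: "real \<Rightarrow> ('a \<Rightarrow> ('n::finite, 'm::finite) state) \<Rightarrow> ('a \<Rightarrow> real^'n^'m) \<Rightarrow> 'a \<Rightarrow> ('n, 'm) state" where
  "shifted lam z y x = z x + lam *\<^sub>R (0, 0, y x)"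

lemma shifted_integrable:
  assumes "pert W u z y"
  shows "integrable lborel (\<lambda>x. (norm (shifted lam z y x))\<^sup>2)"
    "continuous_on UNIV Y \<Longrightarrow> integrable lborel (\<lambda>x. Y x \<bullet> shifted lam z y x)"
    "integrable lborel (shifted lam z y)"
proof -
  from pert_support[OF assms] obtain K where K: "compact K" "K \<subseteq> W"
    "\<forall>x. x \<notin> K \<longrightarrow> u x = 0 \<and> z x = 0 \<and> y x = 0" by (elim exE conjE)
  have 0: "(0, 0, 0) = (0 :: ('a,'b) state)" by (simp add: zero_prod_def)
  have c: "continuous_on UNIV (shifted lam z y)"
    unfolding shifted_def[abs_def]
    by (intro continuous_on_add continuous_on_scaleR
          continuous_on_Pair continuous_on_const pert_continuous[OF assms])
  have z: "shifted lam z y x = 0" if "x \<notin> K" for x using K(3) that by (simp add: shifted_def 0)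
  show "integrable lborel (\<lambda>x. (norm (shifted lam z y x))\<^sup>2)"
    by (rule integrable_compact_support[OF _ K(1)], intro continuous_on_power continuous_on_norm c)
      (simp add: z)
  show "integrable lborel (\<lambda>x. Y x \<bullet> shifted lam z y x)" if "continuous_on UNIV Y"
    by (rule integrable_compact_support[OF _ K(1)], intro continuous_on_inner that c)
      (simp add: z)
  show "integrable lborel (shifted lam z y)"
    by (rule integrable_compact_support[OF c K(1) z])
qed

text \<open>The set \<open>W\<close> carries a small perturbation of the continuous field of states \<open>Z\<close> that realises the energy density \<open>c\<close> and is almost orthogonal to the functions in \<open>F\<close>.
All errors are proportional to the measure of \<open>W\<close>, so that they add up under disjoint unions.\<close>

definition fills where
  "fills S Z c F \<delta> lam W \<longleftrightarrow>
     (\<exists>u z y. pert W u z y \<and> (\<forall>x\<in>W. Z x + shifted lam z y x \<in> S) \<and>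
        (\<forall>x. norm (u x) \<le> \<delta>) \<and> (\<forall>x. norm (y x) \<le> \<delta>) \<and>
        (LINT x:W|lborel. c x) - \<delta> * measure lborel W \<le> (\<integral>x. (norm (shifted lam z y x))\<^sup>2 \<partial>lborel) \<and>
        (\<forall>Y\<in>F. \<bar>\<integral>x. Y x \<bullet> shifted lam z y x \<partial>lborel\<bar> \<le> \<delta> * measure lborel W))"

lemma fills_empty: "\<delta> \<ge> 0 \<Longrightarrow> fills S Z c F \<delta> lam {}"
  unfolding fills_def
  by (intro exI[of _ "\<lambda>x. 0"] conjI pert_zero)
    (simp_all add: shifted_def zero_prod_def[symmetric] set_lebesgue_integral_def)

lemma set_integrable_continuous_compact:
  fixes c :: "'a::euclidean_space \<Rightarrow> real"
  shows "compact W \<Longrightarrow> continuous_on UNIV c \<Longrightarrow> set_integrable lborel W c"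
  unfolding set_integrable_def using borel_integrable_compact continuous_on_subset by blast

lemma fills_Un:
  fixes Z :: "(real^'n) \<times> real \<Rightarrow> ('n, 'm::finite) state"
  assumes f: "fills S Z c F \<delta> lam W" and f': "fills S Z c F \<delta> lam W'"
    and W: "compact W" "compact W'" "W \<inter> W' = {}"
    and c: "continuous_on UNIV c" and F: "\<And>Y. Y \<in> F \<Longrightarrow> continuous_on UNIV Y"
  shows "fills S Z c F \<delta> lam (W \<union> W')"
proof -
  from f obtain u z y where p: "pert W u z y" and st: "\<forall>x\<in>W. Z x + shifted lam z y x \<in> S" and
    uy: "\<forall>x. norm (u x) \<le> \<delta>" "\<forall>x. norm (y x) \<le> \<delta>" and
    en: "(LINT x:W|lborel. c x) - \<delta> * measure lborel W \<le> (\<integral>x. (norm (shifted lam z y x))\<^sup>2 \<partial>lborel)" and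
    ort: "\<forall>Y\<in>F. \<bar>\<integral>x. Y x \<bullet> shifted lam z y x \<partial>lborel\<bar> \<le> \<delta> * measure lborel W"
    unfolding fills_def by (elim exE conjE)
  from f' obtain u' z' y' where p': "pert W' u' z' y'" and st': "\<forall>x\<in>W'. Z x + shifted lam z' y' x \<in> S" and
    uy': "\<forall>x. norm (u' x) \<le> \<delta>" "\<forall>x. norm (y' x) \<le> \<delta>" and
    en': "(LINT x:W'|lborel. c x) - \<delta> * measure lborel W' \<le> (\<integral>x. (norm (shifted lam z' y' x))\<^sup>2 \<partial>lborel)" and
    ort': "\<forall>Y\<in>F. \<bar>\<integral>x. Y x \<bullet> shifted lam z' y' x \<partial>lborel\<bar> \<le> \<delta> * measure lborel W'"
    unfolding fills_def by (elim exE conjE)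
  let ?u = "\<lambda>x. u x + u' x" and ?z = "\<lambda>x. z x + z' x" and ?y = "\<lambda>x. y x + y' x"
  have 0: "(0, 0, 0) = (0 :: ('n,'m) state)" by (simp add: zero_prod_def)
  have out: "u x = 0 \<and> z x = 0 \<and> y x = 0" if "x \<notin> W" for x using pert_outside[OF p that] by simp
  have out': "u' x = 0 \<and> z' x = 0 \<and> y' x = 0" if "x \<notin> W'" for x using pert_outside[OF p' that] by simp
  have sh: "shifted lam ?z ?y x = shifted lam z y x + shifted lam z' y' x" for x
  proof -
    have "(0, 0, y x + y' x) = (0, 0, y x) + ((0, 0, y' x) :: ('n, 'm) state)" by simp
    then show ?thesis unfolding shifted_def by (simp only: scaleR_add_right ac_simps)
  qed
  have cases: "(u' x = 0 \<and> z' x = 0 \<and> y' x = 0) \<or> (u x = 0 \<and> z x = 0 \<and> y x = 0)" for x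
    using out out' W(3) by blast
  have nsq: "(norm (shifted lam ?z ?y x))\<^sup>2 = (norm (shifted lam z y x))\<^sup>2 + (norm (shifted lam z' y' x))\<^sup>2" for x
    using cases[of x] by (auto simp: shifted_def 0)
  have m: "measure lborel (W \<union> W') = measure lborel W + measure lborel W'"
  proof -
    have "W \<in> fmeasurable lborel" "W' \<in> fmeasurable lborel"
      using W(1,2) by (simp_all add: fmeasurable_compact)
    then show ?thesis using measure_Un3[of W lborel W'] W(3) by simp
  qed
  show ?thesis
    unfolding fills_def
  proof (intro exI[of _ ?u] exI[of _ ?z] exI[of _ ?y] conjI ballI allI)
    show "pert (W \<union> W') ?u ?z ?y" by (rule pert_add[OF p p'])
    show "Z x + shifted lam ?z ?y x \<in> S" if "x \<in> W \<union> W'" for x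
    proof (cases "x \<in> W")
      case True
      then have "x \<notin> W'" using W(3) by blast
      then have "shifted lam ?z ?y x = shifted lam z y x" using out'[of x] by (simp add: shifted_def)
      then show ?thesis using st True by simp
    next
      case False
      then have "shifted lam ?z ?y x = shifted lam z' y' x" using out[of x] by (simp add: shifted_def)
      then show ?thesis using st' that False by auto
    qed
    show "norm (?u x) \<le> \<delta>" "norm (?y x) \<le> \<delta>" for x using cases[of x] uy uy' by auto
    have "(LINT x:W \<union> W'|lborel. c x) = (LINT x:W|lborel. c x) + (LINT x:W'|lborel. c x)"
      by (rule set_integral_Un[OF W(3)]) (intro set_integrable_continuous_compact W c)+
    moreover have "(\<integral>x. (norm (shifted lam ?z ?y x))\<^sup>2 \<partial>lborel) =
        (\<integral>x. (norm (shifted lam z y x))\<^sup>2 \<partial>lborel) + (\<integral>x. (norm (shifted lam z' y' x))\<^sup>2 \<partial>lborel)"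
      unfolding nsq by (intro Bochner_Integration.integral_add shifted_integrable(1)[OF p] shifted_integrable(1)[OF p'])
    ultimately show "(LINT x:W \<union> W'|lborel. c x) - \<delta> * measure lborel (W \<union> W')
        \<le> (\<integral>x. (norm (shifted lam ?z ?y x))\<^sup>2 \<partial>lborel)"
      using en en' m by (simp add: distrib_left)
    fix Y assume Y: "Y \<in> F"
    have "(\<integral>x. Y x \<bullet> shifted lam ?z ?y x \<partial>lborel) =
        (\<integral>x. Y x \<bullet> shifted lam z y x \<partial>lborel) + (\<integral>x. Y x \<bullet> shifted lam z' y' x \<partial>lborel)"
      unfolding sh inner_add_right
      by (intro Bochner_Integration.integral_add shifted_integrable(2)[OF p F[OF Y]] shifted_integrable(2)[OF p' F[OF Y]])
    then show "\<bar>\<integral>x. Y x \<bullet> shifted lam ?z ?y x \<partial>lborel\<bar> \<le> \<delta> * measure lborel (W \<union> W')"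
      using ort[rule_format, OF Y] ort'[rule_format, OF Y] m by (simp add: distrib_left)
  qed
qed

lemma fills_Union:
  fixes Z :: "(real^'n) \<times> real \<Rightarrow> ('n, 'm::finite) state"
  assumes "finite C" "\<And>i. i \<in> C \<Longrightarrow> fills S Z c F \<delta> lam (B i)" "\<And>i. i \<in> C \<Longrightarrow> compact (B i)"
    and "pairwise (\<lambda>i j. disjnt (B i) (B j)) C" "\<delta> \<ge> 0"
    and c: "continuous_on UNIV c" and F: "\<And>Y. Y \<in> F \<Longrightarrow> continuous_on UNIV Y"
  shows "fills S Z c F \<delta> lam (\<Union>i\<in>C. B i)"
  using assms(1-4)
proof (induction C rule: finite_induct)
  case empty
  then show ?case using fills_empty[OF assms(5)] by simp
next
  case (insert i C)
  have "fills S Z c F \<delta> lam (B i \<union> (\<Union>i\<in>C. B i))"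
  proof (rule fills_Un[OF _ _ _ _ _ c F])
    show "fills S Z c F \<delta> lam (B i)" "compact (B i)" using insert by auto
    show "fills S Z c F \<delta> lam (\<Union>i\<in>C. B i)" using insert by (auto simp: pairwise_insert)
    show "compact (\<Union>i\<in>C. B i)" using insert by (intro compact_UN) auto
    show "B i \<inter> (\<Union>i\<in>C. B i) = {}"
      using insert(2,6) by (auto simp: pairwise_insert disjnt_def)
  qed
  then show ?case by simp
qed

lemma shifted_integral_zero:
  assumes p: "pert W u z y"
  shows "(\<integral>x. shifted lam z y x \<partial>lborel) = 0"
proof -
  have bl: "bounded_linear (\<lambda>v. (0, 0, v) :: ('a, 'b) state)"
    by (intro bounded_linear_Pair bounded_linear_zero bounded_linear_ident)
  have i: "integrable lborel (\<lambda>x. (0, 0, y x) :: ('a, 'b) state)"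
    using integrable_bounded_linear[OF bl pert_integrable(2)[OF p]] .
  have "(\<integral>x. (0, 0, y x) \<partial>lborel) = (0 :: ('a, 'b) state)"
    using integral_bounded_linear[OF bl pert_integrable(2)[OF p]] pert_integral_zero(2)[OF p]
    by (simp add: zero_prod_def)
  then show ?thesis
    unfolding shifted_def using i pert_integrable(1)[OF p] pert_integral_zero(1)[OF p]
    by (simp del: scaleR_Pair)
qed

lemma eventually_mult_small:
  fixes k b :: real
  assumes "k > 0" "b > 0"
  shows "\<forall>\<^sub>F r in at_right 0. r * k < b"
  unfolding eventually_at_right_field
  by (rule exI[of _ "b / k"]) (use assms in \<open>auto simp: field_simps\<close>)

lemma eventually_small_oscillation:
  fixes f :: "'a::euclidean_space \<Rightarrow> 'b::real_normed_vector"
  assumes "continuous_on UNIV f" "\<epsilon> > 0"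
  shows "\<forall>\<^sub>F r in at_right 0. \<forall>x\<in>cball a r. norm (f x - f a) < \<epsilon>"
proof -
  obtain d where d: "d > 0" "\<And>x. dist x a < d \<Longrightarrow> dist (f x) (f a) < \<epsilon>"
    using assms unfolding continuous_on_iff by (meson UNIV_I)
  show ?thesis
    unfolding eventually_at_right_field
  proof (intro exI[of _ d] conjI allI impI ballI)
    fix r x assume "0 < r" "r < d" "x \<in> cball a r"
    then show "norm (f x - f a) < \<epsilon>" using d(2)[of x] by (simp add: dist_norm norm_minus_commute)
  qed (use d in simp)
qed

text \<open>On a small ball around \<open>a\<close> the fields \<open>Z\<close>, \<open>c\<close> and those in \<open>F\<close> are almost constant. A rescaled copy of a nearly optimal perturbation
at the state \<open>Z a\<close> therefore serves: its flux correction is small by scaling, and it is almost orthogonal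
to nearly constant functions because its mean is zero.\<close>

lemma fills_small_ball:
  fixes Z :: "(real^'n) \<times> real \<Rightarrow> ('n, 'm::finite) state"
  assumes S: "open S" "bounded S" and Z: "continuous_on UNIV Z" and c: "continuous_on UNIV c"
    and F: "finite F" "\<And>Y. Y \<in> F \<Longrightarrow> continuous_on UNIV Y"
    and \<delta>: "\<delta> > 0" and lam: "\<bar>lam\<bar> \<le> 1" and a: "Z a \<in> S" "c a < max_gain S (Z a)"
  shows "\<forall>\<^sub>F r in at_right 0. fills S Z c F \<delta> lam (cball a r)"
proof -
  define vol where "vol = measure lborel (ball (0 :: (real^'n) \<times> real) 1)"
  have vol: "vol > 0" unfolding vol_def by (rule unit_ball_content_pos)
  obtain u :: "(real^'n) \<times> real \<Rightarrow> real^'m" and z y where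
    p: "pert (ball 0 1) u z y" and st: "\<And>x. Z a + z x \<in> S" and
    en: "c a * vol < (\<integral>x. (norm (z x))\<^sup>2 \<partial>lborel)"
    using max_gain_approx[OF S(2) a] unfolding vol_def by blast
  obtain \<eta> where \<eta>: "\<eta> > 0" "\<And>x v. norm v < \<eta> \<Longrightarrow> Z a + z x + v \<in> S"
    using pert_margin[OF p S(1) a(1) st] by blast
  from pert_support[OF p] obtain K where K: "compact K" "K \<subseteq> ball 0 1"
    "\<forall>x. x \<notin> K \<longrightarrow> u x = 0 \<and> z x = 0 \<and> y x = 0" by (elim exE conjE)
  obtain Bu where Bu: "Bu > 0" "\<And>x. norm (u x) \<le> Bu"
    using bounded_compact_support[OF pert_continuous(1)[OF p] K(1)] K(3) by metis
  obtain Bz where Bz: "Bz > 0" "\<And>x. norm (z x) \<le> Bz"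
    using bounded_compact_support[OF pert_continuous(2)[OF p] K(1)] K(3) by metis
  obtain By where By: "By > 0" "\<And>x. norm (y x) \<le> By"
    using bounded_compact_support[OF pert_continuous(3)[OF p] K(1)] K(3) by metis
  have "\<forall>\<^sub>F r in at_right 0. \<forall>Y\<in>F. \<forall>x\<in>cball a r. norm (Y x - Y a) < \<delta> / (Bz + By)"
    using F \<delta> Bz(1) By(1) by (intro eventually_ball_finite ballI eventually_small_oscillation) auto
  moreover have "\<forall>\<^sub>F r in at_right 0. \<forall>x\<in>cball a r. norm (Z x - Z a) < \<eta> / 2"
    using \<eta> Z by (intro eventually_small_oscillation) auto
  moreover have "\<forall>\<^sub>F r in at_right 0. \<forall>x\<in>cball a r. norm (c x - c a) < \<delta> / 2"
    using \<delta> c by (intro eventually_small_oscillation) auto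
  moreover have "\<forall>\<^sub>F r in at_right 0. r * 1 < (1::real)" "\<forall>\<^sub>F r in at_right 0. r * Bu < \<delta>"
    "\<forall>\<^sub>F r in at_right 0. r * By < \<delta>" "\<forall>\<^sub>F r in at_right 0. r * By < \<eta> / 2"
    "\<forall>\<^sub>F r in at_right 0. r * (2 * Bz * By) < \<delta> / 2"
    using Bu By Bz \<delta> \<eta> by (intro eventually_mult_small; simp)+
  moreover have "\<forall>\<^sub>F r in at_right 0. (0::real) < r" by (rule eventually_at_right_less)
  ultimately show ?thesis
  proof eventually_elim
    case (elim r)
    then have r: "r > 0" "r < 1" by auto
    let ?u = "\<lambda>x. r *\<^sub>R u ((x - a) /\<^sub>R r)" and ?z = "\<lambda>x. z ((x - a) /\<^sub>R r)"
      and ?y = "\<lambda>x. r *\<^sub>R y ((x - a) /\<^sub>R r)"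
    have p': "pert (cball a r) ?u ?z ?y"
      by (rule pert_mono[OF pert_scale[OF p r(1)] ball_subset_cball])
    have sh: "shifted lam ?z ?y x = shifted (lam * r) z y ((x - a) /\<^sub>R r)" for x
      by (simp add: shifted_def)
    have m: "measure lborel (cball a r) = r ^ DIM((real^'n) \<times> real) * vol"
      using r by (simp add: vol_def content_cball content_ball del: DIM_prod DIM_cart)
    have nl: "norm ((lam * r) *\<^sub>R (0, 0, y x) :: ('n, 'm) state) \<le> r * norm (y x)" for x
      using lam r mult_right_mono[of "\<bar>lam\<bar>" 1 "r * norm (y x)"]
      by (simp add: norm_Pair abs_mult mult.assoc)
    have nl': "norm ((lam * r) *\<^sub>R (0, 0, y x) :: ('n, 'm) state) \<le> r * By" for x
      using nl[of x] mult_left_mono[OF By(2)[of x], of r] r by linarith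
    have "(c a * vol - \<delta> / 2 * vol) \<le> (\<integral>x. (norm (shifted (lam * r) z y x))\<^sup>2 \<partial>lborel)"
    proof -
      have "(\<integral>x. (norm (z x))\<^sup>2 - indicator (ball 0 1) x * (\<delta> / 2) \<partial>lborel)
          \<le> (\<integral>x. (norm (shifted (lam * r) z y x))\<^sup>2 \<partial>lborel)"
      proof (rule integral_mono)
        show "integrable lborel (\<lambda>x. (norm (z x))\<^sup>2 - indicator (ball 0 1) x * (\<delta> / 2))"
          by (intro Bochner_Integration.integrable_diff pert_energy_integrable(2)[OF p]
              integrable_mult_left integrable_real_indicator)
            (auto simp: emeasure_bounded_finite[unfolded infinity_ennreal_def])
        show "integrable lborel (\<lambda>x. (norm (shifted (lam * r) z y x))\<^sup>2)"
          by (rule shifted_integrable(1)[OF p])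
        show "(norm (z x))\<^sup>2 - indicator (ball 0 1) x * (\<delta> / 2) \<le> (norm (shifted (lam * r) z y x))\<^sup>2" for x
        proof (cases "x \<in> ball 0 1")
          case True
          define b where "b = ((lam * r) *\<^sub>R (0, 0, y x) :: ('n, 'm) state)"
          have "(norm (z x))\<^sup>2 - 2 * (norm (z x) * norm b) \<le> (norm (z x + b))\<^sup>2"
            using Cauchy_Schwarz_ineq2[of "z x" b] by (simp add: power2_norm_eq_inner inner_add inner_commute algebra_simps abs_le_iff)
          moreover have "norm (z x) * norm b \<le> Bz * (r * By)"
            using Bz nl'[of x] unfolding b_def by (intro mult_mono) auto
          moreover have "2 * (Bz * (r * By)) < \<delta> / 2" using elim by (simp add: algebra_simps)
          ultimately have "(norm (z x))\<^sup>2 - \<delta> / 2 \<le> (norm (z x + b))\<^sup>2" by linarith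
          then show ?thesis using True by (simp add: shifted_def b_def del: scaleR_Pair)
        next
          case False
          have "z x = 0" using pert_outside(2)[OF p False] .
          then show ?thesis using False by simp
        qed
      qed
      moreover have "(\<integral>x. (norm (z x))\<^sup>2 - indicator (ball 0 1) x * (\<delta> / 2) \<partial>lborel) =
          (\<integral>x. (norm (z x))\<^sup>2 \<partial>lborel) - vol * (\<delta> / 2)"
        by (subst Bochner_Integration.integral_diff[OF pert_energy_integrable(2)[OF p]])
          (auto simp: vol_def emeasure_bounded_finite[unfolded infinity_ennreal_def]
            intro!: integrable_mult_left integrable_real_indicator)
      ultimately show ?thesis using en by (simp add: algebra_simps)
    qed
    from mult_left_mono[OF this, of "r ^ DIM((real^'n) \<times> real)"] r
    have "(c a - \<delta> / 2) * measure lborel (cball a r) \<le> (\<integral>x. (norm (shifted lam ?z ?y x))\<^sup>2 \<partial>lborel)"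
      unfolding sh m by (subst lborel_integral_affine[of r _ a])
        (simp_all add: algebra_simps del: DIM_prod DIM_cart)
    moreover have cx: "c x \<le> c a + \<delta> / 2" if "x \<in> cball a r" for x
    proof -
      have "norm (c x - c a) < \<delta> / 2" using elim that by blast
      then show ?thesis unfolding real_norm_def by linarith
    qed
    moreover have "(LINT x:cball a r|lborel. c x) \<le> (LINT x:cball a r|lborel. c a + \<delta> / 2)"
      by (intro set_integral_mono set_integrable_continuous_compact c continuous_on_const compact_cball)
        (rule cx)
    moreover have "(LINT x:cball a r|lborel. c a + \<delta> / 2) = measure lborel (cball a r) * (c a + \<delta> / 2)"
      using emeasure_bounded_finite[OF bounded_cball, of a r] by (subst set_integral_const) auto
    ultimately have E: "(LINT x:cball a r|lborel. c x) - \<delta> * measure lborel (cball a r)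
        \<le> (\<integral>x. (norm (shifted lam ?z ?y x))\<^sup>2 \<partial>lborel)"
      by (simp add: algebra_simps)
    show ?case
      unfolding fills_def
    proof (intro exI[of _ ?u] exI[of _ ?z] exI[of _ ?y] conjI ballI allI p' E)
      fix x assume x: "x \<in> cball a r"
      let ?b = "(lam * r) *\<^sub>R (0, 0, y ((x - a) /\<^sub>R r)) :: ('n, 'm) state"
      have "norm (Z x - Z a + ?b) < \<eta>"
        using elim x nl'[of "(x - a) /\<^sub>R r"] norm_triangle_ineq[of "Z x - Z a" ?b] by force
      from \<eta>(2)[OF this, of "(x - a) /\<^sub>R r"]
      show "Z x + shifted lam ?z ?y x \<in> S" unfolding sh by (simp add: shifted_def algebra_simps)
    next
      show "norm (?u x) \<le> \<delta>" for x
      proof -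
        have "r * norm (u ((x - a) /\<^sub>R r)) \<le> r * Bu" using Bu r by (intro mult_left_mono) auto
        moreover have "r * Bu < \<delta>" using elim by blast
        ultimately show ?thesis unfolding norm_scaleR abs_of_pos[OF r(1)] by linarith
      qed
      show "norm (?y x) \<le> \<delta>" for x
      proof -
        have "r * norm (y ((x - a) /\<^sub>R r)) \<le> r * By" using By r by (intro mult_left_mono) auto
        moreover have "r * By < \<delta>" using elim by blast
        ultimately show ?thesis unfolding norm_scaleR abs_of_pos[OF r(1)] by linarith
      qed
    next
      fix Y assume Y: "Y \<in> F"
      let ?w = "shifted lam ?z ?y"
      have "(\<integral>x. Y x \<bullet> ?w x \<partial>lborel) = (\<integral>x. (Y x - Y a) \<bullet> ?w x \<partial>lborel)"
        unfolding inner_diff_left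
        using shifted_integrable(2)[OF p' F(2)[OF Y]] shifted_integrable(3)[OF p'] shifted_integral_zero[OF p']
        by simp
      also have "\<bar>\<dots>\<bar> \<le> (\<integral>x. indicator (cball a r) x * \<delta> \<partial>lborel)"
      proof (rule integral_abs_bound[THEN order_trans], rule integral_mono)
        show "integrable lborel (\<lambda>x. \<bar>(Y x - Y a) \<bullet> ?w x\<bar>)"
          by (intro integrable_abs shifted_integrable(2)[OF p'] continuous_on_diff F(2)[OF Y] continuous_on_const)
        show "integrable lborel (\<lambda>x. indicator (cball a r) x * \<delta> :: real)"
          by (intro integrable_mult_left integrable_real_indicator)
            (auto simp: emeasure_bounded_finite[unfolded infinity_ennreal_def])
        show "\<bar>(Y x - Y a) \<bullet> ?w x\<bar> \<le> indicator (cball a r) x * \<delta>" for x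
        proof (cases "x \<in> cball a r")
          case True
          have rB: "r * By \<le> 1 * By" using r By by (intro mult_right_mono) auto
          have "norm (?w x) \<le> Bz + r * By"
            unfolding sh unfolding shifted_def by (intro norm_triangle_le add_mono nl' Bz(2))
          then have "norm (?w x) \<le> Bz + By" using rB by linarith
          moreover have "norm (Y x - Y a) < \<delta> / (Bz + By)" using elim Y True by blast
          then have "norm (Y x - Y a) \<le> \<delta> / (Bz + By)" by (rule less_imp_le)
          ultimately have "norm (Y x - Y a) * norm (?w x) \<le> \<delta> / (Bz + By) * (Bz + By)"
            using \<delta> Bz By by (intro mult_mono) auto
          then show ?thesis using Cauchy_Schwarz_ineq2[of "Y x - Y a" "?w x"] True Bz By by simp
        next
          case False
          then have "?w x = 0" using pert_outside[OF p' False] by (simp add: shifted_def zero_prod_def)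
          then show ?thesis using False by simp
        qed
      qed
      also have "\<dots> = \<delta> * measure lborel (cball a r)" by simp
      finally show "\<bar>\<integral>x. Y x \<bullet> ?w x \<partial>lborel\<bar> \<le> \<delta> * measure lborel (cball a r)" .
    qed
  qed
qed

text \<open>By the Vitali covering theorem disjoint balls from the preceding lemma exhaust \<open>W\<close> up to a null set, and finitely many of them exhaust it up to a set of measure \<open>\<epsilon>\<close>,
on which \<open>c\<close> contributes little because it is bounded.\<close>

lemma fill:
  fixes Z :: "(real^'n) \<times> real \<Rightarrow> ('n, 'm::finite) state"
  assumes S: "open S" "bounded S" and W: "open W" "bounded W"
    and Z: "continuous_on UNIV Z" and c: "continuous_on UNIV c"
    and F': "finite F" "\<forall>Y\<in>F. continuous_on UNIV Y"
    and \<delta>: "\<delta> > 0" and lam: "\<bar>lam\<bar> \<le> 1"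
    and gain': "\<forall>x\<in>W. Z x \<in> S \<and> c x < max_gain S (Z x)"
  shows "\<exists>u z y. pert W u z y \<and> (\<forall>x\<in>W. Z x + shifted lam z y x \<in> S) \<and>
    (\<forall>x. norm (u x) \<le> \<delta>) \<and> (\<forall>x. norm (y x) \<le> \<delta>) \<and>
    (LINT x:W|lborel. c x) - \<delta> \<le> (\<integral>x. (norm (shifted lam z y x))\<^sup>2 \<partial>lborel) \<and>
    (\<forall>Y\<in>F. \<bar>\<integral>x. Y x \<bullet> shifted lam z y x \<partial>lborel\<bar> \<le> \<delta>)"
proof -
  have F: "finite F" "\<And>Y. Y \<in> F \<Longrightarrow> continuous_on UNIV Y" using F' by auto
  have gain: "Z x \<in> S" "c x < max_gain S (Z x)" if "x \<in> W" for x using gain' that by auto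
  have "bounded (c ` closure W)"
    using W c by (intro compact_imp_bounded compact_continuous_image)
      (auto intro: continuous_on_subset simp: compact_closure)
  then obtain M where M: "M > 0" "\<And>x. x \<in> W \<Longrightarrow> \<bar>c x\<bar> \<le> M"
    unfolding bounded_pos using closure_subset by (metis imageI real_norm_def subsetD)
  define V where "V = measure lborel W"
  have V: "V \<ge> 0" by (simp add: V_def)
  \<comment> \<open>the density error over all of W and the loss on the uncovered set each take half of the allowance\<close>
  define \<delta>1 where "\<delta>1 = min \<delta> (\<delta> / (2 * (V + 1)))"
  have \<delta>1: "\<delta>1 > 0" "\<delta>1 \<le> \<delta>" using \<delta> V by (auto simp: \<delta>1_def)
  have "\<delta>1 * V \<le> \<delta> / (2 * (V + 1)) * V" using V by (intro mult_right_mono) (simp_all add: \<delta>1_def)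
  also have "\<dots> \<le> \<delta> / 2" using V \<delta> by (simp add: field_simps)
  finally have \<delta>1V: "\<delta>1 * V \<le> \<delta> / 2" .
  define \<epsilon> where "\<epsilon> = \<delta> / (2 * M)"
  have \<epsilon>: "\<epsilon> > 0" using \<delta> M by (simp add: \<epsilon>_def)
  define I where "I = {i :: ((real^'n) \<times> real) \<times> real.
      0 < snd i \<and> cball (fst i) (snd i) \<subseteq> W \<and> fills S Z c F \<delta>1 lam (cball (fst i) (snd i))}"
  have vit: "\<exists>i. i \<in> I \<and> x \<in> cball (fst i) (snd i) \<and> snd i < d" if "x \<in> W" "0 < d" for x d
  proof -
    obtain e where e: "e > 0" "cball x e \<subseteq> W" using W(1) \<open>x \<in> W\<close> open_contains_cball by blast
    have "\<forall>\<^sub>F r in at_right 0. fills S Z c F \<delta>1 lam (cball x r)"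
      by (rule fills_small_ball[OF S Z c F \<delta>1(1) lam gain[OF \<open>x \<in> W\<close>]])
    moreover have "\<forall>\<^sub>F r in at_right 0. r * 1 < d" "\<forall>\<^sub>F r in at_right 0. r * 1 < e"
      by (rule eventually_mult_small; use e that in simp)+
    moreover have "\<forall>\<^sub>F r in at_right 0. (0::real) < r" by (rule eventually_at_right_less)
    ultimately have "\<forall>\<^sub>F r in at_right 0. fills S Z c F \<delta>1 lam (cball x r) \<and> r < d \<and> r < e \<and> 0 < r"
      by eventually_elim simp
    then obtain r where r: "fills S Z c F \<delta>1 lam (cball x r)" "r < d" "r < e" "0 < r"
      using eventually_happens'[OF trivial_limit_at_right_real] by blast
    then have "(x, r) \<in> I" unfolding I_def using e(2) by auto
    then show ?thesis using r by (intro exI[of _ "(x, r)"]) auto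
  qed
  obtain C where C: "countable C" "C \<subseteq> I"
    "pairwise (\<lambda>i j. disjnt (cball (fst i) (snd i)) (cball (fst j) (snd j))) C"
    "negligible (W - (\<Union>i\<in>C. cball (fst i) (snd i)))"
    by (rule Vitali_covering_theorem_cballs[of I snd W fst]) (use vit in \<open>auto simp: I_def\<close>)
  let ?D = "(\<lambda>i. cball (fst i) (snd i)) ` C"
  have sub: "\<Union>?D \<subseteq> W" using C(2) by (auto simp: I_def)
  have Wm: "W \<in> lmeasurable" using W by (simp add: bounded_set_imp_lmeasurable)
  have Wl: "measure lebesgue W = V" using W(1) by (simp add: V_def)
  have bound: "measure lebesgue (\<Union>D') \<le> V" if "D' \<subseteq> ?D" "finite D'" for D'
  proof -
    have "\<Union>D' \<in> sets lebesgue" using that by (intro sets.finite_Union) auto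
    moreover have "\<Union>D' \<subseteq> W" using that(1) sub by blast
    ultimately show ?thesis using measure_mono_fmeasurable[OF _ _ Wm] Wl by metis
  qed
  obtain D' where D': "D' \<subseteq> ?D" "finite D'" "measure lebesgue (\<Union>?D) - \<epsilon> < measure lebesgue (\<Union>D')"
    by (rule measure_countable_Union_approachable[of ?D \<epsilon> V]) (use C(1) \<epsilon> bound in auto)
  obtain C' where C': "C' \<subseteq> C" "finite C'" "D' = (\<lambda>i. cball (fst i) (snd i)) ` C'"
    using finite_subset_image[OF D'(2,1)] by metis
  define W' where "W' = (\<Union>i\<in>C'. cball (fst i) (snd i))"
  have W'D: "W' = \<Union>D'" by (simp add: W'_def C'(3))
  have W'W: "W' \<subseteq> W" using sub C'(1) by (auto simp: W'_def)
  have W'c: "compact W'" unfolding W'_def using C'(2) by (intro compact_UN) auto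
  have "fills S Z c F \<delta>1 lam W'"
    unfolding W'_def
  proof (rule fills_Union[OF C'(2) _ _ _ _ c F(2)])
    show "fills S Z c F \<delta>1 lam (cball (fst i) (snd i))" if "i \<in> C'" for i
      using C(2) C'(1) that by (auto simp: I_def)
    show "pairwise (\<lambda>i j. disjnt (cball (fst i) (snd i)) (cball (fst j) (snd j))) C'"
      using C(3) C'(1) pairwise_subset by blast
  qed (use \<delta>1 in auto)
  then obtain u z y where p: "pert W' u z y" and st: "\<forall>x\<in>W'. Z x + shifted lam z y x \<in> S" and
    uy: "\<forall>x. norm (u x) \<le> \<delta>1" "\<forall>x. norm (y x) \<le> \<delta>1" and
    en: "(LINT x:W'|lborel. c x) - \<delta>1 * measure lborel W' \<le> (\<integral>x. (norm (shifted lam z y x))\<^sup>2 \<partial>lborel)" and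
    ort: "\<forall>Y\<in>F. \<bar>\<integral>x. Y x \<bullet> shifted lam z y x \<partial>lborel\<bar> \<le> \<delta>1 * measure lborel W'"
    unfolding fills_def by (elim exE conjE)
  have W's: "W' \<in> sets lborel" using W'c by (simp add: borel_compact)
  have mW': "measure lborel W' = measure lebesgue W'" using W's by simp
  have "measure lborel W' \<le> V"
    using bound[OF D'(1,2)] mW' W'D by simp
  then have \<delta>1W': "\<delta>1 * measure lborel W' \<le> \<delta> / 2"
    using \<delta>1V mult_left_mono[of "measure lborel W'" V \<delta>1] \<delta>1(1) by linarith
  have diff: "measure lborel (W - W') \<le> \<epsilon>"
  proof -
    have "\<Union>?D = W - (W - (\<Union>i\<in>C. cball (fst i) (snd i)))" using sub by auto
    then have "measure lebesgue (\<Union>?D) = V"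
      using measure_Diff_null_set[of W lebesgue "W - (\<Union>i\<in>C. cball (fst i) (snd i))"] C(4) W(1) Wl
      by (simp add: negligible_iff_null_sets)
    moreover have "measure lborel (W - W') = measure lborel W - measure lborel W'"
      using W W's W'W emeasure_bounded_finite[OF W(2)] by (intro measure_Diff) auto
    ultimately show ?thesis using D'(3) W'D mW' by (simp add: V_def)
  qed
  have cW: "set_integrable lborel W c"
  proof -
    have "set_integrable lborel (closure W) c"
      using W c by (intro set_integrable_continuous_compact) (simp_all add: compact_closure)
    then show ?thesis by (rule set_integrable_subset) (use W in \<open>auto simp: closure_subset\<close>)
  qed
  have cWW': "set_integrable lborel (W - W') c"
    by (rule set_integrable_subset[OF cW]) (use W W's in auto)
  have "(LINT x:W|lborel. c x) = (LINT x:W' \<union> (W - W')|lborel. c x)"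
    using W'W by (simp add: Un_absorb1)
  also have "\<dots> = (LINT x:W'|lborel. c x) + (LINT x:W - W'|lborel. c x)"
    by (rule set_integral_Un[OF _ set_integrable_continuous_compact[OF W'c c] cWW']) auto
  also have "(LINT x:W - W'|lborel. c x) \<le> (LINT x:W - W'|lborel. M)"
  proof (rule set_integral_mono[OF cWW'])
    show "set_integrable lborel (W - W') (\<lambda>x. M)"
      unfolding set_integrable_def using W W's
      by (intro integrable_scaleR_left integrable_real_indicator)
        (auto simp: emeasure_bounded_finite[unfolded infinity_ennreal_def] bounded_diff)
    show "c x \<le> M" if "x \<in> W - W'" for x using M(2)[of x] that by auto
  qed
  also have "(LINT x:W - W'|lborel. M) = measure lborel (W - W') * M"
    using W W's emeasure_bounded_finite[OF bounded_subset[OF W(2) Diff_subset[of W W']]]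
    by (subst set_integral_const) auto
  also have "\<dots> \<le> \<epsilon> * M" using diff M(1) by (intro mult_right_mono) auto
  also have "\<dots> = \<delta> / 2" using M by (simp add: \<epsilon>_def)
  finally have I: "(LINT x:W|lborel. c x) \<le> (LINT x:W'|lborel. c x) + \<delta> / 2" by simp
  show ?thesis
  proof (intro exI[of _ u] exI[of _ z] exI[of _ y] conjI ballI allI)
    show "pert W u z y" by (rule pert_mono[OF p W'W])
    show "Z x + shifted lam z y x \<in> S" if "x \<in> W" for x
    proof (cases "x \<in> W'")
      case False
      then have "shifted lam z y x = 0" using pert_outside[OF p False] by (simp add: shifted_def zero_prod_def)
      then show ?thesis using gain(1)[OF that] by simp
    qed (use st in blast)
    show "norm (u x) \<le> \<delta>" "norm (y x) \<le> \<delta>" for x using uy \<delta>1(2) order_trans by blast+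
    show "(LINT x:W|lborel. c x) - \<delta> \<le> (\<integral>x. (norm (shifted lam z y x))\<^sup>2 \<partial>lborel)"
      using I en \<delta>1W' by linarith
    show "\<bar>\<integral>x. Y x \<bullet> shifted lam z y x \<partial>lborel\<bar> \<le> \<delta>" if "Y \<in> F" for Y
      using ort[rule_format, OF that] \<delta>1W' \<delta> by linarith
  qed
qed

section \<open>Plane waves\<close>

lemma integral_pos_continuous:
  fixes f :: "'a::euclidean_space \<Rightarrow> real"
  assumes "continuous_on UNIV f" "integrable lborel f" "\<And>x. f x \<ge> 0" "f a > 0"
  shows "(\<integral>x. f x \<partial>lborel) > 0"
proof -
  obtain d where d: "d > 0" "\<And>x. dist x a < d \<Longrightarrow> dist (f x) (f a) < f a / 2"
    using assms(1,4) unfolding continuous_on_iff by (meson UNIV_I half_gt_zero)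
  have "0 < measure lborel (ball a d) * (f a / 2)" using d(1) assms(4) by simp
  also have "\<dots> = (\<integral>x. indicator (ball a d) x * (f a / 2) \<partial>lborel)" by simp
  also have "\<dots> \<le> (\<integral>x. f x \<partial>lborel)"
  proof (rule integral_mono[OF _ assms(2)])
    show "integrable lborel (\<lambda>x. indicator (ball a d) x * (f a / 2) :: real)"
      using emeasure_bounded_finite[OF bounded_ball, of a d]
      by (intro integrable_mult_left integrable_real_indicator) auto
    show "indicator (ball a d) x * (f a / 2) \<le> f x" for x
    proof (cases "x \<in> ball a d")
      case True
      then have "\<bar>f x - f a\<bar> < f a / 2" using d(2)[of x] by (simp add: dist_real_def dist_commute)
      then have "f a / 2 \<le> f x" by linarith
      then show ?thesis using True by simp
    qed (use assms(3) in simp)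
  qed
  finally show ?thesis .
qed

lemma tensor_mult_vec: "tensor p w *v v = (w \<bullet> v) *\<^sub>R p"
  by (simp add: tensor_def matrix_vector_mult_def vec_eq_iff inner_vec_def sum_distrib_left ac_simps)

lemma dirderiv_linear:
  assumes "f differentiable (at x)"
  shows "linear (\<lambda>h. dirderiv h f x)"
  using has_derivative_dirderiv[OF assms] has_derivative_linear by blast

lemma dirderiv_expand:
  fixes f :: "(real^'n) \<times> real \<Rightarrow> real"
  assumes "f differentiable (at x)"
  shows "dirderiv h f x = (\<chi> k. dirderiv (axis k 1, 0) f x) \<bullet> fst h + snd h * dirderiv (0, 1) f x"
proof -
  have h: "h = (\<Sum>k\<in>UNIV. fst h $ k *\<^sub>R (axis k 1, 0)) + snd h *\<^sub>R (0, 1)"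
  proof -
    have "(\<Sum>k\<in>UNIV. fst h $ k *\<^sub>R (axis k 1 :: real^'n, 0::real)) = (\<Sum>k\<in>UNIV. fst h $ k *\<^sub>R axis k 1, 0)"
      by (simp add: prod_eq_iff fst_sum snd_sum)
    then show ?thesis
      using basis_expansion[of "fst h"] by (simp add: scalar_mult_eq_scaleR)
  qed
  show ?thesis
    by (subst h)
      (simp add: linear_add[OF dirderiv_linear[OF assms]] linear_sum[OF dirderiv_linear[OF assms]]
        linear_scale[OF dirderiv_linear[OF assms]] inner_vec_def mult.commute del: scaleR_Pair)
qed

lemma smooth_expr_scale: "smooth_expr f \<Longrightarrow> smooth_expr (\<lambda>x. c * f x)"
  by (rule smooth_expr.mult[OF smooth_expr.const])

lemma C1_gradient_dest:
  assumes "C1_gradient \<phi> G"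
  shows "(\<phi> has_derivative (\<lambda>h. G x \<bullet> h)) (at x)" "continuous_on UNIV (\<lambda>x. G x \<bullet> e)"
  using assms unfolding C1_gradient_def by (auto intro!: continuous_on_inner)

text \<open>The perturbation is the derivative of a potential, so that its velocity \<open>\<partial>\<^sub>t \<partial>\<^sub>\<alpha> g\<close> is the divergence of the explicit flux
\<open>(\<partial>\<^sub>t g) p \<otimes> \<alpha>\<close>. The second potential \<open>g2\<close> generates the divergence-free flux \<open>(\<partial>\<^sub>\<alpha> g2) B\<^sub>i - (\<partial>\<^bsub>B\<^sub>i\<^esub> g2) \<alpha>\<close>.\<close>

definition wave_u :: "((real^'n) \<times> real \<Rightarrow> real) \<Rightarrow> real^'m \<Rightarrow> real^'n \<Rightarrow> (real^'n) \<times> real \<Rightarrow> real^'m" where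
  "wave_u g p \<alpha> x = dirderiv (\<alpha>, 0) g x *\<^sub>R p"

definition wave_z ::
  "((real^'n) \<times> real \<Rightarrow> real) \<Rightarrow> ((real^'n) \<times> real \<Rightarrow> real) \<Rightarrow> real^'m \<Rightarrow> real^'n \<Rightarrow> real^'n^'m \<Rightarrow>
   (real^'n) \<times> real \<Rightarrow> ('n, 'm) state" where
  "wave_z g1 g2 p \<alpha> B x =
     (tensor p (\<chi> k. dirderiv (axis k 1, 0) (dirderiv (\<alpha>, 0) g1) x),
      dirderiv (0, 1) (dirderiv (\<alpha>, 0) g1) x *\<^sub>R p,
      \<chi> i. dirderiv (\<alpha>, 0) g2 x *\<^sub>R B $ i - dirderiv (B $ i, 0) g2 x *\<^sub>R \<alpha>)"

definition wave_y :: "((real^'n) \<times> real \<Rightarrow> real) \<Rightarrow> real^'m \<Rightarrow> real^'n \<Rightarrow> (real^'n) \<times> real \<Rightarrow> real^'n^'m" where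
  "wave_y g p \<alpha> x = dirderiv (0, 1) g x *\<^sub>R tensor p \<alpha>"

lemma continuous_on_tensor:
  assumes "\<And>k. continuous_on A (\<lambda>x. w x $ k)"
  shows "continuous_on A (\<lambda>x. tensor p (w x))"
  unfolding tensor_def by (intro continuous_on_vec_lambda continuous_on_mult continuous_on_const assms)

lemma wave_pert:
  assumes g1: "smooth_expr g1" and g2: "smooth_expr g2"
    and K: "compact K" "K \<subseteq> W" "\<And>x. x \<notin> K \<Longrightarrow> g1 x = 0" "\<And>x. x \<notin> K \<Longrightarrow> g2 x = 0"
  shows "pert W (wave_u g1 p \<alpha>) (wave_z g1 g2 p \<alpha> B) (wave_y g1 p \<alpha>)"
proof -
  note sm = smooth_expr_dirderiv
  have d0: "dirderiv e g1 x = 0" "dirderiv e g2 x = 0" if "x \<notin> K" for x e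
    using derivative_compact_support[OF smooth_expr_has_derivative[OF g1] compact_imp_closed[OF K(1)] K(3) that]
      derivative_compact_support[OF smooth_expr_has_derivative[OF g2] compact_imp_closed[OF K(1)] K(4) that]
    by (simp_all add: fun_eq_iff)
  have dd0: "dirderiv e (dirderiv e' g1) x = 0" if "x \<notin> K" for x e e'
    using derivative_compact_support[OF smooth_expr_has_derivative[OF sm[OF g1, of e']] compact_imp_closed[OF K(1)] d0(1) that]
    by (simp add: fun_eq_iff)
  have lam0: "(\<chi> k. 0) = 0" by (simp add: vec_eq_iff)
  have t0: "tensor p 0 = 0" by (simp add: tensor_def vec_eq_iff)
  show ?thesis
    unfolding pert_def
  proof (intro conjI exI[of _ K] allI impI K)
    fix x assume x: "x \<notin> K"
    show "wave_u g1 p \<alpha> x = 0" "wave_z g1 g2 p \<alpha> B x = 0" "wave_y g1 p \<alpha> x = 0"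
      using x by (simp_all add: wave_u_def wave_z_def wave_y_def d0 dd0 lam0 t0 zero_prod_def)
  next
    show "continuous_on UNIV (wave_z g1 g2 p \<alpha> B)"
      unfolding wave_z_def[abs_def]
      by (intro continuous_on_Pair continuous_on_tensor continuous_on_scaleR continuous_on_vec_lambda
          continuous_on_diff continuous_on_const smooth_expr_continuous sm g1 g2)
        (simp add: smooth_expr_continuous sm g1)
    show "continuous_on UNIV (wave_y g1 p \<alpha>)"
      unfolding wave_y_def[abs_def]
      by (intro continuous_on_scaleR continuous_on_const smooth_expr_continuous sm g1)
  next
    fix x
    have "(wave_u g1 p \<alpha> has_derivative (\<lambda>h. dirderiv h (dirderiv (\<alpha>, 0) g1) x *\<^sub>R p)) (at x)"
      unfolding wave_u_def[abs_def]
      by (rule has_derivative_scaleR_left[OF smooth_expr_has_derivative[OF sm[OF g1]]])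
    moreover have "dirderiv h (dirderiv (\<alpha>, 0) g1) x *\<^sub>R p = state_deriv (wave_z g1 g2 p \<alpha> B x) h" for h
      by (subst dirderiv_expand[OF smooth_expr_differentiable[OF sm[OF g1]]])
        (simp add: state_deriv_def wave_z_def tensor_mult_vec scaleR_add_left)
    ultimately show "(wave_u g1 p \<alpha> has_derivative state_deriv (wave_z g1 g2 p \<alpha> B x)) (at x)"
      by simp
  next
    fix \<phi> :: "(real^'a) \<times> real \<Rightarrow> real" and G i
    assume G: "C1_gradient \<phi> G"
    note x1 = integral_cross_dirderiv(2)[where \<phi>'="\<lambda>x h. G x \<bullet> h", OF g1 K(1,3) C1_gradient_dest[OF G]]
    note x2 = integral_cross_dirderiv(2)[where \<phi>'="\<lambda>x h. G x \<bullet> h", OF g2 K(1,4) C1_gradient_dest[OF G]]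
    have 1: "(- (wave_y g1 p \<alpha> x $ i), wave_u g1 p \<alpha> x $ i) =
        (p $ i) *\<^sub>R (dirderiv (\<alpha>, 0) g1 x *\<^sub>R (0, 1) - dirderiv (0, 1) g1 x *\<^sub>R (\<alpha>, 0))" for x
      by (simp add: wave_y_def wave_u_def tensor_def vec_eq_iff)
    have "(\<integral>x. G x \<bullet> (- (wave_y g1 p \<alpha> x $ i), wave_u g1 p \<alpha> x $ i) \<partial>lborel) =
        p $ i * (\<integral>x. dirderiv (\<alpha>, 0) g1 x * (G x \<bullet> (0, 1)) - dirderiv (0, 1) g1 x * (G x \<bullet> (\<alpha>, 0)) \<partial>lborel)"
      unfolding 1 inner_scaleR_right inner_diff_right by (rule integral_mult_right_zero)
    then show "(\<integral>x. G x \<bullet> (- (wave_y g1 p \<alpha> x $ i), wave_u g1 p \<alpha> x $ i) \<partial>lborel) = 0"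
      using x1 by simp
    have 2: "(snd (snd (wave_z g1 g2 p \<alpha> B x)) $ i, 0) =
        dirderiv (\<alpha>, 0) g2 x *\<^sub>R (B $ i, 0) - dirderiv (B $ i, 0) g2 x *\<^sub>R (\<alpha>, 0::real)" for x
      by (simp add: wave_z_def)
    show "(\<integral>x. G x \<bullet> (snd (snd (wave_z g1 g2 p \<alpha> B x)) $ i, 0) \<partial>lborel) = 0"
      unfolding 2 inner_scaleR_right inner_diff_right using x2 by simp
  qed
qed

definition bump :: "'a::euclidean_space \<Rightarrow> real \<Rightarrow> 'a \<Rightarrow> real" where
  "bump a s x = bump_tower 0 (s - (norm (x - a))\<^sup>2)"

lemma smooth_expr_bump: "smooth_expr (bump a s)"
  unfolding bump_def[abs_def]
  by (rule smooth_expr.compose[OF derivative_tower_bump])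
    (intro smooth_expr_diff smooth_expr.const smooth_expr_norm_sq)

lemma bump_outside: "x \<notin> cball a r \<Longrightarrow> r \<ge> 0 \<Longrightarrow> bump a (r\<^sup>2) x = 0"
  unfolding bump_def by (rule bump_tower_nonpos) (simp add: dist_norm norm_minus_commute power_mono)

lemma bump_pos: "(norm (x - a))\<^sup>2 < s \<Longrightarrow> bump a s x > 0"
  unfolding bump_def by (subst bump_tower_0) simp_all

lemma bump_le_1: "bump a s x \<le> 1" "bump a s x \<ge> 0"
  unfolding bump_def using bump_tower_0 bump_tower_nonpos
  by (metis exp_le_one_iff less_eq_real_def linorder_not_less neg_le_0_iff_le zero_le_one zero_less_divide_1_iff)
    (metis exp_ge_zero bump_tower_0 bump_tower_nonpos linorder_not_less order_refl)

definition cos_tower :: "nat \<Rightarrow> real \<Rightarrow> real" where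
  "cos_tower n x = cos (x + n * pi / 2)"

lemma derivative_tower_cos_tower: "derivative_tower cos_tower"
  using derivative_tower_cos by (simp add: cos_tower_def[abs_def])

text \<open>The potentials are \<open>\<epsilon>\<^sup>2 \<zeta> k\<^sub>j\<close> and \<open>\<epsilon> \<zeta> k\<^bsub>j+1\<^esub>\<close>, with a cutoff \<open>\<zeta>\<close> and \<open>k\<^sub>j\<close> the cosine of \<open>\<alpha> \<bullet> x / \<epsilon>\<close> shifted by \<open>j\<close> quarter periods.
If all derivatives, two for the first and one for the second, fall on the oscillating factor, the powers of \<open>\<epsilon>\<close> cancel and both components
of the state have the profile \<open>\<zeta> k\<^bsub>j+2\<^esub>\<close>; derivatives of \<open>\<zeta>\<close> leave a factor \<open>\<epsilon>\<close>. The profile keeps a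
definite amount \<open>\<kappa>\<close> of energy however fast it oscillates.\<close>

lemma plane_wave:
  fixes p :: "real^'m" and \<alpha> :: "real^'n" and B :: "real^'n^'m"
  assumes \<alpha>: "norm \<alpha> = 1" and B: "\<And>i. B $ i \<bullet> \<alpha> = 0"
  shows "\<exists>\<kappa>>0. \<forall>\<epsilon>>0. \<exists>u z y f. pert (ball 0 1) u z y \<and> continuous_on UNIV f \<and>
    (\<forall>x. \<bar>f x\<bar> \<le> 1) \<and> (\<forall>x. x \<notin> ball 0 1 \<longrightarrow> f x = 0) \<and>
    (\<forall>x. norm (z x - f x *\<^sub>R (tensor p \<alpha>, 0, B)) \<le> \<epsilon>) \<and>
    \<kappa> \<le> (\<integral>x. (f x)\<^sup>2 \<partial>lborel)"
proof -
  define \<zeta> where "\<zeta> = bump (0 :: (real^'n) \<times> real) ((1/2)\<^sup>2)"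
  let ?K = "cball (0 :: (real^'n) \<times> real) (1/2)"
  have \<zeta>: "smooth_expr \<zeta>" unfolding \<zeta>_def by (rule smooth_expr_bump)
  note sm = smooth_expr_dirderiv and df = smooth_expr_differentiable
  have \<zeta>0: "\<zeta> x = 0" if "x \<notin> ?K" for x unfolding \<zeta>_def using that by (intro bump_outside) auto
  have \<zeta>1: "0 \<le> \<zeta> x" "\<zeta> x \<le> 1" for x unfolding \<zeta>_def by (rule bump_le_1)+
  have d0: "dirderiv e \<zeta> x = 0" if "x \<notin> ?K" for x e
    using derivative_compact_support[OF smooth_expr_has_derivative[OF \<zeta>] closed_cball \<zeta>0 that]
    by (simp add: fun_eq_iff)
  have dd0: "dirderiv e (dirderiv e' \<zeta>) x = 0" if "x \<notin> ?K" for x e e'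
    using derivative_compact_support[OF smooth_expr_has_derivative[OF sm[OF \<zeta>, of e']] closed_cball d0 that]
    by (simp add: fun_eq_iff)
  let ?a = "(\<alpha>, 0) :: (real^'n) \<times> real"
  have aa: "?a \<bullet> ?a = 1" using \<alpha> by (simp add: norm_eq_1)
  define X1 :: "(real^'n) \<times> real \<Rightarrow> ('n, 'm) state" where
    "X1 x = (tensor p (\<chi> k. dirderiv (axis k 1, 0) (dirderiv ?a \<zeta>) x),
        dirderiv (0, 1) (dirderiv ?a \<zeta>) x *\<^sub>R p, 0)" for x
  define X2 :: "(real^'n) \<times> real \<Rightarrow> ('n, 'm) state" where
    "X2 x = (dirderiv ?a \<zeta> x *\<^sub>R tensor p \<alpha> + tensor p (\<chi> k. dirderiv (axis k 1, 0) \<zeta> x),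
        dirderiv (0, 1) \<zeta> x *\<^sub>R p,
        \<chi> i. dirderiv ?a \<zeta> x *\<^sub>R B $ i - dirderiv (B $ i, 0) \<zeta> x *\<^sub>R \<alpha>)" for x
  have lam0: "(\<chi> k. 0) = 0" by (simp add: vec_eq_iff)
  have t0: "tensor p 0 = 0" by (simp add: tensor_def vec_eq_iff)
  have cX: "continuous_on UNIV X1" "continuous_on UNIV X2"
    unfolding X1_def[abs_def] X2_def[abs_def]
    by (intro continuous_on_Pair continuous_on_tensor continuous_on_scaleR continuous_on_vec_lambda
        continuous_on_add continuous_on_diff continuous_on_const smooth_expr_continuous sm \<zeta>,
        simp add: smooth_expr_continuous sm \<zeta>)+
  have X0: "X1 x = 0" "X2 x = 0" if "x \<notin> ?K" for x
    using that by (simp_all add: X1_def X2_def d0 dd0 lam0 t0 zero_prod_def)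
  obtain C1 where C1: "C1 > 0" "\<And>x. norm (X1 x) \<le> C1"
    using bounded_compact_support[OF cX(1) compact_cball X0(1)] by metis
  obtain C2 where C2: "C2 > 0" "\<And>x. norm (X2 x) \<le> C2"
    using bounded_compact_support[OF cX(2) compact_cball X0(2)] by metis
  have \<zeta>2c: "continuous_on UNIV (\<lambda>x. (\<zeta> x)\<^sup>2)" by (intro continuous_on_power smooth_expr_continuous \<zeta>)
  have \<zeta>2i: "integrable lborel (\<lambda>x. (\<zeta> x)\<^sup>2)"
    by (rule integrable_compact_support[OF \<zeta>2c compact_cball[of 0 "1/2"]]) (use \<zeta>0 in simp)
  have \<zeta>2p: "(\<integral>x. (\<zeta> x)\<^sup>2 \<partial>lborel) > 0"
  proof (rule integral_pos_continuous[OF \<zeta>2c \<zeta>2i, of 0])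
    have "\<zeta> 0 > 0" unfolding \<zeta>_def by (rule bump_pos) simp
    then show "0 < (\<zeta> 0)\<^sup>2" by simp
  qed simp
  show ?thesis
  proof (intro exI[of _ "(\<integral>x. (\<zeta> x)\<^sup>2 \<partial>lborel) / 2"] conjI allI impI)
    show "(\<integral>x. (\<zeta> x)\<^sup>2 \<partial>lborel) / 2 > 0" using \<zeta>2p by simp
    fix \<epsilon> :: real assume \<epsilon>: "\<epsilon> > 0"
    define \<epsilon>' where "\<epsilon>' = min 1 (\<epsilon> / (C1 + C2))"
    have "\<epsilon>' * (C1 + C2) \<le> \<epsilon> / (C1 + C2) * (C1 + C2)"
      using C1(1) C2(1) by (intro mult_right_mono) (auto simp: \<epsilon>'_def)
    then have \<epsilon>': "\<epsilon>' > 0" "\<epsilon>' \<le> 1" "\<epsilon>' * (C1 + C2) \<le> \<epsilon>"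
      using \<epsilon> C1(1) C2(1) by (simp_all add: \<epsilon>'_def)
    define k where "k n x = cos_tower n (x \<bullet> ((1 / \<epsilon>') *\<^sub>R ?a))" for n x
    have k: "smooth_expr (k n)" for n
      unfolding k_def[abs_def]
      by (rule smooth_expr_compose_nth[OF derivative_tower_cos_tower smooth_expr.inner])
    have dk: "dirderiv e (k n) = (\<lambda>x. k (Suc n) x * ((e \<bullet> ?a) / \<epsilon>'))" for e n
      unfolding k_def[abs_def]
      by (subst dirderiv_compose[OF derivative_tower_cos_tower df[OF smooth_expr.inner]],
          simp only: dirderiv_inner, simp del: inner_Pair scaleR_Pair)
    have k1: "\<bar>k n x\<bar> \<le> 1" for n x by (simp add: k_def cos_tower_def)
    define f where "f j x = \<zeta> x * k (Suc (Suc j)) x" for j x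
    have f: "smooth_expr (f j)" for j unfolding f_def[abs_def] by (intro smooth_expr.mult \<zeta> k)
    have f0: "f j x = 0" if "x \<notin> ?K" for j x using \<zeta>0[OF that] by (simp add: f_def)
    have f2i: "integrable lborel (\<lambda>x. (f j x)\<^sup>2)" for j
      by (rule integrable_compact_support[OF _ compact_cball[of 0 "1/2"]])
        (use f0 in \<open>simp_all add: continuous_on_power smooth_expr_continuous f\<close>)
    \<comment> \<open>two phases a quarter period apart share the energy of the cutoff, so one of them has at least half of it\<close>
    have "(f 0 x)\<^sup>2 + (f 1 x)\<^sup>2 = (\<zeta> x)\<^sup>2" for x
    proof -
      have t: "cos (3 * pi / 2) = 0" "sin (3 * pi / 2) = - 1"
        using cos_3over2_pi sin_3over2_pi by (simp_all add: field_simps)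
      have *: "k 3 x = sin (x \<bullet> ((1 / \<epsilon>') *\<^sub>R ?a))" "k 2 x = - cos (x \<bullet> ((1 / \<epsilon>') *\<^sub>R ?a))"
        by (simp_all add: k_def cos_tower_def cos_add t del: inner_Pair inner_scaleR_right scaleR_Pair)
      have "(f 0 x)\<^sup>2 + (f 1 x)\<^sup>2 = (\<zeta> x)\<^sup>2 * ((k 2 x)\<^sup>2 + (k 3 x)\<^sup>2)"
        by (simp add: f_def power_mult_distrib distrib_left numeral_2_eq_2 numeral_3_eq_3)
      then show ?thesis unfolding * by simp
    qed
    then have fsum: "(\<integral>x. (f 0 x)\<^sup>2 \<partial>lborel) + (\<integral>x. (f 1 x)\<^sup>2 \<partial>lborel) = (\<integral>x. (\<zeta> x)\<^sup>2 \<partial>lborel)"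
      using f2i by (simp add: Bochner_Integration.integral_add[symmetric])
    obtain j where j: "(\<integral>x. (\<zeta> x)\<^sup>2 \<partial>lborel) / 2 \<le> (\<integral>x. (f j x)\<^sup>2 \<partial>lborel)"
    proof (cases "(\<integral>x. (\<zeta> x)\<^sup>2 \<partial>lborel) / 2 \<le> (\<integral>x. (f 0 x)\<^sup>2 \<partial>lborel)")
      case False
      then have "(\<integral>x. (\<zeta> x)\<^sup>2 \<partial>lborel) / 2 \<le> (\<integral>x. (f 1 x)\<^sup>2 \<partial>lborel)"
        using fsum by linarith
      then show ?thesis by (rule that)
    qed (rule that)
    define g1 where "g1 x = \<epsilon>'\<^sup>2 * (\<zeta> x * k j x)" for x
    define g2 where "g2 x = \<epsilon>' * (\<zeta> x * k (Suc j) x)" for x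
    have g1: "smooth_expr g1" unfolding g1_def[abs_def] by (intro smooth_expr_scale smooth_expr.mult \<zeta> k)
    have g2: "smooth_expr g2" unfolding g2_def[abs_def] by (intro smooth_expr_scale smooth_expr.mult \<zeta> k)
    have p: "pert (ball 0 1) (wave_u g1 p \<alpha>) (wave_z g1 g2 p \<alpha> B) (wave_y g1 p \<alpha>)"
      by (rule wave_pert[OF g1 g2, where K = "cball 0 (1/2)"]) (use \<zeta>0 in \<open>auto simp: g1_def g2_def\<close>)
    note dm = dirderiv_mult[OF df df] and da = dirderiv_add[OF df df]
    have dc: "dirderiv e (\<lambda>x. c * F x) = (\<lambda>x. c * dirderiv e F x)" if "smooth_expr F" for e c F
      using dm[OF smooth_expr.const that] by simp
    have d1: "dirderiv ?a g1 = (\<lambda>x. \<epsilon>'\<^sup>2 * (dirderiv ?a \<zeta> x * k j x) + \<epsilon>' * (\<zeta> x * k (Suc j) x))"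
      unfolding g1_def[abs_def] dc[OF smooth_expr.mult[OF \<zeta> k]] dm[OF \<zeta> k] dk aa
      using \<epsilon>' by (simp add: fun_eq_iff distrib_left power2_eq_square)
    have d2: "dirderiv e (dirderiv ?a g1) x = \<epsilon>'\<^sup>2 * (dirderiv e (dirderiv ?a \<zeta>) x * k j x) +
        \<epsilon>' * (dirderiv ?a \<zeta> x * (e \<bullet> ?a) * k (Suc j) x + dirderiv e \<zeta> x * k (Suc j) x) + f j x * (e \<bullet> ?a)" for e x
      unfolding d1
      apply (subst da)
        apply (intro smooth_expr_scale smooth_expr.mult \<zeta> k sm)
       apply (intro smooth_expr_scale smooth_expr.mult \<zeta> k)
      apply (simp only: dc[OF smooth_expr.mult[OF \<zeta> k]] dc[OF smooth_expr.mult[OF sm[OF \<zeta>] k]] dm[OF \<zeta> k]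
          dm[OF sm[OF \<zeta>] k] dk)
      using \<epsilon>'(1) by (simp add: f_def field_simps power2_eq_square del: inner_Pair)
    have d3: "dirderiv e g2 x = \<epsilon>' * (dirderiv e \<zeta> x * k (Suc j) x) + f j x * (e \<bullet> ?a)" for e x
      unfolding g2_def[abs_def] dc[OF smooth_expr.mult[OF \<zeta> k]] dm[OF \<zeta> k] dk
      using \<epsilon>' by (simp add: f_def distrib_left)
    have err: "wave_z g1 g2 p \<alpha> B x - f j x *\<^sub>R (tensor p \<alpha>, 0, B) =
        \<epsilon>' *\<^sub>R ((\<epsilon>' * k j x) *\<^sub>R X1 x + k (Suc j) x *\<^sub>R X2 x)" for x
      unfolding wave_z_def X1_def X2_def d2 d3 aa
      using B by (simp add: vec_eq_iff tensor_def inner_axis' inner_axis algebra_simps power2_eq_square)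
    show "\<exists>u z y f. pert (ball 0 1) u z y \<and> continuous_on UNIV f \<and>
      (\<forall>x. \<bar>f x\<bar> \<le> 1) \<and> (\<forall>x. x \<notin> ball 0 1 \<longrightarrow> f x = 0) \<and>
      (\<forall>x. norm (z x - f x *\<^sub>R (tensor p \<alpha>, 0, B)) \<le> \<epsilon>) \<and>
      (\<integral>x. (\<zeta> x)\<^sup>2 \<partial>lborel) / 2 \<le> (\<integral>x. (f x)\<^sup>2 \<partial>lborel)"
    proof (intro exI[of _ "wave_u g1 p \<alpha>"] exI[of _ "wave_z g1 g2 p \<alpha> B"] exI[of _ "wave_y g1 p \<alpha>"]
        exI[of _ "f j"] conjI allI impI p j smooth_expr_continuous f)
      fix x
      show "\<bar>f j x\<bar> \<le> 1"
        using mult_mono[OF \<zeta>1(2)[of x] k1[of "Suc (Suc j)" x]] \<zeta>1(1)[of x] by (simp add: f_def abs_mult)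
      show "f j x = 0" if "x \<notin> ball 0 1" using that by (intro f0) auto
      have "norm ((\<epsilon>' * k j x) *\<^sub>R X1 x + k (Suc j) x *\<^sub>R X2 x) \<le> 1 * C1 + 1 * C2"
      proof (rule norm_triangle_le, rule add_mono)
        have "\<bar>\<epsilon>' * k j x\<bar> \<le> 1 * 1" unfolding abs_mult using \<epsilon>' k1 by (intro mult_mono) auto
        then show "norm ((\<epsilon>' * k j x) *\<^sub>R X1 x) \<le> 1 * C1"
          unfolding norm_scaleR by (intro mult_mono C1) auto
        show "norm (k (Suc j) x *\<^sub>R X2 x) \<le> 1 * C2"
          unfolding norm_scaleR by (intro mult_mono C2 k1) auto
      qed
      then have "\<epsilon>' * norm ((\<epsilon>' * k j x) *\<^sub>R X1 x + k (Suc j) x *\<^sub>R X2 x) \<le> \<epsilon>' * (1 * C1 + 1 * C2)"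
        by (rule mult_left_mono) (use \<epsilon>' in simp)
      then show "norm (wave_z g1 g2 p \<alpha> B x - f j x *\<^sub>R (tensor p \<alpha>, 0, B)) \<le> \<epsilon>"
        unfolding err norm_scaleR abs_of_pos[OF \<epsilon>'(1)] using \<epsilon>'(3) by simp
    qed
  qed
qed

section \<open>A minimum principle on tau configurations\<close>

lemma lsc_attains_min:
  fixes G :: "'a::topological_space \<Rightarrow> real"
  assumes "compact C" "C \<noteq> {}" "\<And>t. open {y. t < G y}"
  obtains x where "x \<in> C" "\<And>y. y \<in> C \<Longrightarrow> G x \<le> G y"
proof -
  have "\<exists>x\<in>C. \<forall>y\<in>C. G x \<le> G y"
  proof (rule ccontr)
  assume "\<not> ?thesis"
  then have *: "\<exists>y\<in>C. G y < G x" if "x \<in> C" for x using that by (meson linorder_not_le)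
  have "C \<subseteq> (\<Union>x\<in>C. {y. G x < G y})" using * by blast
  then obtain D where D: "D \<subseteq> C" "finite D" "C \<subseteq> (\<Union>x\<in>D. {y. G x < G y})"
    using compactE_image[OF assms(1), of C "\<lambda>x. {y. G x < G y}"] assms(3) by metis
  have "D \<noteq> {}" using D(3) assms(2) by auto
  then obtain x where x: "x \<in> D" "\<And>y. y \<in> D \<Longrightarrow> G x \<le> G y"
    using D(2) by (metis (no_types, lifting) arg_min_if_finite(1) arg_min_least)
  then obtain y where "y \<in> D" "G y < G x" using D by blast
  then show False using x(2) by force
  qed
  then show ?thesis using that by blast
qed

lemma open_gain_superlevel:
  fixes S :: "('n::finite, 'm::finite) state set"
  assumes S: "open S" "bounded S"
  shows "open {y. t < max_gain S y + (norm (y - \<eta>))\<^sup>2 / 2}"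
  unfolding open_dist
proof (intro ballI, drule CollectD)
  fix y assume y: "t < max_gain S y + (norm (y - \<eta>))\<^sup>2 / 2"
  define d where "d = (max_gain S y + (norm (y - \<eta>))\<^sup>2 / 2 - t) / 2"
  have d: "d > 0" using y by (simp add: d_def)
  obtain e1 where e1: "e1 > 0" "\<And>y'. dist y' y < e1 \<Longrightarrow> max_gain S y - d < max_gain S y'"
    using max_gain_lsc[OF S, of "max_gain S y - d" y] d by auto
  have "continuous_on UNIV (\<lambda>y. (norm (y - \<eta>))\<^sup>2 / 2)" by (intro continuous_intros) auto
  then obtain e2 where e2: "e2 > 0"
    "\<And>y'. dist y' y < e2 \<Longrightarrow> dist ((norm (y' - \<eta>))\<^sup>2 / 2) ((norm (y - \<eta>))\<^sup>2 / 2) < d"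
    unfolding continuous_on_iff using d by (meson UNIV_I)
  have "t < max_gain S y' + (norm (y' - \<eta>))\<^sup>2 / 2" if "dist y' y < min e1 e2" for y'
  proof -
    have "max_gain S y - d < max_gain S y'" using e1(2) that by simp
    moreover have "\<bar>(norm (y' - \<eta>))\<^sup>2 / 2 - (norm (y - \<eta>))\<^sup>2 / 2\<bar> < d"
      using e2(2)[of y'] that unfolding dist_real_def by simp
    moreover have "2 * d = max_gain S y + (norm (y - \<eta>))\<^sup>2 / 2 - t" by (simp add: d_def)
    ultimately show ?thesis by linarith
  qed
  then show "\<exists>e>0. \<forall>y'. dist y' y < e \<longrightarrow> y' \<in> {y. t < max_gain S y + (norm (y - \<eta>))\<^sup>2 / 2}"
    using e1(1) e2(1) by (intro exI[of _ "min e1 e2"]) auto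
qed

text \<open>Let \<open>z\<close> be the state of a plane wave around \<open>\<xi>\<close>. Near-optimal perturbations of the states \<open>\<xi> + z(x)\<close>, packed into the ball, have energy density close
to at least \<open>m - \<bar>\<xi> + z - \<eta>\<bar>\<^sup>2 / 2\<close>. As \<open>z\<close> has mean zero, the integral of \<open>\<bar>\<xi> + z - \<eta>\<bar>\<^sup>2 / 2\<close> exceeds that of \<open>\<bar>\<xi> - \<eta>\<bar>\<^sup>2 / 2\<close> by
half the energy of \<open>z\<close>, whereas the wave itself contributes its full energy to the gain at \<open>\<xi>\<close>. The
other half is the strict surplus.\<close>

lemma strict_gain_along_wave:
  fixes S :: "('n::finite, 'm::finite) state set"
  assumes S: "open S" "bounded S"
    and \<alpha>: "norm \<alpha> = 1" and B: "\<And>i. B $ i \<bullet> \<alpha> = 0"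
    and \<Gamma>: "\<Gamma> = (tensor p \<alpha>, 0, B)" "\<Gamma> \<noteq> 0"
    and seg: "\<And>s. \<bar>s\<bar> \<le> 1 \<Longrightarrow> \<xi> + s *\<^sub>R \<Gamma> \<in> S"
      "\<And>s. \<bar>s\<bar> \<le> 1 \<Longrightarrow> m \<le> max_gain S (\<xi> + s *\<^sub>R \<Gamma>) + (norm (\<xi> + s *\<^sub>R \<Gamma> - \<eta>))\<^sup>2 / 2"
  shows "m < max_gain S \<xi> + (norm (\<xi> - \<eta>))\<^sup>2 / 2"
proof -
  let ?U = "ball (0 :: (real^'n) \<times> real) 1"
  define vol where "vol = measure lborel ?U"
  have vol: "vol > 0" unfolding vol_def by (rule unit_ball_content_pos)
  have finU: "emeasure lborel ?U < \<infinity>" by (rule emeasure_bounded_finite[OF bounded_ball])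
  obtain \<kappa> where \<kappa>: "\<kappa> > 0" and wave: "\<And>\<epsilon>. \<epsilon> > 0 \<Longrightarrow> \<exists>u z y f. pert ?U u z y \<and> continuous_on UNIV f \<and>
    (\<forall>x. \<bar>f x\<bar> \<le> 1) \<and> (\<forall>x. x \<notin> ?U \<longrightarrow> f x = 0) \<and>
    (\<forall>x. norm (z x - f x *\<^sub>R \<Gamma>) \<le> \<epsilon>) \<and> \<kappa> \<le> (\<integral>x. (f x)\<^sup>2 \<partial>lborel)"
    using plane_wave[OF \<alpha> B, of p] unfolding \<Gamma>(1) by blast
  define \<rho> where "\<rho> = (norm \<Gamma>)\<^sup>2"
  have \<rho>: "\<rho> > 0" using \<Gamma>(2) by (simp add: \<rho>_def)
  \<comment> \<open>half the energy of the wave will be at least \<open>\<kappa> \<rho> / 8\<close>; the errors add up to \<open>(vol + 3) \<delta>\<close>, half of that\<close>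
  define \<delta> where "\<delta> = \<kappa> * \<rho> / (16 * (vol + 3))"
  have \<delta>: "\<delta> > 0" using \<kappa> \<rho> vol by (simp add: \<delta>_def)
  have "a / (16 * D) * D = a / 16" if "D > 0" for a D :: real using that by simp
  from this[of "vol + 3"] have \<delta>v: "\<delta> * (vol + 3) = \<kappa> * \<rho> / 16" using vol by (simp only: \<delta>_def)
  let ?L = "(\<lambda>s. \<xi> + s *\<^sub>R \<Gamma>) ` {-1..1}"
  let ?O = "{y. m - \<delta> < max_gain S y + (norm (y - \<eta>))\<^sup>2 / 2} \<inter> S"
  have "compact ?L" by (intro compact_continuous_image continuous_intros compact_Icc)
  moreover have "open ?O" using open_gain_superlevel[OF S] S(1) by blast
  moreover have "?L \<subseteq> ?O"
  proof (rule image_subsetI)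
    fix s :: real assume "s \<in> {-1..1}"
    then have s: "\<bar>s\<bar> \<le> 1" by auto
    show "\<xi> + s *\<^sub>R \<Gamma> \<in> ?O" using seg(1)[OF s] seg(2)[OF s] \<delta> by simp
  qed
  ultimately obtain e where e: "e > 0" "(\<Union>y\<in>?L. cball y e) \<subseteq> ?O"
    by (rule compact_subset_open_imp_cball_epsilon_subset)
  define \<epsilon> where "\<epsilon> = min e (sqrt (\<kappa> * \<rho> / (4 * vol)))"
  have \<epsilon>: "\<epsilon> > 0" using e \<kappa> \<rho> vol by (simp add: \<epsilon>_def)
  have "\<epsilon>\<^sup>2 \<le> (sqrt (\<kappa> * \<rho> / (4 * vol)))\<^sup>2" using \<epsilon> by (intro power_mono) (auto simp: \<epsilon>_def)
  then have "\<epsilon>\<^sup>2 \<le> \<kappa> * \<rho> / (4 * vol)" using \<kappa> \<rho> vol by simp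
  then have \<epsilon>v: "\<epsilon>\<^sup>2 * vol \<le> \<kappa> * \<rho> / 4" using vol by (simp add: field_simps)
  obtain u z y f where p: "pert ?U u z y" and f: "continuous_on UNIV f" "\<And>x. \<bar>f x\<bar> \<le> 1"
    "\<And>x. x \<notin> ?U \<Longrightarrow> f x = 0" "\<And>x. norm (z x - f x *\<^sub>R \<Gamma>) \<le> \<epsilon>" "\<kappa> \<le> (\<integral>x. (f x)\<^sup>2 \<partial>lborel)"
    using wave[OF \<epsilon>] by blast
  have zO: "\<xi> + z x \<in> ?O" for x
  proof -
    have "\<xi> + f x *\<^sub>R \<Gamma> \<in> ?L" using f(2)[of x] by (auto simp: abs_le_iff)
    moreover have "\<xi> + z x \<in> cball (\<xi> + f x *\<^sub>R \<Gamma>) e"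
      using f(4)[of x] by (simp add: dist_norm norm_minus_commute \<epsilon>_def)
    ultimately show ?thesis using e(2) by blast
  qed
  define c where "c x = m - \<delta> - (norm (\<xi> + z x - \<eta>))\<^sup>2 / 2" for x
  \<comment> \<open>the field of states visited by the wave is filled without the flux correction, orthogonally to the wave\<close>
  have cZ: "continuous_on UNIV (\<lambda>x. \<xi> + z x)"
    by (intro continuous_on_add continuous_on_const pert_continuous[OF p])
  have cc: "continuous_on UNIV c"
    unfolding c_def[abs_def] by (intro continuous_intros cZ) auto
  have g: "\<forall>x\<in>?U. \<xi> + z x \<in> S \<and> c x < max_gain S (\<xi> + z x)"
  proof
    show "\<xi> + z x \<in> S \<and> c x < max_gain S (\<xi> + z x)" for x
      using zO[of x] by (simp add: c_def)
  qed
  have Fc: "finite {z}" "\<forall>Y\<in>{z}. continuous_on UNIV Y"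
    using pert_continuous[OF p] by simp_all
  have l: "\<bar>0::real\<bar> \<le> 1" by simp
  obtain u1 z1 y1 where p1: "pert ?U u1 z1 y1"
    and st1: "\<forall>x\<in>?U. \<xi> + z x + shifted 0 z1 y1 x \<in> S"
    and en1: "(LINT x:?U|lborel. c x) - \<delta> \<le> (\<integral>x. (norm (shifted 0 z1 y1 x))\<^sup>2 \<partial>lborel)"
    and or1: "\<forall>Y\<in>{z}. \<bar>\<integral>x. Y x \<bullet> shifted 0 z1 y1 x \<partial>lborel\<bar> \<le> \<delta>"
    using fill[where W="ball 0 1", OF S open_ball bounded_ball cZ cc Fc \<delta> l g]
    by (elim exE conjE)
  have sh: "shifted 0 z1 y1 = z1" by (simp add: shifted_def fun_eq_iff zero_prod_def[symmetric])
  note st1 = st1[unfolded sh] and en1 = en1[unfolded sh] and or1 = or1[unfolded sh]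
  have \<xi>S: "\<xi> \<in> S" using seg(1)[of 0] by simp
  have pp: "pert ?U (\<lambda>x. u x + u1 x) (\<lambda>x. z x + z1 x) (\<lambda>x. y x + y1 x)"
    using pert_add[OF p p1] by simp
  have "\<xi> + (z x + z1 x) \<in> S" for x
  proof (cases "x \<in> ?U")
    case True
    then show ?thesis using bspec[OF st1 True] by (simp add: add.assoc)
  next
    case False
    then show ?thesis using pert_outside(2)[OF p False] pert_outside(2)[OF p1 False] \<xi>S by simp
  qed
  from max_gain_ge[OF S(2) \<xi>S pp this]
  have 1: "(\<integral>x. (norm (z x + z1 x))\<^sup>2 \<partial>lborel) \<le> max_gain S \<xi> * vol" by (simp add: vol_def)
  have i1: "integrable lborel (\<lambda>x. (norm (z x))\<^sup>2)" "integrable lborel (\<lambda>x. (norm (z1 x))\<^sup>2)"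
    "integrable lborel (\<lambda>x. z x \<bullet> z1 x)"
    using pert_energy_integrable(2)[OF p] pert_energy_integrable(2)[OF p1]
      shifted_integrable(2)[OF p1 pert_continuous(2)[OF p], of 0] by (simp_all add: sh)
  have "(norm (z x + z1 x))\<^sup>2 = (norm (z x))\<^sup>2 + (norm (z1 x))\<^sup>2 + 2 * (z x \<bullet> z1 x)" for x
    by (simp add: power2_norm_eq_inner inner_add inner_commute)
  then have "(\<integral>x. (norm (z x + z1 x))\<^sup>2 \<partial>lborel) =
      (\<integral>x. (norm (z x))\<^sup>2 \<partial>lborel) + (\<integral>x. (norm (z1 x))\<^sup>2 \<partial>lborel) + 2 * (\<integral>x. z x \<bullet> z1 x \<partial>lborel)"
    using i1 by simp
  moreover have "\<bar>\<integral>x. z x \<bullet> z1 x \<partial>lborel\<bar> \<le> \<delta>" using or1 by simp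
  ultimately have 2: "(\<integral>x. (norm (z x))\<^sup>2 \<partial>lborel) + (LINT x:?U|lborel. c x) - 3 * \<delta> \<le> max_gain S \<xi> * vol"
    using 1 en1 by linarith
  define b where "b = \<xi> - \<eta>"
  have bz: "(LINT x:?U|lborel. c x) =
      (m - \<delta> - (norm b)\<^sup>2 / 2) * vol - (\<integral>x. (norm (z x))\<^sup>2 \<partial>lborel) / 2"
  proof -
    have "indicator ?U x *\<^sub>R c x = indicator ?U x * (m - \<delta> - (norm b)\<^sup>2 / 2) - (norm (z x))\<^sup>2 / 2 - b \<bullet> z x" for x
    proof (cases "x \<in> ?U")
      case True
      have "(norm (\<xi> + z x - \<eta>))\<^sup>2 = (norm (b + z x))\<^sup>2" by (simp add: b_def algebra_simps)
      also have "\<dots> = (norm b)\<^sup>2 + (norm (z x))\<^sup>2 + 2 * (b \<bullet> z x)"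
        by (simp add: power2_norm_eq_inner inner_add inner_commute)
      finally show ?thesis using True by (simp add: c_def add_divide_distrib)
    qed (use pert_outside(2)[OF p] in simp)
    moreover have "integrable lborel (\<lambda>x. indicator ?U x * (m - \<delta> - (norm b)\<^sup>2 / 2) :: real)"
      using finU by (intro integrable_mult_left integrable_real_indicator) auto
    moreover have "(\<integral>x. b \<bullet> z x \<partial>lborel) = 0" "integrable lborel (\<lambda>x. b \<bullet> z x)"
      using pert_integrable(1)[OF p] pert_integral_zero(1)[OF p] by simp_all
    ultimately show ?thesis
      unfolding set_lebesgue_integral_def using i1(1) by (simp add: vol_def)
  qed
  have "\<kappa> * \<rho> \<le> (\<integral>x. (f x)\<^sup>2 * \<rho> \<partial>lborel)" using f(5) \<rho> by simp
  also have "\<dots> \<le> (\<integral>x. 2 * (norm (z x))\<^sup>2 + indicator ?U x * (2 * \<epsilon>\<^sup>2) \<partial>lborel)"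
  proof (rule integral_mono_AE)
    have "integrable lborel (\<lambda>x. (f x)\<^sup>2)"
      using f by (intro integrable_compact_support[of _ "cball 0 1"] continuous_on_power) auto
    then show "integrable lborel (\<lambda>x. (f x)\<^sup>2 * \<rho>)" by simp
    show "integrable lborel (\<lambda>x. 2 * (norm (z x))\<^sup>2 + indicator ?U x * (2 * \<epsilon>\<^sup>2))"
      using finU by (intro Bochner_Integration.integrable_add integrable_mult_right i1
          integrable_mult_left integrable_real_indicator) auto
    show "AE x in lborel. (f x)\<^sup>2 * \<rho> \<le> 2 * (norm (z x))\<^sup>2 + indicator ?U x * (2 * \<epsilon>\<^sup>2)"
    proof (rule AE_I2)
      fix x
      show "(f x)\<^sup>2 * \<rho> \<le> 2 * (norm (z x))\<^sup>2 + indicator ?U x * (2 * \<epsilon>\<^sup>2)"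
      proof (cases "x \<in> ?U")
        case True
        define w where "w = z x - f x *\<^sub>R \<Gamma>"
        have w: "norm w \<le> \<epsilon>" unfolding w_def by (rule f(4))
        have "(f x)\<^sup>2 * \<rho> = (norm (f x *\<^sub>R \<Gamma>))\<^sup>2" by (simp add: \<rho>_def power_mult_distrib)
        also have "f x *\<^sub>R \<Gamma> = z x - w" by (simp add: w_def)
        also have "(norm (z x - w))\<^sup>2 \<le> (norm (z x) + norm w)\<^sup>2"
          by (intro power_mono norm_triangle_ineq4) simp
        also have "\<dots> \<le> 2 * (norm (z x))\<^sup>2 + 2 * (norm w)\<^sup>2"
          using sum_squares_bound[of "norm (z x)" "norm w"] by (simp add: power2_sum)
        also have "(norm w)\<^sup>2 \<le> \<epsilon>\<^sup>2" using w by (intro power_mono) auto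
        finally show ?thesis using True by simp
      qed (use f(3) in simp)
    qed
  qed
  also have "\<dots> = 2 * (\<integral>x. (norm (z x))\<^sup>2 \<partial>lborel) + vol * (2 * \<epsilon>\<^sup>2)"
    using finU i1 by (subst Bochner_Integration.integral_add)
      (auto intro!: integrable_mult_left integrable_real_indicator simp: vol_def)
  finally have 3: "(\<integral>x. (norm (z x))\<^sup>2 \<partial>lborel) \<ge> \<kappa> * \<rho> / 4" using \<epsilon>v by (simp add: algebra_simps)
  have "m * vol < (max_gain S \<xi> + (norm b)\<^sup>2 / 2) * vol"
  proof -
    have "\<kappa> * \<rho> > 0" using \<kappa> \<rho> by simp
    moreover have "\<delta> * vol + 3 * \<delta> = \<kappa> * \<rho> / 16" using \<delta>v by (simp add: algebra_simps)
    ultimately show ?thesis using 2 3 unfolding bz left_diff_distrib distrib_right by linarith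
  qed
  then show ?thesis using vol by (simp add: b_def mult_less_cancel_right)
qed

definition with_velocity :: "real^'m \<Rightarrow> (real^'n^'m) \<times> (real^'n^'m) \<Rightarrow> ('n, 'm) state" where
  "with_velocity q \<xi> = (fst \<xi>, q, snd \<xi>)"

lemma norm_with_velocity_diff: "norm (with_velocity q \<xi> - with_velocity q \<eta>) = dist \<xi> \<eta>"
  by (simp add: with_velocity_def norm_Pair dist_prod_def dist_norm)

lemma with_velocity_add: "with_velocity q (\<xi> + t *\<^sub>R \<gamma>) = with_velocity q \<xi> + t *\<^sub>R with_velocity 0 \<gamma>"
  by (simp add: with_velocity_def)

text \<open>The bound on the velocity makes the set of states bounded, which yields Lipschitz bounds in time. As the waves have small
velocity, no energy gain is lost.\<close>

definition bounded_velocity_states where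
  "bounded_velocity_states S R = {z. (fst z, snd (snd z)) \<in> S \<and> norm (fst (snd z)) < R}"

lemma open_bounded_velocity_states:
  "open S \<Longrightarrow> open (bounded_velocity_states S R :: ('n::finite, 'm::finite) state set)"
  unfolding bounded_velocity_states_def
  by (intro open_Collect_conj open_Collect_less continuous_intros,
      simp only: vimage_def[symmetric, of "\<lambda>z. (fst z, snd (snd z))" S])
    (intro open_vimage continuous_intros)

lemma bounded_bounded_velocity_states:
  assumes "bounded S"
  shows "bounded (bounded_velocity_states S R :: ('n::finite, 'm::finite) state set)"
proof -
  obtain M where M: "\<And>\<xi>. \<xi> \<in> S \<Longrightarrow> norm \<xi> \<le> M" using assms bounded_iff by blast
  show ?thesis
    unfolding bounded_iff
  proof (intro exI[of _ "M + (R + M)"] ballI)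
    fix z :: "('n, 'm) state" assume "z \<in> bounded_velocity_states S R"
    then have z: "(fst z, snd (snd z)) \<in> S" "norm (fst (snd z)) < R"
      by (simp_all add: bounded_velocity_states_def)
    have "norm z \<le> norm (fst z) + norm (snd z)" using norm_Pair_le[of "fst z" "snd z"] by simp
    also have "norm (snd z) \<le> norm (fst (snd z)) + norm (snd (snd z))"
      using norm_Pair_le[of "fst (snd z)" "snd (snd z)"] by simp
    finally show "norm z \<le> M + (R + M)"
      using M[OF z(1)] z(2) norm_fst_le[of "fst z" "snd (snd z)"] norm_snd_le[of "snd (snd z)" "fst z"] by linarith
  qed
qed

text \<open>Minimum principle: \<open>G\<close> below attains its minimum over the closed polygon of a tau configuration. By the preceding lemma this happens
at an endpoint \<open>\<xi>\<^sub>j\<close>, where the term \<open>\<bar>\<xi>\<^sub>j - \<eta>\<bar>\<^sup>2 / 2\<close> alone gives the bound. The velocity \<open>q\<close> is the same along the polygon.\<close>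

lemma max_gain_ge_dist:
  fixes \<xi> :: "nat \<Rightarrow> (real^'n^'m) \<times> (real^'n^'m)"
  assumes S: "open S" "bounded S" and N: "N \<ge> 2"
    and tau: "tau_configuration N \<xi> \<rho> \<gamma>" and sub: "tau_set N \<xi> \<rho> \<gamma> \<subseteq> S"
    and \<eta>: "\<eta> \<in> tau_set N \<xi> \<rho> \<gamma>" and q: "norm q < R"
    and D: "\<And>j. j \<in> {1..N} \<Longrightarrow> D \<le> dist \<eta> (\<xi> j)" "D \<ge> 0"
  shows "D\<^sup>2 / 2 \<le> max_gain (bounded_velocity_states S R) (with_velocity q \<eta>)"
proof -
  let ?S = "bounded_velocity_states S R :: ('n, 'm) state set"
  have SS: "open ?S" "bounded ?S"
    by (rule open_bounded_velocity_states[OF S(1)], rule bounded_bounded_velocity_states[OF S(2)])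
  have mem: "with_velocity q x \<in> ?S" if "x \<in> S" for x
    using that q by (simp add: with_velocity_def bounded_velocity_states_def)
  from tau obtain \<kappa> :: "nat \<Rightarrow> real" and p :: "nat \<Rightarrow> real^'m" and \<alpha> :: "nat \<Rightarrow> real^'n"
    and s :: "nat \<Rightarrow> real" and \<beta> :: "nat \<Rightarrow> 'm \<Rightarrow> real^'n" where
    conf: "\<And>j. j \<in> {1..N} \<Longrightarrow> \<kappa> j > 1 \<and> \<xi> j = rho_at \<rho> \<gamma> j + \<kappa> j *\<^sub>R \<gamma> j \<and>
           \<gamma> j = (tensor (p j) (\<alpha> j), \<chi> i. s j *\<^sub>R \<beta> j i) \<and>
           \<alpha> j \<noteq> 0 \<and> (\<forall>i. \<beta> j i \<bullet> \<alpha> j = 0)"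
    and sums: "\<forall>i. (\<Sum>j\<in>{1..N}. s j *\<^sub>R \<beta> j i) = 0" "(\<Sum>j\<in>{1..N}. tensor (p j) (\<alpha> j)) = 0"
    unfolding tau_configuration_def by blast
  have "(\<Sum>j\<in>{1..N}. \<gamma> j) = (\<Sum>j\<in>{1..N}. (tensor (p j) (\<alpha> j), \<chi> i. s j *\<^sub>R \<beta> j i))"
    by (rule sum.cong) (use conf in auto)
  also have "\<dots> = 0"
    using sums by (simp add: prod_eq_iff fst_sum snd_sum vec_eq_iff)
  finally have sum\<gamma>: "(\<Sum>j\<in>{1..N}. \<gamma> j) = 0" .
  have rhoN: "rho_at \<rho> \<gamma> 1 = rho_at \<rho> \<gamma> N + \<gamma> N"
  proof -
    have "{1..N} = insert N {1..<N}" using N by auto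
    then have "(\<Sum>l\<in>{1..<N}. \<gamma> l) + \<gamma> N = 0" using sum\<gamma> by (simp add: add.commute)
    then show ?thesis by (simp add: rho_at_def add.assoc)
  qed
  have rhoS: "rho_at \<rho> \<gamma> (Suc j) = rho_at \<rho> \<gamma> j + \<gamma> j" if "j \<ge> 1" for j
    using that by (simp add: rho_at_def add.assoc atLeastLessThanSuc)
  have tauI: "rho_at \<rho> \<gamma> j + t *\<^sub>R \<gamma> j \<in> tau_set N \<xi> \<rho> \<gamma>" if j: "j \<in> {1..N}" and t: "0 < t" "t < \<kappa> j" for j t
  proof -
    have k: "\<kappa> j > 0" using conf[OF j] by simp
    have "rho_at \<rho> \<gamma> j + t *\<^sub>R \<gamma> j = (1 - (1 - t / \<kappa> j)) *\<^sub>R \<xi> j + (1 - t / \<kappa> j) *\<^sub>R rho_at \<rho> \<gamma> j"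
      using k by (subst conf[OF j, THEN conjunct2, THEN conjunct1]) (simp add: algebra_simps)
    moreover have "0 < 1 - t / \<kappa> j" "1 - t / \<kappa> j < 1" using t k by simp_all
    ultimately show ?thesis unfolding tau_set_def using j by blast
  qed
  define C where "C = (\<Union>j\<in>{1..N}. (\<lambda>t. with_velocity q (rho_at \<rho> \<gamma> j + t *\<^sub>R \<gamma> j)) ` {0..\<kappa> j})"
  define G where "G x = max_gain ?S x + (norm (x - with_velocity q \<eta>))\<^sup>2 / 2" for x
  have Ccpt: "compact C"
    unfolding C_def with_velocity_add
    by (intro compact_UN finite_atLeastAtMost compact_continuous_image continuous_intros compact_Icc)
  obtain j0 c0 where jc: "j0 \<in> {1..N}" "0 < c0" "c0 < 1" "\<eta> = (1 - c0) *\<^sub>R \<xi> j0 + c0 *\<^sub>R rho_at \<rho> \<gamma> j0"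
    using \<eta> unfolding tau_set_def by blast
  have \<eta>C: "with_velocity q \<eta> \<in> C"
  proof -
    have k: "\<kappa> j0 > 0" using conf[OF jc(1)] by simp
    have "\<eta> = rho_at \<rho> \<gamma> j0 + ((1 - c0) * \<kappa> j0) *\<^sub>R \<gamma> j0"
      unfolding jc(4) by (subst conf[OF jc(1), THEN conjunct2, THEN conjunct1]) (simp add: algebra_simps)
    moreover have "(1 - c0) * \<kappa> j0 \<in> {0..\<kappa> j0}" using k jc(2,3) by (simp add: mult_left_le_one_le)
    ultimately show ?thesis unfolding C_def using jc(1) by blast
  qed
  obtain x0 where x0: "x0 \<in> C" "\<And>y. y \<in> C \<Longrightarrow> G x0 \<le> G y"
    by (rule lsc_attains_min[OF Ccpt, of G]) (use \<eta>C open_gain_superlevel[OF SS] in \<open>auto simp: G_def\<close>)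
  have end_pt: "D\<^sup>2 / 2 \<le> G x0" if "x0 = with_velocity q (\<xi> j)" "j \<in> {1..N}" for j
  proof -
    have "D\<^sup>2 \<le> (dist (\<xi> j) \<eta>)\<^sup>2" using D(1)[OF that(2)] D(2) by (intro power_mono) (simp_all add: dist_commute)
    then show ?thesis
      using max_gain_nonneg[OF SS(2), of x0] by (simp add: G_def that(1) norm_with_velocity_diff)
  qed
  \<comment> \<open>in fact contradictory unless \<open>\<gamma>\<^sub>j = 0\<close>, in which case the segment consists of \<open>\<xi>\<^sub>j\<close>\<close>
  have interior: "D\<^sup>2 / 2 \<le> G x0"
    if x0': "x0 = with_velocity q (rho_at \<rho> \<gamma> j + t *\<^sub>R \<gamma> j)" and j: "j \<in> {1..N}" and t: "0 < t" "t < \<kappa> j" for j t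
  proof (cases "\<gamma> j = 0")
    case True
    then have "x0 = with_velocity q (\<xi> j)" using conf[OF j] x0' by simp
    then show ?thesis by (rule end_pt[OF _ j])
  next
    case False
    define r where "r = min t (\<kappa> j - t) / 2"
    have r: "r > 0" using t by (simp add: r_def)
    have tr: "0 < t + s * r" "t + s * r < \<kappa> j" if "\<bar>s\<bar> \<le> 1" for s
    proof -
      have "\<bar>s * r\<bar> \<le> 1 * r" unfolding abs_mult using r that by (intro mult_mono) auto
      then show "0 < t + s * r" "t + s * r < \<kappa> j" using t r unfolding r_def by (auto simp: abs_le_iff)
    qed
    let ?a = "inverse (norm (\<alpha> j)) *\<^sub>R \<alpha> j"
    let ?\<Gamma> = "r *\<^sub>R with_velocity 0 (\<gamma> j)"
    have \<alpha>0: "norm (\<alpha> j) > 0" using conf[OF j] by simp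
    have pt: "x0 + s *\<^sub>R ?\<Gamma> = with_velocity q (rho_at \<rho> \<gamma> j + (t + s * r) *\<^sub>R \<gamma> j)" for s
      unfolding x0' with_velocity_add by (simp add: scaleR_add_left)
    have "G x0 < max_gain ?S x0 + (norm (x0 - with_velocity q \<eta>))\<^sup>2 / 2"
    proof (rule strict_gain_along_wave[OF SS, where \<alpha>="?a" and p="(r * norm (\<alpha> j)) *\<^sub>R p j"
          and B="r *\<^sub>R (\<chi> i. s j *\<^sub>R \<beta> j i)" and \<Gamma>="?\<Gamma>"])
      show "norm ?a = 1" using \<alpha>0 by simp
      show "(r *\<^sub>R (\<chi> i. s j *\<^sub>R \<beta> j i)) $ i \<bullet> ?a = 0" for i using conf[OF j] by simp
      show "?\<Gamma> = (tensor ((r * norm (\<alpha> j)) *\<^sub>R p j) ?a, 0, r *\<^sub>R (\<chi> i. s j *\<^sub>R \<beta> j i))"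
        using conf[OF j] \<alpha>0 by (simp add: with_velocity_def tensor_def vec_eq_iff)
      show "?\<Gamma> \<noteq> 0" using False r by (auto simp: with_velocity_def prod_eq_iff)
      show "x0 + s *\<^sub>R ?\<Gamma> \<in> ?S" if "\<bar>s\<bar> \<le> 1" for s
        unfolding pt using mem sub tauI[OF j tr[OF that]] by blast
      show "G x0 \<le> max_gain ?S (x0 + s *\<^sub>R ?\<Gamma>) + (norm (x0 + s *\<^sub>R ?\<Gamma> - with_velocity q \<eta>))\<^sup>2 / 2"
        if "\<bar>s\<bar> \<le> 1" for s
      proof -
        have "x0 + s *\<^sub>R ?\<Gamma> \<in> C" unfolding pt C_def using j tr[OF that] by force
        from x0(2)[OF this] show ?thesis by (simp add: G_def)
      qed
    qed
    then show ?thesis by (simp add: G_def)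
  qed
  obtain j t where jt: "j \<in> {1..N}" "0 \<le> t" "t \<le> \<kappa> j" "x0 = with_velocity q (rho_at \<rho> \<gamma> j + t *\<^sub>R \<gamma> j)"
    using x0(1) unfolding C_def by auto
  have "D\<^sup>2 / 2 \<le> G x0"
  proof -
    consider "t = \<kappa> j" | "0 < t" "t < \<kappa> j" | "t = 0" using jt(2,3) by linarith
    then show ?thesis
    proof cases
      case 1
      then show ?thesis using end_pt[of j] jt conf[OF jt(1)] by simp
    next
      case 2
      then show ?thesis using interior[OF jt(4,1)] by simp
    next
      case 3
      \<comment> \<open>the vertex \<open>\<rho>\<^sub>j\<close> is the point with parameter \<open>1 < \<kappa>\<^sub>i\<close> on the preceding segment\<close>
      define i where "i = (if j = 1 then N else j - 1)"
      have i: "i \<in> {1..N}" using jt(1) N by (auto simp: i_def)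
      have "rho_at \<rho> \<gamma> j = rho_at \<rho> \<gamma> i + \<gamma> i"
        using rhoN rhoS[of "j - 1"] jt(1) by (auto simp: i_def)
      then have "x0 = with_velocity q (rho_at \<rho> \<gamma> i + 1 *\<^sub>R \<gamma> i)" using jt(4) 3 by simp
      from interior[OF this i] conf[OF i] show ?thesis by simp
    qed
  qed
  also have "G x0 \<le> G (with_velocity q \<eta>)" by (rule x0(2)[OF \<eta>C])
  finally show ?thesis by (simp add: G_def)
qed

section \<open>Convex integration\<close>

text \<open>Along a subsequence the increments have squared norms below \<open>4\<^sup>-\<^sup>j\<close>. By \<open>2 d \<le> 2\<^sup>-\<^sup>j + 2\<^sup>j d\<^sup>2\<close>
they are summable in \<open>L\<^sup>1\<close> over the bounded set \<open>U\<close>, hence almost everywhere.\<close>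

lemma L2_Cauchy_AE_convergent_subseq:
  fixes f :: "nat \<Rightarrow> 'a::euclidean_space \<Rightarrow> 'b::euclidean_space"
  assumes [measurable]: "\<And>n. f n \<in> borel_measurable lborel"
    and U: "open U" "bounded U" "\<And>n x. x \<notin> U \<Longrightarrow> f n x = 0"
    and int: "\<And>m n. integrable lborel (\<lambda>x. (norm (f m x - f n x))\<^sup>2)"
    and Cauchy: "\<And>\<epsilon>. \<epsilon> > 0 \<Longrightarrow> \<exists>M. \<forall>m\<ge>M. \<forall>n\<ge>M. (\<integral>x. (norm (f m x - f n x))\<^sup>2 \<partial>lborel) < \<epsilon>"
  shows "\<exists>r g. strict_mono (r :: nat \<Rightarrow> nat) \<and> g \<in> borel_measurable lborel \<and>
    (AE x in lborel. (\<lambda>j. f (r j) x) \<longlonglongrightarrow> g x)"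
proof -
  define P where "P j M \<longleftrightarrow> (\<forall>m\<ge>M. \<forall>n\<ge>M. (\<integral>x. (norm (f m x - f n x))\<^sup>2 \<partial>lborel) < (1/4) ^ j)" for j M :: nat
  have "\<exists>r. \<forall>j. P j (r j) \<and> r j < r (Suc j)"
  proof (rule dependent_nat_choice)
    show "\<exists>M. P 0 M" using Cauchy[of "(1/4)^0"] by (simp add: P_def)
    fix M :: nat and j
    obtain M' where "P (Suc j) M'" using Cauchy[of "(1/4)^Suc j"] by (auto simp: P_def)
    then have "P (Suc j) (max M' (Suc M))" by (simp add: P_def)
    then show "\<exists>y. P (Suc j) y \<and> M < y" by (intro exI[of _ "max M' (Suc M)"]) auto
  qed
  then obtain r where r: "\<And>j. P j (r j)" "\<And>j. r j < r (Suc j)" by blast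
  have rm: "strict_mono r" by (simp add: r(2) strict_mono_Suc_iff)
  define \<Delta> where "\<Delta> j x = f (r (Suc j)) x - f (r j) x" for j x
  have [measurable]: "\<Delta> j \<in> borel_measurable lborel" for j unfolding \<Delta>_def by measurable
  have \<Delta>2: "(\<integral>x. (norm (\<Delta> j x))\<^sup>2 \<partial>lborel) \<le> (1/4) ^ j" for j
    using r(1)[of j] r(2)[of j] unfolding P_def \<Delta>_def by (meson less_imp_le order_refl)
  define V where "V = measure lborel U"
  have Vf: "emeasure lborel U < \<infinity>" by (rule emeasure_bounded_finite[OF U(2)])
  define maj where "maj j x = (indicator U x * (1/2) ^ j + 2 ^ j * (norm (\<Delta> j x))\<^sup>2) / 2" for j x
  have imaj: "integrable lborel (maj j)" for j
    unfolding maj_def \<Delta>_def using Vf U(1)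
    by (intro integrable_divide Bochner_Integration.integrable_add integrable_mult_left integrable_mult_right int
        integrable_real_indicator) auto
  have le: "norm (\<Delta> j x) \<le> maj j x" for j x
  proof (cases "x \<in> U")
    case True
    have "2 * (((1/2)^j) * (2^j * norm (\<Delta> j x))) \<le> ((1/2)^j)\<^sup>2 + (2^j * norm (\<Delta> j x))\<^sup>2"
      using sum_squares_bound[of "(1/2)^j" "2^j * norm (\<Delta> j x)"] by simp
    have e: "(1/2::real)^j * 2^j = 1" by (simp add: power_mult_distrib[symmetric])
    have "0 \<le> (1/2)^j * (1 - 2^j * norm (\<Delta> j x))\<^sup>2" by simp
    also have "\<dots> = (1/2)^j + ((1/2)^j * 2^j) * (2^j * (norm (\<Delta> j x))\<^sup>2) - 2 * (((1/2)^j * 2^j) * norm (\<Delta> j x))"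
      by (simp add: power2_diff power_mult_distrib power2_eq_square algebra_simps)
    finally show ?thesis using True unfolding e by (simp add: maj_def)
  qed (simp add: maj_def \<Delta>_def U(3))
  have "(\<integral>x. maj j x \<partial>lborel) \<le> (V + 1) * (1/2) ^ j" for j
  proof -
    have "(\<integral>x. maj j x \<partial>lborel) = (V * (1/2)^j + 2^j * (\<integral>x. (norm (\<Delta> j x))\<^sup>2 \<partial>lborel)) / 2"
      unfolding maj_def using int[of "r (Suc j)" "r j"] U(1) Vf
      by (simp add: V_def \<Delta>_def Bochner_Integration.integral_add integrable_real_indicator)
    also have "\<dots> \<le> (V * (1/2)^j + 2^j * (1/4)^j) / 2" using \<Delta>2[of j] by simp
    also have "2^j * (1/4)^j = (1/2::real)^j" by (simp add: power_mult_distrib[symmetric])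
    also have "(V * (1/2)^j + (1/2)^j) / 2 \<le> (V + 1) * (1/2) ^ j"
      by (simp add: algebra_simps V_def)
    finally show ?thesis .
  qed
  then have nn: "(\<integral>\<^sup>+x. ennreal (norm (\<Delta> j x)) \<partial>lborel) \<le> ennreal ((V + 1) * (1/2) ^ j)" for j
  proof -
    have "(\<integral>\<^sup>+x. ennreal (norm (\<Delta> j x)) \<partial>lborel) \<le> (\<integral>\<^sup>+x. ennreal (maj j x) \<partial>lborel)"
      by (intro nn_integral_mono ennreal_leI le)
    also have "\<dots> = ennreal (\<integral>x. maj j x \<partial>lborel)"
      by (rule nn_integral_eq_integral[OF imaj]) (auto intro: order_trans[OF norm_ge_zero le])
    also have "\<dots> \<le> ennreal ((V + 1) * (1/2) ^ j)" by (intro ennreal_leI) fact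
    finally show ?thesis .
  qed
  have "(\<integral>\<^sup>+x. (\<Sum>j. ennreal (norm (\<Delta> j x))) \<partial>lborel) = (\<Sum>j. \<integral>\<^sup>+x. ennreal (norm (\<Delta> j x)) \<partial>lborel)"
    by (rule nn_integral_suminf) measurable
  also have "\<dots> \<le> (\<Sum>j. ennreal ((V + 1) * (1/2) ^ j))" by (intro suminf_le nn) auto
  also have "\<dots> = ennreal (\<Sum>j. (V + 1) * (1/2) ^ j)"
    by (rule suminf_ennreal2) (auto simp: V_def intro!: summable_mult summable_geometric)
  also have "\<dots> < \<infinity>" by simp
  finally have "AE x in lborel. (\<Sum>j. ennreal (norm (\<Delta> j x))) \<noteq> \<infinity>"
    by (intro nn_integral_noteq_infinite) auto
  then have "AE x in lborel. (\<lambda>j. f (r j) x) \<longlonglongrightarrow> lim (\<lambda>j. f (r j) x)"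
  proof eventually_elim
    case (elim x)
    then have "summable (\<lambda>j. norm (\<Delta> j x))"
      by (intro summable_suminf_not_top) auto
    then have "summable (\<lambda>j. \<Delta> j x)" by (rule summable_norm_cancel)
    then have "(\<lambda>n. \<Sum>j<n. \<Delta> j x) \<longlonglongrightarrow> (\<Sum>j. \<Delta> j x)" by (rule summable_LIMSEQ)
    moreover have "(\<Sum>j<n. \<Delta> j x) = f (r n) x - f (r 0) x" for n
      unfolding \<Delta>_def by (rule sum_lessThan_telescope)
    ultimately have "(\<lambda>n. (f (r n) x - f (r 0) x) + f (r 0) x) \<longlonglongrightarrow> (\<Sum>j. \<Delta> j x) + f (r 0) x"
      by (intro tendsto_add tendsto_const) simp
    then have "convergent (\<lambda>j. f (r j) x)" by (auto simp: convergent_def)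
    then show ?case by (simp add: convergent_LIMSEQ_iff)
  qed
  moreover have "(\<lambda>x. lim (\<lambda>j. f (r j) x)) \<in> borel_measurable lborel"
    by (intro borel_measurable_lim_metric assms(1))
  ultimately show ?thesis using rm by (intro exI[of _ r] exI[of _ "\<lambda>x. lim (\<lambda>j. f (r j) x)"] conjI)
qed

text \<open>Here the flux component of \<open>z\<close> is the full flux, with \<open>w\<^sub>t = div V\<close>.\<close>

definition subsolution_pert ::
  "((real^'n) \<times> real) set \<Rightarrow> ((real^'n) \<times> real \<Rightarrow> real^'m) \<Rightarrow> ((real^'n) \<times> real \<Rightarrow> ('n, 'm) state) \<Rightarrow> bool" where
  "subsolution_pert W w z \<longleftrightarrow>
     (\<exists>K. compact K \<and> K \<subseteq> W \<and> (\<forall>x. x \<notin> K \<longrightarrow> w x = 0 \<and> z x = 0)) \<and>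
     continuous_on UNIV z \<and>
     (\<forall>x. (w has_derivative state_deriv (z x)) (at x)) \<and>
     (\<forall>\<phi> G i. C1_gradient \<phi> G \<longrightarrow> (\<integral>x. G x \<bullet> (- (snd (snd (z x)) $ i), w x $ i) \<partial>lborel) = 0)"

lemma subsolution_pertD:
  assumes "subsolution_pert W w z"
  shows "\<exists>K. compact K \<and> K \<subseteq> W \<and> (\<forall>x. x \<notin> K \<longrightarrow> w x = 0 \<and> z x = 0)"
    "continuous_on UNIV z" "(w has_derivative state_deriv (z x)) (at x)" "continuous_on UNIV w"
    "C1_gradient \<phi> G \<Longrightarrow> (\<integral>x. G x \<bullet> (- (snd (snd (z x)) $ i), w x $ i) \<partial>lborel) = 0"
proof -
  show 1: "(w has_derivative state_deriv (z x)) (at x)" for x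
    using assms unfolding subsolution_pert_def by blast
  then show "continuous_on UNIV w"
    by (meson continuous_at_imp_continuous_on has_derivative_continuous)
qed (use assms in \<open>unfold subsolution_pert_def, blast+\<close>)

lemma subsolution_pert_outside:
  assumes "subsolution_pert W w z" "x \<notin> W"
  shows "w x = 0" "z x = 0"
  using subsolution_pertD(1)[OF assms(1)] assms(2) by blast+

lemma integrable_gradient_pairing:
  fixes w :: "(real^'n) \<times> real \<Rightarrow> real^'m" and V :: "(real^'n) \<times> real \<Rightarrow> real^'n^'m"
  assumes "continuous_on UNIV w" "continuous_on UNIV V" "continuous_on UNIV G" "compact K"
    "\<And>x. x \<notin> K \<Longrightarrow> w x = 0 \<and> V x = 0"
  shows "integrable lborel (\<lambda>x. G x \<bullet> (- (V x $ i), w x $ i))"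
proof -
  have 0: "(0, 0) = (0 :: (real^'n) \<times> real)" by (simp add: zero_prod_def)
  note vn = bounded_linear.continuous_on[OF bounded_linear_vec_nth]
  show ?thesis
    by (rule integrable_compact_support[OF _ assms(4)],
        intro continuous_on_inner assms continuous_on_Pair continuous_on_minus vn)
      (simp add: assms(5) 0)
qed

lemma subsolution_pert_integrable_pairing:
  assumes "subsolution_pert W w z" "continuous_on UNIV G"
  shows "integrable lborel (\<lambda>x. G x \<bullet> (- (snd (snd (z x)) $ i), w x $ i))"
proof -
  obtain K where K: "compact K" "\<forall>x. x \<notin> K \<longrightarrow> w x = 0 \<and> z x = 0"
    using subsolution_pertD(1)[OF assms(1)] by blast
  show ?thesis
    by (rule integrable_gradient_pairing[OF _ _ assms(2) K(1)], intro subsolution_pertD(4)[OF assms(1)],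
        intro continuous_on_snd subsolution_pertD(2)[OF assms(1)]) (simp add: K(2))
qed

lemma pert_imp_subsolution_pert:
  assumes p: "pert W u z y"
  shows "subsolution_pert W u (shifted 1 z y)"
  unfolding subsolution_pert_def
proof (intro conjI allI impI)
  have 0: "(0, 0, 0) = (0 :: ('a,'b) state)" by (simp add: zero_prod_def)
  show "\<exists>K. compact K \<and> K \<subseteq> W \<and> (\<forall>x. x \<notin> K \<longrightarrow> u x = 0 \<and> shifted 1 z y x = 0)"
    using pert_support[OF p] by (auto simp: shifted_def 0)
  show "continuous_on UNIV (shifted 1 z y)"
    unfolding shifted_def[abs_def]
    by (intro continuous_on_add continuous_on_scaleR continuous_on_Pair continuous_on_const pert_continuous[OF p])
  have "state_deriv (shifted 1 z y x) = state_deriv (z x)" for x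
    by (simp add: shifted_def state_deriv_def fun_eq_iff)
  then show "(u has_derivative state_deriv (shifted 1 z y x)) (at x)" for x
    using pert_has_derivative[OF p] by simp
  fix \<phi> :: "(real^'a) \<times> real \<Rightarrow> real" and G i
  assume G: "C1_gradient \<phi> G"
  have "G x \<bullet> (- (snd (snd (shifted 1 z y x)) $ i), u x $ i) =
      G x \<bullet> (- (y x $ i), u x $ i) - G x \<bullet> (snd (snd (z x)) $ i, 0)" for x
    by (subst inner_diff_right[symmetric]) (simp add: shifted_def algebra_simps)
  then show "(\<integral>x. G x \<bullet> (- (snd (snd (shifted 1 z y x)) $ i), u x $ i) \<partial>lborel) = 0"
    using pert_integrable_pairing[OF p G, of i] p G by (simp add: pert_def)
qed

lemma subsolution_pert_add:
  assumes p: "subsolution_pert W w z" and p': "subsolution_pert W w' z'"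
  shows "subsolution_pert W (\<lambda>x. w x + w' x) (\<lambda>x. z x + z' x)"
  unfolding subsolution_pert_def
proof (intro conjI allI impI)
  obtain K K' where K: "compact K" "K \<subseteq> W" "\<forall>x. x \<notin> K \<longrightarrow> w x = 0 \<and> z x = 0"
    "compact K'" "K' \<subseteq> W" "\<forall>x. x \<notin> K' \<longrightarrow> w' x = 0 \<and> z' x = 0"
    using subsolution_pertD(1)[OF p] subsolution_pertD(1)[OF p'] by blast
  show "\<exists>K. compact K \<and> K \<subseteq> W \<and> (\<forall>x. x \<notin> K \<longrightarrow> w x + w' x = 0 \<and> z x + z' x = 0)"
    by (rule exI[of _ "K \<union> K'"]) (use K in auto)
  show "continuous_on UNIV (\<lambda>x. z x + z' x)"
    by (intro continuous_on_add subsolution_pertD(2)[OF p] subsolution_pertD(2)[OF p'])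
  fix x
  have "((\<lambda>x. w x + w' x) has_derivative (\<lambda>h. state_deriv (z x) h + state_deriv (z' x) h)) (at x)"
    by (intro has_derivative_add subsolution_pertD(3)[OF p] subsolution_pertD(3)[OF p'])
  then show "((\<lambda>x. w x + w' x) has_derivative state_deriv (z x + z' x)) (at x)"
    by (simp add: state_deriv_add[abs_def])
next
  fix \<phi> :: "(real^'a) \<times> real \<Rightarrow> real" and G i
  assume G: "C1_gradient \<phi> G"
  then have cG: "continuous_on UNIV G" by (simp add: C1_gradient_def)
  have "G x \<bullet> (- (snd (snd (z x + z' x)) $ i), (w x + w' x) $ i) =
      G x \<bullet> (- (snd (snd (z x)) $ i), w x $ i) + G x \<bullet> (- (snd (snd (z' x)) $ i), w' x $ i)" for x
    by (subst inner_add_right[symmetric]) simp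
  then show "(\<integral>x. G x \<bullet> (- (snd (snd (z x + z' x)) $ i), (w x + w' x) $ i) \<partial>lborel) = 0"
    using subsolution_pert_integrable_pairing[OF p cG, of i] subsolution_pert_integrable_pairing[OF p' cG, of i]
      subsolution_pertD(5)[OF p G, of i] subsolution_pertD(5)[OF p' G, of i] by simp
qed

definition flux_gradient :: "('n::finite, 'm::finite) state \<Rightarrow> (real^'n^'m) \<times> (real^'n^'m)" where
  "flux_gradient z = (fst z, snd (snd z))"

lemma with_velocity_flux_gradient: "with_velocity (fst (snd z)) (flux_gradient z) = z"
  by (simp add: with_velocity_def flux_gradient_def)

lemma continuous_on_flux_gradient:
  "continuous_on A f \<Longrightarrow> continuous_on A (\<lambda>x. flux_gradient (f x))"
  unfolding flux_gradient_def by (intro continuous_intros)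

lemma energy_step:
  fixes d h :: real
  assumes "I / 2 - d \<le> n" "b + n \<le> b'" "d \<le> h"
  shows "I \<le> 2 * (b' - b + h)"
  using assms by argo

text \<open>The differential inclusion \<open>(Du, V) \<in> K\<close>, where \<open>K\<close> stands for the graph of \<open>\<sigma>\<close> and \<open>S\<close> is covered by tau configurations
with vertices in \<open>K\<close>.\<close>

locale tau_inclusion =
  fixes S K :: "((real^'n::finite^'m::finite) \<times> (real^'n^'m)) set" and R :: real
    and U :: "((real^'n) \<times> real) set"
  assumes S: "open S" "bounded S" and K: "closed K"
    and U: "open U" "bounded U"
    and tau: "\<And>\<eta>. \<eta> \<in> S \<Longrightarrow> \<exists>N\<ge>2. \<exists>\<xi> \<rho> \<gamma>. tau_configuration N \<xi> \<rho> \<gamma> \<and> (\<forall>j\<in>{1..N}. \<xi> j \<in> K) \<and>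
        \<eta> \<in> tau_set N \<xi> \<rho> \<gamma> \<and> tau_set N \<xi> \<rho> \<gamma> \<subseteq> S"
begin

abbreviation states :: "('n, 'm) state set" where
  "states \<equiv> bounded_velocity_states S R"

lemma max_gain_ge_infdist:
  assumes "z \<in> states"
  shows "(infdist (flux_gradient z) K)\<^sup>2 / 2 \<le> max_gain states z"
proof -
  have z: "flux_gradient z \<in> S" "norm (fst (snd z)) < R"
    using assms by (simp_all add: bounded_velocity_states_def flux_gradient_def)
  obtain N \<xi> \<rho> \<gamma> where N: "N \<ge> (2::nat)" and t: "tau_configuration N \<xi> \<rho> \<gamma>" "\<forall>j\<in>{1..N}. \<xi> j \<in> K"
    "flux_gradient z \<in> tau_set N \<xi> \<rho> \<gamma>" "tau_set N \<xi> \<rho> \<gamma> \<subseteq> S"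
    using tau[OF z(1)] by blast
  have "(infdist (flux_gradient z) K)\<^sup>2 / 2 \<le> max_gain states (with_velocity (fst (snd z)) (flux_gradient z))"
    by (rule max_gain_ge_dist[OF S N t(1,4,3) z(2)]) (use t(2) in \<open>auto intro: infdist_le infdist_nonneg\<close>)
  then show ?thesis by (simp add: with_velocity_flux_gradient)
qed

text \<open>The gain at each state is at least half the squared distance to \<open>K\<close>, so this function, lowered slightly to make the
inequality strict, can be realised by filling \<open>U\<close>.\<close>

lemma improvement_step:
  assumes p: "subsolution_pert U w z" and st: "\<And>x. x \<in> U \<Longrightarrow> \<xi> + z x \<in> states"
    and F: "finite F" "\<forall>Y\<in>F. continuous_on UNIV Y" and \<delta>: "\<delta> > 0"
  shows "\<exists>w' z'. subsolution_pert U w' z' \<and> (\<forall>x\<in>U. \<xi> + z' x \<in> states) \<and>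
    (\<forall>x. norm (w' x - w x) \<le> \<delta>) \<and>
    (LINT x:U|lborel. (infdist (flux_gradient (\<xi> + z x)) K)\<^sup>2) / 2 - \<delta>
      \<le> (\<integral>x. (norm (z' x - z x))\<^sup>2 \<partial>lborel) \<and>
    (\<forall>Y\<in>F. \<bar>\<integral>x. Y x \<bullet> (z' x - z x) \<partial>lborel\<bar> \<le> \<delta>)"
proof -
  define V where "V = measure lborel U"
  have V: "V \<ge> 0" by (simp add: V_def)
  have Vf: "emeasure lborel U < \<infinity>" by (rule emeasure_bounded_finite[OF U(2)])
  define \<delta>1 where "\<delta>1 = \<delta> / (V + 1)"
  have \<delta>1: "\<delta>1 > 0" "\<delta>1 \<le> \<delta>" using \<delta> V by (simp_all add: \<delta>1_def divide_le_eq)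
  have "\<delta>1 * (V + 1) = \<delta>" using V by (simp add: \<delta>1_def)
  then have \<delta>1V: "\<delta>1 * V + \<delta>1 = \<delta>" by (simp add: algebra_simps)
  define d where "d x = (infdist (flux_gradient (\<xi> + z x)) K)\<^sup>2 / 2" for x
  have cz: "continuous_on UNIV (\<lambda>x. \<xi> + z x)"
    by (intro continuous_on_add continuous_on_const subsolution_pertD(2)[OF p])
  have cd: "continuous_on UNIV d"
    unfolding d_def[abs_def]
    by (intro continuous_on_divide continuous_on_power continuous_on_infdist continuous_on_flux_gradient cz
        continuous_on_const) simp
  have cc: "continuous_on UNIV (\<lambda>x. d x - \<delta>1)" by (intro continuous_on_diff cd continuous_on_const)
  have g: "\<forall>x\<in>U. \<xi> + z x \<in> states \<and> d x - \<delta>1 < max_gain states (\<xi> + z x)"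
  proof
    show "\<xi> + z x \<in> states \<and> d x - \<delta>1 < max_gain states (\<xi> + z x)" if "x \<in> U" for x
      using st[OF that] max_gain_ge_infdist[OF st[OF that]] \<delta>1 by (simp add: d_def)
  qed
  have l: "\<bar>1::real\<bar> \<le> 1" by simp
  obtain u z1 y1 where p1: "pert U u z1 y1" and st1: "\<forall>x\<in>U. \<xi> + z x + shifted 1 z1 y1 x \<in> states"
    and u1: "\<forall>x. norm (u x) \<le> \<delta>1"
    and en: "(LINT x:U|lborel. d x - \<delta>1) - \<delta>1 \<le> (\<integral>x. (norm (shifted 1 z1 y1 x))\<^sup>2 \<partial>lborel)"
    and ort: "\<forall>Y\<in>F. \<bar>\<integral>x. Y x \<bullet> shifted 1 z1 y1 x \<partial>lborel\<bar> \<le> \<delta>1"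
    using fill[OF open_bounded_velocity_states[OF S(1)] bounded_bounded_velocity_states[OF S(2)] U cz cc F \<delta>1(1) l g]
    by (elim exE conjE)
  have di: "set_integrable lborel U d"
  proof -
    have "set_integrable lborel (closure U) d"
      using U(2) by (intro set_integrable_continuous_compact cd) (simp add: compact_closure)
    then show ?thesis by (rule set_integrable_subset) (use U in \<open>auto simp: closure_subset\<close>)
  qed
  have "(LINT x:U|lborel. d x - \<delta>1) = (LINT x:U|lborel. d x) - \<delta>1 * V"
  proof (subst set_integral_diff(2)[OF di])
    show "set_integrable lborel U (\<lambda>x. \<delta>1)"
      unfolding set_integrable_def using U(1) Vf by (intro integrable_scaleR_left integrable_real_indicator) auto
    have "(LINT x:U|lborel. \<delta>1) = V * \<delta>1" using U(1) Vf by (subst set_integral_const) (auto simp: V_def)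
    then show "(LINT x:U|lborel. d x) - (LINT x:U|lborel. \<delta>1) = (LINT x:U|lborel. d x) - \<delta>1 * V" by simp
  qed
  moreover have "(LINT x:U|lborel. d x) = (LINT x:U|lborel. (infdist (flux_gradient (\<xi> + z x)) K)\<^sup>2) / 2"
    unfolding d_def set_lebesgue_integral_def by simp
  ultimately have en': "(LINT x:U|lborel. (infdist (flux_gradient (\<xi> + z x)) K)\<^sup>2) / 2 - \<delta>
      \<le> (\<integral>x. (norm (shifted 1 z1 y1 x))\<^sup>2 \<partial>lborel)"
    using en \<delta>1V by linarith
  show ?thesis
  proof (intro exI[of _ "\<lambda>x. w x + u x"] exI[of _ "\<lambda>x. z x + shifted 1 z1 y1 x"] conjI ballI allI)
    show "subsolution_pert U (\<lambda>x. w x + u x) (\<lambda>x. z x + shifted 1 z1 y1 x)"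
      by (rule subsolution_pert_add[OF p pert_imp_subsolution_pert[OF p1]])
    show "\<xi> + (z x + shifted 1 z1 y1 x) \<in> states" if "x \<in> U" for x
      using bspec[OF st1 that] by (simp add: add.assoc)
    show "norm (w x + u x - w x) \<le> \<delta>" for x using spec[OF u1, of x] \<delta>1(2) by simp
    show "(LINT x:U|lborel. (infdist (flux_gradient (\<xi> + z x)) K)\<^sup>2) / 2 - \<delta>
        \<le> (\<integral>x. (norm (z x + shifted 1 z1 y1 x - z x))\<^sup>2 \<partial>lborel)" using en' by simp
    show "\<bar>\<integral>x. Y x \<bullet> (z x + shifted 1 z1 y1 x - z x) \<partial>lborel\<bar> \<le> \<delta>" if "Y \<in> F" for Y
      using bspec[OF ort that] \<delta>1(2) by simp
  qed
qed

lemma subsolution_pert_bound: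
  obtains B where "B > 0" "\<forall>w z. subsolution_pert U w z \<longrightarrow> (\<forall>x\<in>U. \<xi> + z x \<in> states) \<longrightarrow> (\<forall>x. norm (z x) \<le> B)"
proof -
  obtain M where M: "M > 0" "\<And>v. v \<in> states \<Longrightarrow> norm v \<le> M"
    using bounded_bounded_velocity_states[OF S(2)] bounded_pos by metis
  have "norm (z x) \<le> M + norm \<xi>" if "subsolution_pert U w z" "\<forall>x\<in>U. \<xi> + z x \<in> states" for w z x
  proof (cases "x \<in> U")
    case True
    then show ?thesis using M(2)[OF bspec[OF that(2) True]] norm_triangle_ineq4[of "\<xi> + z x" \<xi>] by simp
  next
    case False
    then show ?thesis using subsolution_pert_outside(2)[OF that(1) False] M(1) by simp
  qed
  moreover have "M + norm \<xi> > 0" using M(1) by (simp add: add_pos_nonneg)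
  ultimately show ?thesis using that by blast
qed

text \<open>Iteration of the preceding step with errors \<open>\<delta> k\<close> that sum up to at most \<open>e\<close>. Each increment of the states is almost orthogonal to all earlier states, hence
energies are almost additive. They are bounded, so they converge; this gives a Cauchy sequence in \<open>L\<^sup>2\<close>,
and the increments, which dominate the distance to \<open>K\<close>, tend to zero.\<close>

theorem convex_integration:
  assumes p0: "subsolution_pert U w0 z0" and st0: "\<And>x. x \<in> U \<Longrightarrow> \<xi> + z0 x \<in> states" and e: "e > 0"
    and B: "\<forall>w z. subsolution_pert U w z \<longrightarrow> (\<forall>x\<in>U. \<xi> + z x \<in> states) \<longrightarrow> (\<forall>x. norm (z x) \<le> B)" "B \<ge> 0"
  shows "\<exists>w z wk zk. (\<forall>k. subsolution_pert U (wk k) (zk k)) \<and> (\<forall>k x. norm (zk k x) \<le> B) \<and>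
    (\<forall>k x. norm (wk k x - w0 x) \<le> e) \<and> uniform_limit UNIV wk w sequentially \<and>
    (\<forall>x. norm (w x - w0 x) \<le> e) \<and> z \<in> borel_measurable lborel \<and> (\<forall>x. norm (z x) \<le> B) \<and>
    (AE x in lborel. (\<lambda>k. zk k x) \<longlonglongrightarrow> z x) \<and>
    (AE x in lborel. x \<in> U \<longrightarrow> flux_gradient (\<xi> + z x) \<in> K)"
proof -
  define \<delta> where "\<delta> k = min e 1 * (1/2) ^ Suc k" for k
  have \<delta>: "\<delta> k > 0" "\<delta> k \<le> (1/2) ^ Suc k" for k
    using e mult_right_mono[of "min e 1" 1 "(1/2) ^ Suc k"] by (simp_all add: \<delta>_def)
  have \<delta>sum: "(\<Sum>k<n. \<delta> k) \<le> e" for n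
  proof -
    have "(\<Sum>k<n. \<delta> k) = min e 1 * (1 - (1/2) ^ n)"
      by (induction n) (simp_all add: \<delta>_def algebra_simps)
    also have "\<dots> \<le> min e 1 * 1" using e by (intro mult_left_mono) auto
    finally show ?thesis by simp
  qed
  \<comment> \<open>a stage consists of the function, its states, and the finite set of all states so far, to which later increments are made orthogonal\<close>
  define P where "P a \<longleftrightarrow> subsolution_pert U (fst a) (fst (snd a)) \<and> (\<forall>x\<in>U. \<xi> + fst (snd a) x \<in> states) \<and>
      finite (snd (snd a)) \<and> (\<forall>Y\<in>snd (snd a). continuous_on UNIV Y) \<and> fst (snd a) \<in> snd (snd a)"
    for a :: "((real^'n) \<times> real \<Rightarrow> real^'m) \<times> ((real^'n) \<times> real \<Rightarrow> ('n, 'm) state) \<times>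
        ((real^'n) \<times> real \<Rightarrow> ('n, 'm) state) set"
  define Q where "Q k a a' \<longleftrightarrow> snd (snd a') = insert (fst (snd a')) (snd (snd a)) \<and>
      (\<forall>x. norm (fst a' x - fst a x) \<le> \<delta> k) \<and>
      (LINT x:U|lborel. (infdist (flux_gradient (\<xi> + fst (snd a) x)) K)\<^sup>2) / 2 - \<delta> k
        \<le> (\<integral>x. (norm (fst (snd a') x - fst (snd a) x))\<^sup>2 \<partial>lborel) \<and>
      (\<forall>Y\<in>snd (snd a). \<bar>\<integral>x. Y x \<bullet> (fst (snd a') x - fst (snd a) x) \<partial>lborel\<bar> \<le> \<delta> k)"
    for k and a a' :: "((real^'n) \<times> real \<Rightarrow> real^'m) \<times> ((real^'n) \<times> real \<Rightarrow> ('n, 'm) state) \<times>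
        ((real^'n) \<times> real \<Rightarrow> ('n, 'm) state) set"
  have "\<exists>h. (\<forall>k. ((k = 0 \<longrightarrow> h k = (w0, z0, {z0})) \<and> P (h k)) \<and> Q k (h k) (h (Suc k)))"
  proof (rule dependent_nat_choice)
    show "\<exists>a. (0 = (0::nat) \<longrightarrow> a = (w0, z0, {z0})) \<and> P a"
      using p0 st0 subsolution_pertD(2)[OF p0] by (simp add: P_def)
    fix a and k :: nat assume a: "(k = 0 \<longrightarrow> a = (w0, z0, {z0})) \<and> P a"
    obtain w' z' where n: "subsolution_pert U w' z'" "\<forall>x\<in>U. \<xi> + z' x \<in> states"
      "\<forall>x. norm (w' x - fst a x) \<le> \<delta> k"
      "(LINT x:U|lborel. (infdist (flux_gradient (\<xi> + fst (snd a) x)) K)\<^sup>2) / 2 - \<delta> k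
        \<le> (\<integral>x. (norm (z' x - fst (snd a) x))\<^sup>2 \<partial>lborel)"
      "\<forall>Y\<in>snd (snd a). \<bar>\<integral>x. Y x \<bullet> (z' x - fst (snd a) x) \<partial>lborel\<bar> \<le> \<delta> k"
      using improvement_step[of "fst a" "fst (snd a)" \<xi> "snd (snd a)" "\<delta> k"] a \<delta>(1)[of k]
      unfolding P_def by blast
    show "\<exists>a'. ((Suc k = 0 \<longrightarrow> a' = (w0, z0, {z0})) \<and> P a') \<and> Q k a a'"
      by (rule exI[of _ "(w', z', insert z' (snd (snd a)))"])
        (use n a subsolution_pertD(2)[OF n(1)] in \<open>simp add: P_def Q_def\<close>)
  qed
  then obtain h where h0: "h 0 = (w0, z0, {z0})" and hP: "\<And>k. P (h k)" and hQ: "\<And>k. Q k (h k) (h (Suc k))"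
    by blast
  define w where "w k = fst (h k)" for k
  define z where "z k = fst (snd (h k))" for k
  have p: "subsolution_pert U (w k) (z k)" for k using hP[of k] by (simp add: P_def w_def z_def)
  have st: "\<And>x. x \<in> U \<Longrightarrow> \<xi> + z k x \<in> states" for k using hP[of k] by (simp add: P_def z_def)
  have wd: "norm (w (Suc k) x - w k x) \<le> \<delta> k" for k x using hQ[of k] by (simp add: Q_def w_def)
  have "z j \<in> snd (snd (h (j + i)))" for i j
  proof (induction i)
    case 0
    then show ?case using hP[of j] by (simp add: P_def z_def)
  next
    case (Suc i)
    then show ?case using hQ[of "j + i"] by (simp add: Q_def)
  qed
  then have zmem: "z j \<in> snd (snd (h k))" if "j \<le> k" for j k using that by (metis le_Suc_ex)
  have orth: "\<bar>\<integral>x. z j x \<bullet> (z (Suc k) x - z k x) \<partial>lborel\<bar> \<le> \<delta> k" if "j \<le> k" for j k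
    using hQ[of k] zmem[OF that] by (simp add: Q_def z_def)
  have gain: "(LINT x:U|lborel. (infdist (flux_gradient (\<xi> + z k x)) K)\<^sup>2) / 2 - \<delta> k
        \<le> (\<integral>x. (norm (z (Suc k) x - z k x))\<^sup>2 \<partial>lborel)" for k
    using hQ[of k] by (simp add: Q_def z_def)
  have zc: "continuous_on UNIV (z k)" for k by (rule subsolution_pertD(2)[OF p])
  have zB: "norm (z k x) \<le> B" for k x using B(1) p[of k] st[of _ k] by simp
  have zout: "z k x = 0" if "x \<notin> U" for k x using subsolution_pert_outside(2)[OF p that] .
  have Vf: "emeasure lborel U < \<infinity>" by (rule emeasure_bounded_finite[OF U(2)])
  have cint: "integrable lborel f" if f: "continuous_on UNIV f" "\<And>x. x \<notin> U \<Longrightarrow> f x = 0"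
    for f :: "(real^'n) \<times> real \<Rightarrow> real"
  proof (rule integrable_compact_support[OF f(1), of "closure U"])
    show "compact (closure U)" using U(2) by (simp add: compact_closure)
    show "f x = 0" if "x \<notin> closure U" for x using f(2) that closure_subset by blast
  qed
  have i2: "integrable lborel (\<lambda>x. (norm (z j x))\<^sup>2)" "integrable lborel (\<lambda>x. (norm (z j x - z k x))\<^sup>2)"
    "integrable lborel (\<lambda>x. z j x \<bullet> z k x)" for j k
    by (rule cint, intro continuous_on_power continuous_on_norm continuous_on_diff continuous_on_inner zc, simp add: zout)+
  define a where "a k = (\<integral>x. (norm (z k x))\<^sup>2 \<partial>lborel)" for k
  have diff: "(\<integral>x. (norm (z l x - z m x))\<^sup>2 \<partial>lborel) =
      a l - a m - 2 * (\<integral>x. z m x \<bullet> (z l x - z m x) \<partial>lborel)" for l m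
  proof -
    have "(norm (z l x - z m x))\<^sup>2 = (norm (z l x))\<^sup>2 - (norm (z m x))\<^sup>2 - 2 * (z m x \<bullet> (z l x - z m x))" for x
      by (simp add: power2_norm_eq_inner inner_diff inner_commute algebra_simps)
    then show ?thesis using i2 by (simp add: a_def inner_diff_right)
  qed
  have cross: "\<bar>\<integral>x. z m x \<bullet> (z (m + i) x - z m x) \<partial>lborel\<bar> \<le> (1/2) ^ m - (1/2) ^ (m + i)" for m i
  proof (induction i)
    case (Suc i)
    have "(\<integral>x. z m x \<bullet> (z (m + Suc i) x - z m x) \<partial>lborel) =
        (\<integral>x. z m x \<bullet> (z (m + i) x - z m x) \<partial>lborel) + (\<integral>x. z m x \<bullet> (z (Suc (m + i)) x - z (m + i) x) \<partial>lborel)"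
      using i2 by (simp add: inner_diff_right)
    moreover have "\<bar>\<integral>x. z m x \<bullet> (z (Suc (m + i)) x - z (m + i) x) \<partial>lborel\<bar> \<le> (1/2) ^ Suc (m + i)"
      using orth[of m "m + i"] \<delta>(2)[of "m + i"] by linarith
    moreover have "(1/2 :: real) ^ (m + Suc i) = (1/2) ^ (m + i) - (1/2) ^ Suc (m + i)" by simp
    ultimately show ?case using Suc by linarith
  qed simp
  \<comment> \<open>subtracting the remaining orthogonality errors turns the energies into a monotone sequence\<close>
  define b where "b k = a k - 2 * (1/2) ^ k" for k
  have bstep: "b k + (\<integral>x. (norm (z (Suc k) x - z k x))\<^sup>2 \<partial>lborel) \<le> b (Suc k)" for k
    using diff[of "Suc k" k] cross[of k 1] by (simp add: b_def)
  have bmono: "incseq b"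
  proof (rule incseq_SucI)
    fix k
    have "0 \<le> (\<integral>x. (norm (z (Suc k) x - z k x))\<^sup>2 \<partial>lborel)" by simp
    then show "b k \<le> b (Suc k)" using bstep[of k] by linarith
  qed
  have bbdd: "b k \<le> B\<^sup>2 * measure lborel U" for k
  proof -
    have "a k \<le> (\<integral>x. indicator U x * B\<^sup>2 \<partial>lborel)"
      unfolding a_def
    proof (rule integral_mono[OF i2(1)])
      show "integrable lborel (\<lambda>x. indicator U x * B\<^sup>2 :: real)"
        using Vf U(1) by (intro integrable_mult_left integrable_real_indicator) auto
      show "(norm (z k x))\<^sup>2 \<le> indicator U x * B\<^sup>2" for x
        using zout[of x k] zB[of k x] by (cases "x \<in> U") (auto intro!: power_mono)
    qed
    also have "\<dots> = B\<^sup>2 * measure lborel U" using U(1) by simp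
    finally have "a k \<le> B\<^sup>2 * measure lborel U" .
    moreover have "b k \<le> a k" by (simp add: b_def)
    ultimately show ?thesis by linarith
  qed
  obtain L where bL: "b \<longlonglongrightarrow> L" by (rule incseq_convergent[OF bmono]) (use bbdd in blast, blast)
  have half0: "(\<lambda>k. (1/2::real) ^ k) \<longlonglongrightarrow> 0" by (rule LIMSEQ_realpow_zero) auto
  have aL: "a \<longlonglongrightarrow> L"
    using tendsto_add[OF bL tendsto_mult[OF tendsto_const[of 2] half0]] by (simp add: b_def)
  have Cau: "\<exists>M. \<forall>m\<ge>M. \<forall>n\<ge>M. (\<integral>x. (norm (z m x - z n x))\<^sup>2 \<partial>lborel) < \<epsilon>" if \<epsilon>: "\<epsilon> > 0" for \<epsilon>
  proof -
    obtain M1 where M1: "\<And>m n. m \<ge> M1 \<Longrightarrow> n \<ge> M1 \<Longrightarrow> dist (a m) (a n) < \<epsilon> / 2"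
      using LIMSEQ_imp_Cauchy[OF aL] \<epsilon> unfolding Cauchy_def by (meson half_gt_zero)
    have "\<forall>\<^sub>F k in sequentially. 2 * (1/2::real) ^ k < \<epsilon> / 2"
      using order_tendstoD(2)[OF tendsto_mult[OF tendsto_const[of 2] half0], of "\<epsilon> / 2"] \<epsilon> by simp
    then obtain M2 where M2: "\<And>k. k \<ge> M2 \<Longrightarrow> 2 * (1/2::real) ^ k < \<epsilon> / 2"
      unfolding eventually_sequentially by blast
    have *: "(\<integral>x. (norm (z l x - z m x))\<^sup>2 \<partial>lborel) < \<epsilon>" if ml: "m \<ge> max M1 M2" "l \<ge> m" for l m
    proof -
      obtain i where l: "l = m + i" using ml(2) le_Suc_ex by blast
      have "dist (a l) (a m) < \<epsilon> / 2" using M1[of l m] ml by simp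
      moreover have "2 * (1/2::real) ^ m < \<epsilon> / 2" using M2[of m] ml by simp
      moreover have "(1/2::real) ^ (m + i) \<ge> 0" by simp
      ultimately show ?thesis
        using diff[of l m] cross[of m i] unfolding l dist_real_def by (simp only: abs_le_iff abs_less_iff) linarith
    qed
    show ?thesis
    proof (intro exI[of _ "max M1 M2"] allI impI)
      fix m n assume mn: "m \<ge> max M1 M2" "n \<ge> max M1 M2"
      show "(\<integral>x. (norm (z m x - z n x))\<^sup>2 \<partial>lborel) < \<epsilon>"
        using *[of m n] *[of n m] mn by (cases "m \<le> n") (simp_all add: norm_minus_commute)
    qed
  qed
  have zmeas: "z n \<in> borel_measurable lborel" for n
    using zc by (simp add: borel_measurable_continuous_onI)
  obtain r g1 where r: "strict_mono (r :: nat \<Rightarrow> nat)" and g1m: "g1 \<in> borel_measurable lborel"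
    and g1: "AE x in lborel. (\<lambda>j. z (r j) x) \<longlonglongrightarrow> g1 x"
    using L2_Cauchy_AE_convergent_subseq[OF zmeas U zout i2(2) Cau] by blast
  \<comment> \<open>the limit is bounded by B only almost everywhere; a null set is changed to have the bound everywhere\<close>
  define g where "g x = (if norm (g1 x) \<le> B then g1 x else 0)" for x
  have gm: "g \<in> borel_measurable lborel"
    unfolding g_def[abs_def] using g1m by measurable
  have gB: "norm (g x) \<le> B" for x using B(2) by (simp add: g_def)
  have g: "AE x in lborel. (\<lambda>j. z (r j) x) \<longlonglongrightarrow> g x"
    using g1
  proof eventually_elim
    case (elim x)
    have "norm (g1 x) \<le> B"
      by (rule LIMSEQ_le_const2[OF tendsto_norm[OF elim]]) (use zB in blast)
    then show ?case using elim by (simp add: g_def)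
  qed
  \<comment> \<open>by the energy balance the squared distance to K is at most twice an increment of the energies, up to errors\<close>
  define I where "I k x = indicator U x * (infdist (flux_gradient (\<xi> + z k x)) K)\<^sup>2" for k x
  have cI: "continuous_on UNIV (\<lambda>x. (infdist (flux_gradient (\<xi> + z k x)) K)\<^sup>2)" for k
    by (intro continuous_on_power continuous_on_infdist continuous_on_flux_gradient continuous_on_add
        continuous_on_const zc)
  have Iint: "integrable lborel (I k)" for k
  proof -
    have "set_integrable lborel (closure U) (\<lambda>x. (infdist (flux_gradient (\<xi> + z k x)) K)\<^sup>2)"
      using U(2) by (intro set_integrable_continuous_compact cI) (simp add: compact_closure)
    then have "set_integrable lborel U (\<lambda>x. (infdist (flux_gradient (\<xi> + z k x)) K)\<^sup>2)"
      by (rule set_integrable_subset) (use U in \<open>auto simp: closure_subset\<close>)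
    then show ?thesis by (simp add: set_integrable_def I_def[abs_def])
  qed
  have Ile: "(\<integral>x. I k x \<partial>lborel) \<le> 2 * (b (Suc k) - b k + (1/2) ^ k)" for k
  proof -
    have "(\<integral>x. I k x \<partial>lborel) = (LINT x:U|lborel. (infdist (flux_gradient (\<xi> + z k x)) K)\<^sup>2)"
      by (simp add: I_def set_lebesgue_integral_def)
    moreover have \<delta>k: "\<delta> k \<le> (1/2) ^ k" using \<delta>(2)[of k] by (rule order_trans) simp
    moreover have "(LINT x:U|lborel. (infdist (flux_gradient (\<xi> + z k x)) K)\<^sup>2) \<le> 2 * (b (Suc k) - b k + (1/2) ^ k)"
      by (rule energy_step[OF gain[of k] bstep[of k] \<delta>k])
    ultimately show ?thesis by simp
  qed
  have "(\<lambda>k. 2 * (b (Suc k) - b k + (1/2) ^ k)) \<longlonglongrightarrow> 2 * (L - L + 0)"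
    by (rule tendsto_mult[OF tendsto_const tendsto_add[OF tendsto_diff[OF LIMSEQ_Suc[OF bL] bL] half0]])
  then have up: "(\<lambda>k. 2 * (b (Suc k) - b k + (1/2) ^ k)) \<longlonglongrightarrow> 0" by simp
  have "(\<lambda>k. \<integral>x. I k x \<partial>lborel) \<longlonglongrightarrow> 0"
  proof (rule tendsto_sandwich[OF _ _ tendsto_const up])
    show "\<forall>\<^sub>F k in sequentially. 0 \<le> (\<integral>x. I k x \<partial>lborel)"
      by (intro always_eventually allI) (simp add: I_def)
    show "\<forall>\<^sub>F k in sequentially. (\<integral>x. I k x \<partial>lborel) \<le> 2 * (b (Suc k) - b k + (1/2) ^ k)"
      by (intro always_eventually allI Ile)
  qed
  moreover have "norm (I k x) = I k x" for k x by (simp add: I_def)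
  ultimately have I1: "(\<lambda>k. \<integral>x. norm (I k x) \<partial>lborel) \<longlonglongrightarrow> 0" by simp
  have "(\<lambda>j. \<integral>x. norm (I (r j) x) \<partial>lborel) \<longlonglongrightarrow> 0"
    using LIMSEQ_subseq_LIMSEQ[OF I1 r] unfolding o_def .
  from tendsto_L1_AE_subseq[OF Iint this]
  obtain r' where r': "strict_mono (r' :: nat \<Rightarrow> nat)" and I0: "AE x in lborel. (\<lambda>j. I (r (r' j)) x) \<longlonglongrightarrow> 0"
    by blast
  define s where "s = r \<circ> r'"
  have s: "strict_mono s" unfolding s_def by (rule strict_mono_o[OF r r'])
  have gs: "AE x in lborel. (\<lambda>j. z (s j) x) \<longlonglongrightarrow> g x"
    using g
  proof eventually_elim
    case (elim x)
    from LIMSEQ_subseq_LIMSEQ[OF elim r'] show ?case by (simp add: s_def o_def)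
  qed
  have Kg: "AE x in lborel. x \<in> U \<longrightarrow> flux_gradient (\<xi> + g x) \<in> K"
    using gs I0
  proof eventually_elim
    case (elim x)
    show ?case
    proof
      assume x: "x \<in> U"
      have Kne: "K \<noteq> {}"
      proof -
        have "flux_gradient (\<xi> + z0 x) \<in> S"
          using st0[OF x] by (simp add: bounded_velocity_states_def flux_gradient_def)
        from tau[OF this] show ?thesis by fastforce
      qed
      have "continuous_on UNIV (\<lambda>v. (infdist (flux_gradient (\<xi> + v)) K)\<^sup>2)"
        by (intro continuous_on_power continuous_on_infdist continuous_on_flux_gradient continuous_on_add
            continuous_on_const continuous_on_id)
      then have "(\<lambda>j. (infdist (flux_gradient (\<xi> + z (s j) x)) K)\<^sup>2) \<longlonglongrightarrow> (infdist (flux_gradient (\<xi> + g x)) K)\<^sup>2"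
        using elim(1) by (rule continuous_on_tendsto_compose) auto
      moreover have "(\<lambda>j. (infdist (flux_gradient (\<xi> + z (s j) x)) K)\<^sup>2) \<longlonglongrightarrow> 0"
        using elim(2) x by (simp add: I_def s_def)
      ultimately have "infdist (flux_gradient (\<xi> + g x)) K = 0" using LIMSEQ_unique by fastforce
      then show "flux_gradient (\<xi> + g x) \<in> K" using in_closed_iff_infdist_zero[OF K Kne] by blast
    qed
  qed
  \<comment> \<open>the functions themselves converge because their increments are bounded by the summable errors\<close>
  have sum\<delta>: "summable \<delta>"
    unfolding \<delta>_def[abs_def] by (intro summable_mult, subst summable_Suc_iff, rule summable_geometric) simp
  define W where "W x = w0 x + (\<Sum>k. w (Suc k) x - w k x)" for x
  have w0: "w 0 = w0" by (simp add: w_def h0)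
  have tel: "(\<Sum>k<n. w (Suc k) x - w k x) = w n x - w0 x" for n x
    unfolding w0[symmetric] by (rule sum_lessThan_telescope)
  have ul: "uniform_limit UNIV (\<lambda>n x. w n x - w0 x) (\<lambda>x. \<Sum>k. w (Suc k) x - w k x) sequentially"
    using Weierstrass_m_test[of UNIV "\<lambda>k x. w (Suc k) x - w k x" \<delta>, OF _ sum\<delta>] wd unfolding tel by blast
  from uniform_limit_add[OF uniform_limit_const this, of w0]
  have uW: "uniform_limit UNIV w W sequentially" by (simp add: W_def[abs_def])
  have wn: "norm (w n x - w0 x) \<le> e" for n x
  proof -
    have "norm (w n x - w0 x) \<le> (\<Sum>k<n. \<delta> k)"
      unfolding tel[symmetric] by (rule sum_norm_le) (rule wd)
    then show ?thesis using \<delta>sum[of n] by linarith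
  qed
  have We: "norm (W x - w0 x) \<le> e" for x
  proof (rule LIMSEQ_le_const2)
    show "(\<lambda>n. norm (w n x - w0 x)) \<longlonglongrightarrow> norm (W x - w0 x)"
      by (rule tendsto_norm[OF tendsto_diff[OF tendsto_uniform_limitI[OF uW UNIV_I] tendsto_const]])
    show "\<exists>N. \<forall>n\<ge>N. norm (w n x - w0 x) \<le> e" using wn by blast
  qed
  have uWs: "uniform_limit UNIV (\<lambda>k. w (s k)) W sequentially"
    by (rule filterlim_compose[OF uW filterlim_subseq[OF s]])
  show ?thesis
    by (rule exI[of _ W], rule exI[of _ g], rule exI[of _ "\<lambda>k. w (s k)"], rule exI[of _ "\<lambda>k. z (s k)"])
      (intro conjI allI p zB wn uWs We gm gB gs Kg)
qed

end

section \<open>Test functions and weak limits\<close>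

lemma smooth_expr_test_function:
  assumes "smooth_expr f" "compact K" "K \<subseteq> U" "\<And>x. x \<notin> K \<Longrightarrow> f x = 0"
  shows "test_function U f"
proof -
  have "{x. f x \<noteq> 0} \<subseteq> K" using assms(4) by blast
  then have "closure {x. f x \<noteq> 0} \<subseteq> K" using assms(2) by (simp add: closure_minimal compact_imp_closed)
  moreover from this have "compact (closure {x. f x \<noteq> 0})"
    using assms(2) by (metis closed_closure compact_Int_closed inf.absorb2)
  ultimately show ?thesis
    unfolding test_function_def using smooth_expr_cont_diff[OF assms(1)] assms(3) by blast
qed

lemma test_function_mono: "test_function U f \<Longrightarrow> U \<subseteq> V \<Longrightarrow> test_function V f"
  unfolding test_function_def by blast

lemma test_functionD:
  assumes "test_function U \<phi>"
  shows "\<phi> differentiable (at x)" "continuous_on UNIV (dirderiv e \<phi>)" "continuous_on UNIV \<phi>"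
    "\<exists>K. compact K \<and> K \<subseteq> U \<and> (\<forall>x. x \<notin> K \<longrightarrow> \<phi> x = 0 \<and> (\<forall>e. dirderiv e \<phi> x = 0))"
proof -
  have c1: "cont_diff (Suc 0) \<phi>" using assms unfolding test_function_def by blast
  show d: "\<phi> differentiable (at x)" for x using c1 by simp
  have B: "continuous_on UNIV (dirderiv b \<phi>)" if "b \<in> Basis" for b
    using c1 that by (simp add: dirderiv_def[abs_def])
  have eq: "dirderiv e \<phi> = (\<lambda>x. \<Sum>b\<in>Basis. (e \<bullet> b) * dirderiv b \<phi> x)"
  proof
    fix x
    have l: "linear (\<lambda>h. dirderiv h \<phi> x)" by (rule dirderiv_linear[OF d])
    have "dirderiv e \<phi> x = dirderiv (\<Sum>b\<in>Basis. (e \<bullet> b) *\<^sub>R b) \<phi> x" by (simp add: euclidean_representation)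
    also have "\<dots> = (\<Sum>b\<in>Basis. (e \<bullet> b) * dirderiv b \<phi> x)"
      by (simp add: linear_sum[OF l] linear_scale[OF l])
    finally show "dirderiv e \<phi> x = (\<Sum>b\<in>Basis. (e \<bullet> b) * dirderiv b \<phi> x)" .
  qed
  have "continuous_on UNIV (\<lambda>x. \<Sum>b\<in>Basis. (e \<bullet> b) * dirderiv b \<phi> x)"
    by (intro continuous_on_sum continuous_on_mult continuous_on_const B)
  then show "continuous_on UNIV (dirderiv e \<phi>)" by (subst eq)
  show "continuous_on UNIV \<phi>"
    using d by (meson continuous_at_imp_continuous_on differentiable_imp_continuous_within)
  define K where "K = closure {x. \<phi> x \<noteq> 0}"
  have K: "compact K" "K \<subseteq> U" "closed K" using assms unfolding test_function_def K_def by auto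
  have z: "\<phi> x = 0" if "x \<notin> K" for x
  proof (rule ccontr)
    assume "\<phi> x \<noteq> 0"
    then have "x \<in> {x. \<phi> x \<noteq> 0}" by simp
    then show False using that subsetD[OF closure_subset] unfolding K_def by metis
  qed
  have dz: "dirderiv e \<phi> x = 0" if "x \<notin> K" for x e
    using derivative_compact_support[OF has_derivative_dirderiv[OF d] K(3) z that] by (rule fun_cong)
  show "\<exists>K. compact K \<and> K \<subseteq> U \<and> (\<forall>x. x \<notin> K \<longrightarrow> \<phi> x = 0 \<and> (\<forall>e. dirderiv e \<phi> x = 0))"
    by (intro exI[of _ K] conjI allI impI K z dz)
qed

lemma test_function_has_derivative:
  "test_function U \<phi> \<Longrightarrow> (\<phi> has_derivative (\<lambda>h. dirderiv h \<phi> x)) (at x)"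
  by (rule has_derivative_dirderiv[OF test_functionD(1)])

lemma test_function_C1_gradient:
  assumes "test_function U \<phi>"
  shows "\<exists>G. C1_gradient \<phi> G \<and> (\<forall>x e. G x \<bullet> e = dirderiv e \<phi> x)"
proof (intro exI[of _ "\<lambda>x. \<Sum>b\<in>Basis. dirderiv b \<phi> x *\<^sub>R b"] conjI allI)
  show G: "(\<Sum>b\<in>Basis. dirderiv b \<phi> x *\<^sub>R b) \<bullet> e = dirderiv e \<phi> x" for x e
  proof -
    have l: "linear (\<lambda>h. dirderiv h \<phi> x)" by (rule dirderiv_linear[OF test_functionD(1)[OF assms]])
    have "dirderiv e \<phi> x = dirderiv (\<Sum>b\<in>Basis. (e \<bullet> b) *\<^sub>R b) \<phi> x" by (simp add: euclidean_representation)
    also have "\<dots> = (\<Sum>b\<in>Basis. (e \<bullet> b) * dirderiv b \<phi> x)"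
      by (simp add: linear_sum[OF l] linear_scale[OF l])
    finally show ?thesis
      unfolding inner_sum_left inner_scaleR_left by (simp add: inner_commute[of e] mult.commute)
  qed
  show "C1_gradient \<phi> (\<lambda>x. \<Sum>b\<in>Basis. dirderiv b \<phi> x *\<^sub>R b)"
    unfolding C1_gradient_def
  proof (intro conjI allI)
    show "(\<phi> has_derivative (\<lambda>h. (\<Sum>b\<in>Basis. dirderiv b \<phi> x *\<^sub>R b) \<bullet> h)) (at x)" for x
      unfolding G by (rule test_function_has_derivative[OF assms])
    show "continuous_on UNIV (\<lambda>x. \<Sum>b\<in>Basis. dirderiv b \<phi> x *\<^sub>R b)"
      by (intro continuous_on_sum continuous_on_scaleR continuous_on_const test_functionD(2)[OF assms])
  qed
qed

text \<open>An open set is a countable union of balls. With bumps \<open>\<psi>\<close> on these balls that increase to their indicators,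
\<open>1 - \<Prod>\<^sub>i (1 - \<psi>\<^sub>i)\<close> is a smooth substitute for the indicator of a finite union.\<close>

lemma open_indicator_limit_test_functions:
  fixes W :: "'a::euclidean_space set"
  assumes "open W"
  shows "\<exists>\<phi>. (\<forall>n. test_function W (\<phi> n)) \<and> (\<forall>n x. 0 \<le> \<phi> n x \<and> \<phi> n x \<le> indicator W x) \<and>
    (\<forall>x. (\<lambda>n. \<phi> n x) \<longlonglongrightarrow> indicator W x)"
proof (cases "W = {}")
  case True
  have "test_function W (\<lambda>x. 0)" by (rule smooth_expr_test_function[OF smooth_expr.const, of "{}"]) auto
  then show ?thesis using True by (intro exI[of _ "\<lambda>n x. 0"]) auto
next
  case False
  define \<F> where "\<F> = {ball c r | c r. r > 0 \<and> cball c r \<subseteq> W}"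
  have op: "\<And>S. S \<in> \<F> \<Longrightarrow> open S" by (auto simp: \<F>_def)
  obtain \<G> where \<G>: "\<G> \<subseteq> \<F>" "countable \<G>" "\<Union>\<G> = \<Union>\<F>" by (rule Lindelof[OF op])
  have UF: "\<Union>\<F> = W"
  proof
    show "\<Union>\<F> \<subseteq> W" unfolding \<F>_def using ball_subset_cball by blast
    show "W \<subseteq> \<Union>\<F>"
    proof
      fix x assume "x \<in> W"
      then obtain r where "r > 0" "cball x r \<subseteq> W" using assms open_contains_cball by blast
      then show "x \<in> \<Union>\<F>" unfolding \<F>_def by (intro UnionI[of "ball x r"]) auto
    qed
  qed
  have ne: "\<G> \<noteq> {}" using False UF \<G>(3) by auto
  define B where "B = from_nat_into \<G>"
  have rB: "range B = \<G>" unfolding B_def by (rule range_from_nat_into[OF ne \<G>(2)])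
  have "\<forall>i. \<exists>c r. B i = ball c r \<and> r > 0 \<and> cball c r \<subseteq> W"
  proof
    fix i
    have "B i \<in> \<F>" using rB \<G>(1) by blast
    then show "\<exists>c r. B i = ball c r \<and> r > 0 \<and> cball c r \<subseteq> W" unfolding \<F>_def by blast
  qed
  then obtain c r where cr: "\<And>i. B i = ball (c i) (r i)" "\<And>i. r i > 0" "\<And>i. cball (c i) (r i) \<subseteq> W" by metis
  define \<psi> where "\<psi> n i x = bump_tower 0 (real n * ((r i)\<^sup>2 - (norm (x - c i))\<^sup>2))" for n i x
  have \<psi>01: "0 \<le> \<psi> n i x" "\<psi> n i x \<le> 1" for n i x
    using bump_tower_0[of "real n * ((r i)\<^sup>2 - (norm (x - c i))\<^sup>2)"]
      bump_tower_nonpos[of "real n * ((r i)\<^sup>2 - (norm (x - c i))\<^sup>2)" 0]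
    unfolding \<psi>_def by (cases "real n * ((r i)\<^sup>2 - (norm (x - c i))\<^sup>2) \<le> 0"; simp)+
  have \<psi>sm: "smooth_expr (\<psi> n i)" for n i
    unfolding \<psi>_def[abs_def]
    by (rule smooth_expr.compose[OF derivative_tower_bump])
      (intro smooth_expr_scale smooth_expr_diff smooth_expr.const smooth_expr_norm_sq)
  have \<psi>0: "\<psi> n i x = 0" if "x \<notin> ball (c i) (r i)" for n i x
  proof -
    have "r i \<le> norm (x - c i)" using that by (simp add: dist_norm norm_minus_commute)
    then have "(r i)\<^sup>2 \<le> (norm (x - c i))\<^sup>2" using cr(2)[of i] by (intro power_mono) auto
    then show ?thesis unfolding \<psi>_def by (intro bump_tower_nonpos) (simp add: mult_nonneg_nonpos)
  qed
  define \<phi> where "\<phi> n x = 1 - (\<Prod>i\<le>n. 1 - \<psi> n i x)" for n x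
  have pr: "0 \<le> (\<Prod>i\<in>I. 1 - \<psi> n i x)" "(\<Prod>i\<in>I. 1 - \<psi> n i x) \<le> 1" for I n x
    by (rule prod_nonneg, use \<psi>01 in simp, rule prod_le_1, use \<psi>01 in simp)
  have \<phi>0: "\<phi> n x = 0" if "x \<notin> (\<Union>i\<le>n. cball (c i) (r i))" for n x
  proof -
    have "\<psi> n i x = 0" if "i \<le> n" for i
      using \<open>x \<notin> _\<close> that ball_subset_cball by (intro \<psi>0) blast
    then show ?thesis by (simp add: \<phi>_def)
  qed
  show ?thesis
  proof (intro exI[of _ \<phi>] conjI allI)
    fix n
    show "test_function W (\<phi> n)"
    proof (rule smooth_expr_test_function[of _ "\<Union>i\<le>n. cball (c i) (r i)"])
      show "smooth_expr (\<phi> n)"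
        unfolding \<phi>_def[abs_def] by (intro smooth_expr_diff smooth_expr.const smooth_expr_prod \<psi>sm)
      show "compact (\<Union>i\<le>n. cball (c i) (r i))" by (intro compact_UN) auto
      show "(\<Union>i\<le>n. cball (c i) (r i)) \<subseteq> W" using cr(3) by blast
    qed (rule \<phi>0)
    fix x
    show "0 \<le> \<phi> n x" using pr(2) by (simp add: \<phi>_def)
    show "\<phi> n x \<le> indicator W x"
    proof (cases "x \<in> W")
      case True
      then show ?thesis using pr(1)[where I="{..n}" and n=n and x=x] by (simp add: \<phi>_def)
    next
      case False
      then have "x \<notin> (\<Union>i\<le>n. cball (c i) (r i))" using cr(3) by blast
      then show ?thesis using \<phi>0 False by simp
    qed
  next
    fix x
    show "(\<lambda>n. \<phi> n x) \<longlonglongrightarrow> indicator W x"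
    proof (cases "x \<in> W")
      case False
      then have "\<phi> n x = 0" for n using cr(3) by (intro \<phi>0) blast
      then show ?thesis using False by simp
    next
      case True
      then obtain i0 where i0: "x \<in> ball (c i0) (r i0)" using UF \<G>(3) rB cr(1) by blast
      define s where "s = (r i0)\<^sup>2 - (norm (x - c i0))\<^sup>2"
      have "(norm (x - c i0))\<^sup>2 < (r i0)\<^sup>2"
        using i0 by (intro power_strict_mono) (simp_all add: dist_norm norm_minus_commute)
      then have s: "s > 0" by (simp add: s_def)
      have e1: "(\<lambda>n. exp (- (1 / (real n * s)))) \<longlonglongrightarrow> exp (- 0)"
      proof (intro tendsto_exp tendsto_minus)
        have "(\<lambda>n. (1 / s) * (1 / real n)) \<longlonglongrightarrow> (1 / s) * 0"
          by (intro tendsto_mult tendsto_const lim_1_over_n)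
        then show "(\<lambda>n. 1 / (real n * s)) \<longlonglongrightarrow> 0" by (simp add: mult.commute)
      qed
      have e2: "\<forall>\<^sub>F n in sequentially. exp (- (1 / (real n * s))) \<le> \<phi> n x"
        using eventually_ge_at_top[of "max 1 i0"]
      proof eventually_elim
        case (elim n)
        have "(\<Prod>i\<le>n. 1 - \<psi> n i x) = (1 - \<psi> n i0 x) * (\<Prod>i\<in>{..n} - {i0}. 1 - \<psi> n i x)"
          using elim by (subst prod.remove[of _ i0]) auto
        also have "\<dots> \<le> (1 - \<psi> n i0 x) * 1" using pr(2) \<psi>01(2) by (intro mult_left_mono) auto
        also have "\<psi> n i0 x = exp (- (1 / (real n * s)))"
          unfolding \<psi>_def s_def[symmetric] using elim s by (intro bump_tower_0) simp
        finally show ?case by (simp add: \<phi>_def)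
      qed
      have "\<forall>\<^sub>F n in sequentially. \<phi> n x \<le> 1"
        by (intro always_eventually allI) (use pr(1) in \<open>simp add: \<phi>_def\<close>)
      from tendsto_sandwich[OF e2 this e1[unfolded minus_zero exp_zero] tendsto_const]
      have "(\<lambda>n. \<phi> n x) \<longlonglongrightarrow> 1" .
      then show ?thesis using True by simp
    qed
  qed
qed

lemma sigma_finite_lebesgue: "sigma_finite_measure (lebesgue :: 'a::euclidean_space measure)"
proof
  obtain A :: "'a set set" where A: "countable A" "A \<subseteq> sets lborel" "\<Union>A = space lborel"
    "\<forall>a\<in>A. emeasure lborel a \<noteq> \<infinity>"
    using lborel.sigma_finite_countable by blast
  show "\<exists>A::'a set set. countable A \<and> A \<subseteq> sets lebesgue \<and> \<Union>A = space lebesgue \<and> (\<forall>a\<in>A. emeasure lebesgue a \<noteq> \<infinity>)"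
    using A by (intro exI[of _ A]) auto
qed

text \<open>The sets over which the integral vanishes form a Dynkin system, and the open sets are an intersection-stable
generator of the Borel sets.\<close>

lemma set_integral_zero_on_opens:
  fixes f :: "'a::euclidean_space \<Rightarrow> 'b::euclidean_space"
  assumes f: "integrable lebesgue f" and op: "\<And>W. open W \<Longrightarrow> (LINT x:W|lebesgue. f x) = 0"
  shows "AE x in lebesgue. f x = 0"
proof (rule sigma_finite_measure.density_zero[OF sigma_finite_lebesgue f])
  have fi: "set_integrable lebesgue A f" if "A \<in> sets lebesgue" for A
    unfolding set_integrable_def using f that by (rule integrable_mult_indicator[rotated])
  have borel: "(LINT x:A|lebesgue. f x) = 0" if "A \<in> sets borel" for A
  proof -
    have gen: "sets (borel :: 'a measure) = sigma_sets UNIV {S. open S}"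
      by (simp add: borel_def)
    have "Int_stable {S :: 'a set. open S}" by (auto simp: Int_stable_def)
    moreover have "{S :: 'a set. open S} \<subseteq> Pow UNIV" by simp
    moreover have "A \<in> sigma_sets UNIV {S. open S}" using that gen by simp
    ultimately show ?thesis
    proof (induction rule: sigma_sets_induct_disjoint)
      case (basic A) then show ?case using op by simp
    next
      case empty show ?case by (simp add: set_lebesgue_integral_def)
    next
      case (compl A)
      then have A: "A \<in> sets lebesgue" by (simp add: gen[symmetric])
      have "(LINT x:UNIV|lebesgue. f x) = (LINT x:A|lebesgue. f x) + (LINT x:UNIV - A|lebesgue. f x)"
        using set_integral_Un[of A "UNIV - A" lebesgue f] fi[OF A] fi[of "UNIV - A"] sets.compl_sets[OF A] by simp
      then show ?case using compl op[of UNIV] by simp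
    next
      case (union A)
      have A: "A i \<in> sets lebesgue" for i using union(2) by (auto simp: gen[symmetric])
      have "(LINT x:(\<Union>i. A i)|lebesgue. f x) = (\<Sum>i. LINT x:A i|lebesgue. f x)"
        using union(1) A fi[of "\<Union>i. A i"] by (intro lebesgue_integral_countable_add) (auto simp: disjoint_family_on_def)
      then show ?case using union(3) by simp
    qed
  qed
  show "(LINT x:A|lebesgue. f x) = 0" if A: "A \<in> sets lebesgue" for A
  proof -
    obtain S N N' where SN: "A = S \<union> N" "S \<in> sets lborel" "N' \<in> null_sets lborel" "N \<subseteq> N'"
      using A by (auto elim!: sets_completionE)
    have "AE x in lebesgue. x \<notin> N'" using SN(3) by (intro AE_completion AE_not_in)
    then have ae: "AE x in lebesgue. x \<in> A \<longleftrightarrow> x \<in> S" by eventually_elim (use SN in auto)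
    have "(LINT x:A|lebesgue. f x) = (LINT x:S|lebesgue. f x)"
      by (rule set_integral_cong_set)
        (use ae fi[OF A] fi[of S] SN(2) in \<open>auto simp: set_integrable_def set_borel_measurable_def\<close>)
    then show ?thesis using borel[of S] SN(2) by simp
  qed
qed

text \<open>The test functions approximate the indicators of open subsets of a ball in \<open>U\<close>, so that \<open>g\<close> has vanishing integrals over
these. Countably many such balls cover \<open>U\<close>.\<close>

lemma fundamental_lemma:
  fixes g :: "'a::euclidean_space \<Rightarrow> 'b::euclidean_space"
  assumes U: "open U" and g: "L1_loc U g"
    and test: "\<And>\<phi>. test_function U \<phi> \<Longrightarrow> (LINT x:U|lebesgue. \<phi> x *\<^sub>R g x) = 0"
  shows "AE x in lebesgue. x \<in> U \<longrightarrow> g x = 0"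
proof -
  have ball0: "AE x in lebesgue. x \<in> ball a r \<longrightarrow> g x = 0" if B: "cball a r \<subseteq> U" for a r
  proof -
    have "g absolutely_integrable_on cball a r" using g B by (simp add: L1_loc_def)
    then have "set_integrable lebesgue (ball a r) g"
      by (rule set_integrable_subset) auto
    then have fi: "integrable lebesgue (\<lambda>x. indicator (ball a r) x *\<^sub>R g x)"
      by (simp add: set_integrable_def)
    have "AE x in lebesgue. indicator (ball a r) x *\<^sub>R g x = 0"
    proof (rule set_integral_zero_on_opens[OF fi])
      fix W :: "'a set" assume W: "open W"
      let ?W = "W \<inter> ball a r"
      have oW: "open ?W" using W by auto
      from open_indicator_limit_test_functions[OF oW] obtain \<phi> where
        \<phi>: "\<And>n. test_function ?W (\<phi> n)" "\<And>n x. 0 \<le> \<phi> n x \<and> \<phi> n x \<le> indicator ?W x"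
        "\<And>x. (\<lambda>n. \<phi> n x) \<longlonglongrightarrow> indicator ?W x" by blast
      have lim: "(\<lambda>n. \<integral>x. \<phi> n x *\<^sub>R (indicator (ball a r) x *\<^sub>R g x) \<partial>lebesgue)
          \<longlonglongrightarrow> (\<integral>x. indicator ?W x *\<^sub>R (indicator (ball a r) x *\<^sub>R g x) \<partial>lebesgue)"
      proof (rule integral_dominated_convergence[where w="\<lambda>x. norm (indicator (ball a r) x *\<^sub>R g x)"])
        show "(\<lambda>x. indicator ?W x *\<^sub>R (indicator (ball a r) x *\<^sub>R g x)) \<in> borel_measurable lebesgue"
          using oW by (intro borel_measurable_scaleR[OF _ borel_measurable_integrable[OF fi]] borel_measurable_indicator) auto
        show "(\<lambda>x. \<phi> n x *\<^sub>R (indicator (ball a r) x *\<^sub>R g x)) \<in> borel_measurable lebesgue" for n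
          using test_functionD(3)[OF \<phi>(1)]
          by (intro borel_measurable_scaleR[OF _ borel_measurable_integrable[OF fi]] measurable_completion)
            (simp add: borel_measurable_continuous_onI)
        show "integrable lebesgue (\<lambda>x. norm (indicator (ball a r) x *\<^sub>R g x))" using fi by (rule integrable_norm)
        show "AE x in lebesgue. (\<lambda>n. \<phi> n x *\<^sub>R (indicator (ball a r) x *\<^sub>R g x))
            \<longlonglongrightarrow> indicator ?W x *\<^sub>R (indicator (ball a r) x *\<^sub>R g x)"
          by (intro AE_I2 tendsto_scaleR \<phi>(3) tendsto_const)
        show "AE x in lebesgue. norm (\<phi> n x *\<^sub>R (indicator (ball a r) x *\<^sub>R g x))
            \<le> norm (indicator (ball a r) x *\<^sub>R g x)" for n
        proof (rule AE_I2)
          fix x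
          have "indicator ?W x \<le> (1::real)" by (simp add: indicator_def)
          then have "\<bar>\<phi> n x\<bar> \<le> 1" using \<phi>(2)[of n x] by linarith
          then show "norm (\<phi> n x *\<^sub>R (indicator (ball a r) x *\<^sub>R g x)) \<le> norm (indicator (ball a r) x *\<^sub>R g x)"
            unfolding norm_scaleR[of "\<phi> n x"] by (intro mult_left_le_one_le) auto
        qed
      qed
      have "(\<integral>x. \<phi> n x *\<^sub>R (indicator (ball a r) x *\<^sub>R g x) \<partial>lebesgue) = 0" for n
      proof -
        have eq: "\<phi> n x *\<^sub>R (indicator (ball a r) x *\<^sub>R g x) = indicator U x *\<^sub>R (\<phi> n x *\<^sub>R g x)" for x
        proof (cases "x \<in> ball a r")
          case True
          then have "x \<in> U" using B ball_subset_cball by blast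
          then show ?thesis using True by simp
        next
          case False
          then have "\<phi> n x = 0" using \<phi>(2)[of n x] by simp
          then show ?thesis by simp
        qed
        have "(\<integral>x. \<phi> n x *\<^sub>R (indicator (ball a r) x *\<^sub>R g x) \<partial>lebesgue) = (LINT x:U|lebesgue. \<phi> n x *\<^sub>R g x)"
          by (simp only: eq set_lebesgue_integral_def)
        also have "\<dots> = 0"
          by (rule test, rule test_function_mono[OF \<phi>(1)]) (use B ball_subset_cball in blast)
        finally show ?thesis .
      qed
      with lim have "(\<integral>x. indicator ?W x *\<^sub>R (indicator (ball a r) x *\<^sub>R g x) \<partial>lebesgue) = 0"
        by (simp add: LIMSEQ_const_iff)
      moreover have eq: "indicator ?W x *\<^sub>R (indicator (ball a r) x *\<^sub>R g x) = indicator W x *\<^sub>R (indicator (ball a r) x *\<^sub>R g x)" for x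
        by (simp add: indicator_def)
      ultimately show "(LINT x:W|lebesgue. indicator (ball a r) x *\<^sub>R g x) = 0"
        by (simp only: eq set_lebesgue_integral_def)
    qed
    then show ?thesis by eventually_elim (auto simp: indicator_def)
  qed
  define \<F> where "\<F> = {ball c r | c r. r > 0 \<and> cball c r \<subseteq> U}"
  have op: "\<And>S. S \<in> \<F> \<Longrightarrow> open S" by (auto simp: \<F>_def)
  obtain \<G> where \<G>: "\<G> \<subseteq> \<F>" "countable \<G>" "\<Union>\<G> = \<Union>\<F>" by (rule Lindelof[OF op])
  have "AE x in lebesgue. \<forall>B\<in>\<G>. x \<in> B \<longrightarrow> g x = 0"
  proof (rule AE_ball_countable'[OF _ \<G>(2)])
    show "AE x in lebesgue. x \<in> B \<longrightarrow> g x = 0" if "B \<in> \<G>" for B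
      using that \<G>(1) ball0 by (auto simp: \<F>_def)
  qed
  then show ?thesis
  proof eventually_elim
    case (elim x)
    show ?case
    proof
      assume "x \<in> U"
      then obtain r where "r > 0" "cball x r \<subseteq> U" using U open_contains_cball by blast
      then have "x \<in> \<Union>\<F>" unfolding \<F>_def by (intro UnionI[of "ball x r"]) auto
      then show "g x = 0" using elim \<G>(3) by blast
    qed
  qed
qed

text \<open>The representative chosen in the definition of the weak derivative is thus determined almost everywhere, and may be replaced by an explicit one.\<close>

lemma weak_deriv_unique:
  fixes u :: "'a::euclidean_space \<Rightarrow> 'b::euclidean_space"
  assumes U: "open U" and v: "has_weak_deriv U u e v" "has_weak_deriv U u e v'"
  shows "AE x in lebesgue. x \<in> U \<longrightarrow> v x = v' x"
proof -
  have L: "L1_loc U v" "L1_loc U v'" using v by (auto simp: has_weak_deriv_def)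
  have "L1_loc U (\<lambda>x. v x - v' x)" using L unfolding L1_loc_def by (auto intro!: set_integral_diff)
  moreover have "(LINT x:U|lebesgue. \<phi> x *\<^sub>R (v x - v' x)) = 0" if \<phi>: "test_function U \<phi>" for \<phi>
  proof -
    obtain K where K: "compact K" "K \<subseteq> U" "\<forall>x. x \<notin> K \<longrightarrow> \<phi> x = 0 \<and> (\<forall>e. dirderiv e \<phi> x = 0)"
      using test_functionD(4)[OF \<phi>] by blast
    have i: "set_integrable lebesgue U (\<lambda>x. \<phi> x *\<^sub>R v x)" if "L1_loc U v" for v :: "'a \<Rightarrow> 'b"
    proof -
      have vK: "integrable lebesgue (\<lambda>x. indicator K x *\<^sub>R v x)" using that K by (simp add: L1_loc_def set_integrable_def)
      obtain B where B: "\<And>x. norm (\<phi> x) \<le> B"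
        using bounded_compact_support[OF test_functionD(3)[OF \<phi>] K(1)] K(3) by metis
      have "integrable lebesgue (\<lambda>x. \<phi> x *\<^sub>R (indicator K x *\<^sub>R v x))"
      proof (rule Bochner_Integration.integrable_bound[OF integrable_scaleR_right[OF vK, of B]])
        show "(\<lambda>x. \<phi> x *\<^sub>R (indicator K x *\<^sub>R v x)) \<in> borel_measurable lebesgue"
          using test_functionD(3)[OF \<phi>]
          by (intro borel_measurable_scaleR[OF _ borel_measurable_integrable[OF vK]] measurable_completion)
            (simp add: borel_measurable_continuous_onI)
        show "AE x in lebesgue. norm (\<phi> x *\<^sub>R (indicator K x *\<^sub>R v x)) \<le> norm (B *\<^sub>R (indicator K x *\<^sub>R v x))"
        proof (rule AE_I2)
          fix x
          have "\<bar>\<phi> x\<bar> \<le> \<bar>B\<bar>" using B[of x] by simp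
          then show "norm (\<phi> x *\<^sub>R (indicator K x *\<^sub>R v x)) \<le> norm (B *\<^sub>R (indicator K x *\<^sub>R v x))"
            unfolding norm_scaleR[of "\<phi> x"] norm_scaleR[of B] by (intro mult_right_mono norm_ge_zero)
        qed
      qed
      moreover have eq: "\<phi> x *\<^sub>R (indicator K x *\<^sub>R v x) = indicator U x *\<^sub>R (\<phi> x *\<^sub>R v x)" for x
        using K(2,3) by (auto simp: indicator_def)
      ultimately show ?thesis by (simp only: eq set_integrable_def)
    qed
    have "(LINT x:U|lebesgue. \<phi> x *\<^sub>R v x) = (LINT x:U|lebesgue. \<phi> x *\<^sub>R v' x)"
      using v \<phi> unfolding has_weak_deriv_def by (metis neg_equal_iff_equal)
    then show ?thesis
      unfolding scaleR_diff_right using i L by (subst set_integral_diff(2)) auto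
  qed
  ultimately have "AE x in lebesgue. x \<in> U \<longrightarrow> v x - v' x = 0" by (rule fundamental_lemma[OF U])
  then show ?thesis by simp
qed

lemma set_integral_lebesgue_on:
  fixes f :: "'a::euclidean_space \<Rightarrow> 'b::{banach, second_countable_topology}"
  assumes "U \<in> sets lebesgue"
  shows "(LINT x:U|lebesgue. f x) = integral\<^sup>L (lebesgue_on U) f"
  using assms by (simp add: integral_restrict_space set_lebesgue_integral_def)

lemma AE_eq_measurable_lebesgue_on:
  fixes f g :: "'a::euclidean_space \<Rightarrow> 'b::euclidean_space"
  assumes U: "U \<in> sets lebesgue" and f: "f \<in> borel_measurable (lebesgue_on U)"
    and ae: "AE x in lebesgue. x \<in> U \<longrightarrow> g x = f x"
  shows "g \<in> borel_measurable (lebesgue_on U)"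
proof -
  obtain N where N: "N \<in> null_sets lebesgue" "{x. \<not> (x \<in> U \<longrightarrow> g x = f x)} \<subseteq> N"
    using ae unfolding eventually_ae_filter by auto
  have "f measurable_on U" using f U by (simp add: measurable_on_iff_borel_measurable)
  then have "g measurable_on U"
    by (rule measurable_on_spike[of _ _ N]) (use N in \<open>auto simp: negligible_iff_null_sets\<close>)
  then show ?thesis using U by (simp add: measurable_on_iff_borel_measurable)
qed

lemma mult_half_cancel: "a > 0 \<Longrightarrow> a * (r / (2 * a)) = r / (2::real)"
  by simp

text \<open>For a bounded sequence the functionals are equicontinuous on \<open>L\<^sup>1\<close>, so convergence spreads from test functions to indicators of open sets, from these by outer regularity to indicators of
measurable sets, and then to all integrable functions.\<close>

lemma bounded_weak_limit_zero:
  fixes f :: "nat \<Rightarrow> 'a::euclidean_space \<Rightarrow> 'b::euclidean_space"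
  assumes U: "open U" "bounded U"
    and f: "\<And>j. f j \<in> borel_measurable (lebesgue_on U)" "\<And>j x. x \<in> U \<Longrightarrow> norm (f j x) \<le> C"
    and test: "\<And>\<phi>. test_function U \<phi> \<Longrightarrow> (\<lambda>j. \<integral>x. \<phi> x *\<^sub>R f j x \<partial>lebesgue_on U) \<longlonglongrightarrow> 0"
    and h: "integrable (lebesgue_on U) h"
  shows "(\<lambda>j. \<integral>x. f j x \<bullet> h x \<partial>lebesgue_on U) \<longlonglongrightarrow> 0"
proof -
  let ?M = "lebesgue_on U"
  have Us: "U \<in> sets lebesgue" using U(1) by simp
  interpret fm: finite_measure ?M
  proof
    show "emeasure ?M (space ?M) \<noteq> \<infinity>"
      using emeasure_bounded_finite[OF U(2)] U(1)
      by (simp add: emeasure_restrict_space space_restrict_space)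
  qed
  have spM: "space ?M = U" by (simp add: space_restrict_space)
  have C: "0 \<le> C" if "x \<in> U" for x using f(2)[OF that, of 0] norm_ge_zero order_trans by blast
  have bd: "norm (\<integral>x. w x *\<^sub>R f j x \<partial>?M) \<le> \<bar>C\<bar> * (\<integral>x. \<bar>w x\<bar> \<partial>?M)" if w: "integrable ?M w" for w :: "'a \<Rightarrow> real" and j
  proof -
    have "norm (\<integral>x. w x *\<^sub>R f j x \<partial>?M) \<le> (\<integral>x. \<bar>C\<bar> * \<bar>w x\<bar> \<partial>?M)"
    proof (rule order_trans[OF integral_norm_bound integral_mono])
      show "integrable ?M (\<lambda>x. \<bar>C\<bar> * \<bar>w x\<bar>)" using w by simp
      show nb: "norm (w x *\<^sub>R f j x) \<le> \<bar>C\<bar> * \<bar>w x\<bar>" if "x \<in> space ?M" for x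
        using f(2)[of x j] that C[of x] unfolding norm_scaleR spM
        by (subst mult.commute) (intro mult_right_mono, auto)
      show "integrable ?M (\<lambda>x. norm (w x *\<^sub>R f j x))"
        by (rule integrable_norm, rule Bochner_Integration.integrable_bound[OF integrable_mult_right[OF integrable_abs[OF w], of "\<bar>C\<bar>"]])
          (use w f(1) nb in \<open>auto intro!: borel_measurable_scaleR AE_I2 simp: abs_mult\<close>)
    qed
    then show ?thesis by simp
  qed
  have fw: "integrable ?M (\<lambda>x. w x *\<^sub>R f j x)" if w: "integrable ?M w" for w :: "'a \<Rightarrow> real" and j
  proof (rule Bochner_Integration.integrable_bound[OF integrable_mult_right[OF integrable_abs[OF w], of "\<bar>C\<bar>"]])
    show "(\<lambda>x. w x *\<^sub>R f j x) \<in> borel_measurable ?M" using w f(1) by (intro borel_measurable_scaleR) auto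
    show "AE x in ?M. norm (w x *\<^sub>R f j x) \<le> norm (\<bar>C\<bar> * \<bar>w x\<bar>)"
    proof (rule AE_I2)
      fix x assume "x \<in> space ?M"
      then have "norm (f j x) \<le> \<bar>C\<bar>" using f(2)[of x j] spM by auto
      then have "\<bar>w x\<bar> * norm (f j x) \<le> \<bar>w x\<bar> * \<bar>C\<bar>" by (intro mult_left_mono) auto
      then show "norm (w x *\<^sub>R f j x) \<le> norm (\<bar>C\<bar> * \<bar>w x\<bar>)" by (simp add: abs_mult mult.commute)
    qed
  qed
  \<comment> \<open>approximation in L1 transfers the convergence\<close>
  have approx: "(\<lambda>j. \<integral>x. w x *\<^sub>R f j x \<partial>?M) \<longlonglongrightarrow> 0"
    if w: "integrable ?M w" and ap: "\<And>\<epsilon>. \<epsilon> > 0 \<Longrightarrow> \<exists>v. integrable ?M v \<and> (\<integral>x. \<bar>w x - v x\<bar> \<partial>?M) < \<epsilon> \<and>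
      (\<lambda>j. \<integral>x. v x *\<^sub>R f j x \<partial>?M) \<longlonglongrightarrow> 0" for w :: "'a \<Rightarrow> real"
  proof (rule LIMSEQ_I)
    fix r :: real assume r: "r > 0"
    obtain v where v: "integrable ?M v" "(\<integral>x. \<bar>w x - v x\<bar> \<partial>?M) < r / (2 * (\<bar>C\<bar> + 1))"
      "(\<lambda>j. \<integral>x. v x *\<^sub>R f j x \<partial>?M) \<longlonglongrightarrow> 0"
      using ap[of "r / (2 * (\<bar>C\<bar> + 1))"] r by (auto simp: add_nonneg_pos)
    obtain no where no: "\<And>j. j \<ge> no \<Longrightarrow> norm (\<integral>x. v x *\<^sub>R f j x \<partial>?M) < r / 2"
      using LIMSEQ_D[OF v(3), of "r / 2"] r by auto
    have "norm ((\<integral>x. w x *\<^sub>R f j x \<partial>?M) - 0) < r" if "j \<ge> no" for j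
    proof -
      have "(\<integral>x. w x *\<^sub>R f j x \<partial>?M) = (\<integral>x. (w x - v x) *\<^sub>R f j x \<partial>?M) + (\<integral>x. v x *\<^sub>R f j x \<partial>?M)"
        unfolding scaleR_diff_left using fw[OF w] fw[OF v(1)] by simp
      moreover have "norm (\<integral>x. (w x - v x) *\<^sub>R f j x \<partial>?M) \<le> \<bar>C\<bar> * (\<integral>x. \<bar>w x - v x\<bar> \<partial>?M)"
        using w v(1) by (intro bd) simp
      moreover have "\<bar>C\<bar> * (\<integral>x. \<bar>w x - v x\<bar> \<partial>?M) \<le> (\<bar>C\<bar> + 1) * (r / (2 * (\<bar>C\<bar> + 1)))"
        using v(2) by (intro mult_mono) auto
      moreover have "(\<bar>C\<bar> + 1) * (r / (2 * (\<bar>C\<bar> + 1))) = r / 2"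
        by (rule mult_half_cancel) simp
      ultimately show ?thesis
        using no[OF that] norm_triangle_ineq[of "\<integral>x. (w x - v x) *\<^sub>R f j x \<partial>?M" "\<integral>x. v x *\<^sub>R f j x \<partial>?M"] by simp
    qed
    then show "\<exists>no. \<forall>n\<ge>no. norm ((\<integral>x. w x *\<^sub>R f n x \<partial>?M) - 0) < r" by blast
  qed
  have ind: "integrable ?M (indicator A :: 'a \<Rightarrow> real)" if "A \<in> sets ?M" for A
    using that fm.emeasure_finite by (intro integrable_real_indicator) (auto simp: less_top[symmetric])
  \<comment> \<open>first density step: open sets by test functions\<close>
  have opens: "(\<lambda>j. \<integral>x. indicator W x *\<^sub>R f j x \<partial>?M) \<longlonglongrightarrow> 0" if W: "open W" "W \<subseteq> U" for W
  proof -
    have Ws: "W \<in> sets ?M" using W U(1) by (auto simp: sets_restrict_space_iff)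
    obtain \<phi> where \<phi>: "\<And>n. test_function W (\<phi> n)" "\<And>n x. 0 \<le> \<phi> n x \<and> \<phi> n x \<le> indicator W x"
      "\<And>x. (\<lambda>n. \<phi> n x) \<longlonglongrightarrow> indicator W x"
      using open_indicator_limit_test_functions[OF W(1)] by blast
    have i1: "indicator W x \<le> (1::real)" for x by (simp add: indicator_def)
    have \<phi>m: "\<phi> n \<in> borel_measurable ?M" for n
      using test_functionD(3)[OF \<phi>(1)]
      by (intro measurable_restrict_space1 measurable_completion) (simp add: borel_measurable_continuous_onI)
    have \<phi>i: "integrable ?M (\<phi> n)" for n
      by (rule Bochner_Integration.integrable_bound[OF ind[OF Ws] \<phi>m]) (use \<phi>(2) in \<open>auto intro!: AE_I2\<close>)
    have lim: "(\<lambda>n. \<integral>x. \<bar>indicator W x - \<phi> n x\<bar> \<partial>?M) \<longlonglongrightarrow> (\<integral>x. 0 \<partial>?M)"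
    proof (rule integral_dominated_convergence[where w="\<lambda>x. 1"])
      show "AE x in ?M. (\<lambda>n. \<bar>indicator W x - \<phi> n x\<bar>) \<longlonglongrightarrow> 0"
      proof (rule AE_I2)
        fix x
        have "(\<lambda>n. \<bar>indicator W x - \<phi> n x\<bar>) \<longlonglongrightarrow> \<bar>indicator W x - indicator W x\<bar>"
          by (intro tendsto_rabs tendsto_diff tendsto_const \<phi>(3))
        then show "(\<lambda>n. \<bar>indicator W x - \<phi> n x\<bar>) \<longlonglongrightarrow> 0" by simp
      qed
      show "AE x in ?M. norm \<bar>indicator W x - \<phi> n x\<bar> \<le> 1" for n
      proof (rule AE_I2)
        fix x
        have "\<bar>indicator W x - \<phi> n x\<bar> \<le> 1" using \<phi>(2)[of n x] i1[of x] by linarith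
        then show "norm \<bar>indicator W x - \<phi> n x\<bar> \<le> 1" by simp
      qed
      show "(\<lambda>x. \<bar>indicator W x - \<phi> n x\<bar>) \<in> borel_measurable ?M" for n
        using \<phi>m Ws by (intro borel_measurable_abs borel_measurable_diff borel_measurable_indicator) auto
    qed auto
    show ?thesis
    proof (rule approx[OF ind[OF Ws]])
      fix \<epsilon> :: real assume "\<epsilon> > 0"
      then have "\<forall>\<^sub>F n in sequentially. (\<integral>x. \<bar>indicator W x - \<phi> n x\<bar> \<partial>?M) < \<epsilon>"
        using order_tendstoD(2)[OF lim] by simp
      then obtain n where n: "(\<integral>x. \<bar>indicator W x - \<phi> n x\<bar> \<partial>?M) < \<epsilon>"
        using eventually_happens'[OF sequentially_bot] by blast
      have "test_function U (\<phi> n)" by (rule test_function_mono[OF \<phi>(1) W(2)])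
      from test[OF this] n \<phi>i
      show "\<exists>v. integrable ?M v \<and> (\<integral>x. \<bar>indicator W x - v x\<bar> \<partial>?M) < \<epsilon> \<and>
        (\<lambda>j. \<integral>x. v x *\<^sub>R f j x \<partial>?M) \<longlonglongrightarrow> 0" by blast
    qed
  qed
  \<comment> \<open>second density step: measurable sets by open supersets\<close>
  have sets: "(\<lambda>j. \<integral>x. indicator A x *\<^sub>R f j x \<partial>?M) \<longlonglongrightarrow> 0" if A: "A \<in> sets ?M" for A
  proof (rule approx[OF ind[OF A]])
    fix \<epsilon> :: real assume \<epsilon>: "\<epsilon> > 0"
    have AU: "A \<subseteq> U" "A \<in> sets lebesgue" using A Us by (auto simp: sets_restrict_space_iff)
    obtain T where T: "open T" "A \<subseteq> T" "T - A \<in> lmeasurable" "emeasure lebesgue (T - A) < ennreal \<epsilon>"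
      by (rule sets_lebesgue_outer_open[OF AU(2) \<epsilon>])
    let ?W = "T \<inter> U"
    have W: "open ?W" "?W \<subseteq> U" using T(1) U(1) by auto
    have Ws: "?W \<in> sets ?M" using W Us by (auto simp: sets_restrict_space_iff)
    have "(\<integral>x. \<bar>indicator A x - indicator ?W x :: real\<bar> \<partial>?M) = (\<integral>x. indicator (?W - A) x \<partial>?M)"
      using T(2) AU(1) by (intro Bochner_Integration.integral_cong) (auto simp: indicator_def)
    also have "\<dots> = measure ?M ((?W - A) \<inter> space ?M)" using Ws A by simp
    also have "\<dots> = measure ?M (?W - A)" unfolding spM by (rule arg_cong[of _ _ "measure ?M"]) blast
    also have "\<dots> = measure lebesgue (?W - A)"
      using Us by (intro measure_restrict_space) auto
    also have "\<dots> \<le> measure lebesgue (T - A)"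
      using T(3) W AU(2) by (intro measure_mono_fmeasurable) auto
    also have "\<dots> < \<epsilon>"
      using T(3,4) \<epsilon> by (simp add: emeasure_eq_measure2 ennreal_less_iff)
    finally show "\<exists>v. integrable ?M v \<and> (\<integral>x. \<bar>indicator A x - v x\<bar> \<partial>?M) < \<epsilon> \<and>
        (\<lambda>j. \<integral>x. v x *\<^sub>R f j x \<partial>?M) \<longlonglongrightarrow> 0"
      using opens[OF W] ind[OF Ws] by blast
  qed
  have fb: "integrable ?M (\<lambda>x. f j x \<bullet> g x) \<and> \<bar>\<integral>x. f j x \<bullet> g x \<partial>?M\<bar> \<le> \<bar>C\<bar> * (\<integral>x. norm (g x) \<partial>?M)"
    if g: "integrable ?M g" for g j
  proof -
    have nb: "\<bar>f j x \<bullet> g x\<bar> \<le> \<bar>C\<bar> * norm (g x)" if "x \<in> space ?M" for x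
    proof -
      have "\<bar>f j x \<bullet> g x\<bar> \<le> norm (f j x) * norm (g x)" by (rule Cauchy_Schwarz_ineq2)
      also have "\<dots> \<le> \<bar>C\<bar> * norm (g x)" using f(2)[of x j] that spM by (intro mult_right_mono) auto
      finally show ?thesis .
    qed
    have gi: "integrable ?M (\<lambda>x. \<bar>C\<bar> * norm (g x))" using g by simp
    have i: "integrable ?M (\<lambda>x. f j x \<bullet> g x)"
      by (rule Bochner_Integration.integrable_bound[OF gi])
        (use f(1) g nb in \<open>auto intro!: borel_measurable_inner AE_I2 simp: abs_mult\<close>)
    have "norm (\<integral>x. f j x \<bullet> g x \<partial>?M) \<le> (\<integral>x. \<bar>C\<bar> * norm (g x) \<partial>?M)"
      by (rule order_trans[OF integral_norm_bound integral_mono[OF integrable_norm[OF i] gi]]) (use nb in simp)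
    then show ?thesis using i by simp
  qed
  from h show ?thesis
  proof (induct rule: integrable_induct)
    case (base A c)
    have "(\<integral>x. f j x \<bullet> (indicator A x *\<^sub>R c) \<partial>?M) = (\<integral>x. indicator A x *\<^sub>R f j x \<partial>?M) \<bullet> c" for j
    proof -
      have "(\<integral>x. indicator A x *\<^sub>R f j x \<partial>?M) \<bullet> c = (\<integral>x. (indicator A x *\<^sub>R f j x) \<bullet> c \<partial>?M)"
        by (rule integral_inner_left[symmetric]) (rule fw[OF ind[OF base(1)]])
      then show ?thesis by simp
    qed
    moreover have "(\<lambda>j. (\<integral>x. indicator A x *\<^sub>R f j x \<partial>?M) \<bullet> c) \<longlonglongrightarrow> 0 \<bullet> c"
      by (intro tendsto_inner sets base tendsto_const)
    ultimately show ?case by simp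
  next
    case (add g g')
    have "(\<integral>x. f j x \<bullet> (g x + g' x) \<partial>?M) = (\<integral>x. f j x \<bullet> g x \<partial>?M) + (\<integral>x. f j x \<bullet> g' x \<partial>?M)" for j
      unfolding inner_add_right using fb[OF add(1)] fb[OF add(3)] by simp
    then show ?case using tendsto_add[OF add(2,4)] by simp
  next
    case (lim g s)
    have l1: "(\<lambda>i. \<integral>x. norm (g x - s i x) \<partial>?M) \<longlonglongrightarrow> (\<integral>x. 0 \<partial>?M)"
    proof (rule integral_dominated_convergence[where w="\<lambda>x. 3 * norm (g x)"])
      show "integrable ?M (\<lambda>x. 3 * norm (g x))" using lim by simp
      show "AE x in ?M. (\<lambda>i. norm (g x - s i x)) \<longlonglongrightarrow> 0"
      proof (rule AE_I2)
        fix x assume "x \<in> space ?M"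
        then have "(\<lambda>i. norm (g x - s i x)) \<longlonglongrightarrow> norm (g x - g x)"
          by (intro tendsto_norm tendsto_diff tendsto_const lim(3))
        then show "(\<lambda>i. norm (g x - s i x)) \<longlonglongrightarrow> 0" by simp
      qed
      show "AE x in ?M. norm (norm (g x - s i x)) \<le> 3 * norm (g x)" for i
      proof (rule AE_I2)
        fix x assume "x \<in> space ?M"
        then show "norm (norm (g x - s i x)) \<le> 3 * norm (g x)"
          using lim(4)[of x i] norm_triangle_ineq4[of "g x" "s i x"] by simp
      qed
      show "(\<lambda>x. norm (g x - s i x)) \<in> borel_measurable ?M" for i
        by (intro borel_measurable_integrable integrable_norm Bochner_Integration.integrable_diff lim)
    qed auto
    show ?case
    proof (rule LIMSEQ_I)
      fix r :: real assume r: "r > 0"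
      have "(0::real) < r / (2 * (\<bar>C\<bar> + 1))" using r by (simp add: add_nonneg_pos)
      then have "\<forall>\<^sub>F i in sequentially. (\<integral>x. norm (g x - s i x) \<partial>?M) < r / (2 * (\<bar>C\<bar> + 1))"
        using order_tendstoD(2)[OF l1] by simp
      then obtain i where i: "(\<integral>x. norm (g x - s i x) \<partial>?M) < r / (2 * (\<bar>C\<bar> + 1))"
        using eventually_happens'[OF sequentially_bot] by blast
      obtain no where no: "\<And>j. j \<ge> no \<Longrightarrow> norm (\<integral>x. f j x \<bullet> s i x \<partial>?M) < r / 2"
        using LIMSEQ_D[OF lim(2)[of i], of "r / 2"] r by auto
      have "norm ((\<integral>x. f j x \<bullet> g x \<partial>?M) - 0) < r" if "j \<ge> no" for j
      proof -
        have d: "integrable ?M (\<lambda>x. g x - s i x)" using lim by simp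
        have "(\<integral>x. f j x \<bullet> g x \<partial>?M) = (\<integral>x. f j x \<bullet> (g x - s i x) \<partial>?M) + (\<integral>x. f j x \<bullet> s i x \<partial>?M)"
          unfolding inner_diff_right using fb[OF lim(5)] fb[OF lim(1)] by simp
        moreover have "\<bar>C\<bar> * (\<integral>x. norm (g x - s i x) \<partial>?M) \<le> (\<bar>C\<bar> + 1) * (r / (2 * (\<bar>C\<bar> + 1)))"
          using i by (intro mult_mono) auto
        moreover have "(\<bar>C\<bar> + 1) * (r / (2 * (\<bar>C\<bar> + 1))) = r / 2"
        by (rule mult_half_cancel) simp
        moreover have "\<bar>\<integral>x. f j x \<bullet> (g x - s i x) \<partial>?M\<bar> \<le> \<bar>C\<bar> * (\<integral>x. norm (g x - s i x) \<partial>?M)"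
          using fb[OF d, of j] by blast
        ultimately show ?thesis using no[OF that] unfolding real_norm_def diff_0_right by linarith
      qed
      then show "\<exists>no. \<forall>n\<ge>no. norm ((\<integral>x. f n x \<bullet> g x \<partial>?M) - 0) < r" by blast
    qed
  qed
qed

section \<open>Bounded limits of subsolutions\<close>

lemma set_integral_support:
  fixes f :: "'a::euclidean_space \<Rightarrow> 'b::euclidean_space"
  assumes f: "f \<in> borel_measurable lborel" and 0: "\<And>x. x \<notin> U \<Longrightarrow> f x = 0"
  shows "(LINT x:U|lebesgue. f x) = integral\<^sup>L lborel f"
proof -
  have "indicator U x *\<^sub>R f x = f x" for x using 0[of x] by (cases "x \<in> U") auto
  then show ?thesis unfolding set_lebesgue_integral_def by (simp only: integral_completion[OF f])
qed

lemma L_infinityI: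
  fixes f :: "'a::euclidean_space \<Rightarrow> 'b::euclidean_space"
  assumes "f \<in> borel_measurable lborel" "\<And>x. x \<in> U \<Longrightarrow> norm (f x) \<le> C" "U \<in> sets lebesgue"
  shows "L_infinity U f"
  unfolding L_infinity_def
proof (intro conjI exI[of _ C] AE_I2)
  show "f \<in> borel_measurable (lebesgue_on U)"
    by (intro measurable_restrict_space1 measurable_completion assms(1))
  show "norm (f x) \<le> C" if "x \<in> space (lebesgue_on U)" for x
    using that assms(2) by (simp add: space_restrict_space)
qed

lemma bounded_measurable_absolutely_integrable:
  fixes f :: "'a::euclidean_space \<Rightarrow> 'b::euclidean_space"
  assumes f: "f \<in> borel_measurable lborel" and C: "\<And>x. x \<in> K \<Longrightarrow> norm (f x) \<le> C"
    and K: "K \<in> sets borel" "bounded K"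
  shows "f absolutely_integrable_on K"
proof -
  have fin: "emeasure lborel K < \<infinity>" by (rule emeasure_bounded_finite[OF K(2)])
  have "integrable lborel (\<lambda>x. indicator K x *\<^sub>R f x)"
  proof (rule Bochner_Integration.integrable_bound)
    show "integrable lborel (\<lambda>x. indicator K x * \<bar>C\<bar> :: real)"
      using fin K(1) by (intro integrable_mult_left integrable_real_indicator) auto
    show "(\<lambda>x. indicator K x *\<^sub>R f x) \<in> borel_measurable lborel"
      using f K(1) by (intro borel_measurable_scaleR borel_measurable_indicator) auto
    show "AE x in lborel. norm (indicator K x *\<^sub>R f x) \<le> norm (indicator K x * \<bar>C\<bar> :: real)"
    proof (rule AE_I2)
      fix x
      show "norm (indicator K x *\<^sub>R f x) \<le> norm (indicator K x * \<bar>C\<bar> :: real)"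
        using C[of x] by (cases "x \<in> K") auto
    qed
  qed
  then show ?thesis unfolding set_integrable_def by (rule integrable_completion[THEN iffD2, rotated])
    (use f K(1) in \<open>auto intro!: borel_measurable_scaleR borel_measurable_indicator\<close>)
qed

definition affine_map :: "real^'n^'m \<Rightarrow> (real^'n) \<times> real \<Rightarrow> real^'m" where
  "affine_map A x = A *v fst x"

lemma affine_map_has_derivative:
  fixes A b :: "real^'n^'m"
  shows "(affine_map A has_derivative state_deriv (A, 0, b)) (at x)"
proof -
  have "bounded_linear (\<lambda>h::(real^'n) \<times> real. A *v fst h)"
    using bounded_linear_compose[OF matrix_vector_mul_bounded_linear bounded_linear_fst] .
  then have "((\<lambda>x. A *v fst x) has_derivative (\<lambda>h. A *v fst h)) (at x)"
    by (rule bounded_linear_imp_has_derivative)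
  then show ?thesis by (simp add: affine_map_def[abs_def] state_deriv_def[abs_def])
qed

lemma affine_map_continuous: "continuous_on UNIV (affine_map A)"
  using affine_map_has_derivative by (meson continuous_at_imp_continuous_on has_derivative_continuous)

text \<open>What survives of a subsolution under uniform convergence of \<open>w\<close> and bounded pointwise convergence of the states: derivative and conservation law hold weakly.
The affine part with its constant state \<open>(A, 0, b)\<close> is included here.\<close>

definition limit_subsolution ::
  "(real^'n^'m) \<Rightarrow> (real^'n^'m) \<Rightarrow> ((real^'n) \<times> real) set \<Rightarrow> real \<Rightarrow> ((real^'n) \<times> real \<Rightarrow> real^'m) \<Rightarrow>
   ((real^'n) \<times> real \<Rightarrow> ('n, 'm) state) \<Rightarrow> bool" where
  "limit_subsolution A b U B w z \<longleftrightarrow>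
     continuous_on UNIV w \<and> (\<forall>x. x \<notin> U \<longrightarrow> w x = 0) \<and> z \<in> borel_measurable lborel \<and> (\<forall>x. norm (z x) \<le> B) \<and>
     (\<forall>\<phi> e. test_function U \<phi> \<longrightarrow> (\<integral>x. dirderiv e \<phi> x *\<^sub>R (affine_map A x + w x) \<partial>lborel)
        = - (\<integral>x. \<phi> x *\<^sub>R state_deriv ((A, 0, b) + z x) e \<partial>lborel)) \<and>
     (\<forall>\<phi> G i. test_function U \<phi> \<longrightarrow> C1_gradient \<phi> G \<longrightarrow>
        (\<integral>x. G x \<bullet> (- (snd (snd ((A, 0, b) + z x)) $ i), (affine_map A x + w x) $ i) \<partial>lborel) = 0)"

lemma dominated_compact_pairing:
  fixes f :: "nat \<Rightarrow> 'a::euclidean_space \<Rightarrow> 'b::euclidean_space"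
  assumes c: "continuous_on UNIV c" "compact K" "\<And>x. x \<notin> K \<Longrightarrow> c x = (0::real)"
    and f: "\<And>k. f k \<in> borel_measurable lborel" "g \<in> borel_measurable lborel"
      "\<And>k x. x \<in> K \<Longrightarrow> norm (f k x) \<le> C"
    and lim: "AE x in lborel. (\<lambda>k. f k x) \<longlonglongrightarrow> g x"
  shows "(\<lambda>k. \<integral>x. c x *\<^sub>R f k x \<partial>lborel) \<longlonglongrightarrow> (\<integral>x. c x *\<^sub>R g x \<partial>lborel)"
proof (rule integral_dominated_convergence[where w="\<lambda>x. \<bar>c x\<bar> * \<bar>C\<bar>"])
  have cm: "c \<in> borel_measurable lborel" using c(1) by (simp add: borel_measurable_continuous_onI)
  show "(\<lambda>x. c x *\<^sub>R g x) \<in> borel_measurable lborel" "(\<lambda>x. c x *\<^sub>R f k x) \<in> borel_measurable lborel" for k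
    using cm f by (auto intro!: borel_measurable_scaleR)
  show "integrable lborel (\<lambda>x. \<bar>c x\<bar> * \<bar>C\<bar>)"
    by (intro integrable_mult_left integrable_abs integrable_compact_support[OF c])
  show "AE x in lborel. (\<lambda>k. c x *\<^sub>R f k x) \<longlonglongrightarrow> c x *\<^sub>R g x"
    using lim by eventually_elim (intro tendsto_scaleR tendsto_const)
  show "AE x in lborel. norm (c x *\<^sub>R f k x) \<le> \<bar>c x\<bar> * \<bar>C\<bar>" for k
  proof (rule AE_I2)
    fix x
    show "norm (c x *\<^sub>R f k x) \<le> \<bar>c x\<bar> * \<bar>C\<bar>"
    proof (cases "x \<in> K")
      case True
      then show ?thesis using f(3)[OF True, of k] unfolding norm_scaleR by (intro mult_left_mono) auto
    qed (use c(3) in simp)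
  qed
qed

lemma limit_subsolution_of_pert:
  fixes w :: "(real^'n) \<times> real \<Rightarrow> real^'m"
  assumes p: "subsolution_pert U w z" and B: "\<And>x. norm (z x) \<le> B"
  shows "limit_subsolution A b U B w z"
  unfolding limit_subsolution_def
proof (intro conjI allI impI)
  show "continuous_on UNIV w" by (rule subsolution_pertD(4)[OF p])
  show "w x = 0" if "x \<notin> U" for x by (rule subsolution_pert_outside(1)[OF p that])
  show "z \<in> borel_measurable lborel" using subsolution_pertD(2)[OF p] by (simp add: borel_measurable_continuous_onI)
  show "norm (z x) \<le> B" for x by (rule B)
  fix \<phi> assume \<phi>: "test_function U \<phi>"
  obtain K where K: "compact K" "\<And>x. x \<notin> K \<Longrightarrow> \<phi> x = 0" using test_functionD(4)[OF \<phi>] by blast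
  have der: "((\<lambda>x. affine_map A x + w x) has_derivative state_deriv ((A, 0, b) + z x)) (at x)" for x
    unfolding state_deriv_add[abs_def]
    by (intro has_derivative_add affine_map_has_derivative subsolution_pertD(3)[OF p])
  have cs: "continuous_on UNIV (\<lambda>x. state_deriv ((A, 0, b) + z x) e)" for e
    using linear_state_deriv_left[of e] linear_conv_bounded_linear
    by (intro bounded_linear.continuous_on[of "\<lambda>z. state_deriv z e"] continuous_on_add continuous_on_const
        subsolution_pertD(2)[OF p]) blast
  show "(\<integral>x. dirderiv e \<phi> x *\<^sub>R (affine_map A x + w x) \<partial>lborel)
        = - (\<integral>x. \<phi> x *\<^sub>R state_deriv ((A, 0, b) + z x) e \<partial>lborel)" for e
    by (rule integral_by_parts_compact_support(3)[where f'="\<lambda>x h. dirderiv h \<phi> x" and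
          g'="\<lambda>x. state_deriv ((A, 0, b) + z x)", OF test_function_has_derivative[OF \<phi>] _ der cs K])
      (rule test_functionD(2)[OF \<phi>])
  fix G i assume G: "C1_gradient \<phi> G"
  have Ge: "G x \<bullet> e = dirderiv e \<phi> x" for x e
  proof -
    have "(\<phi> has_derivative (\<lambda>h. G x \<bullet> h)) (at x)" using G by (simp add: C1_gradient_def)
    from dirderiv_eqI[OF this] show ?thesis by simp
  qed
  have cG: "continuous_on UNIV G" using G by (simp add: C1_gradient_def)
  have split: "G x \<bullet> (- (snd (snd ((A, 0, b) + z x)) $ i), (affine_map A x + w x) $ i) =
      G x \<bullet> (- (snd (snd (z x)) $ i), w x $ i) +
      (dirderiv (- (b $ i), 0) \<phi> x + dirderiv (0, 1) \<phi> x * (affine_map A x $ i))" for x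
  proof -
    have "(- (snd (snd ((A, 0, b) + z x)) $ i), (affine_map A x + w x) $ i) =
        (- (snd (snd (z x)) $ i), w x $ i) + ((- (b $ i), 0) + (affine_map A x $ i) *\<^sub>R (0, 1))"
      by (simp add: algebra_simps)
    then show ?thesis by (simp only: inner_add_right inner_scaleR_right Ge) simp
  qed
  have i1: "integrable lborel (\<lambda>x. G x \<bullet> (- (snd (snd (z x)) $ i), w x $ i))"
    by (rule subsolution_pert_integrable_pairing[OF p cG])
  have i2: "integrable lborel (dirderiv (- (b $ i), 0) \<phi>)" "(\<integral>x. dirderiv (- (b $ i), 0) \<phi> x \<partial>lborel) = 0"
    using integral_derivative_compact_support[where f'="\<lambda>x h. dirderiv h \<phi> x", OF test_function_has_derivative[OF \<phi>] _ K]
      test_functionD(2)[OF \<phi>] by blast+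
  have dA: "((\<lambda>x. affine_map A x $ i) has_derivative (\<lambda>h. state_deriv (A, 0, b) h $ i)) (at x)" for x
    by (rule bounded_linear.has_derivative[OF bounded_linear_vec_nth affine_map_has_derivative])
  have A0: "state_deriv (A, 0, b) (0, 1) $ i = 0" by (simp add: state_deriv_def)
  have i3: "integrable lborel (\<lambda>x. dirderiv (0, 1) \<phi> x *\<^sub>R (affine_map A x $ i))"
    "(\<integral>x. dirderiv (0, 1) \<phi> x *\<^sub>R (affine_map A x $ i) \<partial>lborel) = - (\<integral>x. \<phi> x *\<^sub>R (state_deriv (A, 0, b) (0, 1) $ i) \<partial>lborel)"
    using integral_by_parts_compact_support[where f'="\<lambda>x h. dirderiv h \<phi> x" and
        g'="\<lambda>x h. state_deriv (A, 0, b) h $ i" and e="(0, 1)", OF test_function_has_derivative[OF \<phi>] _ dA continuous_on_const K(1,2)]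
      test_functionD(2)[OF \<phi>] by blast+
  show "(\<integral>x. G x \<bullet> (- (snd (snd ((A, 0, b) + z x)) $ i), (affine_map A x + w x) $ i) \<partial>lborel) = 0"
    unfolding split using i1 i2 i3 A0 subsolution_pertD(5)[OF p G, of i] by simp
qed

text \<open>Against a test function both identities are integrals over a fixed compact set, and dominated convergence applies.\<close>

lemma limit_subsolution_limit:
  fixes w :: "(real^'n) \<times> real \<Rightarrow> real^'m"
  assumes ls: "\<And>k. limit_subsolution A b U B (wk k) (zk k)"
    and z: "z \<in> borel_measurable lborel" "\<And>x. norm (z x) \<le> B" "AE x in lborel. (\<lambda>k. zk k x) \<longlonglongrightarrow> z x"
    and w: "uniform_limit UNIV wk w sequentially" "\<And>k x. norm (wk k x) \<le> C"
  shows "limit_subsolution A b U B w z"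
  unfolding limit_subsolution_def
proof (intro conjI allI impI z)
  have wl: "(\<lambda>k. wk k x) \<longlonglongrightarrow> w x" for x by (rule tendsto_uniform_limitI[OF w(1) UNIV_I])
  have cwk: "continuous_on UNIV (wk k)" for k using ls by (simp add: limit_subsolution_def)
  show cw: "continuous_on UNIV w"
    by (rule uniform_limit_theorem[OF _ w(1)]) (simp_all add: cwk)
  show "w x = 0" if "x \<notin> U" for x
  proof -
    have "wk k x = 0" for k using ls[of k] that by (simp add: limit_subsolution_def)
    then show ?thesis using wl[of x] by (simp add: LIMSEQ_const_iff)
  qed
  have zkm: "zk k \<in> borel_measurable lborel" "norm (zk k x) \<le> B" for k x
    using ls[of k] by (simp_all add: limit_subsolution_def)
  fix \<phi> assume \<phi>: "test_function U \<phi>"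
  obtain K where K: "compact K" "\<And>x. x \<notin> K \<Longrightarrow> \<phi> x = 0" "\<And>x e. x \<notin> K \<Longrightarrow> dirderiv e \<phi> x = 0"
    using test_functionD(4)[OF \<phi>] by blast
  have cA: "continuous_on UNIV (affine_map A)" by (rule affine_map_continuous)
  have "compact (affine_map A ` K)"
    using cA K(1) compact_continuous_image continuous_on_subset by blast
  then obtain C1 where C1: "\<And>x. x \<in> K \<Longrightarrow> norm (affine_map A x) \<le> C1"
    using compact_imp_bounded[THEN bounded_iff[THEN iffD1]] by (metis imageI)
  have Awm: "(\<lambda>x. affine_map A x + wk k x) \<in> borel_measurable lborel" "(\<lambda>x. affine_map A x + w x) \<in> borel_measurable lborel" for k
    using cA cwk cw by (simp_all add: borel_measurable_continuous_onI continuous_on_add)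
  have Awb: "norm (affine_map A x + wk k x) \<le> C1 + C" if "x \<in> K" for k x
    by (intro norm_triangle_le add_mono C1 w(2) that)
  have bl: "bounded_linear (\<lambda>z. state_deriv z e)" for e :: "(real^'n) \<times> real"
    using linear_state_deriv_left linear_conv_bounded_linear by blast
  have sm: "(\<lambda>x. state_deriv ((A, 0, b) + z x) e) \<in> borel_measurable lborel" if "z \<in> borel_measurable lborel" for z :: "(real^'n) \<times> real \<Rightarrow> ('n, 'm) state" and e
    using measurable_compose[OF borel_measurable_add[OF borel_measurable_const that]
        borel_measurable_continuous_onI[OF linear_continuous_on[OF bl]]] by simp
  show "(\<integral>x. dirderiv e \<phi> x *\<^sub>R (affine_map A x + w x) \<partial>lborel)
        = - (\<integral>x. \<phi> x *\<^sub>R state_deriv ((A, 0, b) + z x) e \<partial>lborel)" for e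
  proof -
    have l1: "(\<lambda>k. \<integral>x. dirderiv e \<phi> x *\<^sub>R (affine_map A x + wk k x) \<partial>lborel)
        \<longlonglongrightarrow> (\<integral>x. dirderiv e \<phi> x *\<^sub>R (affine_map A x + w x) \<partial>lborel)"
      by (rule dominated_compact_pairing[OF test_functionD(2)[OF \<phi>] K(1,3) Awm Awb])
        (auto intro!: AE_I2 tendsto_add wl)
    obtain M where M: "\<And>z :: ('n, 'm) state. norm (state_deriv z e) \<le> norm z * M"
      using bounded_linear.bounded[OF bl[of e]] by blast
    have l2: "(\<lambda>k. \<integral>x. \<phi> x *\<^sub>R state_deriv ((A, 0, b) + zk k x) e \<partial>lborel)
        \<longlonglongrightarrow> (\<integral>x. \<phi> x *\<^sub>R state_deriv ((A, 0, b) + z x) e \<partial>lborel)"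
    proof (rule dominated_compact_pairing[OF test_functionD(3)[OF \<phi>] K(1,2) sm[OF zkm(1)] sm[OF z(1)]])
      fix k x
      have "norm ((A, 0, b) + zk k x) * M \<le> (norm (A, 0::real^'m, b) + B) * \<bar>M\<bar>"
      proof -
        have "norm ((A, 0, b) + zk k x) \<le> norm (A, 0::real^'m, b) + B"
          by (intro norm_triangle_le add_mono zkm(2) order_refl)
        then have "norm ((A, 0, b) + zk k x) * \<bar>M\<bar> \<le> (norm (A, 0::real^'m, b) + B) * \<bar>M\<bar>"
          by (intro mult_right_mono) auto
        moreover have "norm ((A, 0, b) + zk k x) * M \<le> norm ((A, 0, b) + zk k x) * \<bar>M\<bar>"
          by (intro mult_left_mono) auto
        ultimately show ?thesis by linarith
      qed
      then show "norm (state_deriv ((A, 0, b) + zk k x) e) \<le> (norm (A, 0::real^'m, b) + B) * \<bar>M\<bar>"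
        by (rule order_trans[OF M])
    next
      show "AE x in lborel. (\<lambda>k. state_deriv ((A, 0, b) + zk k x) e) \<longlonglongrightarrow> state_deriv ((A, 0, b) + z x) e"
        using z(3)
      proof eventually_elim
        case (elim x)
        show ?case by (intro bounded_linear.tendsto[OF bl] tendsto_add tendsto_const elim)
      qed
    qed
    have "(\<integral>x. dirderiv e \<phi> x *\<^sub>R (affine_map A x + wk k x) \<partial>lborel)
        = - (\<integral>x. \<phi> x *\<^sub>R state_deriv ((A, 0, b) + zk k x) e \<partial>lborel)" for k
      using ls[of k] \<phi> by (simp add: limit_subsolution_def)
    with l1 have "(\<lambda>k. - (\<integral>x. \<phi> x *\<^sub>R state_deriv ((A, 0, b) + zk k x) e \<partial>lborel))
        \<longlonglongrightarrow> (\<integral>x. dirderiv e \<phi> x *\<^sub>R (affine_map A x + w x) \<partial>lborel)" by simp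
    then show ?thesis using tendsto_minus[OF l2] LIMSEQ_unique by blast
  qed
  fix G i assume G: "C1_gradient \<phi> G"
  have Ge: "G x \<bullet> e = dirderiv e \<phi> x" for x e
  proof -
    have "(\<phi> has_derivative (\<lambda>h. G x \<bullet> h)) (at x)" using G by (simp add: C1_gradient_def)
    from dirderiv_eqI[OF this] show ?thesis by simp
  qed
  have cG: "continuous_on UNIV (\<lambda>x. norm (G x))" using G by (simp add: C1_gradient_def continuous_on_norm)
  have G0: "norm (G x) = 0" if "x \<notin> K" for x
    using Ge[of x "G x"] K(3)[OF that] by simp
  \<comment> \<open>components along a basis reduce the pairing to scalar products\<close>
  have ex: "G x \<bullet> v = (\<Sum>e\<in>Basis. dirderiv e \<phi> x *\<^sub>R (v \<bullet> e))" for x v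
    by (subst euclidean_inner) (simp add: Ge)
  define F where "F k x = (- (snd (snd ((A, 0, b) + zk k x)) $ i), (affine_map A x + wk k x) $ i)" for k x
  define H where "H x = (- (snd (snd ((A, 0, b) + z x)) $ i), (affine_map A x + w x) $ i)" for x
  define pr where "pr Z v = (- (snd (snd Z) $ i), v $ i)" for Z :: "('n, 'm) state" and v :: "real^'m"
  have bpr: "bounded_linear (\<lambda>p. pr (fst p) (snd p))"
    unfolding pr_def
    by (intro bounded_linear_Pair bounded_linear_minus
        bounded_linear_compose[OF bounded_linear_vec_nth] bounded_linear_compose[OF bounded_linear_snd]
        bounded_linear_fst bounded_linear_snd)
  have Fpr: "F k x = pr (fst ((A, 0, b) + zk k x, affine_map A x + wk k x)) (snd ((A, 0, b) + zk k x, affine_map A x + wk k x))"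
    and Hpr: "H x = pr (fst ((A, 0, b) + z x, affine_map A x + w x)) (snd ((A, 0, b) + z x, affine_map A x + w x))" for k x
    by (simp_all add: F_def H_def pr_def)
  obtain M where M: "M > 0" "\<And>p :: ('n, 'm) state \<times> (real^'m). norm (pr (fst p) (snd p)) \<le> norm p * M"
    using bounded_linear.pos_bounded[OF bpr] by blast
  have prm: "(\<lambda>x. pr (fst (f x)) (snd (f x))) \<in> borel_measurable lborel" if "f \<in> borel_measurable lborel"
    for f :: "(real^'n) \<times> real \<Rightarrow> ('n, 'm) state \<times> (real^'m)"
    using measurable_compose[OF that borel_measurable_continuous_onI[OF linear_continuous_on[OF bpr]]] by simp
  have Fm: "F k \<in> borel_measurable lborel" for k
    unfolding Fpr[abs_def]
    by (intro prm borel_measurable_Pair borel_measurable_add borel_measurable_const zkm Awm[unfolded borel_measurable_add])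
       (use cA cwk in \<open>simp_all add: borel_measurable_continuous_onI\<close>)
  have Hm: "H \<in> borel_measurable lborel"
    unfolding Hpr[abs_def]
    by (intro prm borel_measurable_Pair borel_measurable_add borel_measurable_const z)
       (use cA cw in \<open>simp_all add: borel_measurable_continuous_onI\<close>)
  have Fb: "norm (F k x) \<le> ((norm (A, 0::real^'m, b) + B) + (C1 + C)) * M" if "x \<in> K" for k x
  proof -
    have "norm ((A, 0, b) + zk k x, affine_map A x + wk k x) \<le> (norm (A, 0::real^'m, b) + B) + (C1 + C)"
      by (rule order_trans[OF norm_Pair_le add_mono])
        (intro norm_triangle_le add_mono zkm(2) order_refl, rule Awb[OF that])
    from mult_right_mono[OF this less_imp_le[OF M(1)]] M(2)[of "((A, 0, b) + zk k x, affine_map A x + wk k x)"]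
    show ?thesis unfolding Fpr by (rule order_trans[rotated])
  qed
  have Fl: "AE x in lborel. (\<lambda>k. F k x) \<longlonglongrightarrow> H x"
    using z(3)
  proof eventually_elim
    case (elim x)
    show ?case unfolding Fpr Hpr
      by (intro bounded_linear.tendsto[OF bpr] tendsto_Pair tendsto_add tendsto_const elim wl)
  qed
  have lim: "(\<lambda>k. \<integral>x. dirderiv e \<phi> x *\<^sub>R (F k x \<bullet> e) \<partial>lborel) \<longlonglongrightarrow> (\<integral>x. dirderiv e \<phi> x *\<^sub>R (H x \<bullet> e) \<partial>lborel)"
    if "e \<in> Basis" for e
  proof (rule dominated_compact_pairing[OF test_functionD(2)[OF \<phi>] K(1,3)])
    show "(\<lambda>x. F k x \<bullet> e) \<in> borel_measurable lborel" "(\<lambda>x. H x \<bullet> e) \<in> borel_measurable lborel" for k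
      using Fm Hm by (auto intro!: borel_measurable_inner)
    show "norm (F k x \<bullet> e) \<le> ((norm (A, 0::real^'m, b) + B) + (C1 + C)) * M" if "x \<in> K" for k x
      using Basis_le_norm[OF \<open>e \<in> Basis\<close>, of "F k x"] Fb[OF that, of k] by simp
    show "AE x in lborel. (\<lambda>k. F k x \<bullet> e) \<longlonglongrightarrow> H x \<bullet> e"
      using Fl by eventually_elim (intro tendsto_inner tendsto_const)
  qed
  have int: "integrable lborel (\<lambda>x. dirderiv e \<phi> x *\<^sub>R (f x \<bullet> e))" if "e \<in> Basis" "f \<in> borel_measurable lborel"
      "\<And>x. x \<in> K \<Longrightarrow> norm (f x) \<le> Q" for e f Q
  proof (rule Bochner_Integration.integrable_bound)
    show "integrable lborel (\<lambda>x. \<bar>dirderiv e \<phi> x\<bar> * \<bar>Q\<bar>)"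
      by (intro integrable_mult_left integrable_abs integrable_compact_support[OF test_functionD(2)[OF \<phi>] K(1,3)])
    show "(\<lambda>x. dirderiv e \<phi> x *\<^sub>R (f x \<bullet> e)) \<in> borel_measurable lborel"
      using that(2) test_functionD(2)[OF \<phi>]
      by (intro borel_measurable_scaleR borel_measurable_inner) (auto simp: borel_measurable_continuous_onI)
    show "AE x in lborel. norm (dirderiv e \<phi> x *\<^sub>R (f x \<bullet> e)) \<le> norm (\<bar>dirderiv e \<phi> x\<bar> * \<bar>Q\<bar>)"
    proof (rule AE_I2)
      fix x
      show "norm (dirderiv e \<phi> x *\<^sub>R (f x \<bullet> e)) \<le> norm (\<bar>dirderiv e \<phi> x\<bar> * \<bar>Q\<bar>)"
      proof (cases "x \<in> K")
        case True
        have "\<bar>f x \<bullet> e\<bar> \<le> \<bar>Q\<bar>" using Basis_le_norm[OF that(1), of "f x"] that(3)[OF True] by linarith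
        then have "\<bar>dirderiv e \<phi> x\<bar> * \<bar>f x \<bullet> e\<bar> \<le> \<bar>dirderiv e \<phi> x\<bar> * \<bar>Q\<bar>" by (intro mult_left_mono) auto
        then show ?thesis by (simp add: abs_mult)
      qed (simp add: K(3))
    qed
  qed
  have Hb: "norm (H x) \<le> ((norm (A, 0::real^'m, b) + B) + (C1 + C)) * M" if "x \<in> K" for x
  proof -
    have "norm (w x) \<le> C" by (rule LIMSEQ_le_const2[OF tendsto_norm[OF wl]]) (use w(2) in blast)
    then have "norm ((A, 0, b) + z x, affine_map A x + w x) \<le> (norm (A, 0::real^'m, b) + B) + (C1 + C)"
      by (intro order_trans[OF norm_Pair_le add_mono] norm_triangle_le add_mono z(2) order_refl C1[OF that])
    from mult_right_mono[OF this less_imp_le[OF M(1)]] M(2)[of "((A, 0, b) + z x, affine_map A x + w x)"]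
    show ?thesis unfolding Hpr by (rule order_trans[rotated])
  qed
  have eqk: "(\<Sum>e\<in>Basis. \<integral>x. dirderiv e \<phi> x *\<^sub>R (F k x \<bullet> e) \<partial>lborel) = 0" for k
  proof -
    have "(\<integral>x. G x \<bullet> F k x \<partial>lborel) = 0"
      using ls[of k] \<phi> G by (simp only: limit_subsolution_def F_def)
    then show ?thesis
      unfolding ex using int[OF _ Fm Fb] by (subst (asm) Bochner_Integration.integral_sum) auto
  qed
  have "(\<lambda>k. \<Sum>e\<in>Basis. \<integral>x. dirderiv e \<phi> x *\<^sub>R (F k x \<bullet> e) \<partial>lborel)
      \<longlonglongrightarrow> (\<Sum>e\<in>Basis. \<integral>x. dirderiv e \<phi> x *\<^sub>R (H x \<bullet> e) \<partial>lborel)"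
    by (intro tendsto_sum lim)
  then have "(\<Sum>e\<in>Basis. \<integral>x. dirderiv e \<phi> x *\<^sub>R (H x \<bullet> e) \<partial>lborel) = 0"
    unfolding eqk by (simp add: LIMSEQ_const_iff)
  moreover have "(\<integral>x. G x \<bullet> H x \<partial>lborel) = (\<Sum>e\<in>Basis. \<integral>x. dirderiv e \<phi> x *\<^sub>R (H x \<bullet> e) \<partial>lborel)"
    unfolding ex using int[OF _ Hm Hb] by (subst Bochner_Integration.integral_sum) auto
  ultimately show "(\<integral>x. G x \<bullet> (- (snd (snd ((A, 0, b) + z x)) $ i), (affine_map A x + w x) $ i) \<partial>lborel) = 0"
    by (simp only: H_def)
qed

section \<open>Sobolev regularity, traces and weak* convergence\<close>

lemma bounded_linear_state_deriv: "bounded_linear (\<lambda>z :: ('n::finite, 'm::finite) state. state_deriv z e)"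
  using linear_state_deriv_left linear_conv_bounded_linear by blast

lemma state_deriv_measurable:
  fixes z :: "'a::euclidean_space \<Rightarrow> ('n::finite, 'm::finite) state"
  assumes "z \<in> borel_measurable lborel"
  shows "(\<lambda>x. state_deriv (\<xi> + z x) e) \<in> borel_measurable lborel"
  using measurable_compose[OF borel_measurable_add[OF borel_measurable_const assms]
        borel_measurable_continuous_onI[OF linear_continuous_on[OF bounded_linear_state_deriv]]] by simp

lemma state_deriv_bound:
  fixes \<xi> :: "('n::finite, 'm::finite) state"
  obtains Q where "Q > 0" "\<And>v. norm v \<le> B \<Longrightarrow> norm (state_deriv (\<xi> + v) e) \<le> Q"
proof -
  obtain M where M: "M > 0" "\<And>z :: ('n, 'm) state. norm (state_deriv z e) \<le> norm z * M"
    using bounded_linear.pos_bounded[OF bounded_linear_state_deriv[of e]] by blast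
  have "norm (state_deriv (\<xi> + v) e) \<le> (norm \<xi> + \<bar>B\<bar>) * M + 1" if "norm v \<le> B" for v
  proof -
    have "norm (\<xi> + v) \<le> norm \<xi> + \<bar>B\<bar>" using that by (intro norm_triangle_le add_mono) auto
    from mult_right_mono[OF this less_imp_le[OF M(1)]] M(2)[of "\<xi> + v"] show ?thesis by linarith
  qed
  moreover have "(norm \<xi> + \<bar>B\<bar>) * M + 1 > 0" using M(1) by (intro add_nonneg_pos mult_nonneg_nonneg) auto
  ultimately show ?thesis using that by blast
qed

context
  fixes A b :: "real^'n^'m" and U :: "((real^'n) \<times> real) set" and B :: real
  assumes U: "open U" "bounded U"
begin

lemma sets_U: "U \<in> sets lebesgue" "U \<in> sets borel" using U(1) by simp_all

lemma continuous_bounded_on_U: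
  fixes f :: "(real^'n) \<times> real \<Rightarrow> 'b::euclidean_space"
  assumes "continuous_on UNIV f"
  obtains C where "C > 0" "\<And>x. x \<in> closure U \<Longrightarrow> norm (f x) \<le> C"
proof -
  have "compact (f ` closure U)"
    using assms U(2) by (intro compact_continuous_image) (auto intro: continuous_on_subset simp: compact_closure)
  then obtain C where "C > 0" "\<And>y. y \<in> f ` closure U \<Longrightarrow> norm y \<le> C"
    using compact_imp_bounded bounded_pos by metis
  then show ?thesis using that by blast
qed

lemma limit_has_weak_deriv:
  assumes ls: "limit_subsolution A b U B w z"
  shows "has_weak_deriv U (\<lambda>x. affine_map A x + w x) e (\<lambda>x. state_deriv ((A, 0, b) + z x) e)"
  unfolding has_weak_deriv_def
proof (intro conjI allI impI)
  have cu: "continuous_on UNIV (\<lambda>x. affine_map A x + w x)"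
    using ls by (auto simp: limit_subsolution_def intro!: continuous_on_add affine_map_continuous)
  have um: "(\<lambda>x. affine_map A x + w x) \<in> borel_measurable lborel"
    using cu by (simp add: borel_measurable_continuous_onI)
  have vm: "(\<lambda>x. state_deriv ((A, 0, b) + z x) e) \<in> borel_measurable lborel"
    using ls by (intro state_deriv_measurable) (simp add: limit_subsolution_def)
  show "L1_loc U (\<lambda>x. affine_map A x + w x)"
    unfolding L1_loc_def
  proof (intro allI impI)
    fix K assume K: "compact K \<and> K \<subseteq> U"
    obtain C where "C > 0" and C: "\<And>x. x \<in> closure U \<Longrightarrow> norm (affine_map A x + w x) \<le> C"
      using continuous_bounded_on_U[OF cu] by blast
    show "(\<lambda>x. affine_map A x + w x) absolutely_integrable_on K"
      by (rule bounded_measurable_absolutely_integrable[OF um C])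
        (use K closure_subset in \<open>auto simp: borel_compact compact_imp_bounded\<close>)
  qed
  show "L1_loc U (\<lambda>x. state_deriv ((A, 0, b) + z x) e)"
    unfolding L1_loc_def
  proof (intro allI impI)
    fix K assume K: "compact K \<and> K \<subseteq> U"
    obtain Q where Q: "Q > 0" "\<And>v. norm v \<le> B \<Longrightarrow> norm (state_deriv ((A, 0, b) + v) e) \<le> Q"
      using state_deriv_bound[of B "(A, 0, b)" e] by blast
    show "(\<lambda>x. state_deriv ((A, 0, b) + z x) e) absolutely_integrable_on K"
      by (rule bounded_measurable_absolutely_integrable[OF vm Q(2)])
        (use K ls in \<open>auto simp: borel_compact compact_imp_bounded limit_subsolution_def\<close>)
  qed
  fix \<phi> assume \<phi>: "test_function U \<phi>"
  obtain K where K: "K \<subseteq> U" "\<And>x. x \<notin> K \<Longrightarrow> \<phi> x = 0" "\<And>x e. x \<notin> K \<Longrightarrow> dirderiv e \<phi> x = 0"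
    using test_functionD(4)[OF \<phi>] by blast
  have K': "\<phi> x = 0" "dirderiv e \<phi> x = 0" if "x \<notin> U" for x
    using K(2,3)[of x] K(1) that by blast+
  have m: "\<phi> \<in> borel_measurable lborel" "dirderiv e \<phi> \<in> borel_measurable lborel"
    using test_functionD(2,3)[OF \<phi>] by (auto simp: borel_measurable_continuous_onI)
  have "(LINT x:U|lebesgue. dirderiv e \<phi> x *\<^sub>R (affine_map A x + w x))
      = (\<integral>x. dirderiv e \<phi> x *\<^sub>R (affine_map A x + w x) \<partial>lborel)"
    by (rule set_integral_support[OF borel_measurable_scaleR[OF m(2) um]]) (simp add: K')
  moreover have "(LINT x:U|lebesgue. \<phi> x *\<^sub>R state_deriv ((A, 0, b) + z x) e)
      = (\<integral>x. \<phi> x *\<^sub>R state_deriv ((A, 0, b) + z x) e \<partial>lborel)"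
    by (rule set_integral_support[OF borel_measurable_scaleR[OF m(1) vm]]) (simp add: K')
  ultimately show "(LINT x:U|lebesgue. frechet_derivative \<phi> (at x) e *\<^sub>R (affine_map A x + w x))
      = - (LINT x:U|lebesgue. \<phi> x *\<^sub>R state_deriv ((A, 0, b) + z x) e)"
    using ls \<phi> by (simp add: limit_subsolution_def dirderiv_def)
qed

lemma limit_weak_deriv_eq:
  assumes ls: "limit_subsolution A b U B w z"
  shows "AE x in lebesgue. x \<in> U \<longrightarrow>
    weak_deriv U (\<lambda>x. affine_map A x + w x) e x = state_deriv ((A, 0, b) + z x) e"
proof (rule weak_deriv_unique[OF U(1)])
  show "has_weak_deriv U (\<lambda>x. affine_map A x + w x) e (weak_deriv U (\<lambda>x. affine_map A x + w x) e)"
    unfolding weak_deriv_def by (rule someI[of "has_weak_deriv U _ e", OF limit_has_weak_deriv[OF ls]])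
qed (rule limit_has_weak_deriv[OF ls])

lemma limit_Sobolev:
  assumes ls: "limit_subsolution A b U B w z"
  shows "W1_infinity U (\<lambda>x. affine_map A x + w x)" "W11 U (\<lambda>x. affine_map A x + w x)"
    "W11_loc U (\<lambda>x. affine_map A x + w x)"
proof -
  have cu: "continuous_on UNIV (\<lambda>x. affine_map A x + w x)"
    using ls by (auto simp: limit_subsolution_def intro!: continuous_on_add affine_map_continuous)
  have um: "(\<lambda>x. affine_map A x + w x) \<in> borel_measurable lborel"
    using cu by (simp add: borel_measurable_continuous_onI)
  have vm: "(\<lambda>x. state_deriv ((A, 0, b) + z x) e) \<in> borel_measurable lborel" for e
    using ls by (intro state_deriv_measurable) (simp add: limit_subsolution_def)
  have zB: "norm (z x) \<le> B" for x using ls by (simp add: limit_subsolution_def)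
  obtain C where "C > 0" and C: "\<And>x. x \<in> closure U \<Longrightarrow> norm (affine_map A x + w x) \<le> C"
    using continuous_bounded_on_U[OF cu] by blast
  have C': "norm (affine_map A x + w x) \<le> C" if "x \<in> U" for x
    by (rule C) (use that closure_subset in blast)
  have Qe: "\<exists>Q. \<forall>x. norm (state_deriv ((A, 0, b) + z x) e) \<le> Q" for e
    by (rule state_deriv_bound[of B "(A, 0, b)" e]) (use zB in blast)
  have wd: "has_weak_deriv U (\<lambda>x. affine_map A x + w x) e (\<lambda>x. state_deriv ((A, 0, b) + z x) e)" for e
    by (rule limit_has_weak_deriv[OF ls])
  have Li: "L_infinity U (\<lambda>x. state_deriv ((A, 0, b) + z x) e)" for e
    using Qe[of e] L_infinityI[OF vm _ sets_U(1)] by blast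
  have ai: "(\<lambda>x. state_deriv ((A, 0, b) + z x) e) absolutely_integrable_on U" for e
    using Qe[of e] bounded_measurable_absolutely_integrable[OF vm _ sets_U(2) U(2)] by blast
  show "W1_infinity U (\<lambda>x. affine_map A x + w x)"
    unfolding W1_infinity_def using L_infinityI[OF um C' sets_U(1)] wd Li by blast
  show "W11 U (\<lambda>x. affine_map A x + w x)"
    unfolding W11_def using bounded_measurable_absolutely_integrable[OF um C' sets_U(2) U(2)] wd ai by blast
  show "W11_loc U (\<lambda>x. affine_map A x + w x)"
    unfolding W11_loc_def using wd wd[unfolded has_weak_deriv_def] by blast
qed

lemma W11_norm_zero: "W11_norm U (\<lambda>x. 0 :: real^'m) = 0"
proof -
  have wd: "has_weak_deriv U (\<lambda>x. 0 :: real^'m) e (\<lambda>x. 0)" for e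
    by (simp add: has_weak_deriv_def L1_loc_def set_lebesgue_integral_def)
  have "(LINT x:U|lebesgue. norm (weak_deriv U (\<lambda>x. 0 :: real^'m) e x)) = 0" for e
  proof -
    have "AE x in lebesgue. x \<in> U \<longrightarrow> weak_deriv U (\<lambda>x. 0 :: real^'m) e x = 0"
      by (rule weak_deriv_unique[OF U(1) _ wd[of e]])
        (unfold weak_deriv_def, rule someI[of "has_weak_deriv U _ e", OF wd])
    then have "AE x in lebesgue. indicator U x *\<^sub>R norm (weak_deriv U (\<lambda>x. 0 :: real^'m) e x) = 0"
    proof eventually_elim
      case (elim x)
      then show ?case by (cases "x \<in> U") simp_all
    qed
    then show ?thesis unfolding set_lebesgue_integral_def by (rule integral_eq_zero_AE)
  qed
  then show ?thesis by (simp add: W11_norm_def set_lebesgue_integral_def)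
qed

text \<open>The function is continuous up to the boundary, so that the constant sequence witnesses its trace, and \<open>w\<close> vanishes outside of \<open>U\<close>.\<close>

lemma limit_trace:
  assumes ls: "limit_subsolution A b U B w z" and \<Gamma>: "\<And>x. x \<in> \<Gamma> \<Longrightarrow> x \<notin> U \<and> f x = affine_map A x"
  shows "trace_eq_on U \<Gamma> (\<lambda>x. affine_map A x + w x) f"
proof -
  let ?u = "\<lambda>x. affine_map A x + w x"
  have cu: "continuous_on UNIV ?u"
    using ls by (auto simp: limit_subsolution_def intro!: continuous_on_add affine_map_continuous)
  have "has_trace U ?u ?u"
    unfolding has_trace_def
  proof (intro conjI limit_Sobolev[OF ls] exI[of _ "\<lambda>k. ?u"] allI)
    show "?u \<in> borel_measurable (restrict_space borel (frontier U))"
      by (intro measurable_restrict_space1 borel_measurable_continuous_onI cu)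
    show "continuous_on (closure U) ?u" by (rule continuous_on_subset[OF cu]) simp
    show "(\<lambda>k. W11_norm U (\<lambda>x. ?u x - ?u x)) \<longlonglongrightarrow> 0" by (simp add: W11_norm_zero)
    show "(\<lambda>k. \<integral>\<^sup>+x\<in>frontier U. ennreal (norm (?u x - ?u x)) \<partial>hausdorff_measure (DIM((real^'n) \<times> real) - 1)) \<longlonglongrightarrow> 0"
      by simp
  qed
  moreover have "?u x = f x" if "x \<in> \<Gamma>" for x
    using ls \<Gamma>[OF that] by (simp add: limit_subsolution_def)
  ultimately show ?thesis unfolding trace_eq_on_def by (intro exI[of _ ?u] conjI AE_I2 impI)
qed

lemma spatial_jacobian_limit:
  assumes ls: "limit_subsolution A b U B w z"
  shows "AE x in lebesgue. x \<in> U \<longrightarrow> spatial_jacobian U (\<lambda>x. affine_map A x + w x) x = A + fst (z x)"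
proof -
  have "AE x in lebesgue. \<forall>k\<in>(UNIV :: 'n set). x \<in> U \<longrightarrow>
      weak_deriv U (\<lambda>x. affine_map A x + w x) (axis k 1, 0) x = state_deriv ((A, 0, b) + z x) (axis k 1, 0)"
    by (rule AE_ball_countable'[OF limit_weak_deriv_eq[OF ls]]) simp
  then show ?thesis
  proof eventually_elim
    case (elim x)
    show ?case
    proof
      assume "x \<in> U"
      then show "spatial_jacobian U (\<lambda>x. affine_map A x + w x) x = A + fst (z x)"
        using elim by (simp add: spatial_jacobian_def state_deriv_def vec_eq_iff matrix_vector_mult_basis column_def)
    qed
  qed
qed

lemma limit_pairing_integrable:
  assumes ls: "limit_subsolution A b U B w z" and \<phi>: "test_function U \<phi>" and G: "C1_gradient \<phi> G"
    and V: "V \<in> borel_measurable lborel" "\<And>x. x \<in> U \<Longrightarrow> norm (V x) \<le> Q"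
  shows "integrable lborel (\<lambda>x. G x \<bullet> (- (V x $ i), (affine_map A x + w x) $ i))"
proof -
  have cu: "continuous_on UNIV (\<lambda>x. affine_map A x + w x)"
    using ls by (auto simp: limit_subsolution_def intro!: continuous_on_add affine_map_continuous)
  obtain C where "C > 0" and C: "\<And>x. x \<in> closure U \<Longrightarrow> norm (affine_map A x + w x) \<le> C"
    using continuous_bounded_on_U[OF cu] by blast
  obtain K where K: "compact K" "K \<subseteq> U" "\<And>x e. x \<notin> K \<Longrightarrow> dirderiv e \<phi> x = 0"
    using test_functionD(4)[OF \<phi>] by blast
  have Ge: "G x \<bullet> e = dirderiv e \<phi> x" for x e
  proof -
    have "(\<phi> has_derivative (\<lambda>h. G x \<bullet> h)) (at x)" using G by (simp add: C1_gradient_def)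
    from dirderiv_eqI[OF this] show ?thesis by simp
  qed
  have G0: "G x = 0" if "x \<notin> K" for x using Ge[of x "G x"] K(3)[OF that] by simp
  have cG: "continuous_on UNIV G" using G by (simp add: C1_gradient_def)
  show ?thesis
  proof (rule Bochner_Integration.integrable_bound)
    show "integrable lborel (\<lambda>x. norm (G x) * (Q + C))"
      by (intro integrable_mult_left integrable_norm integrable_compact_support[OF cG K(1) G0])
    have "(\<lambda>x. V x $ i) \<in> borel_measurable lborel"
      using measurable_compose[OF V(1) borel_measurable_continuous_onI[OF linear_continuous_on[OF bounded_linear_vec_nth]]] by simp
    moreover have "(\<lambda>x. (affine_map A x + w x) $ i) \<in> borel_measurable lborel"
      using bounded_linear.continuous_on[OF bounded_linear_vec_nth cu] by (simp add: borel_measurable_continuous_onI)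
    ultimately show "(\<lambda>x. G x \<bullet> (- (V x $ i), (affine_map A x + w x) $ i)) \<in> borel_measurable lborel"
      using cG by (intro borel_measurable_inner borel_measurable_Pair borel_measurable_uminus)
        (simp_all add: borel_measurable_continuous_onI)
    show "AE x in lborel. norm (G x \<bullet> (- (V x $ i), (affine_map A x + w x) $ i)) \<le> norm (norm (G x) * (Q + C))"
    proof (rule AE_I2)
      fix x
      show "norm (G x \<bullet> (- (V x $ i), (affine_map A x + w x) $ i)) \<le> norm (norm (G x) * (Q + C))"
      proof (cases "x \<in> K")
        case True
        then have xU: "x \<in> U" "x \<in> closure U" using K(2) closure_subset by blast+
        have "norm (- (V x $ i), (affine_map A x + w x) $ i) \<le> Q + C"
          by (rule order_trans[OF norm_Pair_le add_mono])
            (use V(2)[OF xU(1)] C[OF xU(2)] Finite_Cartesian_Product.norm_nth_le[of "V x" i]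
              Finite_Cartesian_Product.norm_nth_le[of "affine_map A x + w x" i] in auto)
        then have "norm (G x) * norm (- (V x $ i), (affine_map A x + w x) $ i) \<le> norm (G x) * (Q + C)"
          by (intro mult_left_mono) auto
        then have "\<bar>G x \<bullet> (- (V x $ i), (affine_map A x + w x) $ i)\<bar> \<le> norm (G x) * (Q + C)"
          using Cauchy_Schwarz_ineq2 order_trans by blast
        then show ?thesis unfolding real_norm_def by linarith
      qed (simp add: G0)
    qed
  qed
qed

end

text \<open>The functions whose convergence is at stake are known only through representatives \<open>f'\<close> and \<open>g'\<close> that agree almost everywhere
on \<open>U\<close>; the latter are bounded, hence testing suffices.\<close>

lemma weak_star_L_infinityI:
  fixes f f' :: "nat \<Rightarrow> 'a::euclidean_space \<Rightarrow> 'b::euclidean_space"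
  assumes U: "open U" "bounded U"
    and f': "\<And>j. f' j \<in> borel_measurable lborel" "\<And>j x. x \<in> U \<Longrightarrow> norm (f' j x) \<le> C"
    and g': "g' \<in> borel_measurable lborel" "\<And>x. x \<in> U \<Longrightarrow> norm (g' x) \<le> C"
    and ae: "\<And>j. AE x in lebesgue. x \<in> U \<longrightarrow> f j x = f' j x" "AE x in lebesgue. x \<in> U \<longrightarrow> g x = g' x"
    and test: "\<And>\<phi>. test_function U \<phi> \<Longrightarrow> (\<lambda>j. \<integral>x. \<phi> x *\<^sub>R (f' j x - g' x) \<partial>lborel) \<longlonglongrightarrow> 0"
  shows "weak_star_L_infinity U f g"
  unfolding weak_star_L_infinity_def
proof (intro allI impI)
  fix h :: "'a \<Rightarrow> 'b" assume h: "h absolutely_integrable_on U"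
  let ?M = "lebesgue_on U"
  have Us: "U \<in> sets lebesgue" using U(1) by simp
  have hM: "integrable ?M h"
    using h Us by (simp add: integrable_restrict_space set_integrable_def)
  have meas: "k \<in> borel_measurable ?M" if "k \<in> borel_measurable lborel" for k :: "'a \<Rightarrow> 'b"
    by (intro measurable_restrict_space1 measurable_completion that)
  have spM: "space ?M = U" by (simp add: space_restrict_space)
  have inth: "integrable ?M (\<lambda>x. k x \<bullet> h x)" if k: "k \<in> borel_measurable lborel" "\<And>x. x \<in> U \<Longrightarrow> norm (k x) \<le> C"
    for k :: "'a \<Rightarrow> 'b"
  proof (rule Bochner_Integration.integrable_bound[OF integrable_mult_right[OF integrable_norm[OF hM], of C]])
    show "(\<lambda>x. k x \<bullet> h x) \<in> borel_measurable ?M"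
      by (intro borel_measurable_inner[OF _ borel_measurable_integrable[OF hM]] meas k)
    show "AE x in ?M. norm (k x \<bullet> h x) \<le> norm (C * norm (h x))"
    proof (rule AE_I2)
      fix x assume "x \<in> space ?M"
      then have "norm (k x) * norm (h x) \<le> C * norm (h x)" using k(2) spM by (intro mult_right_mono) auto
      then have "\<bar>k x \<bullet> h x\<bar> \<le> C * norm (h x)" using Cauchy_Schwarz_ineq2 order_trans by blast
      then show "norm (k x \<bullet> h x) \<le> norm (C * norm (h x))" unfolding real_norm_def by linarith
    qed
  qed
  have cong: "(LINT x:U|lebesgue. k x \<bullet> h x) = (\<integral>x. k' x \<bullet> h x \<partial>?M)"
    if "AE x in lebesgue. x \<in> U \<longrightarrow> k x = k' x" "k' \<in> borel_measurable lborel" for k k' :: "'a \<Rightarrow> 'b"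
    unfolding set_integral_lebesgue_on[OF Us]
  proof (rule integral_cong_AE)
    have "k \<in> borel_measurable ?M" by (rule AE_eq_measurable_lebesgue_on[OF Us meas[OF that(2)] that(1)])
    then show "(\<lambda>x. k x \<bullet> h x) \<in> borel_measurable ?M"
      by (rule borel_measurable_inner[OF _ borel_measurable_integrable[OF hM]])
    show "(\<lambda>x. k' x \<bullet> h x) \<in> borel_measurable ?M"
      by (intro borel_measurable_inner[OF _ borel_measurable_integrable[OF hM]] meas that)
    have "AE x in ?M. k x = k' x" using that(1) Us by (simp add: AE_restrict_space_iff)
    then show "AE x in ?M. k x \<bullet> h x = k' x \<bullet> h x" by eventually_elim simp
  qed
  have "(\<lambda>j. \<integral>x. (f' j x - g' x) \<bullet> h x \<partial>?M) \<longlonglongrightarrow> 0"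
  proof (rule bounded_weak_limit_zero[OF U _ _ _ hM])
    show "(\<lambda>x. f' j x - g' x) \<in> borel_measurable ?M" for j
      by (intro meas borel_measurable_diff f' g')
    show "norm (f' j x - g' x) \<le> C + C" if "x \<in> U" for j x
      by (rule order_trans[OF norm_triangle_ineq4 add_mono[OF f'(2)[OF that] g'(2)[OF that]]])
    fix \<phi> :: "'a \<Rightarrow> real" assume \<phi>: "test_function U \<phi>"
    obtain K where K: "K \<subseteq> U" "\<And>x. x \<notin> K \<Longrightarrow> \<phi> x = 0" using test_functionD(4)[OF \<phi>] by blast
    have "(\<integral>x. \<phi> x *\<^sub>R (f' j x - g' x) \<partial>?M) = (\<integral>x. \<phi> x *\<^sub>R (f' j x - g' x) \<partial>lborel)" for j
      unfolding set_integral_lebesgue_on[OF Us, symmetric]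
    proof (rule set_integral_support)
      show "(\<lambda>x. \<phi> x *\<^sub>R (f' j x - g' x)) \<in> borel_measurable lborel"
        using test_functionD(3)[OF \<phi>]
        by (intro borel_measurable_scaleR borel_measurable_diff f' g') (simp add: borel_measurable_continuous_onI)
      show "\<phi> x *\<^sub>R (f' j x - g' x) = 0" if "x \<notin> U" for x using K that by auto
    qed
    then show "(\<lambda>j. \<integral>x. \<phi> x *\<^sub>R (f' j x - g' x) \<partial>?M) \<longlonglongrightarrow> 0" using test[OF \<phi>] by simp
  qed
  moreover have "(\<integral>x. (f' j x - g' x) \<bullet> h x \<partial>?M) = (\<integral>x. f' j x \<bullet> h x \<partial>?M) - (\<integral>x. g' x \<bullet> h x \<partial>?M)" for j
    unfolding inner_diff_left using inth[OF f'] inth[OF g'] by simp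
  ultimately have "(\<lambda>j. (\<integral>x. f' j x \<bullet> h x \<partial>?M)) \<longlonglongrightarrow> (\<integral>x. g' x \<bullet> h x \<partial>?M)"
    by (simp add: LIM_zero_iff)
  then show "(\<lambda>j. LINT x:U|lebesgue. f j x \<bullet> h x) \<longlonglongrightarrow> (LINT x:U|lebesgue. g x \<bullet> h x)"
    using cong[OF ae(1) f'(1)] cong[OF ae(2) g'(1)] by simp
qed

text \<open>Derivatives are tested by moving them to the test function, where uniform convergence of the functions is
enough. The common bound \<open>B\<close> on the states does the rest.\<close>

lemma limit_weak_star:
  fixes w :: "(real^'n) \<times> real \<Rightarrow> real^'m"
  assumes U: "open U" "bounded U"
    and lj: "\<And>j. limit_subsolution A b U B (wj j) (zj j)" and l: "limit_subsolution A b U B w z"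
    and conv: "\<And>j x. norm (wj j x - w x) \<le> 1 / real (Suc j)"
  shows "weak_star_W1_infinity U (\<lambda>j x. affine_map A x + wj j x) (\<lambda>x. affine_map A x + w x)"
proof -
  have cj: "continuous_on UNIV (wj j)" and c: "continuous_on UNIV w" for j
    using lj l by (auto simp: limit_subsolution_def)
  have lim: "(\<lambda>j. wj j x - w x) \<longlonglongrightarrow> 0" for x
  proof (rule tendsto_norm_zero_cancel, rule tendsto_sandwich[OF _ _ tendsto_const LIMSEQ_inverse_real_of_nat])
    show "\<forall>\<^sub>F j in sequentially. norm (wj j x - w x) \<le> inverse (real (Suc j))"
      using conv[of _ x] by (simp add: inverse_eq_divide)
  qed simp
  have le1: "norm (wj j x - w x) \<le> 1" for j x
    by (rule order_trans[OF conv]) simp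
  have dm: "(\<lambda>x. wj j x - w x) \<in> borel_measurable lborel" for j
    using cj c by (simp add: borel_measurable_continuous_onI continuous_on_diff)
  have small: "(\<lambda>j. \<integral>x. c x *\<^sub>R (wj j x - w x) \<partial>lborel) \<longlonglongrightarrow> 0"
    if "continuous_on UNIV c" "compact K" "\<And>x. x \<notin> K \<Longrightarrow> c x = (0::real)" for c K
    using dominated_compact_pairing[OF that dm borel_measurable_const le1 AE_I2[OF lim]] by simp
  have cA: "continuous_on UNIV (affine_map A)" by (rule affine_map_continuous)
  have cu: "continuous_on UNIV (\<lambda>x. affine_map A x + w x)" by (intro continuous_on_add cA c)
  obtain C where C: "C > 0" "\<And>x. x \<in> closure U \<Longrightarrow> norm (affine_map A x + w x) \<le> C"
    using continuous_bounded_on_U[OF U cu] by blast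
  have C': "norm (affine_map A x + w x) \<le> C + 1" "norm (affine_map A x + wj j x) \<le> C + 1" if "x \<in> U" for x j
  proof -
    have *: "norm (affine_map A x + w x) \<le> C" by (rule C(2)) (use that closure_subset in blast)
    then show "norm (affine_map A x + w x) \<le> C + 1" by simp
    have "affine_map A x + wj j x = (affine_map A x + w x) + (wj j x - w x)" by simp
    then show "norm (affine_map A x + wj j x) \<le> C + 1"
      using norm_triangle_le[OF add_mono[OF * le1[of j x]]] by simp
  qed
  have zm: "zj j \<in> borel_measurable lborel" "z \<in> borel_measurable lborel"
    "norm (zj j x) \<le> B" "norm (z x) \<le> B" for j x
    using lj l by (auto simp: limit_subsolution_def)
  show ?thesis
    unfolding weak_star_W1_infinity_def
  proof (intro conjI allI ballI limit_Sobolev(1)[OF U lj] limit_Sobolev(1)[OF U l])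
    show "weak_star_L_infinity U (\<lambda>j x. affine_map A x + wj j x) (\<lambda>x. affine_map A x + w x)"
    proof (rule weak_star_L_infinityI[OF U _ C'(2) _ C'(1)])
      show "(\<lambda>x. affine_map A x + wj j x) \<in> borel_measurable lborel" "(\<lambda>x. affine_map A x + w x) \<in> borel_measurable lborel" for j
        using cA cj c by (simp_all add: borel_measurable_continuous_onI continuous_on_add)
      fix \<phi> :: "(real^'n) \<times> real \<Rightarrow> real" assume \<phi>: "test_function U \<phi>"
      obtain K where K: "compact K" "\<And>x. x \<notin> K \<Longrightarrow> \<phi> x = 0" using test_functionD(4)[OF \<phi>] by blast
      show "(\<lambda>j. \<integral>x. \<phi> x *\<^sub>R (affine_map A x + wj j x - (affine_map A x + w x)) \<partial>lborel) \<longlonglongrightarrow> 0"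
        using small[OF test_functionD(3)[OF \<phi>] K] by simp
    qed simp_all
  next
    fix e :: "(real^'n) \<times> real"
    obtain Q where Q: "Q > 0" "\<And>v. norm v \<le> B \<Longrightarrow> norm (state_deriv ((A, 0, b) + v) e) \<le> Q"
      using state_deriv_bound[of B "(A, 0, b)" e] by blast
    show "weak_star_L_infinity U (\<lambda>j. weak_deriv U (\<lambda>x. affine_map A x + wj j x) e)
        (weak_deriv U (\<lambda>x. affine_map A x + w x) e)"
    proof (rule weak_star_L_infinityI[OF U state_deriv_measurable[OF zm(1)] Q(2)[OF zm(3)]
          state_deriv_measurable[OF zm(2)] Q(2)[OF zm(4)] limit_weak_deriv_eq[OF U lj] limit_weak_deriv_eq[OF U l]])
      fix \<phi> :: "(real^'n) \<times> real \<Rightarrow> real" assume \<phi>: "test_function U \<phi>"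
      obtain K where K: "compact K" "\<And>x. x \<notin> K \<Longrightarrow> \<phi> x = 0" "\<And>x e. x \<notin> K \<Longrightarrow> dirderiv e \<phi> x = 0"
        using test_functionD(4)[OF \<phi>] by blast
      have isd: "integrable lborel (\<lambda>x. \<phi> x *\<^sub>R state_deriv ((A, 0, b) + z x) e)"
        if "z \<in> borel_measurable lborel" "\<And>x. norm (z x) \<le> B" for z :: "(real^'n) \<times> real \<Rightarrow> ('n, 'm) state"
      proof (rule Bochner_Integration.integrable_bound)
        show "integrable lborel (\<lambda>x. \<bar>\<phi> x\<bar> * Q)"
          by (intro integrable_mult_left integrable_abs integrable_compact_support[OF test_functionD(3)[OF \<phi>] K(1,2)])
        show "(\<lambda>x. \<phi> x *\<^sub>R state_deriv ((A, 0, b) + z x) e) \<in> borel_measurable lborel"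
          using test_functionD(3)[OF \<phi>]
          by (intro borel_measurable_scaleR state_deriv_measurable that) (simp add: borel_measurable_continuous_onI)
        show "AE x in lborel. norm (\<phi> x *\<^sub>R state_deriv ((A, 0, b) + z x) e) \<le> norm (\<bar>\<phi> x\<bar> * Q)"
        proof (rule AE_I2)
          fix x
          have "\<bar>\<phi> x\<bar> * norm (state_deriv ((A, 0, b) + z x) e) \<le> \<bar>\<phi> x\<bar> * Q"
            by (intro mult_left_mono Q(2) that) simp
          then show "norm (\<phi> x *\<^sub>R state_deriv ((A, 0, b) + z x) e) \<le> norm (\<bar>\<phi> x\<bar> * Q)"
            using Q(1) by (simp add: abs_mult)
        qed
      qed
      have iu: "integrable lborel (\<lambda>x. dirderiv e \<phi> x *\<^sub>R (affine_map A x + w x))" if "continuous_on UNIV w" for w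
        by (rule integrable_compact_support[OF _ K(1)])
          (auto intro!: continuous_on_scaleR continuous_on_add test_functionD(2)[OF \<phi>] cA that simp: K(3))
      have "(\<integral>x. \<phi> x *\<^sub>R (state_deriv ((A, 0, b) + zj j x) e - state_deriv ((A, 0, b) + z x) e) \<partial>lborel) =
          - (\<integral>x. dirderiv e \<phi> x *\<^sub>R (wj j x - w x) \<partial>lborel)" for j
      proof -
        have "(\<integral>x. \<phi> x *\<^sub>R (state_deriv ((A, 0, b) + zj j x) e - state_deriv ((A, 0, b) + z x) e) \<partial>lborel) =
            (\<integral>x. \<phi> x *\<^sub>R state_deriv ((A, 0, b) + zj j x) e \<partial>lborel) - (\<integral>x. \<phi> x *\<^sub>R state_deriv ((A, 0, b) + z x) e \<partial>lborel)"
          unfolding scaleR_diff_right using zm by (intro Bochner_Integration.integral_diff isd)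
        also have "\<dots> = (\<integral>x. dirderiv e \<phi> x *\<^sub>R (affine_map A x + w x) \<partial>lborel) -
            (\<integral>x. dirderiv e \<phi> x *\<^sub>R (affine_map A x + wj j x) \<partial>lborel)"
          using lj[of j] l \<phi> by (simp add: limit_subsolution_def)
        also have "\<dots> = (\<integral>x. dirderiv e \<phi> x *\<^sub>R (affine_map A x + w x) - dirderiv e \<phi> x *\<^sub>R (affine_map A x + wj j x) \<partial>lborel)"
          by (rule Bochner_Integration.integral_diff[OF iu[OF c] iu[OF cj], symmetric])
        also have "\<dots> = (\<integral>x. - (dirderiv e \<phi> x *\<^sub>R (wj j x - w x)) \<partial>lborel)"
          by (rule Bochner_Integration.integral_cong) (simp_all add: algebra_simps)
        finally show ?thesis by simp
      qed
      moreover have "(\<lambda>j. - (\<integral>x. dirderiv e \<phi> x *\<^sub>R (wj j x - w x) \<partial>lborel)) \<longlonglongrightarrow> - 0"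
        by (intro tendsto_minus small[OF test_functionD(2)[OF \<phi>] K(1,3)])
      ultimately show "(\<lambda>j. \<integral>x. \<phi> x *\<^sub>R (state_deriv ((A, 0, b) + zj j x) e - state_deriv ((A, 0, b) + z x) e) \<partial>lborel) \<longlonglongrightarrow> 0"
        by simp
    qed
  qed
qed

section \<open>From the inclusion to the equation\<close>

lemma sigma_graph_alt: "sigma_graph \<sigma> = {p. snd p = \<sigma> (fst p)}"
  unfolding sigma_graph_def by (auto simp: row_def vec_eq_iff)

text \<open>By closedness, a limit state at distance zero from the graph lies on it.\<close>

lemma closed_sigma_graph:
  fixes \<sigma> :: "real^'n^'m \<Rightarrow> real^'n^'m"
  assumes "continuous_on UNIV \<sigma>"
  shows "closed (sigma_graph \<sigma>)"
proof -
  have "continuous_on UNIV (\<lambda>p :: (real^'n^'m) \<times> (real^'n^'m). \<sigma> (fst p))"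
    by (rule continuous_on_compose2[OF assms continuous_on_fst[OF continuous_on_id]]) simp
  from closed_Collect_eq[OF continuous_on_snd[OF continuous_on_id] this]
  show ?thesis by (simp add: sigma_graph_alt)
qed

lemma pairing_expand:
  assumes "test_function U \<phi>" "\<And>x e. G x \<bullet> e = dirderiv e \<phi> x"
  shows "G x \<bullet> (- (V $ i), u) = u * dirderiv (0, 1) \<phi> x - (\<Sum>k\<in>UNIV. V $ i $ k * dirderiv (axis k 1, 0) \<phi> x)"
  unfolding assms(2) dirderiv_expand[OF test_functionD(1)[OF assms(1)], of "(- (V $ i), u)"]
  by (simp add: inner_vec_def sum_negf mult.commute)

text \<open>On the graph the flux \<open>V\<close> of a limit equals \<open>\<sigma>\<close> of the spatial gradient almost everywhere, so the weak conservation law is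
the weak form of the equation.\<close>

lemma limit_weak_solution:
  fixes \<sigma> :: "real^'n^'m \<Rightarrow> real^'n^'m"
  assumes U: "open (cylinder \<Omega> T)" "bounded (cylinder \<Omega> T)"
    and ls: "limit_subsolution A b (cylinder \<Omega> T) B w z"
    and K: "AE x in lborel. x \<in> cylinder \<Omega> T \<longrightarrow> flux_gradient ((A, 0, b) + z x) \<in> sigma_graph \<sigma>"
  shows "weak_solution \<sigma> \<Omega> T (\<lambda>x. affine_map A x + w x)"
  unfolding weak_solution_def
proof (intro conjI allI impI limit_Sobolev(3)[OF U ls])
  let ?U = "cylinder \<Omega> T" and ?u = "\<lambda>x. affine_map A x + w x"
  have Us: "?U \<in> sets lebesgue" using U(1) by simp
  fix \<phi> i assume \<phi>: "test_function ?U \<phi>"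
  obtain G where G: "C1_gradient \<phi> G" "\<And>x e. G x \<bullet> e = dirderiv e \<phi> x"
    using test_function_C1_gradient[OF \<phi>] by blast
  obtain L where L: "L \<subseteq> ?U" "\<And>x e. x \<notin> L \<Longrightarrow> dirderiv e \<phi> x = 0"
    using test_functionD(4)[OF \<phi>] by blast
  have G0: "G x = 0" if "x \<notin> ?U" for x 
  proof -
    have "G x \<bullet> G x = 0" unfolding G(2) by (rule L(2)) (use L(1) that in blast)
    then show ?thesis by simp
  qed
  have zm: "z \<in> borel_measurable lborel" "\<And>x. norm (z x) \<le> B" using ls by (auto simp: limit_subsolution_def)
  define V where "V x = snd (snd ((A, 0, b) + z x))" for x
  have bl: "bounded_linear (\<lambda>z :: ('n, 'm) state. snd (snd z))"
    using bounded_linear_compose[OF bounded_linear_snd bounded_linear_snd] .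
  have Vm: "V \<in> borel_measurable lborel"
    unfolding V_def[abs_def]
    by (rule measurable_compose[OF _ borel_measurable_continuous_onI[OF linear_continuous_on[OF bl]]])
      (rule borel_measurable_add[OF borel_measurable_const zm(1)])
  have Vb: "norm (V x) \<le> norm b + B" for x
  proof -
    have "norm (snd (snd (z x))) \<le> norm (z x)"
      using norm_snd_le[of "snd (snd (z x))" "fst (snd (z x))"] norm_snd_le[of "snd (z x)" "fst (z x)"] by simp
    then show ?thesis unfolding V_def using zm(2)[of x]
      by simp (rule norm_triangle_le, simp)
  qed
  define I where "I x = G x \<bullet> (- (V x $ i), ?u x $ i)" for x
  have Ii: "integrable lborel I"
    unfolding I_def[abs_def] by (rule limit_pairing_integrable[OF U ls \<phi> G(1) Vm Vb])
  have I0: "(\<integral>x. I x \<partial>lborel) = 0"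
    using ls \<phi> G(1) unfolding limit_subsolution_def I_def V_def by blast
  let ?J = "\<lambda>p. ?u p $ i * frechet_derivative \<phi> (at p) (0, 1)
             - (\<Sum>k\<in>UNIV. \<sigma> (spatial_jacobian ?U ?u p) $ i $ k * frechet_derivative \<phi> (at p) (axis k 1, 0))"
  have ae: "AE x in lebesgue. x \<in> ?U \<longrightarrow> ?J x = I x"
    using spatial_jacobian_limit[OF U ls] AE_completion[OF K]
  proof eventually_elim
    case (elim x)
    show ?case
    proof
      assume x: "x \<in> ?U"
      have "\<sigma> (spatial_jacobian ?U ?u x) = V x"
        using elim x by (simp add: V_def sigma_graph_alt flux_gradient_def)
      then show "?J x = I x"
        unfolding I_def pairing_expand[OF \<phi> G(2)] by (simp add: dirderiv_def)
    qed
  qed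
  have ILm: "I \<in> borel_measurable (lebesgue_on ?U)"
    using Ii by (intro measurable_restrict_space1 measurable_completion) auto
  have Jm: "?J \<in> borel_measurable (lebesgue_on ?U)"
    by (rule AE_eq_measurable_lebesgue_on[OF Us ILm ae])
  have ae': "AE x in lebesgue_on ?U. ?J x = I x" using ae Us by (simp add: AE_restrict_space_iff)
  have "integrable lebesgue I" using Ii by (simp add: integrable_completion)
  then have IL: "integrable (lebesgue_on ?U) I"
    using integrable_mult_indicator[OF Us, of I] Us by (simp add: integrable_restrict_space)
  have "integral\<^sup>L (lebesgue_on ?U) I = (\<integral>x. I x \<partial>lborel)"
    unfolding set_integral_lebesgue_on[OF Us, symmetric]
  proof (rule set_integral_support)
    show "I \<in> borel_measurable lborel" using Ii by auto
    show "I x = 0" if "x \<notin> ?U" for x unfolding I_def G0[OF that] by (rule inner_zero_left)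
  qed
  then have "integral\<^sup>L (lebesgue_on ?U) I = 0" using I0 by simp
  then show "has_bochner_integral (lebesgue_on ?U) ?J 0"
    unfolding has_bochner_integral_iff
    using integrable_cong_AE[OF Jm ILm ae'] integral_cong_AE[OF Jm ILm ae'] IL by simp
qed

section \<open>A subsolution that is not a solution\<close>

lemma lborel_integral_time_reflection:
  fixes F :: "(real^'n) \<times> real \<Rightarrow> real"
  assumes F: "F \<in> borel_measurable borel"
  shows "(\<integral>x. F (fst x, T - snd x) \<partial>lborel) = (\<integral>x. F x \<partial>lborel)"
proof -
  define c :: "(real^'n) \<times> real \<Rightarrow> real" where "c j = (if j = (0, 1) then - 1 else 1)" for j
  have R: "(0, T) + (\<Sum>j\<in>Basis. (c j * (x \<bullet> j)) *\<^sub>R j) = (fst x, T - snd x)" for x :: "(real^'n) \<times> real"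
  proof -
    have "(\<Sum>i\<in>Basis. (c (i, 0) * (x \<bullet> (i, 0))) *\<^sub>R (i, 0::real)) = (\<Sum>i\<in>Basis. (fst x \<bullet> i) *\<^sub>R (i, 0))"
      by (rule sum.cong) (auto simp: c_def inner_prod_def)
    also have "\<dots> = (fst x, 0)"
      by (simp add: prod_eq_iff fst_sum snd_sum euclidean_representation)
    finally show ?thesis
      by (simp add: sum_Basis_prod_eq c_def inner_prod_def)
  qed
  have P: "(\<Prod>j\<in>Basis. \<bar>c j\<bar>) = 1" by (rule prod.neutral) (simp add: c_def)
  have m: "(\<lambda>x :: (real^'n) \<times> real. (fst x, T - snd x)) \<in> borel_measurable borel"
    by (intro borel_measurable_continuous_onI continuous_intros)
  have "lborel = density (distr lborel borel (\<lambda>x :: (real^'n) \<times> real. (fst x, T - snd x))) (\<lambda>_. ennreal 1)"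
    using lborel_affine_euclidean[of c "(0, T)"] unfolding R P by (simp add: c_def)
  then have "(\<integral>x. F x \<partial>lborel) =
      (\<integral>x. F x \<partial>density (distr lborel borel (\<lambda>x :: (real^'n) \<times> real. (fst x, T - snd x))) (\<lambda>_. ennreal 1))"
    by simp
  also have "\<dots> = (\<integral>x. F (fst x, T - snd x) \<partial>lborel)"
    using F m by (simp add: density_1 integral_distr)
  finally show ?thesis ..
qed

lemma dirderiv_time_reflection:
  fixes f :: "(real^'n) \<times> real \<Rightarrow> real"
  assumes f: "smooth_expr f" and sym: "\<And>x. f (fst x, T - snd x) = c * f x"
  shows "dirderiv (v, s) f (fst x, T - snd x) = c * dirderiv (v, - s) f x"
proof -
  have "((\<lambda>x. (fst x, T - snd x)) has_derivative (\<lambda>h. (fst h, - snd h))) (at x)"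
    by (auto intro!: derivative_eq_intros)
  from has_derivative_compose[OF this smooth_expr_has_derivative[OF f]]
  have "((\<lambda>x. f (fst x, T - snd x)) has_derivative (\<lambda>h. dirderiv (fst h, - snd h) f (fst x, T - snd x))) (at x)" .
  then have "((\<lambda>x. c * f x) has_derivative (\<lambda>h. dirderiv (fst h, - snd h) f (fst x, T - snd x))) (at x)"
    by (simp only: sym)
  moreover have "((\<lambda>x. c * f x) has_derivative (\<lambda>h. c * dirderiv h f x)) (at x)"
    by (rule has_derivative_mult_right[OF smooth_expr_has_derivative[OF f]])
  ultimately have "(\<lambda>h. dirderiv (fst h, - snd h) f (fst x, T - snd x)) = (\<lambda>h. c * dirderiv h f x)"
    by (rule has_derivative_unique)
  from fun_cong[OF this, of "(v, - s)"] show ?thesis by simp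
qed

lemma bump_time_reflection:
  fixes x0 :: "real^'n" and T :: real
  shows "bump (x0, T / 2) s (fst x, T - snd x) = bump (x0, T / 2) s x"
proof -
  have e: "\<bar>T - snd x - T / 2\<bar> = \<bar>snd x - T / 2\<bar>" by linarith
  then have "norm ((fst x, T - snd x) - (x0, T / 2)) = norm (x - (x0, T / 2))"
    by (simp only: norm_prod_def fst_diff snd_diff fst_conv snd_conv real_norm_def e)
  then show ?thesis by (simp add: bump_def)
qed

text \<open>The bump is a function of the squared distance, whose own mixed derivative in orthogonal directions is zero. Only the second derivative of
the profile remains.\<close>

lemma mixed_dirderiv_bump:
  assumes orth: "\<tau> \<bullet> \<alpha> = 0"
  shows "dirderiv \<tau> (dirderiv \<alpha> (bump a s)) x =
    4 * bump_tower 2 (s - (norm (x - a))\<^sup>2) * ((x - a) \<bullet> \<tau>) * ((x - a) \<bullet> \<alpha>)"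
proof -
  define f where "f x = s - (norm (x - a))\<^sup>2" for x
  have f: "smooth_expr f" unfolding f_def[abs_def] by (intro smooth_expr_diff smooth_expr.const smooth_expr_norm_sq)
  note df = smooth_expr_differentiable
  have dfx: "dirderiv e f = (\<lambda>x. - 2 * (x \<bullet> e) + 2 * (a \<bullet> e))" for e
  proof
    fix x
    have "((\<lambda>x. s - (x - a) \<bullet> (x - a)) has_derivative (\<lambda>h. - ((x - a) \<bullet> h + h \<bullet> (x - a)))) (at x)"
      by (auto intro!: derivative_eq_intros)
    then have "(f has_derivative (\<lambda>h. - ((x - a) \<bullet> h + h \<bullet> (x - a)))) (at x)"
      by (simp add: f_def[abs_def] power2_norm_eq_inner)
    from dirderiv_eqI[OF this, of e] show "dirderiv e f x = - 2 * (x \<bullet> e) + 2 * (a \<bullet> e)"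
      by (simp add: inner_diff inner_commute)
  qed
  have l: "smooth_expr (\<lambda>x. - 2 * (x \<bullet> \<alpha>) + 2 * (a \<bullet> \<alpha>))"
    by (rule smooth_expr.add[OF smooth_expr_scale[OF smooth_expr.inner] smooth_expr.const])
  have dl: "dirderiv \<tau> (\<lambda>x. - 2 * (x \<bullet> \<alpha>) + 2 * (a \<bullet> \<alpha>)) x = 0" for x
  proof -
    have "((\<lambda>x. - 2 * (x \<bullet> \<alpha>) + 2 * (a \<bullet> \<alpha>)) has_derivative (\<lambda>h. - 2 * (h \<bullet> \<alpha>))) (at x)"
      by (auto intro!: derivative_eq_intros)
    from dirderiv_eqI[OF this, of \<tau>] orth show ?thesis by simp
  qed
  have b1: "smooth_expr (\<lambda>x. bump_tower (Suc 0) (f x))"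
    by (rule smooth_expr_compose_nth[OF derivative_tower_bump f])
  have "bump a s = (\<lambda>x. bump_tower 0 (f x))" by (simp add: bump_def[abs_def] f_def)
  then have "dirderiv \<alpha> (bump a s) = (\<lambda>x. bump_tower (Suc 0) (f x) * (- 2 * (x \<bullet> \<alpha>) + 2 * (a \<bullet> \<alpha>)))"
    by (simp only: dirderiv_compose[OF derivative_tower_bump df[OF f]] dfx)
  then have "dirderiv \<tau> (dirderiv \<alpha> (bump a s)) x =
      bump_tower (Suc (Suc 0)) (f x) * (- 2 * (x \<bullet> \<tau>) + 2 * (a \<bullet> \<tau>)) * (- 2 * (x \<bullet> \<alpha>) + 2 * (a \<bullet> \<alpha>))"
    by (simp only: dirderiv_mult[OF df[OF b1] df[OF l]] dl dirderiv_compose[OF derivative_tower_bump df[OF f]] dfx)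
  then show ?thesis by (simp add: f_def numeral_2_eq_2 inner_diff_left algebra_simps)
qed

text \<open>The wave with potential a bump, in a coordinate direction and without the divergence-free part.\<close>

definition bump_w :: "(real^'n) \<times> real \<Rightarrow> real \<Rightarrow> 'm::finite \<Rightarrow> 'n \<Rightarrow> (real^'n) \<times> real \<Rightarrow> real^'m" where
  "bump_w a r i k = wave_u (bump a (r\<^sup>2)) (axis i 1) (axis k 1)"

definition bump_z :: "(real^'n) \<times> real \<Rightarrow> real \<Rightarrow> 'm::finite \<Rightarrow> 'n \<Rightarrow> (real^'n) \<times> real \<Rightarrow> ('n, 'm) state" where
  "bump_z a r i k = shifted 1 (wave_z (bump a (r\<^sup>2)) (\<lambda>x. 0) (axis i 1) (axis k 1) 0)
     (wave_y (bump a (r\<^sup>2)) (axis i 1) (axis k 1))"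

lemma bump_subsolution_pert:
  assumes "cball a r \<subseteq> U" "r \<ge> 0"
  shows "subsolution_pert U (bump_w a r i k) (bump_z a r i k)"
  unfolding bump_w_def bump_z_def
proof (rule pert_imp_subsolution_pert)
  show "pert U (wave_u (bump a (r\<^sup>2)) (axis i 1) (axis k 1))
      (wave_z (bump a (r\<^sup>2)) (\<lambda>x. 0) (axis i 1) (axis k 1) 0) (wave_y (bump a (r\<^sup>2)) (axis i 1) (axis k 1))"
  proof (rule wave_pert[where K="cball a r", OF smooth_expr_bump smooth_expr.const compact_cball assms(1)])
    show "bump a (r\<^sup>2) x = 0" if "x \<notin> cball a r" for x by (rule bump_outside[OF that assms(2)])
  qed (rule refl)
qed

lemma subsolution_pert_scaleR:
  assumes p: "subsolution_pert W w z"
  shows "subsolution_pert W (\<lambda>x. c *\<^sub>R w x) (\<lambda>x. c *\<^sub>R z x)"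
  unfolding subsolution_pert_def
proof (intro conjI allI impI)
  obtain K where K: "compact K" "K \<subseteq> W" "\<forall>x. x \<notin> K \<longrightarrow> w x = 0 \<and> z x = 0"
    using subsolution_pertD(1)[OF p] by (elim exE conjE)
  show "\<exists>K. compact K \<and> K \<subseteq> W \<and> (\<forall>x. x \<notin> K \<longrightarrow> c *\<^sub>R w x = 0 \<and> c *\<^sub>R z x = 0)"
    by (intro exI[of _ K] conjI K(1,2)) (use K(3) in simp)
  show "continuous_on UNIV (\<lambda>x. c *\<^sub>R z x)"
    by (intro continuous_on_scaleR continuous_on_const subsolution_pertD(2)[OF p])
  show "((\<lambda>x. c *\<^sub>R w x) has_derivative state_deriv (c *\<^sub>R z x)) (at x)" for x
    using has_derivative_scaleR_right[OF subsolution_pertD(3)[OF p, of x], of c]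
    by (simp add: linear_scale[OF linear_state_deriv_left, abs_def])
  fix \<phi> :: "(real^'a) \<times> real \<Rightarrow> real" and G i
  assume G: "C1_gradient \<phi> G"
  have "G x \<bullet> (- (snd (snd (c *\<^sub>R z x)) $ i), (c *\<^sub>R w x) $ i) = c * (G x \<bullet> (- (snd (snd (z x)) $ i), w x $ i))" for x
    by (subst inner_scaleR_right[symmetric]) simp
  then show "(\<integral>x. G x \<bullet> (- (snd (snd (c *\<^sub>R z x)) $ i), (c *\<^sub>R w x) $ i) \<partial>lborel) = 0"
    using subsolution_pertD(5)[OF p G, of i] by simp
qed

text \<open>The test function \<open>\<phi> = \<partial>\<^sub>t \<partial>\<^sub>k g\<close> is the velocity of the perturbation divided by \<open>\<epsilon>\<close>, so integrating by parts in time gives \<open>- \<epsilon> \<integral>\<phi>\<^sup>2\<close>. The term with \<open>\<sigma>\<close> is the integral of a function \<open>Q\<close> that is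
odd with respect to reflection in the time \<open>T / 2\<close>. The bound \<open>r \<le> 1/2\<close> keeps the profile of the bump convex at the point where \<open>\<phi>\<close> is evaluated.\<close>

lemma bump_not_weak_solution:
  fixes \<sigma> :: "real^'n^'m \<Rightarrow> real^'n^'m"
  assumes \<sigma>: "continuous_on UNIV \<sigma>"
    and U: "open (cylinder \<Omega> T)" "bounded (cylinder \<Omega> T)"
    and r: "0 < r" "r \<le> 1/2" "cball (x0, T / 2) r \<subseteq> cylinder \<Omega> T" and \<epsilon>: "\<epsilon> \<noteq> 0"
  shows "\<not> weak_solution \<sigma> \<Omega> T (\<lambda>x. affine_map A x + \<epsilon> *\<^sub>R bump_w (x0, T / 2) r i k x)"
proof
  let ?U = "cylinder \<Omega> T" and ?w = "\<lambda>x. \<epsilon> *\<^sub>R bump_w (x0, T / 2) r i k x" and ?z = "\<lambda>x. \<epsilon> *\<^sub>R bump_z (x0, T / 2) r i k x"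
  let ?u = "\<lambda>x. affine_map A x + ?w x"
  let ?\<alpha> = "(axis k 1, 0) :: (real^'n) \<times> real" and ?\<tau> = "(0, 1) :: (real^'n) \<times> real"
  assume ws: "weak_solution \<sigma> \<Omega> T ?u"
  define p where "p = (x0, T / 2)"
  define g where "g = bump p (r\<^sup>2)"
  define \<phi> where "\<phi> = dirderiv ?\<tau> (dirderiv ?\<alpha> g)"
  have Us: "?U \<in> sets lebesgue" using U(1) by simp
  have sp: "subsolution_pert ?U ?w ?z"
    by (intro subsolution_pert_scaleR bump_subsolution_pert) (use r in auto)
  have zc: "continuous_on UNIV ?z" by (rule subsolution_pertD(2)[OF sp])
  obtain K where K: "compact K" "\<forall>x. x \<notin> K \<longrightarrow> ?w x = 0 \<and> ?z x = 0" using subsolution_pertD(1)[OF sp] by blast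
  obtain B where B: "\<And>x. norm (?z x) \<le> B" using bounded_compact_support[OF zc K(1)] K(2) by metis
  have ls: "limit_subsolution A 0 ?U B ?w ?z" by (rule limit_subsolution_of_pert[OF sp B])
  have g: "smooth_expr g" unfolding g_def by (rule smooth_expr_bump)
  have sm: "smooth_expr (dirderiv ?\<alpha> g)" "smooth_expr \<phi>"
    unfolding \<phi>_def by (intro smooth_expr_dirderiv g)+
  have g0: "g x = 0" if "x \<notin> cball p r" for x
    unfolding g_def by (rule bump_outside[OF that]) (use r in simp)
  have d0: "dirderiv ?\<alpha> g x = 0" if "x \<notin> cball p r" for x
    using fun_cong[OF derivative_compact_support[OF smooth_expr_has_derivative[OF g] closed_cball g0 that]] .
  have \<phi>0: "\<phi> x = 0" if "x \<notin> cball p r" for x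
    unfolding \<phi>_def using fun_cong[OF derivative_compact_support[OF smooth_expr_has_derivative[OF sm(1)] closed_cball d0 that]] .
  have d\<phi>0: "dirderiv e \<phi> x = 0" if "x \<notin> cball p r" for x e
    using fun_cong[OF derivative_compact_support[OF smooth_expr_has_derivative[OF sm(2)] closed_cball \<phi>0 that]] .
  have \<phi>: "test_function ?U \<phi>"
    by (rule smooth_expr_test_function[OF sm(2) compact_cball _ \<phi>0]) (use r(3) in \<open>simp_all add: p_def\<close>)
  let ?J = "\<lambda>p. ?u p $ i * frechet_derivative \<phi> (at p) (0, 1)
             - (\<Sum>k\<in>UNIV. \<sigma> (spatial_jacobian ?U ?u p) $ i $ k * frechet_derivative \<phi> (at p) (axis k 1, 0))"
  have J: "has_bochner_integral (lebesgue_on ?U) ?J 0" using ws \<phi> unfolding weak_solution_def by blast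
  define Q where "Q x = (\<Sum>l\<in>UNIV. \<sigma> (A + fst (?z x)) $ i $ l * dirderiv (axis l 1, 0) \<phi> x)" for x
  define J' where "J' x = dirderiv ?\<tau> \<phi> x *\<^sub>R (?u x $ i) - Q x" for x
  have vn: "continuous_on UNIV (\<lambda>x. f x $ j)" if "continuous_on UNIV f" for f :: "(real^'n) \<times> real \<Rightarrow> real^'c" and j
    by (rule bounded_linear.continuous_on[OF bounded_linear_vec_nth that])
  have vn2: "continuous_on UNIV (\<lambda>x. f x $ i $ l)" if "continuous_on UNIV f" for f :: "(real^'n) \<times> real \<Rightarrow> real^'n^'m" and l
    by (rule bounded_linear.continuous_on[OF bounded_linear_vec_nth
          bounded_linear.continuous_on[OF bounded_linear_vec_nth that]])
  have cd: "continuous_on UNIV (dirderiv e \<phi>)" for e by (intro smooth_expr_continuous smooth_expr_dirderiv sm)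
  have c\<sigma>: "continuous_on UNIV (\<lambda>x. \<sigma> (A + fst (?z x)))"
    by (rule continuous_on_compose2[OF \<sigma>])
      (intro continuous_on_add continuous_on_const continuous_on_fst zc, simp)
  have cQ: "continuous_on UNIV Q"
    unfolding Q_def[abs_def] by (intro continuous_on_sum continuous_on_mult vn2 c\<sigma> cd)
  have cu: "continuous_on UNIV ?u" by (intro continuous_on_add affine_map_continuous subsolution_pertD(4)[OF sp])
  have Q0: "Q x = 0" if "x \<notin> cball p r" for x using d\<phi>0[OF that] by (simp add: Q_def)
  have c1: "continuous_on UNIV (\<lambda>x. dirderiv ?\<tau> \<phi> x *\<^sub>R (?u x $ i))"
    by (rule continuous_on_scaleR[OF cd]) (rule bounded_linear.continuous_on[OF bounded_linear_vec_nth cu])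
  have iQ: "integrable lborel Q" by (rule integrable_compact_support[OF cQ compact_cball Q0])
  have c10: "dirderiv ?\<tau> \<phi> x *\<^sub>R (?u x $ i) = 0" if "x \<notin> cball p r" for x
    unfolding d\<phi>0[OF that] by (rule scaleR_zero_left)
  have i1: "integrable lborel (\<lambda>x. dirderiv ?\<tau> \<phi> x *\<^sub>R (?u x $ i))"
    by (rule integrable_compact_support[OF c1 compact_cball[of p r] c10])
  have J'i: "integrable lborel J'" unfolding J'_def[abs_def] using i1 iQ by (rule Bochner_Integration.integrable_diff)
  have ae: "AE x in lebesgue. x \<in> ?U \<longrightarrow> ?J x = J' x"
    using spatial_jacobian_limit[OF U ls]
  proof eventually_elim
    case (elim x)
    then show ?case by (simp add: J'_def Q_def dirderiv_def mult.commute)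
  qed
  have J'm: "J' \<in> borel_measurable (lebesgue_on ?U)"
    using J'i by (intro measurable_restrict_space1 measurable_completion) auto
  have Jm: "?J \<in> borel_measurable (lebesgue_on ?U)"
    by (rule AE_eq_measurable_lebesgue_on[OF Us J'm ae])
  have "AE x in lebesgue_on ?U. ?J x = J' x" using ae Us by (simp add: AE_restrict_space_iff)
  from integral_cong_AE[OF Jm J'm this] J have "integral\<^sup>L (lebesgue_on ?U) J' = 0"
    by (simp add: has_bochner_integral_iff)
  moreover have "integral\<^sup>L (lebesgue_on ?U) J' = (\<integral>x. J' x \<partial>lborel)"
    unfolding set_integral_lebesgue_on[OF Us, symmetric]
  proof (rule set_integral_support)
    show "J' \<in> borel_measurable lborel" using J'i by auto
    show "J' x = 0" if "x \<notin> ?U" for x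
    proof -
      have "x \<notin> cball p r" using that r(3) by (auto simp: p_def)
      from c10[OF this] Q0[OF this] show ?thesis unfolding J'_def by argo
    qed
  qed
  ultimately have "(\<integral>x. J' x \<partial>lborel) = 0" by simp
  moreover have "(\<integral>x. J' x \<partial>lborel) =
      (\<integral>x. dirderiv ?\<tau> \<phi> x *\<^sub>R (?u x $ i) \<partial>lborel) - (\<integral>x. Q x \<partial>lborel)"
    unfolding J'_def using i1 iQ by (rule Bochner_Integration.integral_diff)
  ultimately have "(\<integral>x. dirderiv ?\<tau> \<phi> x *\<^sub>R (?u x $ i) \<partial>lborel) - (\<integral>x. Q x \<partial>lborel) = 0"
    by (simp only:)
  moreover have "(\<integral>x. Q x \<partial>lborel) = 0"
  proof -
    have gs: "g (fst x, T - snd x) = 1 * g x" for x unfolding g_def p_def by (simp add: bump_time_reflection)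
    have gas: "dirderiv (v, 0) g (fst x, T - snd x) = 1 * dirderiv (v, 0) g x" for x v
      using dirderiv_time_reflection[where f=g and T=T and c=1, OF g gs, of v 0 x] by simp
    have gaas: "dirderiv (v, 0) (dirderiv ?\<alpha> g) (fst x, T - snd x) = dirderiv (v, 0) (dirderiv ?\<alpha> g) x" for x v
      using dirderiv_time_reflection[where f="dirderiv (axis k 1, 0) g" and T=T and c=1, OF sm(1) gas, of v 0 x] by simp
    have \<phi>s: "\<phi> (fst x, T - snd x) = - 1 * \<phi> x" for x
    proof -
      have "(0, - 1) = - ?\<tau>" by simp
      then have "dirderiv (0, - 1) (dirderiv ?\<alpha> g) x = - dirderiv ?\<tau> (dirderiv ?\<alpha> g) x"
        by (simp only: linear_neg[OF dirderiv_linear[OF smooth_expr_differentiable[OF sm(1)]]])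
      then show ?thesis unfolding \<phi>_def using dirderiv_time_reflection[where f="dirderiv (axis k 1, 0) g" and T=T and c=1, OF sm(1) gas, of 0 1 x] by simp
    qed
    have d\<phi>s: "dirderiv (v, 0) \<phi> (fst x, T - snd x) = - dirderiv (v, 0) \<phi> x" for x v
      using dirderiv_time_reflection[where f=\<phi> and T=T and c="- 1", OF sm(2) \<phi>s, of v 0 x] by simp
    have zs: "fst (?z (fst x, T - snd x)) = fst (?z x)" for x
      using gaas unfolding bump_z_def shifted_def wave_z_def g_def p_def by simp
    have "Q (fst x, T - snd x) = - Q x" for x
      unfolding Q_def zs d\<phi>s by (simp add: sum_negf)
    then have "(\<integral>x. - Q x \<partial>lborel) = (\<integral>x. Q x \<partial>lborel)"
      using lborel_integral_time_reflection[OF borel_measurable_continuous_onI[OF cQ], of T] by simp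
    then show ?thesis by simp
  qed
  moreover have "(\<integral>x. dirderiv ?\<tau> \<phi> x *\<^sub>R (?u x $ i) \<partial>lborel) = - (\<epsilon> * (\<integral>x. (\<phi> x)\<^sup>2 \<partial>lborel))"
  proof -
    have der: "((\<lambda>x. ?u x $ i) has_derivative (\<lambda>h. state_deriv ((A, 0, 0) + ?z x) h $ i)) (at x)" for x
    proof (rule bounded_linear.has_derivative[OF bounded_linear_vec_nth])
      show "(?u has_derivative state_deriv ((A, 0, 0) + ?z x)) (at x)"
        unfolding state_deriv_add[abs_def]
        by (intro has_derivative_add affine_map_has_derivative subsolution_pertD(3)[OF sp])
    qed
    have q: "state_deriv ((A, 0, 0) + ?z x) ?\<tau> $ i = \<epsilon> * \<phi> x" for x
      by (simp add: state_deriv_def bump_z_def shifted_def wave_z_def \<phi>_def g_def p_def)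
    have "continuous_on UNIV (\<lambda>x. state_deriv ((A, 0, 0) + ?z x) ?\<tau> $ i)"
      unfolding q by (intro continuous_on_mult continuous_on_const smooth_expr_continuous sm)
    from integral_by_parts_compact_support(3)[where f'="\<lambda>x h. dirderiv h \<phi> x", OF smooth_expr_has_derivative[OF sm(2)]
        cd der this compact_cball \<phi>0]
    have "(\<integral>x. dirderiv ?\<tau> \<phi> x *\<^sub>R (?u x $ i) \<partial>lborel) = - (\<integral>x. \<phi> x *\<^sub>R (\<epsilon> * \<phi> x) \<partial>lborel)"
      unfolding q .
    also have "(\<integral>x. \<phi> x *\<^sub>R (\<epsilon> * \<phi> x) \<partial>lborel) = (\<integral>x. \<epsilon> * (\<phi> x)\<^sup>2 \<partial>lborel)"
      by (rule Bochner_Integration.integral_cong) (simp_all add: power2_eq_square)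
    finally show ?thesis by simp
  qed
  ultimately have "(\<integral>x. (\<phi> x)\<^sup>2 \<partial>lborel) = 0" using \<epsilon> by simp
  moreover have "(\<integral>x. (\<phi> x)\<^sup>2 \<partial>lborel) > 0"
  proof (rule integral_pos_continuous)
    show c2: "continuous_on UNIV (\<lambda>x. (\<phi> x)\<^sup>2)" by (intro continuous_on_power smooth_expr_continuous sm)
    show "integrable lborel (\<lambda>x. (\<phi> x)\<^sup>2)"
      by (rule integrable_compact_support[OF c2 compact_cball[of p r]]) (simp add: \<phi>0)
    \<comment> \<open>a point off both axes, where \<open>\<phi>\<close> does not vanish\<close>
    define x1 where "x1 = p + (r / 2) *\<^sub>R (axis k 1, 1)"
    have "(norm (x1 - p))\<^sup>2 = r\<^sup>2 / 2"
      by (simp add: x1_def norm_Pair power_mult_distrib power_divide)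
    then have a: "r\<^sup>2 - (norm (x1 - p))\<^sup>2 = r\<^sup>2 / 2" by simp
    have "r\<^sup>2 \<le> (1/2)\<^sup>2" using r by (intro power_mono) auto
    then have "bump_tower 2 (r\<^sup>2 / 2) > 0" using r(1) by (intro bump_tower_2_pos) (auto simp: power2_eq_square)
    moreover have "(x1 - p) \<bullet> ?\<tau> = r / 2" "(x1 - p) \<bullet> ?\<alpha> = r / 2"
      by (simp_all add: x1_def inner_axis_axis)
    ultimately have "\<phi> x1 > 0"
      unfolding \<phi>_def g_def by (subst mixed_dirderiv_bump) (use r(1) a in simp_all)
    then show "0 < (\<phi> x1)\<^sup>2" by simp
  qed simp
  ultimately show False by simp
qed

section \<open>Exact solutions converging to a non-solution\<close>

theorem corollary1p4:
  fixes \<sigma> :: "real^'n^'m \<Rightarrow> real^'n^'m"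
    and \<Omega> :: "(real^'n) set"
    and T :: real
    and S :: "((real^'n^'m) \<times> (real^'n^'m)) set"
    and A b :: "real^'n^'m"
  assumes "bounded_lipschitz_domain \<Omega>"
    and "T > 0"
    and "continuous_on UNIV \<sigma>"
    and "condition_OC \<sigma> S"
    and "(A, b) \<in> S"
  shows "\<exists>(u :: nat \<Rightarrow> (real^'n) \<times> real \<Rightarrow> real^'m) (v :: (real^'n) \<times> real \<Rightarrow> real^'m).
    (\<forall>j. lipschitz_weak_solution_ibvp \<sigma> \<Omega> T (\<lambda>x t. A *v x) (\<lambda>x. A *v x) (u j)) \<and>
    weak_star_W1_infinity (cylinder \<Omega> T) u v \<and>
    \<not> weak_solution_ibvp \<sigma> \<Omega> T (\<lambda>x t. A *v x) (\<lambda>x. A *v x) v"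
proof -
  let ?U = "cylinder \<Omega> T" and ?\<xi> = "(A, 0, b) :: ('n, 'm) state"
  have \<Omega>: "\<Omega> \<noteq> {}" "open \<Omega>" "bounded \<Omega>" using assms(1) by (simp_all add: bounded_lipschitz_domain_def)
  have U: "open ?U" "bounded ?U"
    unfolding cylinder_def using \<Omega> by (auto intro: open_Times bounded_Times)
  have S: "open S" "bounded S" using assms(4) by (simp_all add: condition_OC_def)
  interpret tau_inclusion S "sigma_graph \<sigma>" 1 ?U
  proof
    show "\<exists>N\<ge>2. \<exists>\<xi> \<rho> \<gamma>. tau_configuration N \<xi> \<rho> \<gamma> \<and> (\<forall>j\<in>{1..N}. \<xi> j \<in> sigma_graph \<sigma>) \<and>
        \<eta> \<in> tau_set N \<xi> \<rho> \<gamma> \<and> tau_set N \<xi> \<rho> \<gamma> \<subseteq> S" if "\<eta> \<in> S" for \<eta>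
      using assms(4) that unfolding condition_OC_def by fast
  qed (use S U closed_sigma_graph[OF assms(3)] in auto)
  obtain x0 where x0: "x0 \<in> \<Omega>" using \<Omega>(1) by blast
  have "(x0, T / 2) \<in> ?U" using x0 assms(2) by (simp add: cylinder_def)
  then obtain r0 where r0: "r0 > 0" "cball (x0, T / 2) r0 \<subseteq> ?U" using U(1) open_contains_cball by blast
  define r where "r = min r0 (1/2)"
  have r: "0 < r" "r \<le> 1/2" "cball (x0, T / 2) r \<subseteq> ?U"
    using r0 by (auto simp: r_def)

  let ?w1 = "bump_w (x0, T / 2) r (undefined :: 'm) (undefined :: 'n)"
    and ?z1 = "bump_z (x0, T / 2) r (undefined :: 'm) (undefined :: 'n)"
  have sp1: "subsolution_pert ?U ?w1 ?z1" using r by (intro bump_subsolution_pert) auto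
  obtain K1 where K1: "compact K1" "\<forall>x. x \<notin> K1 \<longrightarrow> ?w1 x = 0 \<and> ?z1 x = 0"
    using subsolution_pertD(1)[OF sp1] by blast
  obtain C where C: "C > 0" "\<And>x. norm (?z1 x) \<le> C"
    using bounded_compact_support[OF subsolution_pertD(2)[OF sp1] K1(1)] K1(2) by metis
  obtain D where D: "D > 0" "\<And>x. norm (?w1 x) \<le> D"
    using bounded_compact_support[OF subsolution_pertD(4)[OF sp1] K1(1)] K1(2) by metis
  obtain e0 where e0: "e0 > 0" "ball (A, b) e0 \<subseteq> S" using S(1) assms(5) open_contains_ball by blast
  \<comment> \<open>small enough to keep the states in S and the velocity below 1\<close>
  define \<epsilon> where "\<epsilon> = min e0 1 / (2 * C)"
  have \<epsilon>: "\<epsilon> > 0" "\<epsilon> * C < e0" "\<epsilon> * C < 1" using e0(1) C(1) by (auto simp: \<epsilon>_def)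
  define w0 where "w0 x = \<epsilon> *\<^sub>R ?w1 x" for x
  define z0 where "z0 x = \<epsilon> *\<^sub>R ?z1 x" for x
  have sp0: "subsolution_pert ?U w0 z0"
    unfolding w0_def[abs_def] z0_def[abs_def] by (rule subsolution_pert_scaleR[OF sp1])
  have z0b: "norm (z0 x) \<le> \<epsilon> * C" for x
    using C(2)[of x] \<epsilon>(1) by (simp add: z0_def)
  have w0b: "norm (w0 x) \<le> \<epsilon> * D" for x
    using D(2)[of x] \<epsilon>(1) by (simp add: w0_def)
  have st0: "?\<xi> + z0 x \<in> states" for x
  proof -
    have n: "norm (flux_gradient (z0 x)) \<le> norm (z0 x)"
      by (cases "z0 x") (simp add: flux_gradient_def norm_Pair)
    have "dist (A, b) (flux_gradient (?\<xi> + z0 x)) = norm (flux_gradient (z0 x))"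
      by (simp add: flux_gradient_def dist_norm norm_Pair)
    then have "flux_gradient (?\<xi> + z0 x) \<in> S" using n z0b[of x] \<epsilon>(2) e0(2) by (auto simp: subset_iff)
    moreover have "norm (fst (snd (?\<xi> + z0 x))) < 1"
      using norm_fst_le[of "fst (snd (z0 x))" "snd (snd (z0 x))"] norm_snd_le[of "snd (z0 x)" "fst (z0 x)"]
        z0b[of x] \<epsilon>(3) by simp
    ultimately show ?thesis by (simp add: bounded_velocity_states_def flux_gradient_def)
  qed
  obtain B where B: "B > 0" "\<forall>w z. subsolution_pert ?U w z \<longrightarrow> (\<forall>x\<in>?U. ?\<xi> + z x \<in> states) \<longrightarrow> (\<forall>x. norm (z x) \<le> B)"
    using subsolution_pert_bound[of ?\<xi>] by metis
  have ls0: "limit_subsolution A b ?U B w0 z0"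
    by (rule limit_subsolution_of_pert[OF sp0]) (use B(2) sp0 st0 in simp)
  define solution_near where "solution_near j w z \<longleftrightarrow> limit_subsolution A b ?U B w z \<and>
      (\<forall>x. norm (w x - w0 x) \<le> 1 / real (Suc j)) \<and>
      (AE x in lborel. x \<in> ?U \<longrightarrow> flux_gradient (?\<xi> + z x) \<in> sigma_graph \<sigma>)" for j w z
  have "\<exists>w z. solution_near j w z" for j
  proof -
    have pos: "1 / real (Suc j) > 0" by simp
    obtain w z wk zk where c: "\<forall>k. subsolution_pert ?U (wk k) (zk k)" "\<forall>k x. norm (zk k x) \<le> B"
      "\<forall>k x. norm (wk k x - w0 x) \<le> 1 / real (Suc j)" "uniform_limit UNIV wk w sequentially"
      "\<forall>x. norm (w x - w0 x) \<le> 1 / real (Suc j)" "z \<in> borel_measurable lborel" "\<forall>x. norm (z x) \<le> B"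
      "AE x in lborel. (\<lambda>k. zk k x) \<longlonglongrightarrow> z x"
      "AE x in lborel. x \<in> ?U \<longrightarrow> flux_gradient (?\<xi> + z x) \<in> sigma_graph \<sigma>"
      using convex_integration[of w0 z0 "(A, 0, b)" "1 / real (Suc j)" B, OF sp0 st0 pos B(2) less_imp_le[OF B(1)]] by (elim exE conjE)
    have "limit_subsolution A b ?U B w z"
    proof (rule limit_subsolution_limit[OF _ c(6) _ c(8) c(4)])
      show "limit_subsolution A b ?U B (wk k) (zk k)" for k
        by (rule limit_subsolution_of_pert[OF spec[OF c(1)]]) (use c(2) in blast)
      show "norm (z x) \<le> B" for x using c(7) by blast
      show "norm (wk k x) \<le> 1 + \<epsilon> * D" for k x
      proof -
        have "norm (wk k x) \<le> norm (wk k x - w0 x) + norm (w0 x)"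
          using norm_triangle_ineq[of "wk k x - w0 x" "w0 x"] by simp
        moreover have "norm (wk k x - w0 x) \<le> 1 / real (Suc j)" using c(3) by blast
        moreover have "1 / real (Suc j) \<le> 1" by simp
        ultimately show ?thesis using w0b[of x] by linarith
      qed
    qed
    then show ?thesis unfolding solution_near_def by (intro exI[of _ w] exI[of _ z] conjI c(5,9))
  qed
  then obtain w z where near: "\<And>j. solution_near j (w j) (z j)" by metis
  have ls: "limit_subsolution A b ?U B (w j) (z j)"
    and wd: "norm (w j x - w0 x) \<le> 1 / real (Suc j)"
    and K: "AE x in lborel. x \<in> ?U \<longrightarrow> flux_gradient (?\<xi> + z j x) \<in> sigma_graph \<sigma>" for j x
    using near[of j] unfolding solution_near_def by simp_all
  have outside: "x \<notin> ?U" if "x \<in> frontier \<Omega> \<times> {0<..<T} \<or> x \<in> \<Omega> \<times> {0}" for x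
    using that \<Omega>(2) by (auto simp: cylinder_def frontier_def interior_open)
  have sol: "lipschitz_weak_solution_ibvp \<sigma> \<Omega> T (\<lambda>x t. A *v x) (\<lambda>x. A *v x) (\<lambda>x. affine_map A x + w j x)" for j
    unfolding lipschitz_weak_solution_ibvp_def weak_solution_ibvp_def
  proof (intro conjI limit_Sobolev(1,2)[OF U ls] limit_weak_solution[OF U ls K])
    show "trace_eq_on ?U (frontier \<Omega> \<times> {0<..<T}) (\<lambda>x. affine_map A x + w j x) (\<lambda>(x, t). A *v x)"
      by (rule limit_trace[OF U ls]) (use outside in \<open>auto simp: affine_map_def\<close>)
    show "trace_eq_on ?U (\<Omega> \<times> {0}) (\<lambda>x. affine_map A x + w j x) (\<lambda>(x, t). A *v x)"
      by (rule limit_trace[OF U ls]) (use outside in \<open>auto simp: affine_map_def\<close>)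
  qed
  have "\<not> weak_solution \<sigma> \<Omega> T (\<lambda>x. affine_map A x + w0 x)"
    unfolding w0_def by (rule bump_not_weak_solution[OF assms(3) U r]) (use \<epsilon>(1) in simp)
  then have nsol: "\<not> weak_solution_ibvp \<sigma> \<Omega> T (\<lambda>x t. A *v x) (\<lambda>x. A *v x) (\<lambda>x. affine_map A x + w0 x)"
    by (simp add: weak_solution_ibvp_def)
  show ?thesis
    by (intro exI[of _ "\<lambda>j x. affine_map A x + w j x"] exI[of _ "\<lambda>x. affine_map A x + w0 x"] conjI allI
        sol nsol limit_weak_star[OF U ls ls0 wd])
qed

end
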